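(* Let $0 \leq \alpha < 1$, $0 < p, q \leq \infty$, $s, b \in \mathbb{R}$ and $0 \leq \delta \leq \alpha \leq \rho \leq 1$. Then all pseudodifferential operators with symbols in $S_{\rho,\delta}^b$ are bounded from $M_{p,q}^{s,\alpha}(\mathbb{R}^n)$ to $M_{p,q}^{s-b,\alpha}(\mathbb{R}^n)$.
   Context: Notation: $\langle x\rangle = 1+|x|$ for $x\in\mathbb{R}^n$. $\mathcal{S}=\mathcal{S}(\mathbb{R}^n)$ is the Schwartz space, $\mathcal{S}'=\mathcal{S}'(\mathbb{R}^n)$ the space of tempered distributions; $\mathcal{F}f(\xi)=\widehat f(\xi)=\int_{\mathbb{R}^n} e^{-i\xi\cdot x}f(x)\,dx$ and $\mathcal{F}^{-1}f(x)=(2\pi)^{-n}\int_{\mathbb{R}^n}e^{ix\cdot\xi}f(\xi)\,d\xi$. For a function $m$, the Fourier multiplier is $m(D)f=\mathcal{F}^{-1}[m\cdot\mathcal{F}f]$. Symbol class: for $b\in\mathbb{R}$ and $0\le\delta\le\rho\le1$, $S^b_{\rho,\delta}$ is the set of all $\sigma\in C^\infty(\mathbb{R}^n\times\mathbb{R}^n)$ such that for all multi-indices $\beta,\gamma\in\mathbb{Z}_+^n$ there is a constant $C_{\beta,\gamma}$ with $|\partial_x^\beta\partial_\xi^\gamma\sigma(x,\xi)|\le C_{\beta,\gamma}\langle\xi\rangle^{b+\delta|\beta|-\rho|\gamma|}$ for all $x,\xi$. The pseudodifferential operator with symbol $\sigma$ is $\sigma(X,D)f(x)=(2\pi)^{-n}\int_{\mathbb{R}^n}e^{ix\cdot\xi}\sigma(x,\xi)\widehat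 f(\xi)\,d\xi$ for $f\in\mathcal{S}(\mathbb{R}^n)$. $\alpha$-modulation spaces ($0\le\alpha<1$): let $C>1$ be a suitable constant depending on $n$ and $\alpha$, and let $\{\eta_k^\alpha\}_{k\in\mathbb{Z}^n}$ be a sequence of Schwartz functions such that (i) $\mathrm{supp}\,\eta_k^\alpha\subset\{\xi\in\mathbb{R}^n:|\xi-\langle k\rangle^{\alpha/(1-\alpha)}k|\le C\langle k\rangle^{\alpha/(1-\alpha)}\}$; (ii) for every multi-index $\beta$ there is a constant $C'_\beta$ with $|\partial_\xi^\beta\eta_k^\alpha(\xi)|\le C'_\beta\langle k\rangle^{-|\beta|\alpha/(1-\alpha)}$ for all $k,\xi$; (iii) $\sum_{k\in\mathbb{Z}^n}\eta_k^\alpha(\xi)=1$ for all $\xi\in\mathbb{R}^n$. For $0<p,q\le\infty$ and $s\in\mathbb{R}$, $M_{p,q}^{s,\alpha}(\mathbb{R}^n)$ is the set of $f\in\mathcal{S}'(\mathbb{R}^n)$ with $\|f\|_{M_{p,q}^{s,\alpha}}=\big\|\langle k\rangle^{s/(1-\alpha)}\|\eta_k^\alpha(D)f\|_{L^p}\big\|_{\ell^q(\mathbb{Z}^n_k)}<\infty$. Different admissible choices of $\{\eta_k^\alpha\}$ give equivalent (quasi-)norms. Boundedness convention: $\sigma(X,D)$ is said to be bounded from $M_{p,q}^{s,\alpha}$ to $M_{p,q}^{t,\alpha}$ if there is a constant $C_\sigma$ such that $\|\sigma(X,D)f\|_{M_{p,q}^{t,\alpha}}\le C_\sigma\|f\|_{M_{p,q}^{s,\alpha}}$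 for all $f\in\mathcal{S}(\mathbb{R}^n)$. *)

theory Defs
  imports "HOL-Analysis.Analysis" "HOL-Probability.Essential_Supremum"
begin

section \<open>Smooth functions and multi-index derivatives\<close>

definition bracket :: "'a::real_normed_vector \<Rightarrow> real"
  where "bracket x = 1 + norm x"

definition partial_deriv :: "'a::euclidean_space \<Rightarrow> ('a \<Rightarrow> complex) \<Rightarrow> 'a \<Rightarrow> complex"
  where "partial_deriv v f x = vector_derivative (\<lambda>t. f (x + t *\<^sub>R v)) (at 0)"

text \<open>All iterated coordinate derivatives are (Frechet) differentiable everywhere, in particular
  continuous; this is \<open>C\<^sup>\<infinity>\<close>.\<close>

definition smooth_function :: "('a::euclidean_space \<Rightarrow> complex) \<Rightarrow> bool"
  where "smooth_function f \<longleftrightarrow>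
    (\<forall>vs. set vs \<subseteq> Basis \<longrightarrow> foldr partial_deriv vs f differentiable_on UNIV)"

type_synonym 'n multi_index = "'n \<Rightarrow> nat"

definition order_of :: "'n::finite multi_index \<Rightarrow> nat"
  where "order_of \<beta> = (\<Sum>i\<in>UNIV. \<beta> i)"

text \<open>The coordinate type carries no order, so an arbitrary enumeration of it fixes the order of
  differentiation. On smooth functions the choice is immaterial.\<close>

definition coordinates :: "'n::finite list"
  where "coordinates = (SOME is. distinct is \<and> set is = UNIV)"

definition multi_deriv ::
    "'n::finite multi_index \<Rightarrow> (real ^ 'n \<Rightarrow> complex) \<Rightarrow> real ^ 'n \<Rightarrow> complex"
  where "multi_deriv \<beta> f = foldr (\<lambda>i. partial_deriv (axis i 1) ^^ \<beta> i) coordinates f"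

section \<open>Schwartz functions and tempered distributions\<close>

definition schwartz :: "(real ^ 'n::finite \<Rightarrow> complex) \<Rightarrow> bool"
  where "schwartz f \<longleftrightarrow> smooth_function f \<and>
    (\<forall>(N::nat) \<beta>. \<exists>B. \<forall>x. bracket x ^ N * norm (multi_deriv \<beta> f x) \<le> B)"

text \<open>The suprema are over bounded sets when \<open>f\<close> is Schwartz.\<close>

definition schwartz_seminorm :: "nat \<Rightarrow> (real ^ 'n::finite \<Rightarrow> complex) \<Rightarrow> real"
  where "schwartz_seminorm N f =
    (\<Sum>\<beta> | order_of \<beta> \<le> N. SUP x. bracket x ^ N * norm (multi_deriv \<beta> f x))"

text \<open>Functionals are total HOL functions; only their values on Schwartz functions matter.\<close>

type_synonym 'n functional = "(real ^ 'n \<Rightarrow> complex) \<Rightarrow> complex"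

definition tempered_distribution :: "'n::finite functional \<Rightarrow> bool"
  where "tempered_distribution T \<longleftrightarrow>
    (\<forall>\<phi> \<psi>. schwartz \<phi> \<longrightarrow> schwartz \<psi> \<longrightarrow> T (\<lambda>x. \<phi> x + \<psi> x) = T \<phi> + T \<psi>) \<and>
    (\<forall>c \<phi>. schwartz \<phi> \<longrightarrow> T (\<lambda>x. c * \<phi> x) = c * T \<phi>) \<and>
    (\<exists>B N. \<forall>\<phi>. schwartz \<phi> \<longrightarrow> norm (T \<phi>) \<le> B * schwartz_seminorm N \<phi>)"

definition dist_of :: "(real ^ 'n::finite \<Rightarrow> complex) \<Rightarrow> 'n functional"
  where "dist_of g \<phi> = (\<integral>x. g x * \<phi> x \<partial>lborel)"

text \<open>Functions that define a tempered distribution by integration; integrability is required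
  explicitly because the Bochner integral of a non-integrable function is \<open>0\<close>.\<close>

definition tempered_function :: "(real ^ 'n::finite \<Rightarrow> complex) \<Rightarrow> bool"
  where "tempered_function g \<longleftrightarrow> g \<in> borel_measurable lborel \<and>
    (\<forall>\<phi>. schwartz \<phi> \<longrightarrow> integrable lborel (\<lambda>x. g x * \<phi> x)) \<and>
    tempered_distribution (dist_of g)"

section \<open>Fourier transform and Fourier multipliers\<close>

definition fourier :: "(real ^ 'n::finite \<Rightarrow> complex) \<Rightarrow> real ^ 'n \<Rightarrow> complex"
  where "fourier f \<xi> = (\<integral>x. exp (- \<i> * complex_of_real (\<xi> \<bullet> x)) * f x \<partial>lborel)"

definition inv_fourier :: "(real ^ 'n::finite \<Rightarrow> complex) \<Rightarrow> real ^ 'n \<Rightarrow> complex"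
  where "inv_fourier f x = complex_of_real (1 / (2 * pi) ^ CARD('n)) *
    (\<integral>\<xi>. exp (\<i> * complex_of_real (x \<bullet> \<xi>)) * f \<xi> \<partial>lborel)"

text \<open>On tempered distributions everything is defined by transposition with respect to the bilinear
  pairing, for which \<open>\<integral>(\<F>f) \<phi> = \<integral>f (\<F>\<phi>)\<close>, and likewise for the inverse transform.\<close>

definition dist_fourier :: "'n::finite functional \<Rightarrow> 'n functional"
  where "dist_fourier T \<phi> = T (fourier \<phi>)"

definition dist_inv_fourier :: "'n::finite functional \<Rightarrow> 'n functional"
  where "dist_inv_fourier T \<phi> = T (inv_fourier \<phi>)"

definition dist_mult :: "(real ^ 'n::finite \<Rightarrow> complex) \<Rightarrow> 'n functional \<Rightarrow> 'n functional"
  where "dist_mult m T \<phi> = T (\<lambda>x. m x * \<phi> x)"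

definition fourier_multiplier ::
    "(real ^ 'n::finite \<Rightarrow> complex) \<Rightarrow> 'n functional \<Rightarrow> 'n functional"
  where "fourier_multiplier m T = dist_inv_fourier (dist_mult m (dist_fourier T))"

section \<open>Lebesgue quasi-norms with exponent in \<open>(0, \<infinity>]\<close>\<close>

text \<open>Used with \<open>r > 0\<close> only.\<close>

definition enn_powr :: "ennreal \<Rightarrow> real \<Rightarrow> ennreal"
  where "enn_powr x r = (if x = top then top else ennreal (enn2real x powr r))"

text \<open>The norm of \<open>\<ell>\<^sup>q\<close> is the instance of counting measure.\<close>

definition Lp_norm :: "'a measure \<Rightarrow> ennreal \<Rightarrow> ('a \<Rightarrow> ennreal) \<Rightarrow> ennreal"
  where "Lp_norm M p F =
    (if p = top then esssup M F
     else enn_powr (\<integral>\<^sup>+ x. enn_powr (F x) (enn2real p) \<partial>M) (1 / enn2real p))"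

text \<open>The functions \<open>g\<close> representing \<open>T\<close> agree almost everywhere, so the infimum is their common
  quasi-norm; it is \<open>top\<close> if \<open>T\<close> is not given by a function.\<close>

definition dist_Lp_norm :: "ennreal \<Rightarrow> 'n::finite functional \<Rightarrow> ennreal"
  where "dist_Lp_norm p T =
    (INF g \<in> {g. tempered_function g \<and> (\<forall>\<phi>. schwartz \<phi> \<longrightarrow> T \<phi> = dist_of g \<phi>)}.
      Lp_norm lborel p (\<lambda>x. ennreal (norm (g x))))"

section \<open>Alpha-modulation spaces\<close>

definition lattice_point :: "int ^ 'n::finite \<Rightarrow> real ^ 'n"
  where "lattice_point k = (\<chi> i. of_int (k $ i))"

definition alpha_partition ::
    "real \<Rightarrow> real \<Rightarrow> (int ^ 'n::finite \<Rightarrow> real ^ 'n \<Rightarrow> complex) \<Rightarrow> bool"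
  where "alpha_partition \<alpha> C \<eta> \<longleftrightarrow>
    (\<forall>k. schwartz (\<eta> k)) \<and>
    (\<forall>k. closure {\<xi>. \<eta> k \<xi> \<noteq> 0} \<subseteq>
      {\<xi>. norm (\<xi> - bracket (lattice_point k) powr (\<alpha> / (1 - \<alpha>)) *\<^sub>R lattice_point k)
            \<le> C * bracket (lattice_point k) powr (\<alpha> / (1 - \<alpha>))}) \<and>
    (\<forall>\<beta>. \<exists>C'. \<forall>k \<xi>. norm (multi_deriv \<beta> (\<eta> k) \<xi>)
      \<le> C' * bracket (lattice_point k) powr (- real (order_of \<beta>) * \<alpha> / (1 - \<alpha>))) \<and>
    (\<forall>\<xi>. ((\<lambda>k. \<eta> k \<xi>) has_sum 1) UNIV)"

definition alpha_modulation_norm ::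
    "(int ^ 'n::finite \<Rightarrow> real ^ 'n \<Rightarrow> complex) \<Rightarrow> real \<Rightarrow> ennreal \<Rightarrow> ennreal \<Rightarrow> real
      \<Rightarrow> 'n functional \<Rightarrow> ennreal"
  where "alpha_modulation_norm \<eta> \<alpha> p q s T =
    Lp_norm (count_space UNIV) q
      (\<lambda>k. ennreal (bracket (lattice_point k) powr (s / (1 - \<alpha>))) *
            dist_Lp_norm p (fourier_multiplier (\<eta> k) T))"

section \<open>Pseudodifferential operators\<close>

definition symbol_class ::
    "real \<Rightarrow> real \<Rightarrow> real \<Rightarrow> (real ^ 'n::finite \<Rightarrow> real ^ 'n \<Rightarrow> complex) set"
  where "symbol_class b \<rho> \<delta> = {\<sigma>. smooth_function (\<lambda>(x, \<xi>). \<sigma> x \<xi>) \<and>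
    (\<forall>\<beta> \<gamma>. \<exists>B. \<forall>x \<xi>. norm (multi_deriv \<beta> (\<lambda>y. multi_deriv \<gamma> (\<sigma> y) \<xi>) x)
      \<le> B * bracket \<xi> powr (b + \<delta> * real (order_of \<beta>) - \<rho> * real (order_of \<gamma>)))}"

definition pseudo_op ::
    "(real ^ 'n::finite \<Rightarrow> real ^ 'n \<Rightarrow> complex) \<Rightarrow> (real ^ 'n \<Rightarrow> complex) \<Rightarrow> real ^ 'n \<Rightarrow> complex"
  where "pseudo_op \<sigma> f x = complex_of_real (1 / (2 * pi) ^ CARD('n)) *
    (\<integral>\<xi>. exp (\<i> * complex_of_real (x \<bullet> \<xi>)) * \<sigma> x \<xi> * fourier f \<xi> \<partial>lborel)"

text \<open>Boundedness from \<open>M\<^sup>s\<^sup>,\<^sup>\<alpha>\<close> to \<open>M\<^sup>t\<^sup>,\<^sup>\<alpha>\<close> (exponents \<open>p, q\<close>), tested on Schwartz functions.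
  The first conjunct makes the quasi-norm of \<open>A f\<close> meaningful.\<close>

definition alpha_modulation_bounded ::
    "(int ^ 'n::finite \<Rightarrow> real ^ 'n \<Rightarrow> complex) \<Rightarrow> real \<Rightarrow> ennreal \<Rightarrow> ennreal \<Rightarrow> real \<Rightarrow> real
      \<Rightarrow> ((real ^ 'n \<Rightarrow> complex) \<Rightarrow> real ^ 'n \<Rightarrow> complex) \<Rightarrow> bool"
  where "alpha_modulation_bounded \<eta> \<alpha> p q s t A \<longleftrightarrow>
    (\<exists>B::real. \<forall>f. schwartz f \<longrightarrow> tempered_function (A f) \<and>
      alpha_modulation_norm \<eta> \<alpha> p q t (dist_of (A f))
        \<le> ennreal B * alpha_modulation_norm \<eta> \<alpha> p q s (dist_of f))"

end

theory Submission
  imports Defs "HOL-Probability.Characteristic_Functions" "HOL-Probability.Sinc_Integral"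
begin

text \<open>Write \<open>\<eta>\<^sub>k(D) \<sigma>(X,D) f\<close> as the sum over \<open>l\<close> of \<open>\<eta>\<^sub>k(D) \<sigma>(X,D) \<eta>\<^sub>l(D) f\<close>. On the frequency ball \<open>l\<close>,
  whose radius is comparable to \<open>r\<^sub>l = \<langle>l\<rangle> powr (\<alpha> / (1 - \<alpha>))\<close>, a symbol with \<open>\<delta> \<le> \<alpha> \<le> \<rho>\<close> costs at most
  \<open>r\<^sub>l\<close> per derivative in \<open>x\<close> and gains at least \<open>r\<^sub>l\<close> per derivative in \<open>\<xi>\<close>. Integrating by parts in \<open>x\<close>,
  against the difference of the two frequency centres, therefore bounds the term \<open>(k, l)\<close> by
  \<open>\<langle>l\<rangle> powr (b / (1 - \<alpha>))\<close> times an arbitrary negative power of \<open>\<langle>k - l\<rangle>\<close> times the Peetre maximal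
  function of \<open>\<eta>\<^sub>l(D) f\<close>. Peetre's inequality controls the maximal function in \<open>L\<^sup>p\<close> for every \<open>p > 0\<close>, and
  the powers of \<open>\<langle>k - l\<rangle>\<close> absorb both the change of weight from \<open>l\<close> to \<open>k\<close> and the sum over \<open>l\<close>
  in \<open>\<ell>\<^sup>q\<close>.\<close>

section \<open>Directional derivatives and smoothness\<close>

text \<open>Two obstacles shape the proof. For exponents below one neither \<open>L\<^sup>p\<close>
  nor \<open>\<ell>\<^sup>q\<close> has a triangle inequality, so the terms (k, l) are never added
  as norms: they are bounded pointwise through numbers \<open>s\<close> with
  \<open>controls f l A x s\<close>, and only powers of these are integrated and summed, with powers
  of \<open>gap\<close> spent on convergence. Secondly, the balls differ in size. Passing between
  the scales \<open>rad k\<close> and \<open>rad l\<close> loses a fixed power of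
  \<open>gap k l\<close>, which is why an arbitrary power has to be gained. The gain has a simple
  source: one integration by parts divides by a coordinate of \<open>ctr k - ctr l\<close>; for k
  different from l and a suitable coordinate this exceeds a constant times
  \<open>max (rad k) (rad l) * gap k l\<close>, while each of the two terms it produces costs a
  single factor \<open>rad k\<close> or \<open>rad l\<close>. Since one coordinate suffices for
  given k and l, the derivative bounds are only ever needed for one space direction and one
  frequency direction at a time.\<close>

lemma partial_deriv_eq:
  assumes "(f has_derivative f') (at x)"
  shows "partial_deriv v f x = f' v"
proof -
  have "((\<lambda>t. x + t *\<^sub>R v) has_derivative (\<lambda>t. t *\<^sub>R v)) (at 0)"
    by (auto intro!: derivative_eq_intros)
  moreover have "(f has_derivative f') (at (x + 0 *\<^sub>R v))" using assms by simp
  ultimately have "((\<lambda>t. f (x + t *\<^sub>R v)) has_derivative (\<lambda>t. f' (t *\<^sub>R v))) (at 0)"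
    using has_derivative_compose[of "\<lambda>t. x + t *\<^sub>R v"] by blast
  moreover have "f' (t *\<^sub>R v) = t *\<^sub>R f' v" for t
    using assms by (simp add: has_derivative_linear linear_cmul)
  ultimately have "((\<lambda>t. f (x + t *\<^sub>R v)) has_vector_derivative f' v) (at 0)"
    by (simp add: has_vector_derivative_def)
  then show ?thesis
    unfolding partial_deriv_def by (rule vector_derivative_at)
qed

lemma has_vector_derivative_partial_deriv:
  assumes "f differentiable at (x + s *\<^sub>R v)"
  shows "((\<lambda>t. f (x + t *\<^sub>R v)) has_vector_derivative partial_deriv v f (x + s *\<^sub>R v)) (at s)"
proof -
  obtain f' where f': "(f has_derivative f') (at (x + s *\<^sub>R v))"
    using assms by (auto simp: differentiable_def)
  have "((\<lambda>t. x + t *\<^sub>R v) has_derivative (\<lambda>t. t *\<^sub>R v)) (at s)"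
    by (auto intro!: derivative_eq_intros)
  then have "((\<lambda>t. f (x + t *\<^sub>R v)) has_derivative (\<lambda>t. f' (t *\<^sub>R v))) (at s)"
    using f' has_derivative_compose[of "\<lambda>t. x + t *\<^sub>R v"] by blast
  moreover have "f' (t *\<^sub>R v) = t *\<^sub>R f' v" for t
    using f' by (simp add: has_derivative_linear linear_cmul)
  ultimately show ?thesis
    by (simp add: has_vector_derivative_def partial_deriv_eq[OF f'])
qed

lemma partial_deriv_const [simp]: "partial_deriv v (\<lambda>x. c) = (\<lambda>x. 0)"
  by (intro ext) (rule partial_deriv_eq[OF has_derivative_const])

lemma partial_deriv_add:
  assumes "f differentiable at x" "g differentiable at x"
  shows "partial_deriv v (\<lambda>x. f x + g x) x = partial_deriv v f x + partial_deriv v g x"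
proof -
  obtain f' g' where fg: "(f has_derivative f') (at x)" "(g has_derivative g') (at x)"
    using assms by (auto simp: differentiable_def)
  show ?thesis
    using partial_deriv_eq[OF has_derivative_add[OF fg]] fg[THEN partial_deriv_eq] by simp
qed

lemma partial_deriv_mult:
  assumes "f differentiable at x" "g differentiable at x"
  shows "partial_deriv v (\<lambda>x. f x * g x) x = f x * partial_deriv v g x + partial_deriv v f x * g x"
proof -
  obtain f' g' where fg: "(f has_derivative f') (at x)" "(g has_derivative g') (at x)"
    using assms by (auto simp: differentiable_def)
  show ?thesis
    using partial_deriv_eq[OF has_derivative_mult[OF fg]] fg[THEN partial_deriv_eq] by simp
qed

lemma partial_deriv_linear:
  assumes "bounded_linear f"
  shows "partial_deriv v (\<lambda>x. f x + c) = (\<lambda>x. f v)"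
  by (intro ext partial_deriv_eq has_derivative_add_const bounded_linear_imp_has_derivative assms)

lemma partial_deriv_zero_on_open:
  assumes "open S" "x \<in> S" "\<And>y. y \<in> S \<Longrightarrow> f y = 0"
  shows "partial_deriv v f x = 0"
proof (rule partial_deriv_eq[where f'="\<lambda>_. 0"])
  show "(f has_derivative (\<lambda>_. 0)) (at x)"
    by (rule has_derivative_transform_within_open[OF _ assms(1,2), where f="\<lambda>_. 0"])
      (use assms(3) in auto)
qed

text \<open>\<open>C\<^sup>n\<close> with one more (Frechet) derivative than counted, so that \<^const>\<open>smooth_function\<close> is the
  intersection over all \<open>n\<close>.\<close>

primrec diffn :: "nat \<Rightarrow> ('a::euclidean_space \<Rightarrow> complex) \<Rightarrow> bool" where
  "diffn 0 f \<longleftrightarrow> (\<forall>x. f differentiable at x)"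
| "diffn (Suc n) f \<longleftrightarrow> (\<forall>x. f differentiable at x) \<and> (\<forall>v\<in>Basis. diffn n (partial_deriv v f))"

lemma smooth_function_imp_differentiable:
  assumes "smooth_function f" shows "f differentiable at x"
proof -
  have "foldr partial_deriv [] f differentiable_on UNIV"
    using assms unfolding smooth_function_def by (metis empty_subsetI list.set(1))
  then show ?thesis by (simp add: differentiable_on_def)
qed

lemma smooth_function_partial_deriv:
  assumes "smooth_function f" "v \<in> Basis" shows "smooth_function (partial_deriv v f)"
  unfolding smooth_function_def
proof (intro allI impI)
  fix vs :: "'a list" assume "set vs \<subseteq> Basis"
  then have "set (vs @ [v]) \<subseteq> Basis" using assms(2) by auto
  then have "foldr partial_deriv (vs @ [v]) f differentiable_on UNIV"
    using assms(1) unfolding smooth_function_def by blast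
  then show "foldr partial_deriv vs (partial_deriv v f) differentiable_on UNIV" by simp
qed

lemma smooth_function_imp_diffn: "smooth_function f \<Longrightarrow> diffn n f"
  by (induction n arbitrary: f)
    (auto simp: smooth_function_imp_differentiable smooth_function_partial_deriv)

lemma diffn_imp_smooth_function:
  assumes "\<And>n. diffn n f" shows "smooth_function f"
proof -
  have "foldr partial_deriv vs f differentiable_on UNIV"
    if "set vs \<subseteq> Basis" "diffn (length vs) f" for vs
    using that
  \<comment> \<open>\<open>foldr\<close> applies the last direction of the list first, so the
    derivative peeled off by \<open>diffn\<close> sits at the end of the list.\<close>
  proof (induction vs arbitrary: f rule: rev_induct)
    case Nil
    then show ?case by (auto simp: differentiable_on_def)
  next
    case (snoc v vs)
    then show ?case by auto
  qed
  then show ?thesis using assms by (auto simp: smooth_function_def)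
qed

lemma smooth_function_iff: "smooth_function f \<longleftrightarrow> (\<forall>n. diffn n f)"
  using smooth_function_imp_diffn diffn_imp_smooth_function by blast

lemma smooth_function_continuous: "smooth_function f \<Longrightarrow> continuous_on S f"
  by (meson continuous_at_imp_continuous_on differentiable_imp_continuous_within
      smooth_function_imp_differentiable)

lemma smooth_function_measurable [measurable_dest]:
  "smooth_function f \<Longrightarrow> f \<in> borel_measurable borel"
  by (intro borel_measurable_continuous_onI smooth_function_continuous)

lemma diffn_const: "diffn n (\<lambda>x. c)"
  by (induction n arbitrary: c) auto

lemma diffn_add: "diffn n f \<Longrightarrow> diffn n g \<Longrightarrow> diffn n (\<lambda>x. f x + g x)"
proof (induction n arbitrary: f g)
  case (Suc n)
  then have "partial_deriv v (\<lambda>x. f x + g x) = (\<lambda>x. partial_deriv v f x + partial_deriv v g x)" for v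
    by (intro ext partial_deriv_add) auto
  with Suc show ?case by auto
qed auto

lemma diffn_Suc: "diffn (Suc n) f \<Longrightarrow> diffn n f"
  by (induction n arbitrary: f) auto

lemma diffn_mult: "diffn n f \<Longrightarrow> diffn n g \<Longrightarrow> diffn n (\<lambda>x. f x * g x)"
proof (induction n arbitrary: f g)
  case (Suc n)
  then have "partial_deriv v (\<lambda>x. f x * g x)
      = (\<lambda>x. f x * partial_deriv v g x + partial_deriv v f x * g x)" for v
    by (intro ext partial_deriv_mult) auto
  \<comment> \<open>The product rule leaves one factor undifferentiated, so the induction hypothesis
    is also applied to f and g themselves, at the lower order.\<close>
  moreover have "diffn n f" "diffn n g" using Suc.prems by (auto intro: diffn_Suc)
  ultimately show ?case using Suc by (auto intro!: diffn_add)
qed auto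

lemma diffn_linear: "bounded_linear f \<Longrightarrow> diffn n (\<lambda>x. f x + c)"
  using has_derivative_add_const[OF bounded_linear_imp_has_derivative[of f], where c=c]
  by (cases n) (auto simp: partial_deriv_linear diffn_const differentiable_def)

lemma smooth_function_const [simp]: "smooth_function (\<lambda>x. c)"
  by (simp add: smooth_function_iff diffn_const)

lemma smooth_function_add:
  "smooth_function f \<Longrightarrow> smooth_function g \<Longrightarrow> smooth_function (\<lambda>x. f x + g x)"
  by (simp add: smooth_function_iff diffn_add)

lemma smooth_function_mult:
  "smooth_function f \<Longrightarrow> smooth_function g \<Longrightarrow> smooth_function (\<lambda>x. f x * g x)"
  by (simp add: smooth_function_iff diffn_mult)

lemma smooth_function_linear: "bounded_linear f \<Longrightarrow> smooth_function (\<lambda>x. f x + c)"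
  by (simp add: smooth_function_iff diffn_linear)

lemma smooth_function_sum:
  "(\<And>i. i \<in> A \<Longrightarrow> smooth_function (f i)) \<Longrightarrow> smooth_function (\<lambda>x. \<Sum>i\<in>A. f i x)"
  by (induction A rule: infinite_finite_induct) (auto intro: smooth_function_add)

lemma smooth_function_power: "smooth_function f \<Longrightarrow> smooth_function (\<lambda>x. f x ^ n)"
  by (induction n) (auto intro: smooth_function_mult)

lemma bounded_linear_coord: "bounded_linear (\<lambda>x::real^'n. complex_of_real (x $ i))"
  by (intro bounded_linear_of_real[THEN bounded_linear_compose] bounded_linear_vec_nth)

section \<open>Functions on a product space and their sections\<close>

lemma differentiable_snd_section:
  "f differentiable at (snd p) \<Longrightarrow> (\<lambda>p. f (snd p)) differentiable at p"
  "F differentiable at (z, \<xi>) \<Longrightarrow> (\<lambda>\<xi>. F (z, \<xi>)) differentiable at \<xi>"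
  "F differentiable at (z, \<xi>) \<Longrightarrow> (\<lambda>z. F (z, \<xi>)) differentiable at z"
  using has_derivative_compose[OF has_derivative_snd[OF has_derivative_ident], of f _ p UNIV]
    has_derivative_compose[OF has_derivative_Pair[OF has_derivative_const has_derivative_ident], of F _ z \<xi> UNIV]
    has_derivative_compose[OF has_derivative_Pair[OF has_derivative_ident has_derivative_const], of F _ z \<xi> UNIV]
  by (auto simp: differentiable_def)

lemma partial_deriv_snd:
  assumes "f differentiable at (snd p)"
  shows "partial_deriv w (\<lambda>p. f (snd p)) p = partial_deriv (snd w) f (snd p)"
proof -
  obtain f' where f': "(f has_derivative f') (at (snd p))"
    using assms by (auto simp: differentiable_def)
  have "((\<lambda>p. f (snd p)) has_derivative (\<lambda>h. f' (snd h))) (at p)"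
    by (rule has_derivative_compose[OF has_derivative_snd[OF has_derivative_ident] f'])
  then show ?thesis
    using partial_deriv_eq[OF f'] by (simp add: partial_deriv_eq)
qed

lemma partial_deriv_zero [simp]: "partial_deriv 0 f = (\<lambda>x. 0)"
  by (auto simp: partial_deriv_def)

lemma smooth_function_snd:
  fixes f :: "'b::euclidean_space \<Rightarrow> complex"
  assumes "smooth_function f"
  shows "smooth_function (\<lambda>p::'a::euclidean_space \<times> 'b. f (snd p))"
proof -
  have "diffn n (\<lambda>p::'a \<times> 'b. f (snd p))" if "diffn n f" for n
    using that
  proof (induction n arbitrary: f)
    case 0
    then show ?case by (auto intro!: differentiable_snd_section)
  next
    case (Suc n)
    have d: "f differentiable at x" for x using Suc.prems by simp
    have "diffn n (partial_deriv w (\<lambda>p::'a \<times> 'b. f (snd p)))" if "w \<in> Basis" for w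
    proof -
      have "snd w = 0 \<or> snd w \<in> Basis" using that by (auto simp: Basis_prod_def)
      then have "diffn n (\<lambda>p::'a \<times> 'b. partial_deriv (snd w) f (snd p))"
        using Suc by (auto simp: diffn_const)
      moreover have "partial_deriv w (\<lambda>p::'a \<times> 'b. f (snd p)) = (\<lambda>p. partial_deriv (snd w) f (snd p))"
        by (rule ext, rule partial_deriv_snd, rule d)
      ultimately show ?thesis by simp
    qed
    then show ?case
      using d by (auto intro!: differentiable_snd_section)
  qed
  then show ?thesis using assms by (simp add: smooth_function_iff)
qed

lemma partial_deriv_section:
  "partial_deriv v (\<lambda>\<xi>. F (z, \<xi>)) \<xi> = partial_deriv (0, v) F (z, \<xi>)"
  "partial_deriv v (\<lambda>z. F (z, \<xi>)) z = partial_deriv (v, 0) F (z, \<xi>)"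
  by (simp_all add: partial_deriv_def)

text \<open>The symbol estimates differentiate sections of the symbol, whereas the scaled bounds
  used later live on the product space. This translates between the two.\<close>

lemma partial_deriv_pow_section:
  "(partial_deriv v ^^ n) (\<lambda>\<xi>. F (z, \<xi>)) \<xi> = (partial_deriv (0, v) ^^ n) F (z, \<xi>)"
  "(partial_deriv v ^^ n) (\<lambda>z. F (z, \<xi>)) z = (partial_deriv (v, 0) ^^ n) F (z, \<xi>)"
proof (induction n arbitrary: F)
  case (Suc n)
  { case 1
    have *: "partial_deriv v (\<lambda>\<xi>. F (z, \<xi>)) = (\<lambda>\<xi>. partial_deriv (0, v) F (z, \<xi>))"
      by (simp add: partial_deriv_def fun_eq_iff)
    show ?case by (simp only: funpow_Suc_right o_apply * Suc(1)) }
  { case 2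
    have *: "partial_deriv v (\<lambda>z. F (z, \<xi>)) = (\<lambda>z. partial_deriv (v, 0) F (z, \<xi>))"
      by (simp add: partial_deriv_def fun_eq_iff)
    show ?case by (simp only: funpow_Suc_right o_apply * Suc(2)) }
qed auto

lemma smooth_function_section:
  fixes F :: "'a::euclidean_space \<times> 'b::euclidean_space \<Rightarrow> complex"
  assumes "smooth_function F"
  shows "smooth_function (\<lambda>\<xi>. F (z, \<xi>))" "smooth_function (\<lambda>z. F (z, \<xi>))"
proof -
  have "diffn n (\<lambda>\<xi>. F (z, \<xi>))" if "diffn n F" for n z
    using that
  proof (induction n arbitrary: F)
    case 0
    then show ?case by (auto intro!: differentiable_snd_section)
  next
    case (Suc n)
    have "(\<lambda>\<xi>. F (z, \<xi>)) differentiable at \<xi>" for \<xi>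
      using Suc.prems
      by (auto intro!: differentiable_snd_section)
    moreover have "partial_deriv v (\<lambda>\<xi>. F (z, \<xi>)) = (\<lambda>\<xi>. partial_deriv (0, v) F (z, \<xi>))" for v
      by (simp add: partial_deriv_def fun_eq_iff)
    ultimately show ?case using Suc.prems by (simp add: Basis_prod_def Suc.IH)
  qed
  then show "smooth_function (\<lambda>\<xi>. F (z, \<xi>))"
    using assms by (simp add: smooth_function_iff)
  have "diffn n (\<lambda>z. F (z, \<xi>))" if "diffn n F" for n \<xi>
    using that
  proof (induction n arbitrary: F)
    case 0
    then show ?case by (auto intro!: differentiable_snd_section)
  next
    case (Suc n)
    have "(\<lambda>z. F (z, \<xi>)) differentiable at z" for z
      using Suc.prems
      by (auto intro!: differentiable_snd_section)
    moreover have "partial_deriv v (\<lambda>z. F (z, \<xi>)) = (\<lambda>z. partial_deriv (v, 0) F (z, \<xi>))" for v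
      by (simp add: partial_deriv_def fun_eq_iff)
    ultimately show ?case using Suc.prems by (simp add: Basis_prod_def Suc.IH)
  qed
  then show "smooth_function (\<lambda>z. F (z, \<xi>))"
    using assms by (simp add: smooth_function_iff)
qed

text \<open>The mean value theorem applied twice to the second-order difference of \<open>f\<close> over the
  parallelogram spanned by \<open>h u\<close> and \<open>h v\<close>.\<close>

lemma second_difference_mvt:
  fixes f :: "'a::real_normed_vector \<Rightarrow> real"
  assumes u: "\<And>x s. ((\<lambda>t. f (x + t *\<^sub>R u)) has_real_derivative fu (x + s *\<^sub>R u)) (at s)"
    and v: "\<And>x s. ((\<lambda>t. fu (x + t *\<^sub>R v)) has_real_derivative fuv (x + s *\<^sub>R v)) (at s)"
    and "0 < h"
  obtains a b where "0 < a" "a < h" "0 < b" "b < h"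
    "f (x + h *\<^sub>R u + h *\<^sub>R v) - f (x + h *\<^sub>R u) - f (x + h *\<^sub>R v) + f x
      = h * h * fuv (x + a *\<^sub>R u + b *\<^sub>R v)"
proof -
  let ?g = "\<lambda>t. f (x + h *\<^sub>R v + t *\<^sub>R u) - f (x + t *\<^sub>R u)"
  have "(?g has_real_derivative fu (x + h *\<^sub>R v + t *\<^sub>R u) - fu (x + t *\<^sub>R u)) (at t)" for t
    by (intro DERIV_diff u)
  from MVT2[OF \<open>0 < h\<close> this] obtain a where a: "0 < a" "a < h"
    "?g h - ?g 0 = (h - 0) * (fu (x + h *\<^sub>R v + a *\<^sub>R u) - fu (x + a *\<^sub>R u))"
    by (elim exE conjE)
  from MVT2[OF \<open>0 < h\<close> v[of "x + a *\<^sub>R u"]] obtain b where b: "0 < b" "b < h"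
    "fu (x + a *\<^sub>R u + h *\<^sub>R v) - fu (x + a *\<^sub>R u + 0 *\<^sub>R v) = (h - 0) * fuv (x + a *\<^sub>R u + b *\<^sub>R v)"
    by (elim exE conjE)
  have "?g h - ?g 0 = h * h * fuv (x + a *\<^sub>R u + b *\<^sub>R v)"
    using a(3) b(3) by (simp add: algebra_simps)
  then show thesis
    using that[OF a(1,2) b(1,2)] by (simp add: algebra_simps)
qed

text \<open>The second-order difference is symmetric in u and v. Hence for every h it is
  \<open>h * h\<close> times a value of either mixed derivative, at points that approach x as h
  tends to 0, and continuity at x concludes.\<close>

lemma mixed_derivative_commute_real:
  fixes f :: "'a::real_normed_vector \<Rightarrow> real"
  assumes u: "\<And>x s. ((\<lambda>t. f (x + t *\<^sub>R u)) has_real_derivative fu (x + s *\<^sub>R u)) (at s)"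
    and uv: "\<And>x s. ((\<lambda>t. fu (x + t *\<^sub>R v)) has_real_derivative fuv (x + s *\<^sub>R v)) (at s)"
    and v: "\<And>x s. ((\<lambda>t. f (x + t *\<^sub>R v)) has_real_derivative fv (x + s *\<^sub>R v)) (at s)"
    and vu: "\<And>x s. ((\<lambda>t. fv (x + t *\<^sub>R u)) has_real_derivative fvu (x + s *\<^sub>R u)) (at s)"
    and "isCont fuv x" "isCont fvu x"
  shows "fuv x = fvu x"
proof -
  define K where "K = norm u + norm v"
  have "\<exists>p q. dist p x \<le> h * K \<and> dist q x \<le> h * K \<and> fuv p = fvu q" if h: "0 < h" for h :: real
  proof -
    obtain a b where ab: "0 < a" "a < h" "0 < b" "b < h"
    "f (x + h *\<^sub>R u + h *\<^sub>R v) - f (x + h *\<^sub>R u) - f (x + h *\<^sub>R v) + f x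
      = h * h * fuv (x + a *\<^sub>R u + b *\<^sub>R v)"
      by (rule second_difference_mvt[where f=f and fu=fu and fuv=fuv and u=u and v=v and x=x, OF u uv h])
    obtain c d where cd: "0 < c" "c < h" "0 < d" "d < h"
    "f (x + h *\<^sub>R v + h *\<^sub>R u) - f (x + h *\<^sub>R v) - f (x + h *\<^sub>R u) + f x
      = h * h * fvu (x + c *\<^sub>R v + d *\<^sub>R u)"
      by (rule second_difference_mvt[where f=f and fu=fv and fuv=fvu and u=v and v=u and x=x, OF v vu h])
    have *: "x + h *\<^sub>R v + h *\<^sub>R u = x + h *\<^sub>R u + h *\<^sub>R v" by simp
    have "h * h * fuv (x + a *\<^sub>R u + b *\<^sub>R v) = h * h * fvu (x + c *\<^sub>R v + d *\<^sub>R u)"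
      using ab(5) cd(5)[unfolded *] by linarith
    then have "fuv (x + a *\<^sub>R u + b *\<^sub>R v) = fvu (x + c *\<^sub>R v + d *\<^sub>R u)"
      using h by simp
    moreover have d: "dist (x + s *\<^sub>R w + t *\<^sub>R w') x \<le> h * (norm w + norm w')"
      if "0 < s" "s < h" "0 < t" "t < h" for s t and w w' :: 'a
    proof -
      have "norm (s *\<^sub>R w + t *\<^sub>R w') \<le> s * norm w + t * norm w'"
        using norm_triangle_ineq[of "s *\<^sub>R w" "t *\<^sub>R w'"] that by simp
      also have "\<dots> \<le> h * norm w + h * norm w'"
        using that by (intro add_mono mult_right_mono) auto
      finally show ?thesis by (simp add: dist_norm add.assoc distrib_left)
    qed
    moreover have "dist (x + a *\<^sub>R u + b *\<^sub>R v) x \<le> h * K"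
      using d[OF ab(1-4), of u v] by (simp add: K_def)
    moreover have "dist (x + c *\<^sub>R v + d *\<^sub>R u) x \<le> h * K"
      using d[OF cd(1-4), of v u] by (simp add: K_def add_ac)
    ultimately show ?thesis by blast
  qed
  from this[of "1 / real (Suc n)" for n]
  have "\<forall>n. \<exists>w. dist (fst w) x \<le> 1 / real (Suc n) * K \<and> dist (snd w) x \<le> 1 / real (Suc n) * K
      \<and> fuv (fst w) = fvu (snd w)"
    by simp
  from choice[OF this] obtain w where w: "\<forall>n. dist (fst (w n)) x \<le> 1 / real (Suc n) * K
      \<and> dist (snd (w n)) x \<le> 1 / real (Suc n) * K \<and> fuv (fst (w n)) = fvu (snd (w n))" ..
  define p where "p n = fst (w n)" for n
  define q where "q n = snd (w n)" for n
  have pq: "\<And>n. dist (p n) x \<le> 1 / real (Suc n) * K"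
    "\<And>n. dist (q n) x \<le> 1 / real (Suc n) * K" "\<And>n. fuv (p n) = fvu (q n)"
    using w by (simp_all add: p_def q_def)
  have lim: "r \<longlonglongrightarrow> x" if "\<And>n. dist (r n) x \<le> 1 / real (Suc n) * K" for r
  proof -
    have "(\<lambda>n. 1 / real (Suc n) * K) \<longlonglongrightarrow> 0 * K"
      by (intro tendsto_intros lim_1_over_n[THEN LIMSEQ_Suc])
    then have "(\<lambda>n. 1 / real (Suc n) * K) \<longlonglongrightarrow> 0" by simp
    then have "(\<lambda>n. dist (r n) x) \<longlonglongrightarrow> 0"
      by (rule tendsto_sandwich[OF _ _ tendsto_const, rotated 2]) (use that in auto)
    then show ?thesis by (rule tendsto_dist_iff[THEN iffD2])
  qed
  have "(\<lambda>n. fuv (p n)) \<longlonglongrightarrow> fuv x"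
    by (rule isCont_tendsto_compose[OF assms(5) lim]) (rule pq)
  moreover have "(\<lambda>n. fvu (q n)) \<longlonglongrightarrow> fvu x"
    by (rule isCont_tendsto_compose[OF assms(6) lim]) (rule pq)
  ultimately show ?thesis unfolding pq(3) by (rule LIMSEQ_unique)
qed

text \<open>The mean value theorem needs real values, hence the detour through real and imaginary
  parts. Commutation is what later reduces arbitrary interleavings of two directions to a product of
  two powers.\<close>

lemma partial_deriv_commute:
  assumes f: "smooth_function f" and "u \<in> Basis" "v \<in> Basis"
  shows "partial_deriv u (partial_deriv v f) = partial_deriv v (partial_deriv u f)"
proof
  fix x
  let ?fu = "partial_deriv u f" and ?fv = "partial_deriv v f"
  let ?fuv = "partial_deriv v ?fu" and ?fvu = "partial_deriv u ?fv"
  have d: "((\<lambda>t. g (x + t *\<^sub>R w)) has_vector_derivative partial_deriv w g (x + s *\<^sub>R w)) (at s)"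
    if "smooth_function g" for g w x s
    using that by (intro has_vector_derivative_partial_deriv smooth_function_imp_differentiable)
  have re: "((\<lambda>t. Re (g (x + t *\<^sub>R w))) has_real_derivative Re (partial_deriv w g (x + s *\<^sub>R w))) (at s)"
    and im: "((\<lambda>t. Im (g (x + t *\<^sub>R w))) has_real_derivative Im (partial_deriv w g (x + s *\<^sub>R w))) (at s)"
    if "smooth_function g" for g w x s
    using d[OF that, of x w s, THEN bounded_linear.has_vector_derivative[OF bounded_linear_Re]] d[OF that, of x w s, THEN bounded_linear.has_vector_derivative[OF bounded_linear_Im]]
    by (simp_all add: has_real_derivative_iff_has_vector_derivative)
  have s: "smooth_function ?fu" "smooth_function ?fv" "smooth_function ?fuv" "smooth_function ?fvu"
    using assms by (auto intro: smooth_function_partial_deriv)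
  have c: "isCont ?fuv x" "isCont ?fvu x"
    using s by (meson differentiable_imp_continuous_within smooth_function_imp_differentiable)+
  have "Re (?fuv x) = Re (?fvu x)"
    by (rule mixed_derivative_commute_real[where f="\<lambda>x. Re (f x)" and fu="\<lambda>x. Re (?fu x)"
          and fv="\<lambda>x. Re (?fv x)" and u=u and v=v]) (auto intro!: re s f isCont_Re[OF c(1)] isCont_Re[OF c(2)])
  moreover have "Im (?fuv x) = Im (?fvu x)"
    by (rule mixed_derivative_commute_real[where f="\<lambda>x. Im (f x)" and fu="\<lambda>x. Im (?fu x)"
          and fv="\<lambda>x. Im (?fv x)" and u=u and v=v]) (auto intro!: im s f isCont_Im[OF c(1)] isCont_Im[OF c(2)])
  ultimately show "?fvu x = ?fuv x" by (simp add: complex_eq_iff)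
qed

lemma smooth_function_partial_deriv_pow:
  "smooth_function f \<Longrightarrow> v \<in> Basis \<Longrightarrow> smooth_function ((partial_deriv v ^^ n) f)"
  by (induction n) (auto intro: smooth_function_partial_deriv)

lemma partial_deriv_commute_pow:
  "smooth_function f \<Longrightarrow> u \<in> Basis \<Longrightarrow> v \<in> Basis \<Longrightarrow>
    partial_deriv v ((partial_deriv u ^^ n) f) = (partial_deriv u ^^ n) (partial_deriv v f)"
  by (induction n) (auto simp: partial_deriv_commute[of _ v u] smooth_function_partial_deriv_pow)

section \<open>Families of functions with scaled derivative bounds\<close>

text \<open>A family \<open>\<tau> l\<close> of functions satisfies, on \<open>\<Omega> l\<close> and uniformly in \<open>l\<close>, the bounds
  \<open>\<bar>\<partial>\<^sub>v\<^sub>1 \<dots> \<partial>\<^sub>v\<^sub>j \<tau> l\<bar> \<lesssim> W l * r v\<^sub>1 l * \<dots> * r v\<^sub>j l\<close> for \<open>j \<le> n\<close> directions from \<open>V\<close>.\<close>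

primrec bdd :: "nat \<Rightarrow> 'a set \<Rightarrow> ('a \<Rightarrow> 'i \<Rightarrow> real) \<Rightarrow> ('i \<Rightarrow> 'a set) \<Rightarrow> ('i \<Rightarrow> real) \<Rightarrow>
    ('i \<Rightarrow> 'a::euclidean_space \<Rightarrow> complex) \<Rightarrow> bool" where
  "bdd 0 V r \<Omega> W \<tau> \<longleftrightarrow> (\<exists>B. \<forall>l. \<forall>x\<in>\<Omega> l. norm (\<tau> l x) \<le> B * W l)"
| "bdd (Suc n) V r \<Omega> W \<tau> \<longleftrightarrow> (\<exists>B. \<forall>l. \<forall>x\<in>\<Omega> l. norm (\<tau> l x) \<le> B * W l) \<and>
    (\<forall>v\<in>V. bdd n V r \<Omega> (\<lambda>l. W l * r v l) (\<lambda>l. partial_deriv v (\<tau> l)))"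

lemma bdd_bound:
  assumes "bdd n V r \<Omega> W \<tau>" "\<And>l. W l > 0"
  obtains B where "B \<ge> 0" "\<And>l x. x \<in> \<Omega> l \<Longrightarrow> norm (\<tau> l x) \<le> B * W l"
proof -
  have "\<exists>B. \<forall>l. \<forall>x\<in>\<Omega> l. norm (\<tau> l x) \<le> B * W l"
    using assms(1) by (cases n) auto
  then obtain B where B: "\<And>l x. x \<in> \<Omega> l \<Longrightarrow> norm (\<tau> l x) \<le> B * W l"
    by blast
  show thesis
  proof (rule that[of "\<bar>B\<bar>"])
    fix l x assume "x \<in> \<Omega> l"
    then have "norm (\<tau> l x) \<le> B * W l" by (rule B)
    also have "\<dots> \<le> \<bar>B\<bar> * W l" using assms(2)[of l] by (intro mult_right_mono) auto
    finally show "norm (\<tau> l x) \<le> \<bar>B\<bar> * W l" .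
  qed auto
qed

lemma bdd_Suc: "bdd (Suc n) V r \<Omega> W \<tau> \<Longrightarrow> bdd n V r \<Omega> W \<tau>"
  by (induction n arbitrary: W \<tau>) auto

lemma bdd_add:
  assumes "bdd n V r \<Omega> W f" "bdd n V r \<Omega> W g" "\<And>l. smooth_function (f l)" "\<And>l. smooth_function (g l)"
    and V: "V \<subseteq> Basis"
  shows "bdd n V r \<Omega> W (\<lambda>l x. f l x + g l x)"
proof -
  have base: "\<exists>B. \<forall>l. \<forall>x\<in>\<Omega> l. norm (f l x + g l x) \<le> B * W l"
    if "bdd 0 V r \<Omega> W f" "bdd 0 V r \<Omega> W g" for f g W
  proof -
    from that obtain B C where BC: "\<forall>l. \<forall>x\<in>\<Omega> l. norm (f l x) \<le> B * W l"
      "\<forall>l. \<forall>x\<in>\<Omega> l. norm (g l x) \<le> C * W l"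
      unfolding bdd.simps by blast
    have "norm (f l x + g l x) \<le> (B + C) * W l" if "x \<in> \<Omega> l" for l x
      using BC that norm_triangle_mono[of "f l x" "B * W l" "g l x" "C * W l"]
      by (simp add: distrib_right)
    then show ?thesis by blast
  qed
  show ?thesis using assms(1-4)
  proof (induction n arbitrary: f g W)
    case 0
    then show ?case using base[of W f g] by simp
  next
    case (Suc n)
    have "bdd n V r \<Omega> (\<lambda>l. W l * r v l) (\<lambda>l. partial_deriv v (\<lambda>x. f l x + g l x))" if "v \<in> V" for v
    proof -
      have "partial_deriv v (\<lambda>x. f l x + g l x) = (\<lambda>x. partial_deriv v (f l) x + partial_deriv v (g l) x)" for l
        using Suc.prems by (intro ext partial_deriv_add smooth_function_imp_differentiable)
      then show ?thesis
        using Suc that V by (auto intro!: Suc.IH smooth_function_partial_deriv)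
    qed
    then show ?case using Suc.prems base[of W f g] by (auto simp: subset_iff)
  qed
qed

text \<open>Leibniz's rule without binomial coefficients: a derivative falls on one factor, and both
  resulting products are again of the same kind, with the scale \<open>r v\<close> absorbed into the
  weight of the factor that was differentiated.\<close>

lemma bdd_mult:
  assumes "bdd n V r \<Omega> W f" "bdd n V r \<Omega> U g" "\<And>l. smooth_function (f l)" "\<And>l. smooth_function (g l)"
    and V: "V \<subseteq> Basis" and "\<And>l. W l > 0" "\<And>l. U l > 0" and r: "\<And>v l. v \<in> V \<Longrightarrow> r v l > 0"
  shows "bdd n V r \<Omega> (\<lambda>l. W l * U l) (\<lambda>l x. f l x * g l x)"
proof -
  have base: "\<exists>B. \<forall>l. \<forall>x\<in>\<Omega> l. norm (f l x * g l x) \<le> B * (W l * U l)"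
    if W: "bdd n V r \<Omega> W f" "\<And>l. W l > 0" and U: "bdd n V r \<Omega> U g" "\<And>l. U l > 0" for f g W U n
  proof -
    obtain B where B: "B \<ge> 0" "\<And>l x. x \<in> \<Omega> l \<Longrightarrow> norm (f l x) \<le> B * W l"
      using bdd_bound[OF W] by blast
    obtain C where C: "C \<ge> 0" "\<And>l x. x \<in> \<Omega> l \<Longrightarrow> norm (g l x) \<le> C * U l"
      using bdd_bound[OF U] by blast
    have "\<forall>l. \<forall>x\<in>\<Omega> l. norm (f l x * g l x) \<le> (B * W l) * (C * U l)"
      using B C W(2) by (auto simp: norm_mult intro!: mult_mono mult_nonneg_nonneg less_imp_le[OF W(2)])
    then show ?thesis by (intro exI[of _ "B * C"]) (auto simp: mult_ac)
  qed
  show ?thesis using assms(1-4,6,7)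
  proof (induction n arbitrary: f g W U)
    case 0
    then show ?case using base[of 0 W f U g] by simp
  next
    case (Suc n)
    have "bdd n V r \<Omega> (\<lambda>l. W l * U l * r v l) (\<lambda>l. partial_deriv v (\<lambda>x. f l x * g l x))" if "v \<in> V" for v
    proof -
      have *: "partial_deriv v (\<lambda>x. f l x * g l x) = (\<lambda>x. f l x * partial_deriv v (g l) x + partial_deriv v (f l) x * g l x)" for l
        using Suc.prems by (intro ext partial_deriv_mult smooth_function_imp_differentiable)
      have s: "smooth_function (partial_deriv v (f l))" "smooth_function (partial_deriv v (g l))" for l
        using Suc.prems that V by (auto intro!: smooth_function_partial_deriv)
      have "bdd n V r \<Omega> (\<lambda>l. W l * (U l * r v l)) (\<lambda>l x. f l x * partial_deriv v (g l) x)"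
        using Suc.prems that s r by (intro Suc.IH bdd_Suc[of n V r \<Omega> W f]) auto
      moreover have "bdd n V r \<Omega> (\<lambda>l. (W l * r v l) * U l) (\<lambda>l x. partial_deriv v (f l) x * g l x)"
        using Suc.prems that s r by (intro Suc.IH bdd_Suc[of n V r \<Omega> U g]) auto
      ultimately show ?thesis
        unfolding * using s Suc.prems V
        by (intro bdd_add smooth_function_mult) (simp_all add: mult_ac)
    qed
    then show ?case using base[of "Suc n" W f U g] Suc.prems by auto
  qed
qed

text \<open>Every differentiation uses up one order of the hypothesis, so it is assumed for all
  orders.\<close>

lemma bdd_partial_deriv_pow:
  assumes "\<And>n. bdd n V r \<Omega> W f" "v \<in> V"
  shows "bdd n V r \<Omega> (\<lambda>l. W l * r v l ^ m) (\<lambda>l. (partial_deriv v ^^ m) (f l))"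
  using assms(1)
proof (induction m arbitrary: f W)
  case (Suc m)
  have "bdd n V r \<Omega> (\<lambda>l. W l * r v l) (\<lambda>l. partial_deriv v (f l))" for n
    using Suc.prems[of "Suc n"] assms(2) by simp
  from Suc.IH[OF this] show ?case
    by (simp add: mult_ac funpow_Suc_right del: funpow.simps)
qed auto

section \<open>Integration over Euclidean space\<close>

lemma lborel_integral_affine:
  fixes f :: "'a::euclidean_space \<Rightarrow> 'b::{banach, second_countable_topology}"
  assumes [measurable]: "f \<in> borel_measurable borel" and c: "c \<noteq> 0"
  shows "integrable lborel (\<lambda>x. f (t + c *\<^sub>R x)) \<longleftrightarrow> integrable lborel f"
    and "\<bar>c\<bar> ^ DIM('a) *\<^sub>R (\<integral>x. f (t + c *\<^sub>R x) \<partial>lborel) = (\<integral>x. f x \<partial>lborel)"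
proof -
  let ?D = "density (distr lborel borel (\<lambda>x. t + c *\<^sub>R x)) (\<lambda>_. ennreal (\<bar>c\<bar> ^ DIM('a)))"
  have eq: "lborel = ?D" using lborel_affine[OF c, of t] by (simp add: ennreal_power)
  have "integrable lborel f = integrable ?D f"
    using arg_cong[OF eq, of "\<lambda>M. integrable M f"] .
  also have "\<dots> = integrable lborel (\<lambda>x. \<bar>c\<bar> ^ DIM('a) *\<^sub>R f (t + c *\<^sub>R x))"
    by (subst integrable_density) (auto simp: integrable_distr_eq)
  also have "\<dots> = integrable lborel (\<lambda>x. f (t + c *\<^sub>R x))"
  proof
    assume "integrable lborel (\<lambda>x. \<bar>c\<bar> ^ DIM('a) *\<^sub>R f (t + c *\<^sub>R x))"
    then have "integrable lborel (\<lambda>x. inverse (\<bar>c\<bar> ^ DIM('a)) *\<^sub>R (\<bar>c\<bar> ^ DIM('a) *\<^sub>R f (t + c *\<^sub>R x)))"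
      by - (rule integrable_scaleR_right, assumption)
    moreover have "inverse (\<bar>c\<bar> ^ DIM('a)) *\<^sub>R (\<bar>c\<bar> ^ DIM('a) *\<^sub>R y) = y" for y :: 'b
      using c by simp
    ultimately show "integrable lborel (\<lambda>x. f (t + c *\<^sub>R x))" by (simp only:)
  qed (intro integrable_scaleR_right)
  finally show "integrable lborel (\<lambda>x. f (t + c *\<^sub>R x)) \<longleftrightarrow> integrable lborel f" by simp
  have "(\<integral>x. f x \<partial>lborel) = (\<integral>x. f x \<partial>?D)"
    using arg_cong[OF eq, of "\<lambda>M. integral\<^sup>L M f"] .
  also have "\<dots> = (\<integral>x. \<bar>c\<bar> ^ DIM('a) *\<^sub>R f (t + c *\<^sub>R x) \<partial>lborel)"
    by (subst integral_density) (auto simp: integral_distr)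
  finally show "\<bar>c\<bar> ^ DIM('a) *\<^sub>R (\<integral>x. f (t + c *\<^sub>R x) \<partial>lborel) = (\<integral>x. f x \<partial>lborel)" by simp
qed

lemma lborel_integral_translate:
  fixes f :: "'a::euclidean_space \<Rightarrow> 'b::{banach, second_countable_topology}"
  assumes "f \<in> borel_measurable borel"
  shows "integrable lborel (\<lambda>x. f (x + t)) \<longleftrightarrow> integrable lborel f"
    and "(\<integral>x. f (x + t) \<partial>lborel) = (\<integral>x. f x \<partial>lborel)"
    and "integrable lborel (\<lambda>x. f (t - x)) \<longleftrightarrow> integrable lborel f"
    and "(\<integral>x. f (t - x) \<partial>lborel) = (\<integral>x. f x \<partial>lborel)"
  using lborel_integral_affine[OF assms, of 1 t] lborel_integral_affine[OF assms, of "-1" t]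
  by (simp_all add: add.commute)

text \<open>Fubini's theorem in the one form used below. Domination by an integrable function of x
  times a kernel whose mass in y is bounded uniformly in x covers both products and
  convolutions.\<close>

lemma lborel_swap:
  fixes f :: "'a::euclidean_space \<Rightarrow> 'b::euclidean_space \<Rightarrow> complex"
  assumes m[measurable]: "(\<lambda>(x, y). f x y) \<in> borel_measurable (lborel \<Otimes>\<^sub>M lborel)"
    and g: "integrable lborel g" and k[measurable]: "\<And>x. k x \<in> borel_measurable borel"
    and pos: "\<And>x. 0 \<le> g x" "\<And>x y. 0 \<le> k x y"
    and c: "\<And>x. (\<integral>\<^sup>+y. ennreal (k x y) \<partial>lborel) \<le> ennreal c"
    and bound: "\<And>x y. norm (f x y) \<le> g x * k x y"
  shows "integrable (lborel \<Otimes>\<^sub>M lborel) (\<lambda>(x, y). f x y)"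
    and "(\<integral>x. (\<integral>y. f x y \<partial>lborel) \<partial>lborel) = (\<integral>y. (\<integral>x. f x y \<partial>lborel) \<partial>lborel)"
proof -
  have "(\<integral>\<^sup>+p. ennreal (norm (case p of (x, y) \<Rightarrow> f x y)) \<partial>(lborel \<Otimes>\<^sub>M lborel))
      = (\<integral>\<^sup>+x. \<integral>\<^sup>+y. ennreal (norm (f x y)) \<partial>lborel \<partial>lborel)"
    by (subst lborel.nn_integral_fst[symmetric]) auto
  also have "\<dots> \<le> (\<integral>\<^sup>+x. ennreal (g x) * ennreal c \<partial>lborel)"
  proof (intro nn_integral_mono)
    fix x
    have "(\<integral>\<^sup>+y. ennreal (norm (f x y)) \<partial>lborel) \<le> (\<integral>\<^sup>+y. ennreal (g x) * ennreal (k x y) \<partial>lborel)"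
      using bound pos by (intro nn_integral_mono) (simp add: ennreal_mult[symmetric])
    also have "\<dots> = ennreal (g x) * (\<integral>\<^sup>+y. ennreal (k x y) \<partial>lborel)"
      by (intro nn_integral_cmult) simp
    also have "\<dots> \<le> ennreal (g x) * ennreal c"
      by (intro mult_left_mono c) simp
    finally show "(\<integral>\<^sup>+y. ennreal (norm (f x y)) \<partial>lborel) \<le> ennreal (g x) * ennreal c" .
  qed
  also have "\<dots> = (\<integral>\<^sup>+x. ennreal (g x) \<partial>lborel) * ennreal c"
    using g by (intro nn_integral_multc) auto
  also have "\<dots> < \<infinity>"
    using integrableD(2)[OF g] pos by (simp add: ennreal_mult_less_top less_top)
  finally show *: "integrable (lborel \<Otimes>\<^sub>M lborel) (\<lambda>(x, y). f x y)"
    by (intro integrableI_bounded) auto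
  show "(\<integral>x. (\<integral>y. f x y \<partial>lborel) \<partial>lborel) = (\<integral>y. (\<integral>x. f x y \<partial>lborel) \<partial>lborel)"
    by (rule lborel_pair.Fubini_integral[symmetric]) (rule *)
qed

text \<open>Averaging replaces boundary terms: integrating \<open>F'\<close> along the unit segment
  in direction v gives \<open>F (x + v) - F x\<close>, whose integral over x vanishes by translation
  invariance. Exchanging the integrals leaves the integral of \<open>F'\<close>, so no decay of F
  beyond integrability is required.\<close>

lemma integral_directional_derivative_eq_0:
  fixes F F' :: "'a::euclidean_space \<Rightarrow> complex"
  assumes d: "\<And>x s. ((\<lambda>t. F (x + t *\<^sub>R v)) has_vector_derivative F' (x + s *\<^sub>R v)) (at s)"
    and c: "continuous_on UNIV F'" and F: "integrable lborel F" and F': "integrable lborel F'"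
  shows "(\<integral>x. F' x \<partial>lborel) = 0"
proof -
  have [measurable]: "F \<in> borel_measurable borel" "F' \<in> borel_measurable borel"
    using F F' by auto
  let ?i = "indicator {0..1} :: real \<Rightarrow> real"
  have ftc: "(\<integral>s. ?i s *\<^sub>R F' (x + s *\<^sub>R v) \<partial>lborel) = F (x + v) - F x" for x
  proof -
    have "(\<integral>s. ?i s *\<^sub>R F' (x + s *\<^sub>R v) \<partial>lborel) = F (x + 1 *\<^sub>R v) - F (x + 0 *\<^sub>R v)"
      by (rule integral_FTC_Icc[where F="\<lambda>t. F (x + t *\<^sub>R v)"])
        (auto intro!: has_vector_derivative_at_within[OF d] continuous_on_compose2[OF c] continuous_intros)
    then show ?thesis by simp
  qed
  have "(\<integral>s. (\<integral>x. ?i s *\<^sub>R F' (x + s *\<^sub>R v) \<partial>lborel) \<partial>lborel)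
      = (\<integral>x. (\<integral>s. ?i s *\<^sub>R F' (x + s *\<^sub>R v) \<partial>lborel) \<partial>lborel)"
  proof (rule lborel_swap(2)[where g="?i" and k="\<lambda>s x. norm (F' (x + s *\<^sub>R v))" and c="\<integral>x. norm (F' x) \<partial>lborel"])
    show "(\<lambda>(s, x). ?i s *\<^sub>R F' (x + s *\<^sub>R v)) \<in> borel_measurable (lborel \<Otimes>\<^sub>M lborel)"
      by measurable
    show "integrable lborel ?i" by simp
    show "(\<integral>\<^sup>+x. ennreal (norm (F' (x + s *\<^sub>R v))) \<partial>lborel) \<le> ennreal (\<integral>x. norm (F' x) \<partial>lborel)" for s
      using lborel_integral_translate[of "\<lambda>x. norm (F' x)" "s *\<^sub>R v"] F'
      by (subst nn_integral_eq_integral) auto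
  qed auto
  also have "\<dots> = (\<integral>x. F (x + v) - F x \<partial>lborel)" by (simp add: ftc)
  also have "\<dots> = 0"
    using lborel_integral_translate[of F v] F by simp
  also have "(\<integral>s. (\<integral>x. ?i s *\<^sub>R F' (x + s *\<^sub>R v) \<partial>lborel) \<partial>lborel) = (\<integral>s. ?i s *\<^sub>R (\<integral>x. F' x \<partial>lborel) \<partial>lborel)"
    using lborel_integral_translate[of F'] by simp
  also have "\<dots> = (\<integral>x. F' x \<partial>lborel)" by simp
  finally show ?thesis .
qed

text \<open>The weight that expresses concentration at scale \<open>1 / R\<close>.\<close>

definition decay :: "real \<Rightarrow> nat \<Rightarrow> 'a::real_normed_vector \<Rightarrow> real"
  where "decay R N x = 1 / (1 + R * norm x) ^ N"

text \<open>The exponent is twice the dimension because \<open>(1 + norm x)\<^sup>2\<close>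
  dominates \<open>1 + (x \<bullet> b)\<^sup>2\<close> for every basis vector b, so that the
  integrand lies below a product of integrable functions of one variable.\<close>

definition decay_mass :: "'a::euclidean_space itself \<Rightarrow> real"
  where "decay_mass _ = (\<integral>x. decay 1 (2 * DIM('a)) (x :: 'a) \<partial>lborel)"

lemma decay_pos: "0 \<le> R \<Longrightarrow> 0 < decay R N x"
  by (simp add: decay_def add_pos_nonneg)

lemma decay_nonneg: "0 \<le> R \<Longrightarrow> 0 \<le> decay R N x"
  by (simp add: decay_pos less_imp_le)

lemma decay_le_1: "0 \<le> R \<Longrightarrow> decay R N x \<le> 1"
  using one_le_power[of "1 + R * norm x" N] by (simp add: decay_def divide_le_eq_1 zero_less_power add_pos_nonneg)

lemma decay_mono: "0 \<le> R \<Longrightarrow> M \<le> N \<Longrightarrow> decay R N x \<le> decay R M x"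
  by (simp add: decay_def frac_le power_increasing add_pos_nonneg)

lemma decay_add: "decay R (M + N) x = decay R M x * decay R N x"
  by (simp add: decay_def power_add)

lemma decay_minus_commute: "decay R N (x - y) = decay R N (y - x)"
  by (simp add: decay_def norm_minus_commute)

lemma decay_measurable [measurable]: "decay R N \<in> borel_measurable borel"
  unfolding decay_def[abs_def] by measurable

text \<open>The weight \<open>1 + R * norm x\<close> is submultiplicative. This is what allows a
  decaying factor to be moved from one centre to another in Peetre's argument.\<close>

lemma decay_triangle:
  assumes "0 \<le> R" shows "decay R N (x - y) * decay R N (y - z) \<le> decay R N (x - z)"
proof -
  have "norm (x - z) \<le> norm (x - y) + norm (y - z)"
    using norm_triangle_ineq[of "x - y" "y - z"] by simp
  then have "1 + R * norm (x - z) \<le> 1 + R * (norm (x - y) + norm (y - z))"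
    using assms by (simp add: mult_left_mono)
  also have "\<dots> \<le> (1 + R * norm (x - y)) * (1 + R * norm (y - z))"
    using assms by (simp add: algebra_simps)
  finally have "(1 + R * norm (x - z)) ^ N \<le> ((1 + R * norm (x - y)) * (1 + R * norm (y - z))) ^ N"
    using assms by (intro power_mono) auto
  then show ?thesis
    using assms by (auto simp: decay_def power_mult_distrib intro!: frac_le zero_less_power add_pos_nonneg)
qed

lemma prod_le_power_norm:
  fixes x :: "'a::euclidean_space"
  shows "(\<Prod>b\<in>Basis. 1 + (x \<bullet> b)\<^sup>2) \<le> (1 + norm x) ^ (2 * DIM('a))"
proof -
  have "1 + (x \<bullet> b)\<^sup>2 \<le> (1 + norm x)\<^sup>2" if "b \<in> Basis" for b
  proof -
    have "(x \<bullet> b)\<^sup>2 \<le> (norm x)\<^sup>2"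
      using Basis_le_norm[OF that, of x] by (simp add: abs_le_square_iff[symmetric])
    then show ?thesis by (simp add: power2_sum) (use norm_ge_zero[of x] in linarith)
  qed
  then have "(\<Prod>b\<in>Basis. 1 + (x \<bullet> b)\<^sup>2) \<le> (\<Prod>b\<in>(Basis::'a set). (1 + norm x)\<^sup>2)"
    by (intro prod_mono) (simp add: add_nonneg_nonneg)
  also have "\<dots> = (1 + norm x) ^ (2 * DIM('a))" by (simp add: power_mult)
  finally show ?thesis .
qed

lemma integrable_decay_1: "integrable lborel (decay 1 (2 * DIM('a)) :: 'a::euclidean_space \<Rightarrow> real)"
proof (rule integrableI_bounded)
  have "set_integrable lborel UNIV (\<lambda>x::real. inverse (1 + x\<^sup>2))"
    using integrable_inverse_1_plus_square by simp
  then have i: "integrable lborel (\<lambda>x::real. inverse (1 + x\<^sup>2))"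
    by (simp add: set_integrable_def)
  have "(\<integral>\<^sup>+x. ennreal (norm (decay 1 (2 * DIM('a)) (x::'a))) \<partial>lborel)
      \<le> (\<integral>\<^sup>+x. (\<Prod>b\<in>Basis. ennreal (inverse (1 + (x \<bullet> b)\<^sup>2))) \<partial>(lborel :: 'a measure))"
  proof (intro nn_integral_mono)
    fix x :: 'a
    have "norm (decay 1 (2 * DIM('a)) x) \<le> inverse (\<Prod>b\<in>Basis. 1 + (x \<bullet> b)\<^sup>2)"
      using prod_le_power_norm[of x]
      by (auto simp: decay_def inverse_eq_divide intro!: frac_le prod_pos add_pos_nonneg)
    also have "\<dots> = (\<Prod>b\<in>Basis. inverse (1 + (x \<bullet> b)\<^sup>2))"
      by (simp add: prod_inversef[symmetric] comp_def)
    finally show "ennreal (norm (decay 1 (2 * DIM('a)) x)) \<le> (\<Prod>b\<in>Basis. ennreal (inverse (1 + (x \<bullet> b)\<^sup>2)))"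
      by (subst prod_ennreal) (auto intro: ennreal_leI)
  qed
  also have "\<dots> = (\<Prod>b\<in>(Basis::'a set). (\<integral>\<^sup>+x. ennreal (inverse (1 + x\<^sup>2)) \<partial>lborel))"
    by (rule nn_integral_lborel_prod) auto
  also have "\<dots> < \<infinity>"
    using integrableD(2)[OF i] by (auto simp: less_top[symmetric] power_eq_top_ennreal)
  finally show "(\<integral>\<^sup>+x. ennreal (norm (decay 1 (2 * DIM('a)) (x::'a))) \<partial>lborel) < \<infinity>" .
qed simp

lemma decay_mass_nonneg: "0 \<le> decay_mass TYPE('a::euclidean_space)"
  unfolding decay_mass_def by (intro Bochner_Integration.integral_nonneg decay_nonneg) auto

text \<open>By scaling, the mass for the exponent \<open>2 * DIM('a)\<close> times
  \<open>R ^ DIM('a)\<close> does not depend on R, and a larger exponent only decreases it. Kernels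
  of height \<open>R ^ DIM('a)\<close> at scale \<open>1 / R\<close> thus have uniformly bounded
  mass.\<close>

lemma integrable_decay:
  fixes y :: "'a::euclidean_space"
  assumes R: "0 < R" and N: "2 * DIM('a) \<le> N"
  shows "integrable lborel (\<lambda>z. decay R N (y - z))"
    and "R ^ DIM('a) * (\<integral>z. decay R N (y - z) \<partial>lborel) \<le> decay_mass TYPE('a)"
proof -
  let ?d = "decay 1 (2 * DIM('a)) :: 'a \<Rightarrow> real"
  have eq: "decay R (2 * DIM('a)) (y - z) = ?d (R *\<^sub>R y + (- R) *\<^sub>R z)" for z
  proof -
    have "R *\<^sub>R y + (- R) *\<^sub>R z = R *\<^sub>R (y - z)" by (simp add: algebra_simps)
    then show ?thesis using R by (simp add: decay_def del: scaleR_minus_left)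
  qed
  have i: "integrable lborel (\<lambda>z. decay R (2 * DIM('a)) (y - z))"
    and m: "R ^ DIM('a) * (\<integral>z. decay R (2 * DIM('a)) (y - z) \<partial>lborel) = decay_mass TYPE('a)"
    using lborel_integral_affine[of ?d "- R" "R *\<^sub>R y"] integrable_decay_1[where 'a='a] R
    by (simp_all add: decay_mass_def eq[abs_def] eq)
  have le: "decay R N (y - z) \<le> decay R (2 * DIM('a)) (y - z)" for z
    using R N by (intro decay_mono) auto
  show i': "integrable lborel (\<lambda>z. decay R N (y - z))"
    by (rule Bochner_Integration.integrable_bound[OF i])
      (use le R in \<open>auto simp: decay_nonneg abs_of_nonneg\<close>)
  have "(\<integral>z. decay R N (y - z) \<partial>lborel) \<le> (\<integral>z. decay R (2 * DIM('a)) (y - z) \<partial>lborel)"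
    by (intro integral_mono i i' le)
  then show "R ^ DIM('a) * (\<integral>z. decay R N (y - z) \<partial>lborel) \<le> decay_mass TYPE('a)"
    unfolding m[symmetric] using R by (intro mult_left_mono) auto
qed

lemma decay_integrable_bound:
  fixes f :: "'a::euclidean_space \<Rightarrow> 'b::{banach, second_countable_topology}"
  assumes "f \<in> borel_measurable borel" "0 < R" "2 * DIM('a) \<le> N"
    and "\<And>z. norm (f z) \<le> B * decay R N (y - z)"
  shows "integrable lborel f"
  by (rule Bochner_Integration.integrable_bound[OF integrable_mult_right[OF integrable_decay(1)[OF assms(2,3), of y], of B]])
    (use assms in \<open>auto intro: order_trans abs_ge_self\<close>)

section \<open>Gaussians and Fourier inversion\<close>

lemma
  fixes f :: "'a::euclidean_space \<Rightarrow> real \<Rightarrow> complex"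
  assumes f: "\<And>b. b \<in> Basis \<Longrightarrow> integrable lborel (f b)"
  shows integrable_lborel_prod: "integrable lborel (\<lambda>x::'a. \<Prod>b\<in>Basis. f b (x \<bullet> b))"
    and integral_lborel_prod: "(\<integral>x. (\<Prod>b\<in>Basis. f b (x \<bullet> b)) \<partial>(lborel :: 'a measure)) = (\<Prod>b\<in>Basis. \<integral>x. f b x \<partial>lborel)"
proof -
  interpret P: product_sigma_finite "\<lambda>_::'a. lborel :: real measure"
    by unfold_locales
  have [measurable]: "b \<in> Basis \<Longrightarrow> f b \<in> borel_measurable borel" for b
    using f[of b] by auto
  have m: "(\<lambda>x::'a. \<Prod>b\<in>Basis. f b (x \<bullet> b)) \<in> borel_measurable borel" by measurable
  let ?P = "\<Pi>\<^sub>M b\<in>(Basis :: 'a set). (lborel :: real measure)"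
  have T: "(\<lambda>y. \<Sum>b\<in>(Basis::'a set). y b *\<^sub>R b) \<in> measurable ?P borel" by measurable
  have eq: "(\<Prod>b\<in>Basis. f b ((\<Sum>b\<in>(Basis::'a set). y b *\<^sub>R b) \<bullet> b)) = (\<Prod>b\<in>Basis. f b (y b))" for y
    by (intro prod.cong) auto
  show "integrable lborel (\<lambda>x::'a. \<Prod>b\<in>Basis. f b (x \<bullet> b))"
    unfolding lborel_eq[where 'a='a] integrable_distr_eq[OF T m] eq
    by (rule P.product_integrable_prod) (use f in auto)
  show "(\<integral>x. (\<Prod>b\<in>Basis. f b (x \<bullet> b)) \<partial>(lborel :: 'a measure)) = (\<Prod>b\<in>Basis. \<integral>x. f b x \<partial>lborel)"
    unfolding lborel_eq[where 'a='a] integral_distr[OF T m] eq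
    by (rule P.product_integral_prod) (use f in auto)
qed

text \<open>The Fourier transform of the one-dimensional Gaussian is read off from the
  characteristic function of the standard normal distribution.\<close>

lemma
  fixes t :: real
  shows integrable_gaussian_real: "integrable lborel (\<lambda>x. iexp (t * x) * complex_of_real (exp (- x\<^sup>2 / 2)))" (is ?i)
    and integral_gaussian_real: "(\<integral>x. iexp (t * x) * complex_of_real (exp (- x\<^sup>2 / 2)) \<partial>lborel)
      = complex_of_real (sqrt (2 * pi) * exp (- t\<^sup>2 / 2))"
proof -
  let ?c = "1 / sqrt (2 * pi)"
  have r: "integrable lborel (\<lambda>x::real. exp (- x\<^sup>2 / 2))"
  proof -
    have "integrable lborel (\<lambda>x. sqrt (2 * pi) * std_normal_density x)"
      by (intro integrable_mult_right) (simp add: integrable_normal_density)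
    then show ?thesis by (simp add: std_normal_density_def)
  qed
  show ?i
    by (rule Bochner_Integration.integrable_bound[OF r]) (auto simp: norm_mult)
  have "complex_of_real (exp (- t\<^sup>2 / 2)) = char std_normal_distribution t"
    by (simp add: char_std_normal_distribution)
  also have "\<dots> = (\<integral>x. std_normal_density x *\<^sub>R iexp (t * x) \<partial>lborel)"
    unfolding char_def by (subst integral_density) auto
  also have "\<dots> = (\<integral>x. complex_of_real ?c * (iexp (t * x) * complex_of_real (exp (- x\<^sup>2 / 2))) \<partial>lborel)"
    by (intro Bochner_Integration.integral_cong) (auto simp: std_normal_density_def scaleR_conv_of_real)
  also have "\<dots> = complex_of_real ?c * (\<integral>x. iexp (t * x) * complex_of_real (exp (- x\<^sup>2 / 2)) \<partial>lborel)"
    by (rule integral_mult_right_zero)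
  finally show "(\<integral>x. iexp (t * x) * complex_of_real (exp (- x\<^sup>2 / 2)) \<partial>lborel)
      = complex_of_real (sqrt (2 * pi) * exp (- t\<^sup>2 / 2))"
    by (simp add: field_simps)
qed

lemma gaussian_prod:
  fixes w x :: "'a::euclidean_space"
  shows "iexp (w \<bullet> x) * complex_of_real (exp (- (norm x)\<^sup>2 / 2))
    = (\<Prod>b\<in>Basis. iexp ((w \<bullet> b) * (x \<bullet> b)) * complex_of_real (exp (- (x \<bullet> b)\<^sup>2 / 2)))"
proof -
  have 1: "iexp (w \<bullet> x) = (\<Prod>b\<in>Basis. iexp ((w \<bullet> b) * (x \<bullet> b)))"
    by (subst euclidean_inner) (simp only: of_real_sum sum_distrib_left exp_sum[OF finite_Basis])
  have "(norm x)\<^sup>2 = (\<Sum>b\<in>Basis. (x \<bullet> b)\<^sup>2)"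
    unfolding power2_norm_eq_inner using euclidean_inner[of x x] by (simp add: power2_eq_square)
  then have "- (norm x)\<^sup>2 / 2 = (\<Sum>b\<in>Basis. - (x \<bullet> b)\<^sup>2 / 2)"
    by (simp add: sum_negf[symmetric] sum_divide_distrib)
  then have 2: "exp (- (norm x)\<^sup>2 / 2) = (\<Prod>b\<in>Basis. exp (- (x \<bullet> b)\<^sup>2 / 2))"
    by (simp only: exp_sum[OF finite_Basis])
  show ?thesis unfolding 1 2 of_real_prod prod.distrib ..
qed

lemma
  fixes w :: "'a::euclidean_space"
  shows integrable_gaussian: "integrable lborel (\<lambda>x::'a. iexp (w \<bullet> x) * complex_of_real (exp (- (norm x)\<^sup>2 / 2)))"
    and integral_gaussian: "(\<integral>x. iexp (w \<bullet> x) * complex_of_real (exp (- (norm x)\<^sup>2 / 2)) \<partial>lborel)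
      = complex_of_real (sqrt (2 * pi) ^ DIM('a) * exp (- (norm w)\<^sup>2 / 2))"
proof -
  show "integrable lborel (\<lambda>x::'a. iexp (w \<bullet> x) * complex_of_real (exp (- (norm x)\<^sup>2 / 2)))"
    unfolding gaussian_prod by (rule integrable_lborel_prod) (rule integrable_gaussian_real)
  have "(\<integral>x. iexp (w \<bullet> x) * complex_of_real (exp (- (norm x)\<^sup>2 / 2)) \<partial>lborel)
      = (\<Prod>b\<in>(Basis::'a set). \<integral>x. iexp ((w \<bullet> b) * x) * complex_of_real (exp (- x\<^sup>2 / 2)) \<partial>lborel)"
    unfolding gaussian_prod
    by (rule integral_lborel_prod[where f="\<lambda>b x. iexp ((w \<bullet> b) * x) * complex_of_real (exp (- x\<^sup>2 / 2))"])
      (rule integrable_gaussian_real)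
  also have "\<dots> = (\<Prod>b\<in>Basis. complex_of_real (sqrt (2 * pi) * exp (- (w \<bullet> b)\<^sup>2 / 2)))"
    by (simp only: integral_gaussian_real)
  also have "\<dots> = complex_of_real (sqrt (2 * pi) ^ DIM('a)) * (\<Prod>b\<in>Basis. complex_of_real (exp (- (w \<bullet> b)\<^sup>2 / 2)))"
    by (simp add: prod.distrib)
  also have "(\<Prod>b\<in>Basis. complex_of_real (exp (- (w \<bullet> b)\<^sup>2 / 2))) = complex_of_real (exp (- (norm w)\<^sup>2 / 2))"
    using gaussian_prod[of 0 w] by simp
  finally show "(\<integral>x. iexp (w \<bullet> x) * complex_of_real (exp (- (norm x)\<^sup>2 / 2)) \<partial>lborel)
      = complex_of_real (sqrt (2 * pi) ^ DIM('a) * exp (- (norm w)\<^sup>2 / 2))"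
    by simp
qed

lemma integrable_exp_norm_square:
  "integrable lborel (\<lambda>x::'a::euclidean_space. exp (- (norm x)\<^sup>2 / 2))"
  using integrable_norm[OF integrable_gaussian[of "0::'a"]] by simp

lemma
  fixes w :: "'a::euclidean_space"
  assumes e: "0 < e"
  shows integrable_gaussian_scaled: "integrable lborel (\<lambda>x::'a. exp (- (e * norm x)\<^sup>2 / 2))"
    and integral_gaussian_scaled: "(\<integral>x. iexp (w \<bullet> x) * complex_of_real (exp (- (e * norm x)\<^sup>2 / 2)) \<partial>lborel)
      = complex_of_real ((sqrt (2 * pi) / e) ^ DIM('a) * exp (- (norm w / e)\<^sup>2 / 2))"
proof -
  show "integrable lborel (\<lambda>x::'a. exp (- (e * norm x)\<^sup>2 / 2))"
    using lborel_integral_affine(1)[of "\<lambda>x::'a. exp (- (norm x)\<^sup>2 / 2)" e 0] integrable_exp_norm_square[where 'a='a] e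
    by simp
  let ?f = "\<lambda>x::'a. iexp (((1/e) *\<^sub>R w) \<bullet> x) * complex_of_real (exp (- (norm x)\<^sup>2 / 2))"
  have "?f (0 + e *\<^sub>R x) = iexp (w \<bullet> x) * complex_of_real (exp (- (e * norm x)\<^sup>2 / 2))" for x
    using e by (simp add: power_mult_distrib)
  then have "e ^ DIM('a) *\<^sub>R (\<integral>x. iexp (w \<bullet> x) * complex_of_real (exp (- (e * norm x)\<^sup>2 / 2)) \<partial>lborel)
      = (\<integral>x. ?f x \<partial>lborel)"
    using lborel_integral_affine(2)[of ?f e 0] e by simp
  also have "\<dots> = complex_of_real (sqrt (2 * pi) ^ DIM('a) * exp (- (norm ((1/e) *\<^sub>R w))\<^sup>2 / 2))"
    by (rule integral_gaussian)
  finally have "complex_of_real (e ^ DIM('a)) * (\<integral>x. iexp (w \<bullet> x) * complex_of_real (exp (- (e * norm x)\<^sup>2 / 2)) \<partial>lborel)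
      = complex_of_real (sqrt (2 * pi) ^ DIM('a) * exp (- (norm w / e)\<^sup>2 / 2))"
    using e by (simp add: scaleR_conv_of_real)
  then show "(\<integral>x. iexp (w \<bullet> x) * complex_of_real (exp (- (e * norm x)\<^sup>2 / 2)) \<partial>lborel)
      = complex_of_real ((sqrt (2 * pi) / e) ^ DIM('a) * exp (- (norm w / e)\<^sup>2 / 2))"
    using e by (simp add: power_divide field_simps)
qed

lemma fourier_measurable_aux:
  fixes f :: "'a::euclidean_space \<Rightarrow> complex"
  assumes [measurable]: "f \<in> borel_measurable borel"
  shows "(\<lambda>x. \<integral>\<xi>. exp (\<i> * complex_of_real (c * (x \<bullet> \<xi>))) * f \<xi> \<partial>lborel) \<in> borel_measurable borel"
proof -
  have "(\<lambda>x. \<integral>\<xi>. exp (\<i> * complex_of_real (c * (x \<bullet> \<xi>))) * f \<xi> \<partial>lborel) \<in> borel_measurable lborel"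
    by (rule lborel.borel_measurable_lebesgue_integral) measurable
  then show ?thesis by simp
qed

text \<open>The double integral does not converge absolutely, so its order cannot be exchanged
  directly. A Gaussian factor of width \<open>1 / a\<close> in x is inserted first; after the
  exchange it becomes an averaging of f around \<open>\<xi>0\<close> at scale a, and a tends to 0 on
  both sides.\<close>

theorem fourier_inv_fourier:
  fixes f :: "real ^ 'n::finite \<Rightarrow> complex"
  assumes c: "continuous_on UNIV f" and B: "\<And>x. norm (f x) \<le> B"
    and f: "integrable lborel f" and i: "integrable lborel (inv_fourier f)"
  shows "fourier (inv_fourier f) \<xi>0 = f \<xi>0"
proof -
  let ?n = "CARD('n)"
  have [measurable]: "f \<in> borel_measurable borel" "inv_fourier f \<in> borel_measurable borel"
    using f i by auto
  define K :: complex where "K = complex_of_real (1 / (2 * pi) ^ ?n)"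
  define e where "e m = 1 / real (Suc m)" for m
  have e: "0 < e m" for m by (simp add: e_def)
  have e0: "e \<longlonglongrightarrow> 0" unfolding e_def[abs_def] by (rule LIMSEQ_Suc[OF lim_1_over_n])
  define G where "G a x = complex_of_real (exp (- (a * norm x)\<^sup>2 / 2))" for a and x :: "real ^ 'n"
  have [measurable]: "G a \<in> borel_measurable borel" for a unfolding G_def by measurable
  define J where "J a = (\<integral>x. exp (- \<i> * complex_of_real (\<xi>0 \<bullet> x)) * inv_fourier f x * G a x \<partial>lborel)" for a
  have "(\<lambda>m. J (e m)) \<longlonglongrightarrow> (\<integral>x. exp (- \<i> * complex_of_real (\<xi>0 \<bullet> x)) * inv_fourier f x \<partial>lborel)"
    unfolding J_def
  proof (rule integral_dominated_convergence[where w="\<lambda>x. norm (inv_fourier f x)"])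
    show "AE x in lborel. (\<lambda>m. exp (- \<i> * complex_of_real (\<xi>0 \<bullet> x)) * inv_fourier f x * G (e m) x)
        \<longlonglongrightarrow> exp (- \<i> * complex_of_real (\<xi>0 \<bullet> x)) * inv_fourier f x"
    proof (intro AE_I2)
      fix x :: "real ^ 'n"
      have "(\<lambda>m. exp (- \<i> * complex_of_real (\<xi>0 \<bullet> x)) * inv_fourier f x * G (e m) x)
        \<longlonglongrightarrow> exp (- \<i> * complex_of_real (\<xi>0 \<bullet> x)) * inv_fourier f x * complex_of_real (exp (- (0 * norm x)\<^sup>2 / 2))"
        unfolding G_def by (intro tendsto_intros e0) auto
      then show "(\<lambda>m. exp (- \<i> * complex_of_real (\<xi>0 \<bullet> x)) * inv_fourier f x * G (e m) x)
        \<longlonglongrightarrow> exp (- \<i> * complex_of_real (\<xi>0 \<bullet> x)) * inv_fourier f x" by simp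
    qed
    show "AE x in lborel. norm (exp (- \<i> * complex_of_real (\<xi>0 \<bullet> x)) * inv_fourier f x * G (e m) x)
        \<le> norm (inv_fourier f x)" for m
      by (auto simp: G_def norm_mult norm_exp_eq_Re mult_left_le)
  qed (use i in auto)
  then have 1: "(\<lambda>m. J (e m)) \<longlonglongrightarrow> fourier (inv_fourier f) \<xi>0" by (simp add: fourier_def)
  \<comment> \<open>The same regularized integral computed in the other order: the transform of the
    Gaussian factor, rescaled, averages f around \<open>\<xi>0\<close>.\<close>
  have J: "J a = K * complex_of_real (sqrt (2 * pi) ^ ?n) * (\<integral>v. f (\<xi>0 + a *\<^sub>R v) * G 1 v \<partial>lborel)"
    if a: "0 < a" for a
  proof -
    have "J a = (\<integral>x. (\<integral>\<xi>. K * G a x * (iexp ((\<xi> - \<xi>0) \<bullet> x) * f \<xi>) \<partial>lborel) \<partial>lborel)"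
      unfolding J_def
    proof (intro Bochner_Integration.integral_cong refl)
      fix x :: "real ^ 'n"
      have "iexp ((\<xi> - \<xi>0) \<bullet> x) = exp (- \<i> * complex_of_real (\<xi>0 \<bullet> x)) * iexp (x \<bullet> \<xi>)" for \<xi>
        by (simp add: exp_add[symmetric] inner_diff_left inner_commute algebra_simps)
      then have "(\<integral>\<xi>. K * G a x * (iexp ((\<xi> - \<xi>0) \<bullet> x) * f \<xi>) \<partial>lborel)
          = (\<integral>\<xi>. (K * G a x * exp (- \<i> * complex_of_real (\<xi>0 \<bullet> x))) * (iexp (x \<bullet> \<xi>) * f \<xi>) \<partial>lborel)"
        by (simp only: mult.assoc)
      also have "\<dots> = (K * G a x * exp (- \<i> * complex_of_real (\<xi>0 \<bullet> x))) * (\<integral>\<xi>. iexp (x \<bullet> \<xi>) * f \<xi> \<partial>lborel)"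
        by (rule integral_mult_right_zero)
      finally show "exp (- \<i> * complex_of_real (\<xi>0 \<bullet> x)) * inv_fourier f x * G a x
          = (\<integral>\<xi>. K * G a x * (iexp ((\<xi> - \<xi>0) \<bullet> x) * f \<xi>) \<partial>lborel)"
        by (simp add: inv_fourier_def K_def mult_ac)
    qed
    also have "\<dots> = (\<integral>\<xi>. (\<integral>x. K * G a x * (iexp ((\<xi> - \<xi>0) \<bullet> x) * f \<xi>) \<partial>lborel) \<partial>lborel)"
    proof (rule lborel_swap(2)[where g="\<lambda>x. norm K * exp (- (a * norm x)\<^sup>2 / 2)"
          and k="\<lambda>x \<xi>. norm (f \<xi>)" and c="\<integral>\<xi>. norm (f \<xi>) \<partial>lborel"])
      show "(\<lambda>(x, \<xi>). K * G a x * (iexp ((\<xi> - \<xi>0) \<bullet> x) * f \<xi>)) \<in> borel_measurable (lborel \<Otimes>\<^sub>M lborel)"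
        by measurable
      show "integrable lborel (\<lambda>x::real ^ 'n. norm K * exp (- (a * norm x)\<^sup>2 / 2))"
        by (intro integrable_mult_right integrable_gaussian_scaled a)
      show "(\<integral>\<^sup>+\<xi>. ennreal (norm (f \<xi>)) \<partial>lborel) \<le> ennreal (\<integral>\<xi>. norm (f \<xi>) \<partial>lborel)"
        using f by (subst nn_integral_eq_integral) auto
      show "norm (K * G a x * (iexp ((\<xi> - \<xi>0) \<bullet> x) * f \<xi>)) \<le> norm K * exp (- (a * norm x)\<^sup>2 / 2) * norm (f \<xi>)" for x \<xi>
        by (simp add: norm_mult G_def)
    qed auto
    also have "\<dots> = (\<integral>\<xi>. K * f \<xi> * complex_of_real ((sqrt (2 * pi) / a) ^ ?n * exp (- (norm (\<xi> - \<xi>0) / a)\<^sup>2 / 2)) \<partial>lborel)"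
    proof (intro Bochner_Integration.integral_cong refl)
      fix \<xi> :: "real ^ 'n"
      have "(\<integral>x. K * G a x * (iexp ((\<xi> - \<xi>0) \<bullet> x) * f \<xi>) \<partial>lborel)
          = (\<integral>x. (K * f \<xi>) * (iexp ((\<xi> - \<xi>0) \<bullet> x) * complex_of_real (exp (- (a * norm x)\<^sup>2 / 2))) \<partial>lborel)"
        by (simp add: G_def mult_ac)
      also have "\<dots> = K * f \<xi> * (\<integral>x. iexp ((\<xi> - \<xi>0) \<bullet> x) * complex_of_real (exp (- (a * norm x)\<^sup>2 / 2)) \<partial>lborel)"
        by (rule integral_mult_right_zero)
      finally show "(\<integral>x. K * G a x * (iexp ((\<xi> - \<xi>0) \<bullet> x) * f \<xi>) \<partial>lborel)
        = K * f \<xi> * complex_of_real ((sqrt (2 * pi) / a) ^ ?n * exp (- (norm (\<xi> - \<xi>0) / a)\<^sup>2 / 2))"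
        by (simp only: integral_gaussian_scaled[OF a] DIM_cart DIM_real mult_1_right)
    qed
    \<comment> \<open>Substituting \<open>\<xi> = \<xi>0 + a *\<^sub>R v\<close> makes the Gaussian
      independent of a and moves the dependence on a into the argument of f, where continuity can
      act.\<close>
    also have "\<dots> = a ^ ?n *\<^sub>R (\<integral>v. K * f (\<xi>0 + a *\<^sub>R v) *
        complex_of_real ((sqrt (2 * pi) / a) ^ ?n * exp (- (norm (\<xi>0 + a *\<^sub>R v - \<xi>0) / a)\<^sup>2 / 2)) \<partial>lborel)"
      using a by (subst lborel_integral_affine(2)[where c=a and t=\<xi>0, symmetric]) auto
    also have "\<dots> = a ^ ?n *\<^sub>R (\<integral>v. (K * complex_of_real ((sqrt (2 * pi) / a) ^ ?n)) * (f (\<xi>0 + a *\<^sub>R v) * G 1 v) \<partial>lborel)"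
      using a by (simp add: G_def mult_ac)
    also have "\<dots> = a ^ ?n *\<^sub>R ((K * complex_of_real ((sqrt (2 * pi) / a) ^ ?n)) * (\<integral>v. f (\<xi>0 + a *\<^sub>R v) * G 1 v \<partial>lborel))"
      by (simp only: integral_mult_right_zero)
    also have "\<dots> = K * complex_of_real (sqrt (2 * pi) ^ ?n) * (\<integral>v. f (\<xi>0 + a *\<^sub>R v) * G 1 v \<partial>lborel)"
      using a by (simp add: scaleR_conv_of_real power_divide)
    finally show ?thesis .
  qed
  have "(\<lambda>m. \<integral>v. f (\<xi>0 + e m *\<^sub>R v) * G 1 v \<partial>lborel) \<longlonglongrightarrow> (\<integral>v. f \<xi>0 * G 1 v \<partial>lborel)"
  proof (rule integral_dominated_convergence[where w="\<lambda>v. B * exp (- (norm v)\<^sup>2 / 2)"])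
    show "AE v in lborel. (\<lambda>m. f (\<xi>0 + e m *\<^sub>R v) * G 1 v) \<longlonglongrightarrow> f \<xi>0 * G 1 v"
    proof (intro AE_I2 tendsto_mult tendsto_const)
      fix v :: "real ^ 'n"
      have "(\<lambda>m. \<xi>0 + e m *\<^sub>R v) \<longlonglongrightarrow> \<xi>0 + 0 *\<^sub>R v" by (intro tendsto_intros e0)
      moreover have "isCont f \<xi>0" using c by (simp add: continuous_on_eq_continuous_at)
      ultimately show "(\<lambda>m. f (\<xi>0 + e m *\<^sub>R v)) \<longlonglongrightarrow> f \<xi>0"
        by (auto intro: isCont_tendsto_compose)
    qed
    show "AE v in lborel. norm (f (\<xi>0 + e m *\<^sub>R v) * G 1 v) \<le> B * exp (- (norm v)\<^sup>2 / 2)" for m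
      using B by (auto simp: norm_mult G_def)
    show "integrable lborel (\<lambda>v::real ^ 'n. B * exp (- (norm v)\<^sup>2 / 2))"
      by (intro integrable_mult_right integrable_exp_norm_square)
  qed auto
  also have "(\<integral>v. f \<xi>0 * G 1 v \<partial>lborel) = f \<xi>0 * (\<integral>v. G 1 v \<partial>lborel)"
    by (rule integral_mult_right_zero)
  also have "(\<integral>v. G 1 v \<partial>lborel) = complex_of_real (sqrt (2 * pi) ^ ?n)"
    using integral_gaussian[of "0 :: real ^ 'n"] by (simp add: G_def)
  finally have "(\<lambda>m. J (e m)) \<longlonglongrightarrow> K * complex_of_real (sqrt (2 * pi) ^ ?n) * (f \<xi>0 * complex_of_real (sqrt (2 * pi) ^ ?n))"
    unfolding J[OF e] by (intro tendsto_intros)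
  \<comment> \<open>The two Gaussian integrals contribute \<open>sqrt (2 * pi)\<close> twice per
    dimension, which the normalization of \<open>inv_fourier\<close> cancels exactly.\<close>
  also have "K * complex_of_real (sqrt (2 * pi) ^ ?n) * (f \<xi>0 * complex_of_real (sqrt (2 * pi) ^ ?n))
      = f \<xi>0 * complex_of_real ((sqrt (2 * pi) * sqrt (2 * pi)) ^ ?n / (2 * pi) ^ ?n)"
    by (simp add: K_def power_mult_distrib del: real_sqrt_mult_self)
  also have "\<dots> = f \<xi>0" by simp
  finally show ?thesis using 1 LIMSEQ_unique by blast
qed

section \<open>Schwartz functions\<close>

lemma set_coordinates: "distinct (coordinates :: 'n::finite list)" "set (coordinates :: 'n list) = UNIV"
proof -
  have "\<exists>is :: 'n list. distinct is \<and> set is = UNIV"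
    using finite_distinct_list[of "UNIV :: 'n set"] by auto
  from someI_ex[OF this] show "distinct (coordinates :: 'n::finite list)" "set (coordinates :: 'n list) = UNIV"
    by (simp_all add: coordinates_def)
qed

text \<open>Multi-index bounds are only read off at multi-indices with at most one nonzero entry, so
  the enumeration in \<open>coordinates\<close> drops out.\<close>

lemma multi_deriv_single:
  "multi_deriv (\<lambda>j. if j = i then m else 0) f = (partial_deriv (axis i 1) ^^ m) f"
proof -
  have "foldr (\<lambda>j. partial_deriv (axis j 1) ^^ (if j = i then m else 0)) is f
      = (if i \<in> set is then (partial_deriv (axis i 1) ^^ m) f else f)" if "distinct is" for "is"
    using that by (induction "is") auto
  from this[of coordinates] show ?thesis by (simp add: multi_deriv_def set_coordinates)
qed

lemma multi_deriv_0: "multi_deriv (\<lambda>_. 0) f = f"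
  using multi_deriv_single[of _ 0 f] by simp

lemma order_of_single: "order_of (\<lambda>j. if j = i then m else 0) = m"
  by (simp add: order_of_def)

lemma schwartz_smooth: "schwartz f \<Longrightarrow> smooth_function f"
  by (simp add: schwartz_def)

lemma schwartz_measurable: "schwartz f \<Longrightarrow> f \<in> borel_measurable borel"
  by (intro smooth_function_measurable schwartz_smooth)

lemma schwartz_multi_deriv_bound:
  fixes f :: "real ^ 'n::finite \<Rightarrow> complex"
  assumes "schwartz f"
  obtains B where "0 \<le> B" "\<And>x. norm (multi_deriv \<beta> f x) \<le> B * decay 1 N x"
proof -
  obtain B where B: "\<And>x. bracket x ^ N * norm (multi_deriv \<beta> f x) \<le> B"
    using assms unfolding schwartz_def by blast
  have b: "bracket x > 0" for x :: "real ^ 'n" by (simp add: bracket_def add_pos_nonneg)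
  have "0 \<le> bracket (0 :: real ^ 'n) ^ N * norm (multi_deriv \<beta> f 0)"
    using b[of 0] by (intro mult_nonneg_nonneg zero_le_power) auto
  then have "0 \<le> B" using B[of 0] by linarith
  moreover have "norm (multi_deriv \<beta> f x) \<le> B * decay 1 N x" for x
    using B[of x] b[of x] by (simp add: decay_def bracket_def pos_le_divide_eq mult.commute)
  ultimately show thesis using that by blast
qed

lemma schwartz_bound:
  assumes "schwartz f"
  obtains B where "0 \<le> B" "\<And>x. norm (f x) \<le> B * decay 1 N x"
proof -
  obtain B where "0 \<le> B" "\<And>x. norm (multi_deriv (\<lambda>_. 0) f x) \<le> B * decay 1 N x"
    using schwartz_multi_deriv_bound[OF assms, of "\<lambda>_. 0" N] by blast
  then show thesis by (intro that[of B]) (simp_all add: multi_deriv_0)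
qed

lemma schwartz_pow_bound:
  assumes "schwartz f"
  obtains B where "0 \<le> B" "\<And>x. norm ((partial_deriv (axis i 1) ^^ m) f x) \<le> B * decay 1 N x"
proof -
  obtain B where "0 \<le> B" "\<And>x. norm (multi_deriv (\<lambda>j. if j = i then m else 0) f x) \<le> B * decay 1 N x"
    using schwartz_multi_deriv_bound[OF assms, of "\<lambda>j. if j = i then m else 0" N] by blast
  then show thesis by (intro that[of B]) (simp_all add: multi_deriv_single)
qed

lemma decay_bound_integrable:
  fixes f :: "'a::euclidean_space \<Rightarrow> 'b::{banach, second_countable_topology}"
  assumes "f \<in> borel_measurable borel" "\<And>x. norm (f x) \<le> B * decay 1 (2 * DIM('a)) x"
  shows "integrable lborel f"
  by (rule decay_integrable_bound[OF assms(1), of 1 "2 * DIM('a)" B 0])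
    (use assms(2) in \<open>auto simp: decay_def\<close>)

lemma schwartz_integrable:
  fixes f :: "real ^ 'n::finite \<Rightarrow> complex"
  assumes "schwartz f" shows "integrable lborel f"
proof -
  obtain B where "\<And>x. norm (f x) \<le> B * decay 1 (2 * CARD('n)) x"
    using schwartz_bound[OF assms] by blast
  then show ?thesis
    using schwartz_measurable[OF assms] by (intro decay_bound_integrable) auto
qed

section \<open>Bounded functions as tempered distributions\<close>

lemma finite_multi_index: "finite {\<beta> :: 'n::finite multi_index. order_of \<beta> \<le> N}"
proof (rule finite_subset)
  show "{\<beta> :: 'n multi_index. order_of \<beta> \<le> N} \<subseteq> PiE UNIV (\<lambda>_. {..N})"
  proof
    fix \<beta> :: "'n multi_index" assume "\<beta> \<in> {\<beta>. order_of \<beta> \<le> N}"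
    then have "\<beta> i \<le> N" for i
      using member_le_sum[of i UNIV \<beta>] by (simp add: order_of_def)
    then show "\<beta> \<in> PiE UNIV (\<lambda>_. {..N})" by auto
  qed
qed (auto intro: finite_PiE)

lemma schwartz_seminorm_bound:
  fixes f :: "real ^ 'n::finite \<Rightarrow> complex"
  assumes "schwartz f" shows "norm (f x) \<le> schwartz_seminorm N f * decay 1 N x"
proof -
  let ?s = "\<lambda>\<beta>. SUP x. bracket x ^ N * norm (multi_deriv \<beta> f x)"
  have b: "bracket x > 0" for x :: "real ^ 'n" by (simp add: bracket_def add_pos_nonneg)
  have bdd: "bdd_above (range (\<lambda>x. bracket x ^ N * norm (multi_deriv \<beta> f x)))" for \<beta>
  proof -
    obtain B where "\<And>x. bracket x ^ N * norm (multi_deriv \<beta> f x) \<le> B"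
      using assms unfolding schwartz_def by blast
    then show ?thesis by (auto intro!: bdd_aboveI2)
  qed
  have le: "bracket x ^ N * norm (multi_deriv \<beta> f x) \<le> ?s \<beta>" for \<beta> x
    by (rule cSUP_upper[OF UNIV_I bdd])
  have "0 \<le> ?s \<beta>" for \<beta>
    using le[of 0 \<beta>] b[of 0] by (meson mult_nonneg_nonneg norm_ge_zero order_trans zero_le_power less_imp_le)
  then have "?s (\<lambda>_. 0) \<le> schwartz_seminorm N f"
    unfolding schwartz_seminorm_def
    by (intro member_le_sum[of "\<lambda>_. 0"] finite_multi_index) (auto simp: order_of_def)
  then have "bracket x ^ N * norm (f x) \<le> schwartz_seminorm N f"
    using le[of x "\<lambda>_. 0"] by (simp add: multi_deriv_0)
  then show ?thesis
    using b[of x] by (simp add: decay_def bracket_def pos_le_divide_eq mult.commute)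
qed

text \<open>Continuity of the functional uses the seminorm of order \<open>2 * CARD('n)\<close>, the
  decay that was shown to be integrable. The frequency pieces, their representatives and the images
  under the operator are all bounded, so this settles every temperedness obligation.\<close>

lemma bounded_tempered_function:
  fixes g :: "real ^ 'n::finite \<Rightarrow> complex"
  assumes [measurable]: "g \<in> borel_measurable borel" and B: "\<And>x. norm (g x) \<le> B"
  shows "tempered_function g"
proof -
  let ?N = "2 * CARD('n)" and ?D = "decay_mass TYPE(real ^ 'n)"
  have B0: "0 \<le> B" using B[of 0] norm_ge_zero order_trans by blast
  have int: "integrable lborel (\<lambda>x. g x * \<phi> x)" if "schwartz \<phi>" for \<phi>
  proof (rule Bochner_Integration.integrable_bound[OF integrable_mult_right[OF integrable_norm[OF schwartz_integrable[OF that]], of B]])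
    have [measurable]: "\<phi> \<in> borel_measurable borel" using that by (rule schwartz_measurable)
    show "(\<lambda>x. g x * \<phi> x) \<in> borel_measurable lborel" by measurable
    show "AE x in lborel. norm (g x * \<phi> x) \<le> norm (B * norm (\<phi> x))"
      using B B0 by (auto simp: norm_mult intro!: mult_right_mono)
  qed
  have "norm (dist_of g \<phi>) \<le> B * ?D * schwartz_seminorm ?N \<phi>" if \<phi>: "schwartz \<phi>" for \<phi>
  proof -
    have "norm (dist_of g \<phi>) \<le> (\<integral>x. norm (g x * \<phi> x) \<partial>lborel)"
      unfolding dist_of_def by (rule integral_norm_bound)
    also have "\<dots> \<le> (\<integral>x. B * schwartz_seminorm ?N \<phi> * decay 1 ?N (0 - x) \<partial>(lborel :: (real ^ 'n) measure))"
    proof (rule integral_mono)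
      show "integrable lborel (\<lambda>x. norm (g x * \<phi> x))" by (rule integrable_norm[OF int[OF \<phi>]])
      show "integrable lborel (\<lambda>x::real ^ 'n. B * schwartz_seminorm ?N \<phi> * decay 1 ?N (0 - x))"
        by (rule integrable_mult_right, rule integrable_decay(1)) auto
      fix x :: "real ^ 'n"
      show "norm (g x * \<phi> x) \<le> B * schwartz_seminorm ?N \<phi> * decay 1 ?N (0 - x)"
        using mult_mono[OF B[of x] schwartz_seminorm_bound[OF \<phi>, of x ?N] B0]
        by (simp add: norm_mult mult.assoc decay_def)
    qed
    also have "\<dots> = B * schwartz_seminorm ?N \<phi> * (\<integral>x. decay 1 ?N (0 - x) \<partial>(lborel :: (real ^ 'n) measure))"
      by (rule integral_mult_right_zero)
    also have "\<dots> = B * schwartz_seminorm ?N \<phi> * ?D"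
      by (simp add: decay_mass_def decay_def)
    finally show ?thesis by (simp add: mult_ac)
  qed
  then show ?thesis
    using int unfolding tempered_function_def tempered_distribution_def
    by (auto simp: dist_of_def distrib_left mult.left_commute)
qed

text \<open>The span of the products of a Gaussian with polynomials is closed under differentiation, so it
  consists of Schwartz functions when \<open>t > 0\<close>.\<close>

inductive_set gaussian_poly :: "real \<Rightarrow> 'a::euclidean_space \<Rightarrow> ('a \<Rightarrow> complex) set"
  for t :: real and y :: "'a::euclidean_space" where
  base: "(\<lambda>x. complex_of_real (exp (- t * ((x - y) \<bullet> (x - y))))) \<in> gaussian_poly t y"
| coord: "f \<in> gaussian_poly t y \<Longrightarrow> (\<lambda>x. complex_of_real ((x - y) \<bullet> w) * f x) \<in> gaussian_poly t y"
| scale: "f \<in> gaussian_poly t y \<Longrightarrow> (\<lambda>x. c * f x) \<in> gaussian_poly t y"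
| plus: "f \<in> gaussian_poly t y \<Longrightarrow> g \<in> gaussian_poly t y \<Longrightarrow> (\<lambda>x. f x + g x) \<in> gaussian_poly t y"

lemma gaussian_poly_derivative:
  assumes "f \<in> gaussian_poly t y"
  shows "(\<forall>x. f differentiable at x) \<and> (\<forall>v. partial_deriv v f \<in> gaussian_poly t y)"
  using assms
proof (induction rule: gaussian_poly.induct)
  case base
  let ?g = "\<lambda>x. complex_of_real (exp (- t * ((x - y) \<bullet> (x - y))))"
  have d: "(?g has_derivative (\<lambda>h. complex_of_real (exp (- t * ((x - y) \<bullet> (x - y))) * (- t * (2 * ((x - y) \<bullet> h)))))) (at x)" for x
    by (rule bounded_linear.has_derivative[OF bounded_linear_of_real])
      (auto intro!: derivative_eq_intros simp: inner_commute algebra_simps)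
  have "partial_deriv v ?g = (\<lambda>x. complex_of_real (- 2 * t) * (complex_of_real ((x - y) \<bullet> v) * ?g x))" for v
    by (rule ext, rule partial_deriv_eq[OF d, THEN trans]) simp
  then have "partial_deriv v ?g \<in> gaussian_poly t y" for v
    by (simp only: gaussian_poly.intros)
  moreover have "?g differentiable at x" for x
    using d unfolding differentiable_def by blast
  ultimately show ?case by blast
next
  case (coord f w)
  let ?l = "\<lambda>x. complex_of_real ((x - y) \<bullet> w)"
  have d: "(?l has_derivative (\<lambda>h. complex_of_real (h \<bullet> w))) (at x)" for x
    by (rule bounded_linear.has_derivative[OF bounded_linear_of_real])
      (auto intro!: derivative_eq_intros)
  then have l: "?l differentiable at x" for x by (auto simp: differentiable_def)
  have "partial_deriv v (\<lambda>x. ?l x * f x) = (\<lambda>x. ?l x * partial_deriv v f x + complex_of_real (v \<bullet> w) * f x)" for v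
    by (rule ext, subst partial_deriv_mult) (use l coord partial_deriv_eq[OF d] in auto)
  then show ?case
    using coord l by (auto intro!: gaussian_poly.intros)
next
  case (scale f c)
  have "partial_deriv v (\<lambda>x. c * f x) = (\<lambda>x. c * partial_deriv v f x)" for v
    by (rule ext, subst partial_deriv_mult) (use scale in auto)
  then show ?case
    using scale by (auto intro!: gaussian_poly.intros)
next
  case (plus f g)
  have "partial_deriv v (\<lambda>x. f x + g x) = (\<lambda>x. partial_deriv v f x + partial_deriv v g x)" for v
    by (rule ext, subst partial_deriv_add) (use plus in auto)
  then show ?case
    using plus by (auto intro!: gaussian_poly.intros)
qed

lemma gaussian_poly_differentiable: "f \<in> gaussian_poly t y \<Longrightarrow> f differentiable at x"
  and gaussian_poly_partial_deriv: "f \<in> gaussian_poly t y \<Longrightarrow> partial_deriv v f \<in> gaussian_poly t y"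
  by (simp_all add: gaussian_poly_derivative)

lemma gaussian_poly_smooth: "f \<in> gaussian_poly t y \<Longrightarrow> smooth_function f"
proof (rule diffn_imp_smooth_function)
  show "f \<in> gaussian_poly t y \<Longrightarrow> diffn n f" for n
    by (induction n arbitrary: f) (simp_all add: gaussian_poly_differentiable gaussian_poly_partial_deriv)
qed

lemma gaussian_poly_multi_deriv:
  assumes "f \<in> gaussian_poly t y" shows "multi_deriv \<beta> f \<in> gaussian_poly t y"
proof -
  have pow: "(partial_deriv v ^^ m) g \<in> gaussian_poly t y" if "g \<in> gaussian_poly t y" for g v m
    using that by (induction m) (simp_all add: gaussian_poly_partial_deriv)
  have "foldr (\<lambda>i. partial_deriv (axis i 1) ^^ \<beta> i) is f \<in> gaussian_poly t y" for "is"
    using assms pow by (induction "is") auto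
  then show ?thesis by (simp add: multi_deriv_def)
qed

lemma bracket_triangle: "bracket x \<le> bracket y * bracket (x - y)"
proof -
  have "norm x \<le> norm y + norm (x - y)" by (metis add_diff_cancel_left' diff_add_cancel norm_triangle_ineq add.commute)
  then show ?thesis by (simp add: bracket_def algebra_simps) (smt (verit) mult_nonneg_nonneg norm_ge_zero)
qed

lemma gaussian_poly_bound:
  assumes "f \<in> gaussian_poly t y" "0 < t"
  shows "\<exists>B. \<forall>x. bracket x ^ N * norm (f x) \<le> B"
  using assms
proof (induction arbitrary: N rule: gaussian_poly.induct)
  case base
  have "bracket x ^ N * norm (complex_of_real (exp (- t * ((x - y) \<bullet> (x - y)))))
      \<le> bracket y ^ N * exp (real N * real N / (4 * t))" for x
  proof -
    let ?s = "norm (x - y)"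
    have "bracket (x - y) \<le> exp ?s" using exp_ge_add_one_self[of ?s] by (simp add: bracket_def)
    then have "bracket (x - y) ^ N \<le> exp ?s ^ N" by (intro power_mono) (auto simp: bracket_def)
    also have "\<dots> = exp (real N * ?s)" by (simp add: exp_of_nat_mult)
    finally have 1: "bracket (x - y) ^ N \<le> exp (real N * ?s)" .
    \<comment> \<open>Completing the square in \<open>?s\<close>; this is where the constant
      \<open>real N * real N / (4 * t)\<close> comes from.\<close>
    have "0 \<le> (2 * t * ?s - real N)\<^sup>2 / (4 * t)" using \<open>0 < t\<close> by simp
    also have "\<dots> = t * ?s\<^sup>2 - real N * ?s + real N * real N / (4 * t)"
      using \<open>0 < t\<close> by (simp add: power2_eq_square field_simps)
    finally have 2: "real N * ?s - t * ?s\<^sup>2 \<le> real N * real N / (4 * t)" by linarith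
    have "bracket x ^ N \<le> (bracket y * bracket (x - y)) ^ N"
      by (intro power_mono bracket_triangle) (simp add: bracket_def)
    then have "bracket x ^ N * exp (- t * ?s\<^sup>2) \<le> (bracket y * bracket (x - y)) ^ N * exp (- t * ?s\<^sup>2)"
      by (intro mult_right_mono) auto
    also have "\<dots> \<le> (bracket y ^ N * exp (real N * ?s)) * exp (- t * ?s\<^sup>2)"
      unfolding power_mult_distrib
      by (intro mult_right_mono mult_left_mono 1) (auto simp: bracket_def)
    also have "\<dots> = bracket y ^ N * exp (real N * ?s - t * ?s\<^sup>2)"
      by (simp add: exp_add[symmetric])
    also have "\<dots> \<le> bracket y ^ N * exp (real N * real N / (4 * t))"
      using 2 by (intro mult_left_mono) (auto simp: bracket_def)
    finally show ?thesis by (simp add: power2_norm_eq_inner)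
  qed
  then show ?case by blast
next
  case (coord f w)
  then obtain B where B: "\<And>x. bracket x ^ Suc N * norm (f x) \<le> B" by blast
  have "bracket x ^ N * norm (complex_of_real ((x - y) \<bullet> w) * f x) \<le> (bracket y * norm w) * B" for x
  proof -
    have "\<bar>(x - y) \<bullet> w\<bar> \<le> norm (x - y) * norm w" by (rule Cauchy_Schwarz_ineq2)
    also have "\<dots> \<le> (bracket y * bracket x) * norm w"
      using bracket_triangle[of "x - y" "- y"] norm_ge_zero
      by (intro mult_right_mono) (auto simp: bracket_def)
    finally have "bracket x ^ N * norm (complex_of_real ((x - y) \<bullet> w) * f x)
        \<le> bracket x ^ N * ((bracket y * bracket x * norm w) * norm (f x))"
      by (auto simp: norm_mult bracket_def intro!: mult_left_mono mult_right_mono)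
    also have "\<dots> = (bracket y * norm w) * (bracket x ^ Suc N * norm (f x))" by (simp add: mult_ac)
    also have "\<dots> \<le> (bracket y * norm w) * B"
      using B[of x] by (intro mult_left_mono) (auto simp: bracket_def)
    finally show ?thesis .
  qed
  then show ?case by blast
next
  case (scale f c)
  then obtain B where "\<And>x. bracket x ^ N * norm (f x) \<le> B" by blast
  then have "bracket x ^ N * norm (c * f x) \<le> norm c * B" for x
    using mult_left_mono[of "bracket x ^ N * norm (f x)" B "norm c"] by (simp add: norm_mult mult_ac)
  then show ?case by blast
next
  case (plus f g)
  then obtain B C where "\<And>x. bracket x ^ N * norm (f x) \<le> B" "\<And>x. bracket x ^ N * norm (g x) \<le> C" by blast
  moreover have "bracket x ^ N * norm (f x + g x) \<le> bracket x ^ N * norm (f x) + bracket x ^ N * norm (g x)" for x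
    unfolding distrib_left[symmetric]
    by (intro mult_left_mono norm_triangle_ineq) (simp add: bracket_def)
  ultimately have "bracket x ^ N * norm (f x + g x) \<le> B + C" for x
    by (meson add_mono order_trans)
  then show ?case by blast
qed

lemma schwartz_gaussian:
  fixes y :: "real ^ 'n::finite"
  assumes "0 < t" shows "schwartz (\<lambda>x. complex_of_real (exp (- t * (norm (x - y))\<^sup>2)))"
proof -
  have g: "(\<lambda>x. complex_of_real (exp (- t * (norm (x - y))\<^sup>2))) \<in> gaussian_poly t y"
    using gaussian_poly.base[of t y] by (simp add: power2_norm_eq_inner)
  show ?thesis
    unfolding schwartz_def
    using gaussian_poly_smooth[OF g] gaussian_poly_bound[OF gaussian_poly_multi_deriv[OF g] assms] by blast
qed

text \<open>The positive and the negative part of k are regarded as densities. They give boxes the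
  same finite mass, boxes are stable under intersection and generate the Borel sets, so the two
  measures agree, and densities are unique almost everywhere.\<close>

lemma AE_eq_0_if_box_integrals_eq_0:
  fixes k :: "'a::euclidean_space \<Rightarrow> real"
  assumes [measurable]: "k \<in> borel_measurable borel"
    and i: "\<And>a b. integrable lborel (\<lambda>x. indicator (box a b) x * k x)"
    and z: "\<And>a b. (\<integral>x. indicator (box a b) x * k x \<partial>lborel) = 0"
  shows "AE x in lborel. k x = 0"
proof -
  let ?P = "density lborel (\<lambda>x. ennreal (k x))" and ?Q = "density lborel (\<lambda>x. ennreal (- k x))"
  let ?E = "range (\<lambda>(a, b). box a b :: 'a set)"
  have P: "emeasure ?P (box a b) = (\<integral>\<^sup>+x. ennreal (indicator (box a b) x * k x) \<partial>lborel)" for a b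
    by (subst emeasure_density) (auto intro!: nn_integral_cong split: split_indicator)
  have Q: "emeasure ?Q (box a b) = (\<integral>\<^sup>+x. ennreal (- (indicator (box a b) x * k x)) \<partial>lborel)" for a b
    by (subst emeasure_density) (auto intro!: nn_integral_cong split: split_indicator)
  have fin: "emeasure ?P (box a b) \<noteq> \<infinity>" "emeasure ?Q (box a b) \<noteq> \<infinity>" for a b
    using i[of a b] unfolding P Q real_integrable_def by auto
  have eq: "emeasure ?P (box a b) = emeasure ?Q (box a b)" for a b
  proof -
    have "enn2real (emeasure ?P (box a b)) = enn2real (emeasure ?Q (box a b))"
      using real_lebesgue_integral_def[OF i[of a b]] z[of a b] unfolding P Q by simp
    then show ?thesis
      using fin[of a b] by (metis ennreal_enn2real less_top infinity_ennreal_def)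
  qed
  have "?P = ?Q"
  proof (rule measure_eqI_generator_eq[where E="?E" and \<Omega>=UNIV and A="\<lambda>i::nat. box (- (real i *\<^sub>R One)) (real i *\<^sub>R One)"])
    show "Int_stable ?E" by (auto simp: Int_stable_def box_Int_box)
    show "emeasure ?P X = emeasure ?Q X" if "X \<in> ?E" for X using that eq by auto
    show "(\<Union>i::nat. box (- (real i *\<^sub>R One)) (real i *\<^sub>R One)) = (UNIV :: 'a set)"
      by (rule UN_box_eq_UNIV)
    show "emeasure ?P (box (- (real i *\<^sub>R One)) (real i *\<^sub>R One)) \<noteq> \<infinity>" for i :: nat
      using fin by simp
  qed (auto simp: borel_eq_box)
  then have "AE x in lborel. ennreal (k x) = ennreal (- k x)"
    by (intro sigma_finite_measure.density_unique[OF lborel.sigma_finite_measure_axioms]) auto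
  then show ?thesis
  proof eventually_elim
    case (elim x)
    then show ?case by (cases "k x \<ge> 0") (auto simp: ennreal_neg ennreal_eq_0_iff)
  qed
qed

text \<open>An indicator is not a Schwartz function. It is approximated by its average against
  Gaussians of width e: such an average superposes translated Gaussians, each of which is
  annihilated by h, and it converges to a multiple of the indicator off the frontier of the box as e
  tends to 0.\<close>

lemma integral_box_eq_0:
  fixes h :: "real ^ 'n::finite \<Rightarrow> complex"
  assumes [measurable]: "h \<in> borel_measurable borel"
    and int: "\<And>\<phi>. schwartz \<phi> \<Longrightarrow> integrable lborel (\<lambda>x. h x * \<phi> x)"
    and zero: "\<And>\<phi>. schwartz \<phi> \<Longrightarrow> (\<integral>x. h x * \<phi> x \<partial>lborel) = 0"
  shows "integrable lborel (\<lambda>x. indicator (box a b) x * h x)"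
    and "(\<integral>x. indicator (box a b) x * h x \<partial>lborel) = 0"
proof -
  let ?n = "CARD('n)" and ?B = "box a b"
  obtain r where r: "\<And>y. y \<in> ?B \<Longrightarrow> norm y \<le> r" "0 < r"
    using bounded_box[of a b] by (auto simp: bounded_pos)
  have hg: "integrable lborel (\<lambda>x. norm (h x) * exp (- t * (norm x)\<^sup>2))" if "0 < t" for t
    using integrable_norm[OF int[OF schwartz_gaussian[OF that, of 0]]] by (simp add: norm_mult)
  define w where "w e x = (\<integral>v. complex_of_real (indicator ?B (x + e *\<^sub>R v) * exp (- (norm v)\<^sup>2 / 2)) \<partial>lborel)"
    for e and x :: "real ^ 'n"
  have wm[measurable]: "w e \<in> borel_measurable borel" for e
  proof -
    have "w e \<in> borel_measurable lborel"
      unfolding w_def by (rule lborel.borel_measurable_lebesgue_integral) measurable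
    then show ?thesis by simp
  qed
  define D where "D = (\<integral>v. exp (- (norm v)\<^sup>2 / 4) \<partial>(lborel :: (real ^ 'n) measure))"
  have Di: "integrable lborel (\<lambda>v::real ^ 'n. exp (- (norm v)\<^sup>2 / 4))"
    using integrable_gaussian_scaled[of "1 / sqrt 2", where 'a="real ^ 'n"]
    by (simp add: power_divide power_mult_distrib)
  have wb: "norm (w e x) \<le> exp (r\<^sup>2 / 4) * D * exp (- (1/8) * (norm x)\<^sup>2)" if e: "0 < e" "e \<le> 1" for e x
  proof -
    have le: "indicator ?B (x + e *\<^sub>R v) * exp (- (norm v)\<^sup>2 / 2)
        \<le> exp (r\<^sup>2 / 4) * exp (- (1/8) * (norm x)\<^sup>2) * exp (- (norm v)\<^sup>2 / 4)" for v
    proof (cases "x + e *\<^sub>R v \<in> ?B")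
      case True
      have "norm x \<le> norm (x + e *\<^sub>R v) + norm (e *\<^sub>R v)"
        using norm_triangle_ineq4[of "x + e *\<^sub>R v" "e *\<^sub>R v"] by simp
      also have "\<dots> \<le> r + norm v"
        using r(1)[OF True] e mult_right_mono[of e 1 "norm v"] by simp
      finally have "(norm x)\<^sup>2 \<le> (r + norm v)\<^sup>2" by (intro power_mono) auto
      also have "\<dots> \<le> 2 * r\<^sup>2 + 2 * (norm v)\<^sup>2"
        using sum_squares_ge_zero[of "r - norm v" 0] by (simp add: power2_eq_square algebra_simps)
      \<comment> \<open>Half of the exponent is spent on decay in x, the other half keeps the
        integral over v finite. The resulting majorant is independent of e.\<close>
      finally have "- (norm v)\<^sup>2 / 2 \<le> r\<^sup>2 / 4 + - (1/8) * (norm x)\<^sup>2 + - (norm v)\<^sup>2 / 4" by simp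
      then have "exp (- (norm v)\<^sup>2 / 2) \<le> exp (r\<^sup>2 / 4 + - (1/8) * (norm x)\<^sup>2 + - (norm v)\<^sup>2 / 4)" by simp
      then show ?thesis using True unfolding exp_add by simp
    qed auto
    have n: "norm (complex_of_real (indicator ?B (x + e *\<^sub>R v) * exp (- (norm v)\<^sup>2 / 2)))
        = indicator ?B (x + e *\<^sub>R v) * exp (- (norm v)\<^sup>2 / 2)" for v
      by (subst norm_of_real) (simp add: abs_mult)
    have "norm (w e x) \<le> (\<integral>v. norm (complex_of_real (indicator ?B (x + e *\<^sub>R v) * exp (- (norm v)\<^sup>2 / 2))) \<partial>lborel)"
      unfolding w_def by (rule integral_norm_bound)
    also have "\<dots> \<le> (\<integral>v. exp (r\<^sup>2 / 4) * exp (- (1/8) * (norm x)\<^sup>2) * exp (- (norm v)\<^sup>2 / 4) \<partial>(lborel :: (real ^ 'n) measure))"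
    proof (rule integral_mono)
      show "integrable lborel (\<lambda>v :: real ^ 'n. exp (r\<^sup>2 / 4) * exp (- (1/8) * (norm x)\<^sup>2) * exp (- (norm v)\<^sup>2 / 4))"
        by (intro integrable_mult_right Di)
      then show "integrable lborel (\<lambda>v. norm (complex_of_real (indicator ?B (x + e *\<^sub>R v) * exp (- (norm v)\<^sup>2 / 2))))"
        unfolding n
      proof (rule Bochner_Integration.integrable_bound)
        show "AE v in lborel. norm (indicator ?B (x + e *\<^sub>R v) * exp (- (norm v)\<^sup>2 / 2))
            \<le> norm (exp (r\<^sup>2 / 4) * exp (- (1/8) * (norm x)\<^sup>2) * exp (- (norm v)\<^sup>2 / 4))"
          using le by (intro AE_I2) (simp add: abs_mult)
      qed measurable
      show "norm (complex_of_real (indicator ?B (x + e *\<^sub>R v) * exp (- (norm v)\<^sup>2 / 2)))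
          \<le> exp (r\<^sup>2 / 4) * exp (- (1/8) * (norm x)\<^sup>2) * exp (- (norm v)\<^sup>2 / 4)" for v
        unfolding n by (rule le)
    qed
    also have "\<dots> = exp (r\<^sup>2 / 4) * exp (- (1/8) * (norm x)\<^sup>2) * D"
      unfolding D_def by (rule integral_mult_right_zero)
    finally show ?thesis by (simp add: mult_ac)
  qed
  have wz: "(\<integral>x. h x * w e x \<partial>lborel) = 0" if e: "0 < e" for e
  proof -
    \<comment> \<open>Chosen such that the substitution \<open>y = x + e *\<^sub>R v\<close> turns
      \<open>t * (norm (x - y))\<^sup>2\<close> into \<open>(norm v)\<^sup>2 / 2\<close>.\<close>
    define t where "t = 1 / (2 * e\<^sup>2)"
    have t: "0 < t" using e by (simp add: t_def)
    let ?G = "\<lambda>x y. complex_of_real (exp (- t * (norm (x - y))\<^sup>2))"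
    have "(\<integral>x. (\<integral>y. indicator ?B y * (h x * ?G x y) \<partial>lborel) \<partial>lborel)
        = (\<integral>y. (\<integral>x. indicator ?B y * (h x * ?G x y) \<partial>lborel) \<partial>lborel)"
    proof (rule lborel_swap(2)[where g="\<lambda>x. norm (h x) * exp (- (t/2) * (norm x)\<^sup>2)"
          and k="\<lambda>x y. indicator ?B y * exp (t * r\<^sup>2)" and c="measure lborel ?B * exp (t * r\<^sup>2)"])
      show "(\<lambda>(x, y). indicator ?B y * (h x * ?G x y)) \<in> borel_measurable (lborel \<Otimes>\<^sub>M lborel)"
        by measurable
      show "integrable lborel (\<lambda>x. norm (h x) * exp (- (t/2) * (norm x)\<^sup>2))"
        using t by (intro hg) auto
      have "integrable lborel (\<lambda>y. indicator ?B y * exp (t * r\<^sup>2))"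
        by (intro integrable_mult_left integrable_real_indicator emeasure_bounded_finite bounded_box) auto
      then show "(\<integral>\<^sup>+y. ennreal (indicator ?B y * exp (t * r\<^sup>2)) \<partial>lborel) \<le> ennreal (measure lborel ?B * exp (t * r\<^sup>2))"
        by (subst nn_integral_eq_integral) auto
      show "norm (indicator ?B y * (h x * ?G x y))
          \<le> norm (h x) * exp (- (t/2) * (norm x)\<^sup>2) * (indicator ?B y * exp (t * r\<^sup>2))" for x y
      proof (cases "y \<in> ?B")
        case True
        have "norm x \<le> norm (x - y) + norm y" using norm_triangle_ineq[of "x - y" y] by simp
        also have "\<dots> \<le> norm (x - y) + r" using r(1)[OF True] by simp
        finally have "(norm x)\<^sup>2 \<le> (norm (x - y) + r)\<^sup>2" by (intro power_mono) auto
        also have "\<dots> \<le> 2 * (norm (x - y))\<^sup>2 + 2 * r\<^sup>2"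
          using sum_squares_ge_zero[of "norm (x - y) - r" 0] by (simp add: power2_eq_square algebra_simps)
        finally have "t * (norm x)\<^sup>2 \<le> t * (2 * (norm (x - y))\<^sup>2 + 2 * r\<^sup>2)"
          using t by (intro mult_left_mono) auto
        then have "- t * (norm (x - y))\<^sup>2 \<le> - (t/2) * (norm x)\<^sup>2 + t * r\<^sup>2"
          by (simp add: algebra_simps)
        then have "exp (- t * (norm (x - y))\<^sup>2) \<le> exp (- (t/2) * (norm x)\<^sup>2 + t * r\<^sup>2)" by simp
        then have "norm (h x) * exp (- t * (norm (x - y))\<^sup>2) \<le> norm (h x) * (exp (- (t/2) * (norm x)\<^sup>2) * exp (t * r\<^sup>2))"
          unfolding exp_add by (intro mult_left_mono) auto
        then show ?thesis using True by (simp add: norm_mult mult_ac)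
      qed auto
    qed auto
    also have "\<dots> = (\<integral>y. indicator ?B y * (\<integral>x. h x * ?G x y \<partial>lborel) \<partial>lborel)"
      by (simp only: integral_mult_right_zero)
    also have "\<dots> = 0" using zero[OF schwartz_gaussian[OF t]] by simp
    finally have z: "(\<integral>x. (\<integral>y. indicator ?B y * (h x * ?G x y) \<partial>lborel) \<partial>lborel) = 0" .
    have "(\<integral>y. indicator ?B y * (h x * ?G x y) \<partial>lborel) = complex_of_real (e ^ ?n) * (h x * w e x)" for x
    proof -
      have g: "?G x (x + e *\<^sub>R v) = complex_of_real (exp (- (norm v)\<^sup>2 / 2))" for v
        using e by (simp add: t_def power_mult_distrib)
      have "(\<integral>y. indicator ?B y * (h x * ?G x y) \<partial>lborel)
          = e ^ ?n *\<^sub>R (\<integral>v. indicator ?B (x + e *\<^sub>R v) * (h x * ?G x (x + e *\<^sub>R v)) \<partial>lborel)"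
        using e lborel_integral_affine(2)[of "\<lambda>y. indicator ?B y * (h x * ?G x y)" e x] by simp
      also have "(\<integral>v. indicator ?B (x + e *\<^sub>R v) * (h x * ?G x (x + e *\<^sub>R v)) \<partial>lborel)
          = (\<integral>v. h x * complex_of_real (indicator ?B (x + e *\<^sub>R v) * exp (- (norm v)\<^sup>2 / 2)) \<partial>lborel)"
        unfolding g by (intro Bochner_Integration.integral_cong) (auto split: split_indicator)
      also have "\<dots> = h x * w e x" unfolding w_def by (rule integral_mult_right_zero)
      finally show ?thesis by (simp add: scaleR_conv_of_real)
    qed
    then have "complex_of_real (e ^ ?n) * (\<integral>x. h x * w e x \<partial>lborel) = 0"
      using z by (simp only: integral_mult_right_zero)
    then show ?thesis using e by simp
  qed
  define e where "e m = 1 / real (Suc m)" for m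
  have e: "0 < e m" "e m \<le> 1" for m by (simp_all add: e_def)
  have e0: "e \<longlonglongrightarrow> 0" unfolding e_def[abs_def] by (rule LIMSEQ_Suc[OF lim_1_over_n])
  let ?c = "complex_of_real (sqrt (2 * pi) ^ ?n)"
  \<comment> \<open>Off the frontier the indicator is locally constant. The frontier of a convex set
    is a null set, so almost every x is covered.\<close>
  have lim: "(\<lambda>m. w (e m) x) \<longlonglongrightarrow> indicator ?B x * ?c" if x: "x \<notin> frontier ?B" for x
  proof -
    have "(\<lambda>m. w (e m) x) \<longlonglongrightarrow> (\<integral>v. complex_of_real (indicator ?B x * exp (- (norm v)\<^sup>2 / 2)) \<partial>(lborel :: (real ^ 'n) measure))"
      unfolding w_def
    proof (rule integral_dominated_convergence[where w="\<lambda>v::real ^ 'n. exp (- (norm v)\<^sup>2 / 2)"])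
      show "AE v in lborel. (\<lambda>m. complex_of_real (indicator ?B (x + e m *\<^sub>R v) * exp (- (norm v)\<^sup>2 / 2)))
          \<longlonglongrightarrow> complex_of_real (indicator ?B x * exp (- (norm v)\<^sup>2 / 2))"
      proof (intro AE_I2 tendsto_intros)
        fix v :: "real ^ 'n"
        have "(\<lambda>m. x + e m *\<^sub>R v) \<longlonglongrightarrow> x + 0 *\<^sub>R v" by (intro tendsto_intros e0)
        then have l: "(\<lambda>m. x + e m *\<^sub>R v) \<longlonglongrightarrow> x" by simp
        have "\<forall>\<^sub>F m in sequentially. indicator ?B (x + e m *\<^sub>R v) = (indicator ?B x :: real)"
        proof (cases "x \<in> ?B")
          case True
          then have "\<forall>\<^sub>F m in sequentially. x + e m *\<^sub>R v \<in> ?B"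
            using l by (intro topological_tendstoD) auto
          then show ?thesis by (rule eventually_mono) (use True in auto)
        next
          case False
          then have "x \<in> - closure ?B" using x by (auto simp: frontier_def interior_open[OF open_box])
          then have "\<forall>\<^sub>F m in sequentially. x + e m *\<^sub>R v \<in> - closure ?B"
            using l by (intro topological_tendstoD) auto
          then show ?thesis by (rule eventually_mono) (use False closure_subset[of ?B] in \<open>auto split: split_indicator\<close>)
        qed
        then show "(\<lambda>m. indicator ?B (x + e m *\<^sub>R v) :: real) \<longlonglongrightarrow> indicator ?B x"
          by (rule tendsto_eventually)
      qed
      show "AE v in lborel. norm (complex_of_real (indicator ?B (x + e m *\<^sub>R v) * exp (- (norm v)\<^sup>2 / 2)))
          \<le> exp (- (norm v)\<^sup>2 / 2)" for m
        by (auto split: split_indicator)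
      show "integrable lborel (\<lambda>v::real ^ 'n. exp (- (norm v)\<^sup>2 / 2))"
        by (rule integrable_exp_norm_square)
    qed auto
    also have "(\<integral>v. complex_of_real (indicator ?B x * exp (- (norm v)\<^sup>2 / 2)) \<partial>(lborel :: (real ^ 'n) measure)) = indicator ?B x * ?c"
      using integral_gaussian[of "0 :: real ^ 'n"] by (auto split: split_indicator)
    finally show ?thesis .
  qed
  have dom: "integrable lborel (\<lambda>x. exp (r\<^sup>2 / 4) * D * (norm (h x) * exp (- (1/8) * (norm x)\<^sup>2)))"
    by (intro integrable_mult_right hg) auto
  have "negligible (frontier ?B)" by (intro negligible_convex_frontier convex_box)
  then have "frontier ?B \<in> null_sets lebesgue" by (simp add: negligible_iff_null_sets)
  then have null: "frontier ?B \<in> null_sets lborel"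
    by (subst (asm) null_sets_completion_iff) auto
  have AE: "AE x in lborel. (\<lambda>m. h x * w (e m) x) \<longlonglongrightarrow> h x * (indicator ?B x * ?c)"
    using AE_not_in[OF null] by eventually_elim (intro tendsto_intros lim)
  have bd: "AE x in lborel. norm (h x * w (e m) x) \<le> exp (r\<^sup>2 / 4) * D * (norm (h x) * exp (- (1/8) * (norm x)\<^sup>2))" for m
  proof (intro AE_I2)
    show "norm (h x * w (e m) x) \<le> exp (r\<^sup>2 / 4) * D * (norm (h x) * exp (- (1/8) * (norm x)\<^sup>2))" for x
      using mult_left_mono[OF wb[OF e(1)[of m] e(2)[of m], of x], of "norm (h x)"] by (simp add: norm_mult mult_ac)
  qed
  have "(\<lambda>m. \<integral>x. h x * w (e m) x \<partial>lborel) \<longlonglongrightarrow> (\<integral>x. h x * (indicator ?B x * ?c) \<partial>lborel)"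
    by (rule integral_dominated_convergence[OF _ _ dom AE bd]) auto
  then have "(\<integral>x. h x * (indicator ?B x * ?c) \<partial>lborel) = 0"
    unfolding wz[OF e(1)] by (simp add: LIMSEQ_const_iff)
  then have "?c * (\<integral>x. indicator ?B x * h x \<partial>lborel) = 0"
    unfolding integral_mult_right_zero[symmetric] by (simp add: mult_ac)
  then show "(\<integral>x. indicator ?B x * h x \<partial>lborel) = 0" by simp
  have "integrable lborel (\<lambda>x. h x * (indicator ?B x * ?c))"
    by (rule integrable_dominated_convergence[OF _ _ dom AE bd]) auto
  then have "integrable lborel (\<lambda>x. inverse ?c * (h x * (indicator ?B x * ?c)))"
    by (rule integrable_mult_right)
  then show "integrable lborel (\<lambda>x. indicator ?B x * h x)" by (simp add: mult_ac)
qed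

text \<open>Two functions defining the same distribution agree almost everywhere; hence the infimum
  in \<open>dist_Lp_norm\<close> runs over functions of equal quasi-norm and can be bounded from
  below.\<close>

lemma AE_eq_0_if_schwartz_integrals_eq_0:
  fixes h :: "real ^ 'n::finite \<Rightarrow> complex"
  assumes [measurable]: "h \<in> borel_measurable borel"
    and "\<And>\<phi>. schwartz \<phi> \<Longrightarrow> integrable lborel (\<lambda>x. h x * \<phi> x)"
    and "\<And>\<phi>. schwartz \<phi> \<Longrightarrow> (\<integral>x. h x * \<phi> x \<partial>lborel) = 0"
  shows "AE x in lborel. h x = 0"
proof -
  note box = integral_box_eq_0[OF assms]
  have re: "Re (indicator A x * h x) = indicator A x * Re (h x)"
    "Im (indicator A x * h x) = indicator A x * Im (h x)" for A x
    by (auto split: split_indicator)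
  have "AE x in lborel. Re (h x) = 0"
  proof (rule AE_eq_0_if_box_integrals_eq_0)
    show "integrable lborel (\<lambda>x. indicator (box a b) x * Re (h x))" for a b
      using integrable_Re[OF box(1)[of a b]] by (simp only: re)
    show "(\<integral>x. indicator (box a b) x * Re (h x) \<partial>lborel) = 0" for a b
      using integral_Re[OF box(1)[of a b]] box(2)[of a b] by (simp only: re) simp
  qed simp
  moreover have "AE x in lborel. Im (h x) = 0"
  proof (rule AE_eq_0_if_box_integrals_eq_0)
    show "integrable lborel (\<lambda>x. indicator (box a b) x * Im (h x))" for a b
      using integrable_Im[OF box(1)[of a b]] by (simp only: re)
    show "(\<integral>x. indicator (box a b) x * Im (h x) \<partial>lborel) = 0" for a b
      using integral_Im[OF box(1)[of a b]] box(2)[of a b] by (simp only: re) simp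
  qed simp
  ultimately show ?thesis by eventually_elim (simp add: complex_eq_iff)
qed

section \<open>Decay of Fourier integrals\<close>

lemma bdd_if_pow_bounded:
  assumes "\<And>N. \<exists>B. \<forall>k. \<forall>x\<in>\<Omega> k. norm ((partial_deriv v ^^ N) (\<tau> k) x) \<le> B * (W k * r v k ^ N)"
  shows "bdd n {v} r \<Omega> W \<tau>"
  using assms
proof (induction n arbitrary: W \<tau>)
  case 0
  from 0[of 0] show ?case by simp
next
  case (Suc n)
  have "bdd n {v} r \<Omega> (\<lambda>k. W k * r v k) (\<lambda>k. partial_deriv v (\<tau> k))"
  proof (rule Suc.IH)
    fix N
    show "\<exists>B. \<forall>k. \<forall>x\<in>\<Omega> k. norm ((partial_deriv v ^^ N) (partial_deriv v (\<tau> k)) x) \<le> B * (W k * r v k * r v k ^ N)"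
      using Suc.prems[of "Suc N"] by (simp add: funpow_Suc_right mult.assoc del: funpow.simps)
  qed
  then show ?case using Suc.prems[of 0] by simp
qed

text \<open>Integrating by parts N times in coordinate j yields a factor
  \<open>\<bar>u $ j\<bar> ^ N\<close>. The full weight is at most a constant times the N-th power
  of the largest of 1 and the numbers \<open>R * \<bar>u $ j\<bar>\<close>, so pure powers of single
  coordinates are enough.\<close>

lemma decay_weight_le_sum:
  fixes u :: "real ^ 'n::finite"
  assumes "0 \<le> R"
  shows "(1 + R * norm u) ^ N \<le> real (CARD('n) + 1) ^ N * (1 + (\<Sum>j\<in>UNIV. (R * \<bar>u $ j\<bar>) ^ N))"
proof -
  define M where "M = Max (insert 1 ((\<lambda>j. R * \<bar>u $ j\<bar>) ` UNIV))"
  have M1: "1 \<le> M" unfolding M_def by (intro Max_ge) auto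
  have Mj: "R * \<bar>u $ j\<bar> \<le> M" for j unfolding M_def by (intro Max_ge) auto
  have "M \<in> insert 1 ((\<lambda>j. R * \<bar>u $ j\<bar>) ` UNIV)" unfolding M_def by (intro Max_in) auto
  then consider "M = 1" | j where "M = R * \<bar>u $ j\<bar>" by blast
  then have MN: "M ^ N \<le> 1 + (\<Sum>j\<in>UNIV. (R * \<bar>u $ j\<bar>) ^ N)"
  proof cases
    case 1
    have "0 \<le> (\<Sum>j\<in>UNIV. (R * \<bar>u $ j\<bar>) ^ N)" by (intro sum_nonneg) (use assms in auto)
    then show ?thesis unfolding 1 power_one by linarith
  next
    case (2 j)
    have "(R * \<bar>u $ j\<bar>) ^ N \<le> (\<Sum>j\<in>UNIV. (R * \<bar>u $ j\<bar>) ^ N)"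
      by (rule member_le_sum[of j UNIV "\<lambda>j. (R * \<bar>u $ j\<bar>) ^ N"]) (use assms in auto)
    then show ?thesis using 2 by simp
  qed
  have "R * norm u \<le> R * (\<Sum>j\<in>UNIV. \<bar>u $ j\<bar>)"
    using assms norm_le_l1_cart by (intro mult_left_mono) auto
  also have "\<dots> = (\<Sum>j\<in>UNIV. R * \<bar>u $ j\<bar>)" by (rule sum_distrib_left)
  also have "\<dots> \<le> (\<Sum>j\<in>(UNIV::'n set). M)" by (intro sum_mono Mj)
  finally have "1 + R * norm u \<le> real (CARD('n) + 1) * M" using M1 by (simp add: algebra_simps)
  then have "(1 + R * norm u) ^ N \<le> (real (CARD('n) + 1) * M) ^ N"
    using assms by (intro power_mono) auto
  also have "\<dots> \<le> real (CARD('n) + 1) ^ N * (1 + (\<Sum>j\<in>UNIV. (R * \<bar>u $ j\<bar>) ^ N))"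
    by (subst power_mult_distrib) (intro mult_left_mono MN, auto)
  finally show ?thesis .
qed

lemma iexp_has_vector_derivative:
  "((\<lambda>t. iexp (u \<bullet> (x + t *\<^sub>R v))) has_vector_derivative \<i> * complex_of_real (u \<bullet> v) * iexp (u \<bullet> (x + s *\<^sub>R v))) (at s)"
proof -
  have "((\<lambda>t. \<i> * complex_of_real (u \<bullet> (x + t *\<^sub>R v))) has_vector_derivative \<i> * complex_of_real (u \<bullet> v)) (at s)"
    unfolding inner_add_right inner_scaleR_right
    by (auto intro!: derivative_eq_intros simp: has_vector_derivative_def scaleR_conv_of_real)
  from field_vector_diff_chain_at[OF this DERIV_exp] show ?thesis
    by (simp add: o_def mult.commute)
qed

text \<open>Integration by parts: the derivative of
  \<open>iexp (u \<bullet> \<xi>) * g \<xi>\<close> integrates to 0, and the product rule splits it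
  into the two sides.\<close>

lemma fourier_partial_deriv:
  fixes g :: "real ^ 'n::finite \<Rightarrow> complex"
  assumes g: "smooth_function g" and i: "integrable lborel g" "integrable lborel (partial_deriv (axis j 1) g)"
  shows "(\<integral>\<xi>. iexp (u \<bullet> \<xi>) * partial_deriv (axis j 1) g \<xi> \<partial>lborel)
    = - (\<i> * complex_of_real (u $ j)) * (\<integral>\<xi>. iexp (u \<bullet> \<xi>) * g \<xi> \<partial>lborel)"
proof -
  let ?v = "axis j 1 :: real ^ 'n"
  have s: "smooth_function (partial_deriv ?v g)"
    using g by (intro smooth_function_partial_deriv) auto
  note [measurable] = smooth_function_measurable[OF g] smooth_function_measurable[OF s]
  have uv: "u \<bullet> ?v = u $ j" by (simp add: inner_axis)
  have i1: "integrable lborel (\<lambda>\<xi>. iexp (u \<bullet> \<xi>) * g \<xi>)"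
    by (rule Bochner_Integration.integrable_bound[OF i(1)]) (auto simp: norm_mult)
  have i2: "integrable lborel (\<lambda>\<xi>. iexp (u \<bullet> \<xi>) * partial_deriv ?v g \<xi>)"
    by (rule Bochner_Integration.integrable_bound[OF i(2)]) (auto simp: norm_mult)
  let ?c = "\<i> * complex_of_real (u $ j)"
  have "(\<integral>\<xi>. iexp (u \<bullet> \<xi>) * partial_deriv ?v g \<xi> + ?c * (iexp (u \<bullet> \<xi>) * g \<xi>) \<partial>lborel) = 0"
  proof (rule integral_directional_derivative_eq_0[where F="\<lambda>\<xi>. iexp (u \<bullet> \<xi>) * g \<xi>" and v="?v"])
    fix x :: "real ^ 'n" and s :: real
    have "((\<lambda>t. g (x + t *\<^sub>R ?v)) has_vector_derivative partial_deriv ?v g (x + s *\<^sub>R ?v)) (at s)"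
      by (intro has_vector_derivative_partial_deriv smooth_function_imp_differentiable g)
    from has_vector_derivative_mult[OF iexp_has_vector_derivative[of u x ?v s] this]
    show "((\<lambda>t. iexp (u \<bullet> (x + t *\<^sub>R ?v)) * g (x + t *\<^sub>R ?v)) has_vector_derivative
        iexp (u \<bullet> (x + s *\<^sub>R ?v)) * partial_deriv ?v g (x + s *\<^sub>R ?v) + ?c * (iexp (u \<bullet> (x + s *\<^sub>R ?v)) * g (x + s *\<^sub>R ?v))) (at s)"
      by (simp add: uv mult.assoc)
  next
    show "continuous_on UNIV (\<lambda>\<xi>. iexp (u \<bullet> \<xi>) * partial_deriv ?v g \<xi> + ?c * (iexp (u \<bullet> \<xi>) * g \<xi>))"
      by (intro continuous_intros smooth_function_continuous g s)
  qed (intro i1 i2 Bochner_Integration.integrable_add integrable_mult_right)+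
  then have "(\<integral>\<xi>. iexp (u \<bullet> \<xi>) * partial_deriv ?v g \<xi> \<partial>lborel) + ?c * (\<integral>\<xi>. iexp (u \<bullet> \<xi>) * g \<xi> \<partial>lborel) = 0"
    using i1 i2 by (subst (asm) Bochner_Integration.integral_add) auto
  then show ?thesis by (simp add: add_eq_0_iff)
qed

lemma fourier_partial_deriv_pow:
  fixes g :: "real ^ 'n::finite \<Rightarrow> complex"
  assumes g: "smooth_function g" and i: "\<And>m. integrable lborel ((partial_deriv (axis j 1) ^^ m) g)"
  shows "(\<integral>\<xi>. iexp (u \<bullet> \<xi>) * (partial_deriv (axis j 1) ^^ N) g \<xi> \<partial>lborel)
    = (- (\<i> * complex_of_real (u $ j))) ^ N * (\<integral>\<xi>. iexp (u \<bullet> \<xi>) * g \<xi> \<partial>lborel)"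
proof (induction N)
  case (Suc N)
  have "smooth_function ((partial_deriv (axis j 1) ^^ N) g)"
    by (intro smooth_function_partial_deriv_pow g) auto
  from fourier_partial_deriv[OF this i[of N], where u=u] i[of "Suc N"] Suc show ?case by simp
qed auto

text \<open>If N derivatives cost \<open>(1 / R) ^ N\<close> in the integral norm, then trading them
  for \<open>\<bar>u $ j\<bar> ^ N\<close> leaves decay in \<open>R * norm u\<close>. The bound
  \<open>c0\<close> takes care of small u.\<close>

lemma fourier_decay:
  fixes g :: "real ^ 'n::finite \<Rightarrow> complex"
  assumes g: "smooth_function g" and R: "0 < R"
    and i: "\<And>j m. integrable lborel ((partial_deriv (axis j 1) ^^ m) g)"
    and c: "\<And>j. (\<integral>\<xi>. norm ((partial_deriv (axis j 1) ^^ N) g \<xi>) \<partial>lborel) \<le> c j * (1 / R) ^ N"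
    and c0: "(\<integral>\<xi>. norm (g \<xi>) \<partial>lborel) \<le> c0"
  shows "norm (\<integral>\<xi>. iexp (u \<bullet> \<xi>) * g \<xi> \<partial>lborel)
    \<le> real (CARD('n) + 1) ^ N * (c0 + (\<Sum>j\<in>UNIV. c j)) * decay R N u"
proof -
  let ?I = "norm (\<integral>\<xi>. iexp (u \<bullet> \<xi>) * g \<xi> \<partial>lborel)"
  have le: "norm (\<integral>\<xi>. iexp (u \<bullet> \<xi>) * h \<xi> \<partial>lborel) \<le> (\<integral>\<xi>. norm (h \<xi>) \<partial>lborel)" for h :: "real ^ 'n \<Rightarrow> complex"
    using integral_norm_bound[of lborel "\<lambda>\<xi>. iexp (u \<bullet> \<xi>) * h \<xi>"] by (simp add: norm_mult)
  have I0: "?I \<le> c0" using le[of g] c0 by simp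
  have Ij: "(R * \<bar>u $ j\<bar>) ^ N * ?I \<le> c j" for j
  proof -
    have "\<bar>u $ j\<bar> ^ N * ?I = norm (\<integral>\<xi>. iexp (u \<bullet> \<xi>) * (partial_deriv (axis j 1) ^^ N) g \<xi> \<partial>lborel)"
      unfolding fourier_partial_deriv_pow[OF g i] by (simp add: norm_mult norm_power)
    also have "\<dots> \<le> c j * (1 / R) ^ N" using le c order_trans by blast
    finally have "R ^ N * (\<bar>u $ j\<bar> ^ N * ?I) \<le> R ^ N * (c j * (1 / R) ^ N)"
      using R by (intro mult_left_mono) auto
    then show ?thesis using R by (simp add: power_mult_distrib power_divide mult_ac)
  qed
  have "(1 + R * norm u) ^ N * ?I \<le> real (CARD('n) + 1) ^ N * (1 + (\<Sum>j\<in>UNIV. (R * \<bar>u $ j\<bar>) ^ N)) * ?I"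
    using R by (intro mult_right_mono decay_weight_le_sum) auto
  also have "\<dots> = real (CARD('n) + 1) ^ N * (?I + (\<Sum>j\<in>UNIV. (R * \<bar>u $ j\<bar>) ^ N * ?I))"
    by (simp add: algebra_simps sum_distrib_right)
  also have "\<dots> \<le> real (CARD('n) + 1) ^ N * (c0 + (\<Sum>j\<in>UNIV. c j))"
    by (intro mult_left_mono add_mono I0 sum_mono Ij) auto
  finally show ?thesis
    using R by (simp add: decay_def pos_le_divide_eq add_pos_nonneg mult.commute)
qed

lemma schwartz_fourier_decay:
  fixes f :: "real ^ 'n::finite \<Rightarrow> complex"
  assumes f: "schwartz f"
  obtains B where "0 \<le> B" "\<And>\<xi>. norm (fourier f \<xi>) \<le> B * decay 1 N \<xi>"
proof -
  have s: "smooth_function ((partial_deriv (axis j 1) ^^ m) f)" for j m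
    by (intro smooth_function_partial_deriv_pow schwartz_smooth f) auto
  have i: "integrable lborel ((partial_deriv (axis j 1) ^^ m) f)" for j m
  proof -
    obtain B where "\<And>x. norm ((partial_deriv (axis j 1) ^^ m) f x) \<le> B * decay 1 (2 * CARD('n)) x"
      using schwartz_pow_bound[OF f] by blast
    then show ?thesis
      using smooth_function_measurable[OF s] by (intro decay_bound_integrable) auto
  qed
  let ?c = "\<lambda>j. \<integral>\<xi>. norm ((partial_deriv (axis j 1) ^^ N) f \<xi>) \<partial>lborel" and ?z = "\<integral>\<xi>. norm (f \<xi>) \<partial>lborel"
  let ?B = "real (CARD('n) + 1) ^ N * (?z + (\<Sum>j\<in>UNIV. ?c j))"
  have "norm (\<integral>\<xi>. iexp ((- u) \<bullet> \<xi>) * f \<xi> \<partial>lborel) \<le> ?B * decay 1 N (- u)" for u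
    by (rule fourier_decay[OF schwartz_smooth[OF f] _ i]) auto
  then have "norm (fourier f u) \<le> ?B * decay 1 N u" for u
    by (simp add: fourier_def decay_def)
  moreover have "0 \<le> ?B"
    by (intro mult_nonneg_nonneg add_nonneg_nonneg sum_nonneg Bochner_Integration.integral_nonneg) auto
  ultimately show thesis using that by blast
qed

lemma partial_deriv_pow_zero_on_open:
  assumes "open S" "\<And>y. y \<in> S \<Longrightarrow> f y = 0" "x \<in> S"
  shows "(partial_deriv v ^^ m) f x = 0"
  using assms(3) by (induction m arbitrary: x) (auto intro: partial_deriv_zero_on_open[OF assms(1)] assms(2))

text \<open>The indicator of the ball is dominated by \<open>(1 + A) ^ (2 * DIM('a))\<close> times
  the decay weight of scale R, which avoids volumes of balls and reuses the scaling of
  \<open>decay_mass\<close>.\<close>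

lemma compact_support_bound:
  fixes g :: "'a::euclidean_space \<Rightarrow> complex"
  assumes [measurable]: "g \<in> borel_measurable borel" and R: "0 < R" and A: "0 \<le> A" and B: "0 \<le> B"
    and supp: "\<And>x. A * R < norm (x - y) \<Longrightarrow> g x = 0" and le: "\<And>x. norm (x - y) \<le> A * R \<Longrightarrow> norm (g x) \<le> B"
  shows "integrable lborel g"
    and "(\<integral>x. norm (g x) \<partial>lborel) \<le> (1 + A) ^ (2 * DIM('a)) * decay_mass TYPE('a) * B * R ^ DIM('a)"
proof -
  let ?N = "2 * DIM('a)" and ?D = "\<integral>x. decay (1 / R) (2 * DIM('a)) (y - x) \<partial>(lborel :: 'a measure)"
  have bd: "norm (g x) \<le> ((1 + A) ^ ?N * B) * decay (1 / R) ?N (y - x)" for x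
  proof (cases "norm (x - y) \<le> A * R")
    case True
    then have "1 + 1 / R * norm (y - x) \<le> 1 + A" using R by (simp add: norm_minus_commute pos_divide_le_eq)
    then have "(1 + 1 / R * norm (y - x)) ^ ?N \<le> (1 + A) ^ ?N" using R by (intro power_mono) auto
    then have "1 \<le> (1 + A) ^ ?N * decay (1 / R) ?N (y - x)"
      using R by (simp add: decay_def pos_le_divide_eq add_pos_nonneg)
    then have "B * 1 \<le> B * ((1 + A) ^ ?N * decay (1 / R) ?N (y - x))"
      using B by (intro mult_left_mono) auto
    then show ?thesis using le[OF True] by (simp add: mult_ac)
  next
    case False
    then show ?thesis using supp[of x] R A B by (simp add: decay_nonneg)
  qed
  show g: "integrable lborel g"
    by (rule decay_integrable_bound[OF _ _ _ bd]) (use R in auto)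
  have iD: "integrable lborel (\<lambda>x::'a. decay (1 / R) ?N (y - x))"
    using R by (intro integrable_decay(1)) auto
  have "(\<integral>x. norm (g x) \<partial>lborel) \<le> (\<integral>x. ((1 + A) ^ ?N * B) * decay (1 / R) ?N (y - x) \<partial>lborel)"
    by (intro integral_mono integrable_norm g integrable_mult_right iD bd)
  also have "\<dots> = ((1 + A) ^ ?N * B) * ?D" by (rule integral_mult_right_zero)
  also have "?D = R ^ DIM('a) * ((1 / R) ^ DIM('a) * ?D)"
    using R by (simp add: power_divide)
  also have "((1 + A) ^ ?N * B) * \<dots> \<le> ((1 + A) ^ ?N * B) * (R ^ DIM('a) * decay_mass TYPE('a))"
    using R A B integrable_decay(2)[of "1 / R" ?N y] by (intro mult_left_mono) auto
  finally show "(\<integral>x. norm (g x) \<partial>lborel) \<le> (1 + A) ^ ?N * decay_mass TYPE('a) * B * R ^ DIM('a)"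
    by (simp add: mult_ac)
qed

text \<open>A bump of height W and width R in frequency has a Fourier integral of height
  \<open>W * R ^ CARD('n)\<close> concentrated at scale \<open>1 / R\<close>. The constant is
  uniform over the index type, which will also contain points of space.\<close>

lemma bdd_fourier_decay:
  fixes \<tau> :: "'i \<Rightarrow> real ^ 'n::finite \<Rightarrow> complex" and c :: "'i \<Rightarrow> real ^ 'n"
  assumes smooth: "\<And>k. smooth_function (\<tau> k)" and R: "\<And>k. 0 < R k" and W: "\<And>k. 0 < W k" and A: "0 \<le> A"
    and supp: "\<And>k \<xi>. A * R k < norm (\<xi> - c k) \<Longrightarrow> \<tau> k \<xi> = 0"
    and bdd: "\<And>j n. bdd n {axis j 1} (\<lambda>_ k. 1 / R k) (\<lambda>k. {\<xi>. norm (\<xi> - c k) \<le> A * R k}) W \<tau>"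
  shows "\<exists>B\<ge>0. \<forall>k u. norm (\<integral>\<xi>. iexp (u \<bullet> \<xi>) * \<tau> k \<xi> \<partial>lborel) \<le> B * (W k * R k ^ CARD('n)) * decay (R k) N u"
proof -
  let ?\<Omega> = "\<lambda>k. {\<xi>. norm (\<xi> - c k) \<le> A * R k}"
  have "\<exists>B\<ge>0. \<forall>k. \<forall>\<xi>\<in>?\<Omega> k. norm ((partial_deriv (axis j 1) ^^ m) (\<tau> k) \<xi>) \<le> B * (W k * (1 / R k) ^ m)" for j m
  proof -
    have "bdd 0 {axis j 1} (\<lambda>_ k. 1 / R k) ?\<Omega> (\<lambda>k. W k * (1 / R k) ^ m) (\<lambda>k. (partial_deriv (axis j 1) ^^ m) (\<tau> k))"
      by (rule bdd_partial_deriv_pow[OF bdd]) auto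
    then obtain B where "B \<ge> 0"
      "\<And>k \<xi>. \<xi> \<in> ?\<Omega> k \<Longrightarrow> norm ((partial_deriv (axis j 1) ^^ m) (\<tau> k) \<xi>) \<le> B * (W k * (1 / R k) ^ m)"
      by (rule bdd_bound) (use W R in auto)
    then show ?thesis by blast
  qed
  then have "\<forall>m. \<exists>B. B\<ge>0 \<and> (\<forall>k. \<forall>\<xi>\<in>?\<Omega> k. norm ((partial_deriv (axis j 1) ^^ m) (\<tau> k) \<xi>) \<le> B * (W k * (1 / R k) ^ m))" for j
    by blast
  from choice[OF this]
  have "\<forall>j. \<exists>b. \<forall>m. b m \<ge> 0 \<and> (\<forall>k. \<forall>\<xi>\<in>?\<Omega> k. norm ((partial_deriv (axis j 1) ^^ m) (\<tau> k) \<xi>) \<le> b m * (W k * (1 / R k) ^ m))"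
    by blast
  from choice[OF this] obtain b where b0: "\<And>j m. b j m \<ge> 0" and
    b: "\<And>j m k \<xi>. \<xi> \<in> ?\<Omega> k \<Longrightarrow> norm ((partial_deriv (axis j 1) ^^ m) (\<tau> k) \<xi>) \<le> b j m * (W k * (1 / R k) ^ m)"
    by blast
  define K where "K = (1 + A) ^ (2 * CARD('n)) * decay_mass TYPE(real ^ 'n)"
  have K: "0 \<le> K" using A by (simp add: K_def decay_mass_nonneg)
  have D0: "(partial_deriv (axis j 1) ^^ m) (\<tau> k) \<xi> = 0" if "A * R k < norm (\<xi> - c k)" for j m k \<xi>
  proof (rule partial_deriv_pow_zero_on_open[where S="{\<xi>. A * R k < norm (\<xi> - c k)}"])
    show "open {\<xi>. A * R k < norm (\<xi> - c k)}" by (intro open_Collect_less continuous_intros)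
  qed (use that supp in auto)
  have sm: "(partial_deriv (axis j 1) ^^ m) (\<tau> k) \<in> borel_measurable borel" for j m k
    by (intro smooth_function_measurable smooth_function_partial_deriv_pow smooth) auto
  have WR: "0 \<le> b j m * (W k * (1 / R k) ^ m)" for j m k
    using b0 W[of k] R[of k] by (intro mult_nonneg_nonneg) auto
  have i: "integrable lborel ((partial_deriv (axis j 1) ^^ m) (\<tau> k))" for j m k
    by (rule compact_support_bound(1)[where y="c k" and R="R k" and A=A and B="b j m * (W k * (1 / R k) ^ m)"])
      (use sm R A WR D0 b in auto)
  have n: "(\<integral>\<xi>. norm ((partial_deriv (axis j 1) ^^ m) (\<tau> k) \<xi>) \<partial>lborel)
      \<le> K * (b j m * (W k * (1 / R k) ^ m)) * R k ^ CARD('n)" for j m k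
    unfolding K_def DIM_cart[where 'a=real, unfolded DIM_real mult_1_right, symmetric]
    by (rule compact_support_bound(2)[where y="c k" and R="R k" and A=A and B="b j m * (W k * (1 / R k) ^ m)"])
      (use sm R A WR D0 b in auto)
  \<comment> \<open>\<open>SOME j. True\<close> names an arbitrary coordinate: the zeroth derivative
    is the function itself, whichever direction is chosen.\<close>
  define B where "B = real (CARD('n) + 1) ^ N * (K * b (SOME j. True) 0 + (\<Sum>j\<in>(UNIV::'n set). K * b j N))"
  show ?thesis
  proof (intro exI[of _ B] conjI allI)
    show "0 \<le> B" using b0 K by (auto simp: B_def intro!: mult_nonneg_nonneg add_nonneg_nonneg sum_nonneg)
    fix k and u :: "real ^ 'n"
    let ?Q = "W k * R k ^ CARD('n)"
    have "norm (\<integral>\<xi>. iexp (u \<bullet> \<xi>) * \<tau> k \<xi> \<partial>lborel)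
      \<le> real (CARD('n) + 1) ^ N * (K * b (SOME j. True) 0 * ?Q + (\<Sum>j\<in>(UNIV::'n set). K * b j N * ?Q)) * decay (R k) N u"
    proof (rule fourier_decay[OF smooth R i])
      show "(\<integral>\<xi>. norm ((partial_deriv (axis j 1) ^^ N) (\<tau> k) \<xi>) \<partial>lborel) \<le> K * b j N * ?Q * (1 / R k) ^ N" for j
        using n[where j=j and m=N and k=k] by (simp add: mult_ac)
      show "(\<integral>\<xi>. norm (\<tau> k \<xi>) \<partial>lborel) \<le> K * b (SOME j. True) 0 * ?Q"
        using n[where j="SOME j. True" and m=0 and k=k] by (simp add: mult_ac)
    qed
    also have "\<dots> = B * ?Q * decay (R k) N u"
      by (simp add: B_def algebra_simps sum_distrib_left sum_distrib_right)
    finally show "norm (\<integral>\<xi>. iexp (u \<bullet> \<xi>) * \<tau> k \<xi> \<partial>lborel) \<le> B * ?Q * decay (R k) N u" .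
  qed
qed

section \<open>Continuity and differentiation of Fourier integrals\<close>

lemma continuous_on_fourier_integral:
  fixes a :: "real ^ 'n::finite \<Rightarrow> complex"
  assumes a: "integrable lborel a"
  shows "continuous_on UNIV (\<lambda>x. \<integral>\<xi>. iexp (x \<bullet> \<xi>) * a \<xi> \<partial>lborel)"
proof -
  have [measurable]: "a \<in> borel_measurable borel" using a by auto
  have "isCont (\<lambda>x. \<integral>\<xi>. iexp (x \<bullet> \<xi>) * a \<xi> \<partial>lborel) x" for x
    unfolding continuous_at_sequentially comp_def
  proof (intro allI impI)
    fix y assume y: "y \<longlonglongrightarrow> x"
    show "(\<lambda>n. \<integral>\<xi>. iexp (y n \<bullet> \<xi>) * a \<xi> \<partial>lborel) \<longlonglongrightarrow> (\<integral>\<xi>. iexp (x \<bullet> \<xi>) * a \<xi> \<partial>lborel)"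
      by (rule integral_dominated_convergence[where w="\<lambda>\<xi>. norm (a \<xi>)"])
        (use a in \<open>auto simp: norm_mult intro!: tendsto_intros y\<close>)
  qed
  then show ?thesis by (simp add: continuous_on_eq_continuous_at)
qed

text \<open>Limits of difference quotients can be tested along sequences, the form to which
  dominated convergence applies.\<close>

lemma has_vector_derivative_at_iff_quotient:
  "(f has_vector_derivative D) (at s) \<longleftrightarrow> ((\<lambda>t. (f t - f s) /\<^sub>R (t - s)) \<longlongrightarrow> D) (at s)"
proof -
  have "norm (f t - f s - (t - s) *\<^sub>R D) / norm (t - s) = norm ((f t - f s) /\<^sub>R (t - s) - D)" if "t \<noteq> s" for t
  proof -
    have "(f t - f s) /\<^sub>R (t - s) - D = (f t - f s - (t - s) *\<^sub>R D) /\<^sub>R (t - s)"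
      using that by (simp add: scaleR_diff_right)
    then show ?thesis by (simp add: divide_inverse mult.commute)
  qed
  then have "((\<lambda>t. norm (f t - f s - (t - s) *\<^sub>R D) / norm (t - s)) \<longlongrightarrow> 0) (at s)
      \<longleftrightarrow> ((\<lambda>t. norm ((f t - f s) /\<^sub>R (t - s) - D)) \<longlongrightarrow> 0) (at s)"
    by (intro Lim_cong_within) auto
  also have "\<dots> \<longleftrightarrow> ((\<lambda>t. (f t - f s) /\<^sub>R (t - s)) \<longlongrightarrow> D) (at s)"
    unfolding tendsto_norm_zero_iff by (rule LIM_zero_iff)
  finally show ?thesis
    unfolding has_vector_derivative_def has_derivative_iff_norm
    by (simp add: bounded_linear_scaleR_left)
qed

lemma norm_iexp_minus_1: "norm (iexp t - 1) \<le> \<bar>t\<bar>"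
  using iexp_approx1[of t 0] by simp

lemma fourier_integral_has_vector_derivative:
  fixes a :: "real ^ 'n::finite \<Rightarrow> complex"
  assumes a: "integrable lborel a" and a': "integrable lborel (\<lambda>\<xi>. complex_of_real (v \<bullet> \<xi>) * a \<xi>)"
  shows "((\<lambda>t. \<integral>\<xi>. iexp ((x + t *\<^sub>R v) \<bullet> \<xi>) * a \<xi> \<partial>lborel) has_vector_derivative
    (\<integral>\<xi>. iexp ((x + s *\<^sub>R v) \<bullet> \<xi>) * (\<i> * complex_of_real (v \<bullet> \<xi>) * a \<xi>) \<partial>lborel)) (at s)"
proof -
  have [measurable]: "a \<in> borel_measurable borel" using a by auto
  let ?f = "\<lambda>t. \<integral>\<xi>. iexp ((x + t *\<^sub>R v) \<bullet> \<xi>) * a \<xi> \<partial>lborel"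
  let ?D = "\<integral>\<xi>. iexp ((x + s *\<^sub>R v) \<bullet> \<xi>) * (\<i> * complex_of_real (v \<bullet> \<xi>) * a \<xi>) \<partial>lborel"
  have i: "integrable lborel (\<lambda>\<xi>. iexp (y \<bullet> \<xi>) * a \<xi>)" for y
    by (rule Bochner_Integration.integrable_bound[OF a]) (auto simp: norm_mult)
  have "((\<lambda>t. (?f t - ?f s) /\<^sub>R (t - s)) \<longlongrightarrow> ?D) (at s)"
    unfolding tendsto_at_iff_sequentially comp_def
  proof (intro allI impI)
    fix X :: "nat \<Rightarrow> real" assume X: "\<forall>m. X m \<in> UNIV - {s}" and lim: "X \<longlonglongrightarrow> s"
    let ?q = "\<lambda>m \<xi>. (iexp ((X m - s) * (v \<bullet> \<xi>)) - 1) /\<^sub>R (X m - s)"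
    have split: "iexp ((x + t *\<^sub>R v) \<bullet> \<xi>) = iexp ((x + s *\<^sub>R v) \<bullet> \<xi>) * iexp ((t - s) * (v \<bullet> \<xi>))" for t \<xi>
      by (simp add: exp_add[symmetric] inner_add_left algebra_simps)
    have eq: "(?f (X m) - ?f s) /\<^sub>R (X m - s) = (\<integral>\<xi>. iexp ((x + s *\<^sub>R v) \<bullet> \<xi>) * (?q m \<xi> * a \<xi>) \<partial>lborel)" for m
    proof -
      have "(?f (X m) - ?f s) /\<^sub>R (X m - s)
          = (\<integral>\<xi>. (iexp ((x + X m *\<^sub>R v) \<bullet> \<xi>) * a \<xi> - iexp ((x + s *\<^sub>R v) \<bullet> \<xi>) * a \<xi>) /\<^sub>R (X m - s) \<partial>lborel)"
        using i by (subst integral_scaleR_right, subst Bochner_Integration.integral_diff) auto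
      also have "\<dots> = (\<integral>\<xi>. iexp ((x + s *\<^sub>R v) \<bullet> \<xi>) * (?q m \<xi> * a \<xi>) \<partial>lborel)"
        unfolding split[of "X m"] by (intro Bochner_Integration.integral_cong refl) (simp add: algebra_simps)
      finally show ?thesis .
    qed
    \<comment> \<open>The bound \<open>\<bar>t\<bar>\<close> for \<open>iexp t - 1\<close> makes the
      difference quotients dominated by the derivative's own size, uniformly in m.\<close>
    have q: "norm (?q m \<xi>) \<le> \<bar>v \<bullet> \<xi>\<bar>" for m \<xi>
    proof -
      have "norm (?q m \<xi>) = norm (iexp ((X m - s) * (v \<bullet> \<xi>)) - 1) / \<bar>X m - s\<bar>"
        by (simp add: divide_inverse mult.commute)
      also have "\<dots> \<le> \<bar>(X m - s) * (v \<bullet> \<xi>)\<bar> / \<bar>X m - s\<bar>"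
        by (intro divide_right_mono norm_iexp_minus_1) auto
      also have "\<dots> = \<bar>v \<bullet> \<xi>\<bar>" using X by (simp add: abs_mult)
      finally show ?thesis .
    qed
    show "(\<lambda>m. (?f (X m) - ?f s) /\<^sub>R (X m - s)) \<longlonglongrightarrow> ?D"
      unfolding eq
    proof (rule integral_dominated_convergence[where w="\<lambda>\<xi>. norm (complex_of_real (v \<bullet> \<xi>) * a \<xi>)"])
      show "AE \<xi> in lborel. (\<lambda>m. iexp ((x + s *\<^sub>R v) \<bullet> \<xi>) * (?q m \<xi> * a \<xi>))
          \<longlonglongrightarrow> iexp ((x + s *\<^sub>R v) \<bullet> \<xi>) * (\<i> * complex_of_real (v \<bullet> \<xi>) * a \<xi>)"
      proof (intro AE_I2 tendsto_mult tendsto_const)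
        fix \<xi> :: "real ^ 'n"
        \<comment> \<open>The earlier derivative rule is applied in the real line regarded as a
          Euclidean space, with direction 1 and base point 0.\<close>
        have "((\<lambda>t. iexp ((v \<bullet> \<xi>) *\<^sub>R 1 \<bullet> (0 + t *\<^sub>R (1::real)))) has_vector_derivative
            \<i> * complex_of_real ((v \<bullet> \<xi>) *\<^sub>R 1 \<bullet> (1::real)) * iexp ((v \<bullet> \<xi>) *\<^sub>R 1 \<bullet> (0 + 0 *\<^sub>R (1::real)))) (at 0)"
          by (rule iexp_has_vector_derivative)
        then have "((\<lambda>t. iexp (t * (v \<bullet> \<xi>))) has_vector_derivative \<i> * complex_of_real (v \<bullet> \<xi>)) (at 0)"
          by (simp add: mult.commute)
        then have "((\<lambda>h. (iexp (h * (v \<bullet> \<xi>)) - 1) /\<^sub>R h) \<longlongrightarrow> \<i> * complex_of_real (v \<bullet> \<xi>)) (at 0)"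
          unfolding has_vector_derivative_at_iff_quotient by simp
        moreover have "(\<lambda>m. X m - s) \<longlonglongrightarrow> 0" using tendsto_diff[OF lim tendsto_const[of s]] by simp
        then have "filterlim (\<lambda>m. X m - s) (at 0) sequentially"
          by (rule filterlim_atI) (use X in auto)
        ultimately show "(\<lambda>m. ?q m \<xi>) \<longlonglongrightarrow> \<i> * complex_of_real (v \<bullet> \<xi>)"
          by (rule filterlim_compose)
      qed
      show "AE \<xi> in lborel. norm (iexp ((x + s *\<^sub>R v) \<bullet> \<xi>) * (?q m \<xi> * a \<xi>)) \<le> norm (complex_of_real (v \<bullet> \<xi>) * a \<xi>)" for m
      proof (intro AE_I2)
        fix \<xi> :: "real ^ 'n"
        have "norm (?q m \<xi>) * norm (a \<xi>) \<le> \<bar>v \<bullet> \<xi>\<bar> * norm (a \<xi>)"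
          by (intro mult_right_mono q) auto
        then show "norm (iexp ((x + s *\<^sub>R v) \<bullet> \<xi>) * (?q m \<xi> * a \<xi>)) \<le> norm (complex_of_real (v \<bullet> \<xi>) * a \<xi>)"
          by (simp only: norm_mult norm_exp_i_times mult_1_left norm_of_real)
      qed
      show "integrable lborel (\<lambda>\<xi>. norm (complex_of_real (v \<bullet> \<xi>) * a \<xi>))" using a' by (rule integrable_norm)
    qed measurable
  qed
  then show ?thesis
    unfolding has_vector_derivative_at_iff_quotient by simp
qed

section \<open>The covering of frequency space\<close>

lemma lattice_point_diff: "lattice_point (k - l) = lattice_point k - lattice_point l"
  by (simp add: lattice_point_def vec_eq_iff)

lemma norm_lattice_point_ge_1:
  assumes "k \<noteq> (0 :: int ^ 'n::finite)" shows "1 \<le> norm (lattice_point k)"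
proof -
  obtain i where "k $ i \<noteq> 0" using assms by (auto simp: vec_eq_iff)
  then have "1 \<le> \<bar>k $ i\<bar>" by linarith
  then have "(1::real) \<le> \<bar>lattice_point k $ i\<bar>" by (simp add: lattice_point_def)
  then show ?thesis using component_le_norm_cart[of "lattice_point k" i] by linarith
qed

lemma finite_lattice_ball: "finite {m :: int ^ 'n::finite. norm (lattice_point m) \<le> K}"
proof (rule finite_subset)
  let ?T = "{- \<lceil>K\<rceil>..\<lceil>K\<rceil>}"
  show "{m :: int ^ 'n. norm (lattice_point m) \<le> K} \<subseteq> (\<lambda>f. \<chi> i. f i) ` PiE UNIV (\<lambda>_. ?T)"
  proof
    fix m :: "int ^ 'n" assume "m \<in> {m. norm (lattice_point m) \<le> K}"
    then have "\<bar>real_of_int (m $ i)\<bar> \<le> K" for i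
      using component_le_norm_cart[of "lattice_point m" i] by (simp add: lattice_point_def)
    then have "m $ i \<in> ?T" for i
      by (simp add: abs_le_iff) (metis ceiling_mono ceiling_of_int of_int_minus minus_le_iff)
    then have "(\<lambda>i. m $ i) \<in> PiE UNIV (\<lambda>_. ?T)" by auto
    moreover have "m = (\<chi> i. m $ i)" by (simp add: vec_eq_iff)
    ultimately show "m \<in> (\<lambda>f. \<chi> i. f i) ` PiE UNIV (\<lambda>_. ?T)" by blast
  qed
qed (auto intro!: finite_imageI finite_PiE)

lemma near_lattice_points:
  fixes l :: "int ^ 'n::finite"
  shows "finite {m. norm (lattice_point m - lattice_point l) \<le> K}"
    and "card {m. norm (lattice_point m - lattice_point l) \<le> K} \<le> card {m :: int ^ 'n. norm (lattice_point m) \<le> K}"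
proof -
  have eq: "{m. norm (lattice_point m - lattice_point l) \<le> K} = (\<lambda>m. m + l) ` {m. norm (lattice_point m) \<le> K}"
    by (auto simp: lattice_point_diff[symmetric] intro!: image_eqI[where x="m - l" for m])
  show "finite {m. norm (lattice_point m - lattice_point l) \<le> K}"
    unfolding eq by (intro finite_imageI finite_lattice_ball)
  show "card {m. norm (lattice_point m - lattice_point l) \<le> K} \<le> card {m :: int ^ 'n. norm (lattice_point m) \<le> K}"
    unfolding eq by (intro card_image_le finite_lattice_ball)
qed

text \<open>Removing \<open>(A - B) *\<^sub>R y\<close> from
  \<open>A *\<^sub>R x - B *\<^sub>R y\<close> leaves \<open>A *\<^sub>R (x - y)\<close>. What is
  removed is itself at most the difference of the two lengths, since y is the shorter vector and has
  the smaller factor.\<close>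

lemma scaled_difference:
  fixes x y :: "'a::real_normed_vector"
  assumes "norm y \<le> norm x" "0 \<le> B" "B \<le> A"
  shows "A * norm (x - y) \<le> 2 * norm (A *\<^sub>R x - B *\<^sub>R y)"
proof -
  have "A * norm (x - y) = norm ((A *\<^sub>R x - B *\<^sub>R y) - (A - B) *\<^sub>R y)"
    using assms by (simp add: algebra_simps flip: scaleR_diff_right)
  also have "\<dots> \<le> norm (A *\<^sub>R x - B *\<^sub>R y) + (A - B) * norm y"
    using assms norm_triangle_ineq4[of "A *\<^sub>R x - B *\<^sub>R y" "(A - B) *\<^sub>R y"] by simp
  also have "(A - B) * norm y \<le> A * norm x - B * norm y"
    using assms mult_left_mono[of "norm y" "norm x" A] by (simp add: algebra_simps)
  also have "\<dots> \<le> norm (A *\<^sub>R x - B *\<^sub>R y)"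
    using assms norm_triangle_ineq2[of "A *\<^sub>R x" "B *\<^sub>R y"] by simp
  finally show ?thesis by simp
qed

text \<open>Comparability in both directions is assumed because the exponent may have either
  sign.\<close>

lemma powr_abs_le:
  fixes x y K e :: real
  assumes "0 < x" "0 < y" "x \<le> K * y" "y \<le> K * x" "1 \<le> K"
  shows "x powr e \<le> K powr \<bar>e\<bar> * y powr e"
proof (cases "0 \<le> e")
  case True
  have "x powr e \<le> (K * y) powr e" using assms True by (intro powr_mono2) auto
  then show ?thesis using assms True by (simp add: powr_mult)
next
  case False
  have "y powr - e \<le> (K * x) powr - e" using assms False by (intro powr_mono2) auto
  then have "y powr - e \<le> K powr - e * x powr - e" using assms by (simp add: powr_mult)
  then have "x powr e * (y powr - e) * y powr e \<le> x powr e * (K powr - e * x powr - e) * y powr e"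
    by (intro mult_right_mono mult_left_mono) auto
  then show ?thesis using assms False by (simp add: powr_minus field_simps)
qed

lemma partial_deriv_sum:
  fixes f :: "'i \<Rightarrow> 'a::euclidean_space \<Rightarrow> complex"
  assumes "finite A" "\<And>m. m \<in> A \<Longrightarrow> smooth_function (f m)"
  shows "partial_deriv v (\<lambda>x. \<Sum>m\<in>A. f m x) = (\<lambda>x. \<Sum>m\<in>A. partial_deriv v (f m) x)"
  using assms
proof (induction A)
  case (insert m A)
  have s: "smooth_function (\<lambda>x. \<Sum>m\<in>A. f m x)" using insert by (intro smooth_function_sum) auto
  have "partial_deriv v (\<lambda>x. f m x + (\<Sum>m\<in>A. f m x)) = (\<lambda>x. partial_deriv v (f m) x + partial_deriv v (\<lambda>x. \<Sum>m\<in>A. f m x) x)"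
    using insert s by (intro ext partial_deriv_add smooth_function_imp_differentiable) auto
  then show ?case using insert by simp
qed simp

lemma partial_deriv_pow_sum:
  fixes f :: "'i \<Rightarrow> 'a::euclidean_space \<Rightarrow> complex"
  assumes "finite A" "\<And>m. m \<in> A \<Longrightarrow> smooth_function (f m)" "v \<in> Basis"
  shows "(partial_deriv v ^^ N) (\<lambda>x. \<Sum>m\<in>A. f m x) = (\<lambda>x. \<Sum>m\<in>A. (partial_deriv v ^^ N) (f m) x)"
proof (induction N)
  case (Suc N)
  then show ?case
    using partial_deriv_sum[OF assms(1), of "\<lambda>m. (partial_deriv v ^^ N) (f m)" v] assms
    by (simp add: smooth_function_partial_deriv_pow)
qed auto

locale alpha_cover =
  fixes \<alpha> C :: real and \<eta> :: "int ^ 'n::finite \<Rightarrow> real ^ 'n \<Rightarrow> complex"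
  assumes \<alpha>: "0 \<le> \<alpha>" "\<alpha> < 1" and C: "1 < C" and partition: "alpha_partition \<alpha> C \<eta>"
begin

definition br :: "int ^ 'n \<Rightarrow> real" where "br k = bracket (lattice_point k)"

definition rad :: "int ^ 'n \<Rightarrow> real" where "rad k = br k powr (\<alpha> / (1 - \<alpha>))"

definition ctr :: "int ^ 'n \<Rightarrow> real ^ 'n" where "ctr k = rad k *\<^sub>R lattice_point k"

definition gap :: "int ^ 'n \<Rightarrow> int ^ 'n \<Rightarrow> real" where "gap k l = bracket (lattice_point k - lattice_point l)"

lemma br_ge_1: "1 \<le> br k" by (simp add: br_def bracket_def)
lemma br_pos: "0 < br k" using br_ge_1[of k] by linarith
lemma gap_ge_1: "1 \<le> gap k l" by (simp add: gap_def bracket_def)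
lemma gap_pos: "0 < gap k l" using gap_ge_1[of k l] by linarith
lemma gap_commute: "gap k l = gap l k" by (simp add: gap_def bracket_def norm_minus_commute)
lemma rad_ge_1: "1 \<le> rad k" unfolding rad_def using br_ge_1[of k] \<alpha> by (intro ge_one_powr_ge_zero) auto
lemma rad_pos: "0 < rad k" using rad_ge_1[of k] by linarith

lemma br_le: "br k \<le> br l * gap k l"
  unfolding br_def gap_def by (rule bracket_triangle)

text \<open>The weight is moderate: exchanging k for l costs a power of their gap. The exponent is
  rounded up so that all losses are natural powers, which add up with the powers gained
  later.\<close>

lemma br_powr_le: "br k powr e \<le> br l powr e * gap k l ^ nat \<lceil>\<bar>e\<bar>\<rceil>"
proof -
  have "br k powr e \<le> gap k l powr \<bar>e\<bar> * br l powr e"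
    using br_le[of k l] br_le[of l k] br_pos gap_ge_1[of k l]
    by (intro powr_abs_le) (auto simp: mult.commute gap_commute)
  moreover have "gap k l powr \<bar>e\<bar> \<le> gap k l powr real (nat \<lceil>\<bar>e\<bar>\<rceil>)"
    using gap_ge_1 by (intro powr_mono) linarith+
  moreover have "gap k l powr real (nat \<lceil>\<bar>e\<bar>\<rceil>) = gap k l ^ nat \<lceil>\<bar>e\<bar>\<rceil>" by (rule powr_realpow[OF gap_pos])
  ultimately show ?thesis
    using mult_right_mono[of "gap k l powr \<bar>e\<bar>" "gap k l ^ nat \<lceil>\<bar>e\<bar>\<rceil>" "br l powr e"]
    by (simp add: mult.commute)
qed

definition ord :: nat where "ord = nat \<lceil>\<bar>\<alpha> / (1 - \<alpha>)\<bar>\<rceil>"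

lemma rad_le: "rad k \<le> rad l * gap k l ^ ord"
  unfolding rad_def ord_def by (rule br_powr_le)

text \<open>Measured in the larger of the two radii, the centres are at least half as far apart as
  the lattice points. This ratio is the net gain of one integration by parts.\<close>

lemma ctr_dist: "max (rad k) (rad l) * norm (lattice_point k - lattice_point l) \<le> 2 * norm (ctr k - ctr l)"
proof -
  have *: "max (rad k) (rad l) * norm (lattice_point k - lattice_point l) \<le> 2 * norm (ctr k - ctr l)"
    if "norm (lattice_point l) \<le> norm (lattice_point k)" for k l
  proof -
    have "rad l \<le> rad k"
      unfolding rad_def using that \<alpha> by (intro powr_mono2) (auto simp: br_def bracket_def)
    then show ?thesis
      using scaled_difference[OF that, of "rad l" "rad k"] rad_pos[of l] by (simp add: ctr_def max_def)
  qed
  show ?thesis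
    using *[of k l] *[of l k]
    by (cases "norm (lattice_point l) \<le> norm (lattice_point k)") (auto simp: norm_minus_commute max.commute)
qed

lemma eta_schwartz: "schwartz (\<eta> k)"
  using partition by (simp add: alpha_partition_def)

lemma eta_smooth: "smooth_function (\<eta> k)"
  by (rule schwartz_smooth[OF eta_schwartz])

lemma eta_measurable [measurable]: "\<eta> k \<in> borel_measurable borel"
  by (rule smooth_function_measurable[OF eta_smooth])

lemma eta_supp: "\<eta> k \<xi> \<noteq> 0 \<Longrightarrow> norm (\<xi> - ctr k) \<le> C * rad k"
  using partition closure_subset[of "{\<xi>. \<eta> k \<xi> \<noteq> 0}"]
  unfolding alpha_partition_def ctr_def rad_def br_def by blast

lemma eta_deriv_bound:
  obtains B where "0 \<le> B" "\<And>k \<xi>. norm ((partial_deriv (axis j 1) ^^ N) (\<eta> k) \<xi>) \<le> B * (1 / rad k) ^ N"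
proof -
  let ?\<beta> = "\<lambda>i. if i = j then N else 0"
  obtain B where B: "\<And>k \<xi>. norm (multi_deriv ?\<beta> (\<eta> k) \<xi>)
      \<le> B * bracket (lattice_point k) powr (- real (order_of ?\<beta>) * \<alpha> / (1 - \<alpha>))"
    using partition unfolding alpha_partition_def by blast
  have e: "bracket (lattice_point k) powr (- real (order_of ?\<beta>) * \<alpha> / (1 - \<alpha>)) = (1 / rad k) ^ N" for k
  proof -
    have "br k powr (- real N * \<alpha> / (1 - \<alpha>)) = (br k powr (\<alpha> / (1 - \<alpha>))) powr (- real N)"
      by (simp add: powr_powr mult.commute)
    also have "\<dots> = (1 / rad k) ^ N"
      using rad_pos[of k] by (simp add: rad_def[symmetric] powr_minus powr_realpow power_divide inverse_eq_divide)
    finally show ?thesis by (simp add: br_def order_of_single)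
  qed
  show thesis
  proof (rule that[of "\<bar>B\<bar>"])
    fix k \<xi>
    have "norm ((partial_deriv (axis j 1) ^^ N) (\<eta> k) \<xi>) \<le> B * (1 / rad k) ^ N"
      using B[of k \<xi>] unfolding e by (simp only: multi_deriv_single)
    also have "\<dots> \<le> \<bar>B\<bar> * (1 / rad k) ^ N" using rad_pos[of k] by (intro mult_right_mono) auto
    finally show "norm ((partial_deriv (axis j 1) ^^ N) (\<eta> k) \<xi>) \<le> \<bar>B\<bar> * (1 / rad k) ^ N" .
  qed auto
qed

lemma eta_bound:
  obtains B where "0 \<le> B" "\<And>k \<xi>. norm (\<eta> k \<xi>) \<le> B"
proof -
  obtain B where "0 \<le> B" "\<And>k \<xi>. norm ((partial_deriv (axis undefined 1) ^^ 0) (\<eta> k) \<xi>) \<le> B * (1 / rad k) ^ 0"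
    using eta_deriv_bound[where j=undefined and N=0] by blast
  then show thesis by (intro that) auto
qed

lemma eta_sum: "((\<lambda>k. \<eta> k \<xi>) has_sum 1) UNIV"
  using partition by (simp add: alpha_partition_def)

section \<open>Neighbouring balls and cutoffs built from them\<close>

definition nb :: "int ^ 'n \<Rightarrow> (int ^ 'n) set"
  where "nb l = {m. \<exists>\<xi>. \<eta> m \<xi> \<noteq> 0 \<and> \<eta> l \<xi> \<noteq> 0}"

text \<open>The factor 4 consists of a 2 for the two balls meeting and a 2 from
  \<open>ctr_dist\<close>.\<close>

lemma supports_meet:
  assumes "norm (\<xi> - ctr m) \<le> K * rad m" "norm (\<xi> - ctr l) \<le> K * rad l"
  shows "norm (lattice_point m - lattice_point l) \<le> 4 * K"
proof -
  have M: "0 < max (rad m) (rad l)" using rad_pos[of m] by (auto simp: less_max_iff_disj)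
  have "0 \<le> K * rad m" using assms(1) norm_ge_zero order_trans by blast
  then have K: "0 \<le> K" using rad_pos[of m] by (simp add: zero_le_mult_iff)
  have "norm (ctr m - ctr l) \<le> norm (\<xi> - ctr m) + norm (\<xi> - ctr l)"
    using norm_triangle_ineq4[of "\<xi> - ctr l" "\<xi> - ctr m"] by simp
  also have "\<dots> \<le> K * rad m + K * rad l" using assms by linarith
  also have "\<dots> \<le> K * max (rad m) (rad l) + K * max (rad m) (rad l)"
    using K by (intro add_mono mult_left_mono) auto
  finally have "max (rad m) (rad l) * norm (lattice_point m - lattice_point l) \<le> max (rad m) (rad l) * (4 * K)"
    using ctr_dist[of m l] by (simp add: mult_ac)
  then show ?thesis using M by (simp only: mult_le_cancel_left_pos)
qed

lemma nb_near: "m \<in> nb l \<Longrightarrow> norm (lattice_point m - lattice_point l) \<le> 4 * C"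
  unfolding nb_def using supports_meet eta_supp by blast

lemma nb_finite: "finite (nb l)"
  by (rule finite_subset[OF _ near_lattice_points(1)[of l "4 * C"]]) (use nb_near in auto)

definition overlap :: nat where "overlap = card {m :: int ^ 'n. norm (lattice_point m) \<le> 4 * C}"

lemma nb_card: "card (nb l) \<le> overlap"
  unfolding overlap_def
  by (rule order_trans[OF card_mono[OF near_lattice_points(1)[of l "4 * C"]] near_lattice_points(2)]) (use nb_near in auto)

lemma nb_gap: "m \<in> nb l \<Longrightarrow> gap m l \<le> 1 + 4 * C"
  using nb_near by (simp add: gap_def bracket_def)

lemma nb_rad: "m \<in> nb l \<Longrightarrow> rad m \<le> (1 + 4 * C) ^ ord * rad l" "m \<in> nb l \<Longrightarrow> rad l \<le> (1 + 4 * C) ^ ord * rad m"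
proof -
  assume m: "m \<in> nb l"
  have *: "gap m l ^ ord \<le> (1 + 4 * C) ^ ord"
    using nb_gap[OF m] gap_pos[of m l] by (intro power_mono) auto
  show "rad m \<le> (1 + 4 * C) ^ ord * rad l"
    using order_trans[OF rad_le mult_left_mono[OF * less_imp_le[OF rad_pos[of l]]]] by (simp add: mult.commute)
  show "rad l \<le> (1 + 4 * C) ^ ord * rad m"
    using order_trans[OF rad_le[of l m, unfolded gap_commute[of l m]] mult_left_mono[OF * less_imp_le[OF rad_pos[of m]]]]
    by (simp add: mult.commute)
qed

text \<open>This serves as a smooth cutoff: it equals 1 wherever \<open>\<eta> l\<close> does not
  vanish, because all members of the partition active at such a point are neighbours of l. Being a
  bounded number of comparable members, it inherits their derivative bounds.\<close>

definition fat :: "int ^ 'n \<Rightarrow> real ^ 'n \<Rightarrow> complex"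
  where "fat l \<xi> = (\<Sum>m\<in>nb l. \<eta> m \<xi>)"

text \<open>The support radius arises from the path from \<open>\<xi>\<close> to the centre of a
  neighbour m, on to a point common to m and l, and from there to \<open>ctr l\<close>. The first
  two legs have length at most \<open>C * rad m\<close>, and \<open>rad m\<close> is at most
  \<open>(1 + 4 * C) ^ ord * rad l\<close>.\<close>

definition fatness :: real where "fatness = C * (2 * (1 + 4 * C) ^ ord + 1)"

lemma fatness: "C \<le> fatness"
  unfolding fatness_def using C by (simp add: algebra_simps)

lemma fat_smooth: "smooth_function (fat l)"
  unfolding fat_def[abs_def] by (intro smooth_function_sum eta_smooth)

lemma fat_eta: "fat l \<xi> * \<eta> l \<xi> = \<eta> l \<xi>"
proof (cases "\<eta> l \<xi> = 0")
  case False
  have "((\<lambda>k. \<eta> k \<xi>) has_sum (\<Sum>m\<in>nb l. \<eta> m \<xi>)) UNIV"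
    by (rule has_sum_finite_neutralI[OF nb_finite]) (use False in \<open>auto simp: nb_def\<close>)
  then have "fat l \<xi> = 1"
    unfolding fat_def using eta_sum has_sum_unique by blast
  then show ?thesis by simp
qed auto

lemma fat_supp: "fat l \<xi> \<noteq> 0 \<Longrightarrow> norm (\<xi> - ctr l) \<le> fatness * rad l"
proof -
  assume "fat l \<xi> \<noteq> 0"
  then obtain m where m: "m \<in> nb l" "\<eta> m \<xi> \<noteq> 0"
    unfolding fat_def by (meson sum.neutral)
  then obtain \<zeta> where z: "\<eta> m \<zeta> \<noteq> 0" "\<eta> l \<zeta> \<noteq> 0" by (auto simp: nb_def)
  have "\<xi> - ctr l = (\<xi> - ctr m) - (\<zeta> - ctr m) + (\<zeta> - ctr l)" by simp
  then have "norm (\<xi> - ctr l) \<le> norm (\<xi> - ctr m) + norm (\<zeta> - ctr m) + norm (\<zeta> - ctr l)"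
    by (metis norm_triangle_ineq norm_triangle_ineq4 norm_triangle_mono order_refl)
  also have "\<dots> \<le> C * rad m + C * rad m + C * rad l"
    using eta_supp[OF m(2)] eta_supp[OF z(1)] eta_supp[OF z(2)] by linarith
  also have "\<dots> \<le> C * ((1 + 4 * C) ^ ord * rad l) + C * ((1 + 4 * C) ^ ord * rad l) + C * rad l"
    using C nb_rad(1)[OF m(1)] by (intro add_mono mult_left_mono) auto
  finally show ?thesis by (simp add: fatness_def algebra_simps)
qed

lemma fat_bdd: "bdd n {axis j 1} (\<lambda>_ l. 1 / rad l) \<Omega> (\<lambda>_. 1) fat"
proof (rule bdd_if_pow_bounded)
  fix N
  obtain B where B: "0 \<le> B" "\<And>k \<xi>. norm ((partial_deriv (axis j 1) ^^ N) (\<eta> k) \<xi>) \<le> B * (1 / rad k) ^ N"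
    using eta_deriv_bound[where j=j and N=N] by blast
  let ?K = "((1 + 4 * C) ^ ord) ^ N"
  have "norm ((partial_deriv (axis j 1) ^^ N) (fat l) \<xi>) \<le> (real overlap * B * ?K) * (1 * (1 / rad l) ^ N)" for l \<xi>
  proof -
    have "norm ((partial_deriv (axis j 1) ^^ N) (fat l) \<xi>) = norm (\<Sum>m\<in>nb l. (partial_deriv (axis j 1) ^^ N) (\<eta> m) \<xi>)"
      unfolding fat_def[abs_def] by (subst partial_deriv_pow_sum) (auto simp: nb_finite eta_smooth)
    also have "\<dots> \<le> (\<Sum>m\<in>nb l. B * ?K * (1 / rad l) ^ N)"
    proof (rule sum_norm_le)
      fix m assume m: "m \<in> nb l"
      have "1 / rad m \<le> (1 + 4 * C) ^ ord * (1 / rad l)"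
        using nb_rad(2)[OF m] rad_pos[of l] rad_pos[of m] by (simp add: field_simps)
      then have "(1 / rad m) ^ N \<le> ((1 + 4 * C) ^ ord * (1 / rad l)) ^ N"
        using rad_pos[of m] by (intro power_mono) auto
      then have "B * (1 / rad m) ^ N \<le> B * (?K * (1 / rad l) ^ N)"
        unfolding power_mult_distrib by (intro mult_left_mono B)
      then show "norm ((partial_deriv (axis j 1) ^^ N) (\<eta> m) \<xi>) \<le> B * ?K * (1 / rad l) ^ N"
        using B(2)[of m \<xi>] by (simp add: mult.assoc)
    qed
    also have "\<dots> = real (card (nb l)) * (B * ?K * (1 / rad l) ^ N)" by simp
    also have "\<dots> \<le> real overlap * (B * ?K * (1 / rad l) ^ N)"
      using nb_card[of l] B C rad_pos[of l] by (intro mult_right_mono) auto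
    finally show ?thesis by (simp add: mult_ac)
  qed
  then show "\<exists>B. \<forall>k. \<forall>x\<in>\<Omega> k. norm ((partial_deriv (axis j 1) ^^ N) (fat k) x) \<le> B * (1 * (1 / rad k) ^ N)"
    by blast
qed

lemma eta_bdd: "bdd n {axis j 1} (\<lambda>_ l. 1 / rad l) \<Omega> (\<lambda>_. 1) \<eta>"
proof (rule bdd_if_pow_bounded)
  fix N
  obtain B where "0 \<le> B" "\<And>k \<xi>. norm ((partial_deriv (axis j 1) ^^ N) (\<eta> k) \<xi>) \<le> B * (1 / rad k) ^ N"
    using eta_deriv_bound[where j=j and N=N] by blast
  then show "\<exists>B. \<forall>k. \<forall>x\<in>\<Omega> k. norm ((partial_deriv (axis j 1) ^^ N) (\<eta> k) x) \<le> B * (1 * (1 / rad k) ^ N)"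
    unfolding mult_1 by blast
qed

end

section \<open>Symbols localized in frequency\<close>

lemma bdd_zero: "bdd n V r \<Omega> W (\<lambda>_ _. 0)"
  by (induction n arbitrary: W) (auto intro: exI[of _ 0])

text \<open>Since the two directions commute, every iterated derivative can be brought into the form
  of a power in u applied to a power in v, and such derivatives are closed under one more
  differentiation in either direction.\<close>

lemma bdd_if_pow_bounded2:
  assumes smooth: "\<And>k. smooth_function (\<tau> k)" and uv: "u \<in> Basis" "v \<in> Basis"
    and bound: "\<And>m N. \<exists>B. \<forall>k. \<forall>x\<in>\<Omega> k. norm ((partial_deriv u ^^ m) ((partial_deriv v ^^ N) (\<tau> k)) x)
      \<le> B * (W k * r u k ^ m * r v k ^ N)"
  shows "bdd n {u, v} r \<Omega> W \<tau>"
proof -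
  have "bdd n {u, v} r \<Omega> (\<lambda>k. W k * r u k ^ m * r v k ^ N) (\<lambda>k. (partial_deriv u ^^ m) ((partial_deriv v ^^ N) (\<tau> k)))" for m N
  proof (induction n arbitrary: m N)
    case 0
    show ?case using bound[of m N] by simp
  next
    case (Suc n)
    have comm: "partial_deriv v ((partial_deriv u ^^ m) ((partial_deriv v ^^ N) (\<tau> k)))
        = (partial_deriv u ^^ m) (partial_deriv v ((partial_deriv v ^^ N) (\<tau> k)))" for k
      by (intro partial_deriv_commute_pow smooth_function_partial_deriv_pow smooth uv)
    have "bdd n {u, v} r \<Omega> (\<lambda>k. W k * r u k ^ m * r v k ^ N * r u k)
        (\<lambda>k. partial_deriv u ((partial_deriv u ^^ m) ((partial_deriv v ^^ N) (\<tau> k))))"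
      using Suc.IH[of "Suc m" N] by (simp add: mult_ac)
    moreover have "bdd n {u, v} r \<Omega> (\<lambda>k. W k * r u k ^ m * r v k ^ N * r v k)
        (\<lambda>k. partial_deriv v ((partial_deriv u ^^ m) ((partial_deriv v ^^ N) (\<tau> k))))"
      unfolding comm using Suc.IH[of m "Suc N"] by (simp add: mult_ac)
    ultimately show ?case using bound[of m N] by simp
  qed
  from this[of 0 0] show ?thesis by simp
qed

text \<open>Freezing the space variable makes the point z part of the index: the new indices are
  pairs (l, z). Bounds that are uniform in the index are then uniform in z as well.\<close>

lemma bdd_section:
  assumes "bdd n V r \<Omega> W \<tau>" "(0, w) \<in> V"
  shows "bdd n {w} (\<lambda>_ q. r (0, w) (fst q)) (\<lambda>q. {\<xi>. (snd q, \<xi>) \<in> \<Omega> (fst q)}) (\<lambda>q. W (fst q))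
    (\<lambda>q \<xi>. \<tau> (fst q) (snd q, \<xi>))"
  using assms(1)
proof (induction n arbitrary: W \<tau>)
  case 0
  then show ?case by auto
next
  case (Suc n)
  have eq: "partial_deriv w (\<lambda>\<xi>. \<tau> l (z, \<xi>)) = (\<lambda>\<xi>. partial_deriv (0, w) (\<tau> l) (z, \<xi>))" for l z
    by (simp add: partial_deriv_def fun_eq_iff)
  have "bdd n V r \<Omega> (\<lambda>l. W l * r (0, w) l) (\<lambda>l. partial_deriv (0, w) (\<tau> l))"
    using Suc.prems assms(2) by auto
  from Suc.IH[OF this]
  have "bdd n {w} (\<lambda>_ q. r (0, w) (fst q)) (\<lambda>q. {\<xi>. (snd q, \<xi>) \<in> \<Omega> (fst q)}) (\<lambda>q. W (fst q) * r (0, w) (fst q))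
      (\<lambda>q. partial_deriv w (\<lambda>\<xi>. \<tau> (fst q) (snd q, \<xi>)))"
    by (simp only: eq)
  moreover have "\<exists>B. \<forall>q. \<forall>\<xi>\<in>{\<xi>. (snd q, \<xi>) \<in> \<Omega> (fst q)}. norm (\<tau> (fst q) (snd q, \<xi>)) \<le> B * W (fst q)"
    using Suc.prems by auto
  ultimately show ?case by simp
qed

lemma bdd_snd:
  fixes g :: "'i \<Rightarrow> 'b::euclidean_space \<Rightarrow> complex" and u :: "'a::euclidean_space"
  assumes "bdd n {w} (\<lambda>_ l. r (0, w) l) (\<lambda>l. snd ` \<Omega> l) W g" "\<And>l. smooth_function (g l)" "w \<in> Basis"
  shows "bdd n {(u, 0), (0, w)} r \<Omega> W (\<lambda>l p. g l (snd p))"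
  using assms(1,2)
proof (induction n arbitrary: W g)
  case 0
  then show ?case by auto
next
  case (Suc n)
  have d: "partial_deriv y (\<lambda>p::'a \<times> 'b. g l (snd p)) = (\<lambda>p. partial_deriv (snd y) (g l) (snd p))" for y l
    by (rule ext, rule partial_deriv_snd, rule smooth_function_imp_differentiable, rule Suc.prems)
  have "bdd n {(u, 0), (0, w)} r \<Omega> (\<lambda>l. W l * r (0, w) l) (\<lambda>l p. partial_deriv w (g l) (snd p))"
    using Suc.prems by (intro Suc.IH smooth_function_partial_deriv assms(3)) auto
  then show ?case
    using Suc.prems by (auto simp: d bdd_zero)
qed

context alpha_cover
begin

definition slab :: "int ^ 'n \<Rightarrow> ((real ^ 'n) \<times> (real ^ 'n)) set"
  where "slab l = {p. norm (snd p - ctr l) \<le> fatness * rad l}"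

text \<open>Within \<open>dirs i j\<close> the two kinds of direction are distinguished by their
  frequency component: space derivatives cost \<open>rad l\<close>, frequency derivatives gain
  it.\<close>

definition scale :: "(real ^ 'n) \<times> (real ^ 'n) \<Rightarrow> int ^ 'n \<Rightarrow> real"
  where "scale w l = (if snd w = 0 then rad l else 1 / rad l)"

definition dirs :: "'n \<Rightarrow> 'n \<Rightarrow> ((real ^ 'n) \<times> (real ^ 'n)) set"
  where "dirs i j = {(axis i 1, 0), (0, axis j 1)}"

text \<open>This isolates what the off-diagonal estimate needs from a symbol. The class contains the
  cut-off symbols and is preserved by \<open>twist\<close>, so that integration by parts can be
  iterated. One space direction i is fixed, because all these integrations use the same coordinate,
  while the decay of the kernel requires every frequency direction j.\<close>

definition admissible :: "'n \<Rightarrow> (int ^ 'n \<Rightarrow> real) \<Rightarrow> (int ^ 'n \<Rightarrow> (real ^ 'n) \<times> (real ^ 'n) \<Rightarrow> complex) \<Rightarrow> bool"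
  where "admissible i W \<tau> \<longleftrightarrow> (\<forall>l. smooth_function (\<tau> l)) \<and> (\<forall>l p. p \<notin> slab l \<longrightarrow> \<tau> l p = 0) \<and>
    (\<forall>j n. bdd n (dirs i j) scale slab W \<tau>)"

lemma rad_nz: "rad l \<noteq> 0" and br_nz: "br l \<noteq> 0"
  using rad_pos[of l] br_pos[of l] by auto

lemma scale_pos: "0 < scale w l"
  using rad_pos[of l] by (simp add: scale_def)

lemma scale_dirs: "scale (axis i 1, 0) l = rad l" "scale (0, axis j 1) l = 1 / rad l"
  by (simp_all add: scale_def axis_eq_0_iff)

lemma dirs_Basis: "dirs i j \<subseteq> Basis"
  by (auto simp: dirs_def Basis_prod_def)

lemma fatness_pos: "0 < fatness"
  using fatness C by linarith

text \<open>The product \<open>rad l * br l\<close> is exactly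
  \<open>br l powr (1 / (1 - \<alpha>))\<close>, and \<open>ctr l\<close> has norm
  \<open>rad l * br l - rad l\<close>. A shift by at most \<open>fatness * rad l\<close> is harmless
  except for small l, where the ball may reach the origin.\<close>

lemma bracket_slab:
  obtains K where "1 \<le> K"
    "\<And>l \<xi>. norm (\<xi> - ctr l) \<le> fatness * rad l \<Longrightarrow> bracket \<xi> \<le> K * br l powr (1 / (1 - \<alpha>))"
    "\<And>l \<xi>. norm (\<xi> - ctr l) \<le> fatness * rad l \<Longrightarrow> br l powr (1 / (1 - \<alpha>)) \<le> K * bracket \<xi>"
proof -
  let ?F = "1 + fatness"
  \<comment> \<open>The exponent is at least 1, so K exceeds \<open>2 * ?F\<close>; it also bounds
    \<open>br l powr (1 / (1 - \<alpha>))\<close> for the finitely many l with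
    \<open>br l < 2 * ?F\<close>.\<close>
  define K where "K = (2 * ?F) powr (1 / (1 - \<alpha>))"
  have e: "1 / (1 - \<alpha>) = \<alpha> / (1 - \<alpha>) + 1" using \<alpha> by (simp add: field_simps)
  have "(2 * ?F) powr 1 \<le> K"
    unfolding K_def using \<alpha> fatness_pos by (intro powr_mono) (auto simp: e)
  then have K: "2 * ?F \<le> K" using fatness_pos by simp
  have X: "br l powr (1 / (1 - \<alpha>)) = rad l * br l" for l
    unfolding e powr_add rad_def using br_pos[of l] by simp
  have nc: "norm (ctr l) = rad l * br l - rad l" for l
    using rad_pos[of l] by (simp add: ctr_def br_def bracket_def algebra_simps)
  show thesis
  proof (rule that[of K])
    show "1 \<le> K" using K fatness_pos by simp
    fix l and \<xi> :: "real ^ 'n" assume *: "norm (\<xi> - ctr l) \<le> fatness * rad l"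
    have rb: "rad l \<le> rad l * br l" using rad_pos[of l] br_ge_1[of l] by simp
    have "norm \<xi> \<le> norm (ctr l) + norm (\<xi> - ctr l)" using norm_triangle_ineq[of "ctr l" "\<xi> - ctr l"] by simp
    then have "bracket \<xi> \<le> rad l * br l + fatness * rad l"
      using * nc[of l] rad_ge_1[of l] by (simp add: bracket_def)
    also have "\<dots> \<le> ?F * (rad l * br l)"
      using mult_left_mono[OF rb, of fatness] fatness_pos by (simp add: algebra_simps)
    also have "\<dots> \<le> K * (rad l * br l)"
      using K fatness_pos rad_pos[of l] br_pos[of l] by (intro mult_right_mono) auto
    finally show "bracket \<xi> \<le> K * br l powr (1 / (1 - \<alpha>))" unfolding X .
    have b1: "1 \<le> bracket \<xi>" by (simp add: bracket_def)
    have "norm (ctr l) \<le> norm \<xi> + norm (\<xi> - ctr l)" using norm_triangle_ineq4[of \<xi> "\<xi> - ctr l"] by simp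
    then have L: "rad l * br l \<le> ?F * rad l + bracket \<xi>"
      using * nc[of l] by (simp add: bracket_def algebra_simps)
    show "br l powr (1 / (1 - \<alpha>)) \<le> K * bracket \<xi>"
    \<comment> \<open>For large \<open>br l\<close> the shift consumes at most half of
      \<open>rad l * br l\<close>. Otherwise the left-hand side is bounded by K and
      \<open>bracket \<xi>\<close> is at least 1.\<close>
    proof (cases "2 * ?F \<le> br l")
      case True
      then have "2 * ?F * rad l \<le> rad l * br l" using rad_pos[of l] by (simp add: mult.commute)
      then have "rad l * br l \<le> 2 * bracket \<xi>" using L by (simp add: algebra_simps)
      also have "\<dots> \<le> K * bracket \<xi>" using K fatness_pos b1 by (intro mult_right_mono) auto
      finally show ?thesis unfolding X .
    next
      case False
      then have "br l powr (1 / (1 - \<alpha>)) \<le> K"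
        unfolding K_def using \<alpha> br_pos[of l] by (intro powr_mono2) auto
      also have "\<dots> \<le> K * bracket \<xi>" using K fatness_pos b1 by simp
      finally show ?thesis .
    qed
  qed
qed

text \<open>With \<open>?X = br l powr (1 / (1 - \<alpha>))\<close>, which is comparable to
  \<open>bracket \<xi>\<close> on the slab, \<open>?X powr \<alpha>\<close> is exactly
  \<open>rad l\<close>. Powers of the bracket thus become powers of the radius, for exponents of
  either sign.\<close>

lemma symbol_bdd:
  assumes \<sigma>: "\<sigma> \<in> symbol_class b \<rho> \<delta>" and \<delta>: "\<delta> \<le> \<alpha>" "\<alpha> \<le> \<rho>"
  shows "bdd n (dirs i j) scale slab (\<lambda>l. br l powr (b / (1 - \<alpha>))) (\<lambda>_ (x, \<xi>). \<sigma> x \<xi>)"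
  unfolding dirs_def
proof (rule bdd_if_pow_bounded2)
  let ?F = "\<lambda>(x, \<xi>). \<sigma> x \<xi>"
  show "smooth_function ?F" using \<sigma> by (simp add: symbol_class_def)
  show "(axis i 1, 0) \<in> (Basis :: ((real ^ 'n) \<times> (real ^ 'n)) set)" "(0, axis j 1) \<in> (Basis :: ((real ^ 'n) \<times> (real ^ 'n)) set)"
    using dirs_Basis[of i j] by (auto simp: dirs_def)
  fix m N :: nat
  obtain K where K: "1 \<le> K"
    "\<And>l \<xi>. norm (\<xi> - ctr l) \<le> fatness * rad l \<Longrightarrow> bracket \<xi> \<le> K * br l powr (1 / (1 - \<alpha>))"
    "\<And>l \<xi>. norm (\<xi> - ctr l) \<le> fatness * rad l \<Longrightarrow> br l powr (1 / (1 - \<alpha>)) \<le> K * bracket \<xi>"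
    by (rule bracket_slab) blast
  let ?\<beta> = "\<lambda>k. if k = i then m else 0" and ?\<gamma> = "\<lambda>k. if k = j then N else 0"
  define e where "e = b + \<delta> * real m - \<rho> * real N"
  have "\<forall>\<beta> \<gamma>. \<exists>B. \<forall>x \<xi>. norm (multi_deriv \<beta> (\<lambda>y. multi_deriv \<gamma> (\<sigma> y) \<xi>) x)
      \<le> B * bracket \<xi> powr (b + \<delta> * real (order_of \<beta>) - \<rho> * real (order_of \<gamma>))"
    using \<sigma> unfolding symbol_class_def by blast
  from this[THEN spec, of ?\<beta>, THEN spec, of ?\<gamma>]
  obtain B where B: "\<And>x \<xi>. norm (multi_deriv ?\<beta> (\<lambda>y. multi_deriv ?\<gamma> (\<sigma> y) \<xi>) x) \<le> B * bracket \<xi> powr e"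
    unfolding order_of_single e_def by blast
  have eq: "multi_deriv ?\<beta> (\<lambda>y. multi_deriv ?\<gamma> (\<sigma> y) \<xi>) x
      = (partial_deriv (axis i 1, 0) ^^ m) ((partial_deriv (0, axis j 1) ^^ N) ?F) (x, \<xi>)" for x \<xi>
  proof -
    have "multi_deriv ?\<gamma> (\<sigma> y) \<xi> = (partial_deriv (0, axis j 1) ^^ N) ?F (y, \<xi>)" for y
      using partial_deriv_pow_section(1)[of N "axis j 1" ?F y \<xi>] by (simp add: multi_deriv_single)
    then show ?thesis
      using partial_deriv_pow_section(2)[of m "axis i 1" "(partial_deriv (0, axis j 1) ^^ N) ?F" \<xi> x]
      by (simp add: multi_deriv_single)
  qed
  have "norm ((partial_deriv (axis i 1, 0) ^^ m) ((partial_deriv (0, axis j 1) ^^ N) ?F) p)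
      \<le> (\<bar>B\<bar> * K powr \<bar>e\<bar>) * (br l powr (b / (1 - \<alpha>)) * scale (axis i 1, 0) l ^ m * scale (0, axis j 1) l ^ N)"
    if "p \<in> slab l" for l p
  proof -
    obtain x \<xi> where p: "p = (x, \<xi>)" by (cases p)
    have s: "norm (\<xi> - ctr l) \<le> fatness * rad l" using that by (simp add: slab_def p)
    let ?X = "br l powr (1 / (1 - \<alpha>))"
    have X1: "1 \<le> ?X" using br_ge_1[of l] \<alpha> by (intro ge_one_powr_ge_zero) auto
    have Xa: "?X powr \<alpha> = rad l" by (simp add: powr_powr rad_def)
    \<comment> \<open>Both parameters may be replaced by \<open>\<alpha>\<close> because
      \<open>?X\<close> is at least 1: the growing exponent increases and the decaying one
      weakens.\<close>
    have "?X powr e \<le> ?X powr (b + \<alpha> * real m - \<alpha> * real N)"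
      unfolding e_def using X1 \<delta> by (intro powr_mono diff_mono add_mono mult_right_mono) auto
    also have "\<dots> = ?X powr b * (?X powr \<alpha>) powr real m * (?X powr \<alpha>) powr - real N"
      by (simp add: powr_powr powr_add[symmetric] add_divide_distrib diff_divide_distrib)
    also have "\<dots> = br l powr (b / (1 - \<alpha>)) * rad l ^ m * (1 / rad l) ^ N"
      using rad_pos[of l] unfolding Xa
      by (simp add: powr_powr powr_realpow powr_minus power_divide inverse_eq_divide)
    finally have X: "?X powr e \<le> br l powr (b / (1 - \<alpha>)) * rad l ^ m * (1 / rad l) ^ N" .
    have bp: "0 < bracket \<xi>" by (simp add: bracket_def add_pos_nonneg)
    have "norm ((partial_deriv (axis i 1, 0) ^^ m) ((partial_deriv (0, axis j 1) ^^ N) ?F) p) \<le> B * bracket \<xi> powr e"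
      using B[of \<xi> x] unfolding eq p .
    also have "\<dots> \<le> \<bar>B\<bar> * bracket \<xi> powr e" by (intro mult_right_mono) auto
    also have "\<dots> \<le> \<bar>B\<bar> * (K powr \<bar>e\<bar> * ?X powr e)"
      using K(1) K(2)[OF s] K(3)[OF s] bp X1 by (intro mult_left_mono powr_abs_le) auto
    also have "\<dots> \<le> \<bar>B\<bar> * (K powr \<bar>e\<bar> * (br l powr (b / (1 - \<alpha>)) * rad l ^ m * (1 / rad l) ^ N))"
      using X by (intro mult_left_mono) auto
    finally show ?thesis by (simp only: scale_dirs mult.assoc)
  qed
  then show "\<exists>B. \<forall>l. \<forall>p\<in>slab l. norm ((partial_deriv (axis i 1, 0) ^^ m) ((partial_deriv (0, axis j 1) ^^ N) ?F) p)
      \<le> B * (br l powr (b / (1 - \<alpha>)) * scale (axis i 1, 0) l ^ m * scale (0, axis j 1) l ^ N)"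
    by blast
qed

text \<open>The coordinate distance to the centre, written as a linear function plus a constant to
  match the smoothness rule. The factor c is \<open>\<i>\<close> for twisted symbols and 1 for
  moments.\<close>

definition cdist :: "complex \<Rightarrow> 'n \<Rightarrow> int ^ 'n \<Rightarrow> real ^ 'n \<Rightarrow> complex"
  where "cdist c i l \<xi> = c * complex_of_real (\<xi> $ i) + c * complex_of_real (- (ctr l $ i))"

lemma bounded_linear_mult_coord: "bounded_linear (\<lambda>\<xi>::real ^ 'n. c * complex_of_real (\<xi> $ i))"
  by (rule bounded_linear_compose[OF bounded_linear_mult_right bounded_linear_coord])

lemma cdist_smooth: "smooth_function (cdist c i l)"
  unfolding cdist_def[abs_def] by (rule smooth_function_linear[OF bounded_linear_mult_coord])

lemma norm_cdist_le: "norm (cdist c i l \<xi>) \<le> norm c * norm (\<xi> - ctr l)"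
proof -
  have "cdist c i l \<xi> = c * complex_of_real ((\<xi> - ctr l) $ i)" by (simp add: cdist_def algebra_simps)
  moreover have "norm c * \<bar>(\<xi> - ctr l) $ i\<bar> \<le> norm c * norm (\<xi> - ctr l)"
    by (intro mult_left_mono component_le_norm_cart) auto
  ultimately show ?thesis by (simp only: norm_mult norm_of_real)
qed

lemma cdist_bdd:
  assumes "\<And>l \<xi>. \<xi> \<in> \<Omega> l \<Longrightarrow> norm (\<xi> - ctr l) \<le> K * rad l"
  shows "bdd n {axis j 1} (\<lambda>_ l. 1 / rad l) \<Omega> rad (cdist c i)"
proof (rule bdd_if_pow_bounded)
  fix N
  have d: "partial_deriv (axis j 1) (cdist c i l) = (\<lambda>\<xi>. c * complex_of_real (axis j 1 $ i))" for l
    unfolding cdist_def[abs_def] by (rule partial_deriv_linear[OF bounded_linear_mult_coord])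
  have z: "(partial_deriv v ^^ M) (\<lambda>\<xi>::real ^ 'n. 0) = (\<lambda>\<xi>. 0)" for v M by (induction M) auto
  have r: "rad l * (1 / rad l) = 1" for l using rad_pos[of l] by simp
  consider "N = 0" | "N = Suc 0" | M where "N = Suc (Suc M)" by (metis not0_implies_Suc)
  then show "\<exists>B. \<forall>l. \<forall>\<xi>\<in>\<Omega> l. norm ((partial_deriv (axis j 1) ^^ N) (cdist c i l) \<xi>) \<le> B * (rad l * (1 / rad l) ^ N)"
  proof cases
    case 1
    have "norm (cdist c i l \<xi>) \<le> (norm c * K) * rad l" if "\<xi> \<in> \<Omega> l" for l \<xi>
      using order_trans[OF norm_cdist_le mult_left_mono[OF assms[OF that]]] by (simp add: mult.assoc)
    then show ?thesis unfolding 1 by (intro exI[of _ "norm c * K"]) simp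
  next
    case 2
    have "\<bar>axis j 1 $ i :: real\<bar> \<le> 1" by (simp add: axis_def)
    then show ?thesis unfolding 2
      by (intro exI[of _ "norm c"]) (simp add: d r norm_mult mult_left_le rad_nz)
  next
    case (3 M)
    have "(partial_deriv (axis j 1) ^^ N) (cdist c i l) = (\<lambda>\<xi>. 0)" for l
      unfolding 3 funpow_Suc_right o_apply d partial_deriv_const z ..
    then show ?thesis by (intro exI[of _ 0]) simp
  qed
qed

text \<open>This is the derivative in \<open>x $ i\<close> of \<open>\<tau>\<close> conjugated by
  the oscillation that remains after the central frequency is removed,
  \<open>iexp (x \<bullet> (\<xi> - ctr l))\<close>.\<close>

definition twist :: "'n \<Rightarrow> (int ^ 'n \<Rightarrow> (real ^ 'n) \<times> (real ^ 'n) \<Rightarrow> complex) \<Rightarrow> int ^ 'n \<Rightarrow> (real ^ 'n) \<times> (real ^ 'n) \<Rightarrow> complex"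
  where "twist i \<tau> l p = partial_deriv (axis i 1, 0) (\<tau> l) p + cdist \<i> i l (snd p) * \<tau> l p"

lemma open_slab_complement: "open (- slab l)"
proof -
  have "- slab l = {p. fatness * rad l < norm (snd p - ctr l)}" by (auto simp: slab_def)
  then show ?thesis by (simp add: open_Collect_less continuous_intros)
qed

lemma bdd_snd_slab:
  assumes "bdd n {axis j 1} (\<lambda>_ l. 1 / rad l) (\<lambda>l. snd ` slab l) W g" "\<And>l. smooth_function (g l)"
  shows "bdd n (dirs i j) scale slab W (\<lambda>l p. g l (snd p))"
  unfolding dirs_def
proof (rule bdd_snd)
  show "bdd n {axis j 1} (\<lambda>_. scale (0, axis j 1)) (\<lambda>l. snd ` slab l) W g"
    using assms(1) by (simp add: scale_dirs[abs_def] fun_eq_iff scale_def axis_eq_0_iff)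
qed (use assms(2) in auto)

text \<open>Both summands cost exactly one factor \<open>rad l\<close>: a space derivative by the
  scaling, and the distance to the centre because the slab has width comparable to
  \<open>rad l\<close>.\<close>

lemma admissible_twist:
  assumes \<tau>: "admissible i W \<tau>" and W: "\<And>l. 0 < W l"
  shows "admissible i (\<lambda>l. W l * rad l) (twist i \<tau>)"
  unfolding admissible_def
proof (intro conjI allI impI)
  have u: "(axis i 1, 0) \<in> (Basis :: ((real ^ 'n) \<times> (real ^ 'n)) set)"
    using dirs_Basis[of i i] by (simp add: dirs_def)
  have s: "smooth_function (\<tau> l)" "smooth_function (partial_deriv (axis i 1, 0) (\<tau> l))"
    "smooth_function (\<lambda>p::(real ^ 'n) \<times> (real ^ 'n). cdist \<i> i l (snd p))" for l
    using \<tau> u by (auto simp: admissible_def intro!: smooth_function_partial_deriv smooth_function_snd cdist_smooth)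
  show "smooth_function (twist i \<tau> l)" for l
    unfolding twist_def[abs_def] by (intro smooth_function_add smooth_function_mult s)
  show "twist i \<tau> l p = 0" if "p \<notin> slab l" for l p
  proof -
    have "\<forall>l p. p \<notin> slab l \<longrightarrow> \<tau> l p = 0" using \<tau> unfolding admissible_def by blast
    then have z: "\<tau> l p = 0" if "p \<in> - slab l" for p using that by blast
    have "partial_deriv (axis i 1, 0) (\<tau> l) p = 0"
      by (rule partial_deriv_zero_on_open[OF open_slab_complement[of l]]) (use that z in auto)
    then show ?thesis using z[of p] that by (simp add: twist_def)
  qed
  fix j n
  have b: "bdd n (dirs i j) scale slab W \<tau>" for n using \<tau> by (auto simp: admissible_def)
  have "bdd n (dirs i j) scale slab (\<lambda>l. W l * scale (axis i 1, 0) l) (\<lambda>l. partial_deriv (axis i 1, 0) (\<tau> l))"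
    using b[of "Suc n"] by (simp add: dirs_def)
  then have 1: "bdd n (dirs i j) scale slab (\<lambda>l. W l * rad l) (\<lambda>l. partial_deriv (axis i 1, 0) (\<tau> l))"
    by (simp only: scale_dirs)
  have "bdd n (dirs i j) scale slab rad (\<lambda>l p. cdist \<i> i l (snd p))"
    by (intro bdd_snd_slab cdist_bdd[of _ fatness] cdist_smooth) (auto simp: slab_def)
  then have "bdd n (dirs i j) scale slab (\<lambda>l. rad l * W l) (\<lambda>l p. cdist \<i> i l (snd p) * \<tau> l p)"
    by (intro bdd_mult b s dirs_Basis rad_pos W scale_pos)
  then have 2: "bdd n (dirs i j) scale slab (\<lambda>l. W l * rad l) (\<lambda>l p. cdist \<i> i l (snd p) * \<tau> l p)"
    by (simp only: mult.commute)
  show "bdd n (dirs i j) scale slab (\<lambda>l. W l * rad l) (twist i \<tau>)"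
    unfolding twist_def[abs_def] by (intro bdd_add 1 2 dirs_Basis s smooth_function_mult)
qed

lemma admissible_kernel:
  assumes \<tau>: "admissible i W \<tau>" and W: "\<And>l. 0 < W l"
  obtains B where "0 \<le> B" "\<And>l z u. norm (\<integral>\<xi>. iexp (u \<bullet> \<xi>) * \<tau> l (z, \<xi>) \<partial>lborel)
    \<le> B * (W l * rad l ^ CARD('n)) * decay (rad l) N u"
proof -
  have "\<exists>B\<ge>0. \<forall>q u. norm (\<integral>\<xi>. iexp (u \<bullet> \<xi>) * (\<lambda>q \<xi>. \<tau> (fst q) (snd q, \<xi>)) q \<xi> \<partial>lborel)
      \<le> B * (W (fst q) * rad (fst q) ^ CARD('n)) * decay (rad (fst q)) N u"
  proof (rule bdd_fourier_decay[where c="\<lambda>q. ctr (fst q)" and A=fatness])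
    show "smooth_function (\<lambda>\<xi>. \<tau> (fst q) (snd q, \<xi>))" for q
      using \<tau> by (intro smooth_function_section) (auto simp: admissible_def)
    show "\<tau> (fst q) (snd q, \<xi>) = 0" if "fatness * rad (fst q) < norm (\<xi> - ctr (fst q))" for q \<xi>
      using \<tau> that by (auto simp: admissible_def slab_def)
    fix j n
    have "bdd n (dirs i j) scale slab W \<tau>" using \<tau> by (simp add: admissible_def)
    from bdd_section[OF this, of "axis j 1"]
    show "bdd n {axis j 1} (\<lambda>_ q. 1 / rad (fst q)) (\<lambda>q. {\<xi>. norm (\<xi> - ctr (fst q)) \<le> fatness * rad (fst q)})
      (\<lambda>q. W (fst q)) (\<lambda>q \<xi>. \<tau> (fst q) (snd q, \<xi>))"
      by (simp add: dirs_def scale_def axis_eq_0_iff slab_def)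
  qed (use W rad_pos fatness_pos in \<open>auto intro: less_imp_le\<close>)
  then obtain B where "0 \<le> B" and B: "\<And>q u. norm (\<integral>\<xi>. iexp (u \<bullet> \<xi>) * \<tau> (fst q) (snd q, \<xi>) \<partial>lborel)
      \<le> B * (W (fst q) * rad (fst q) ^ CARD('n)) * decay (rad (fst q)) N u" by blast
  from \<open>0 \<le> B\<close> show thesis
    by (rule that) (use B[where q="(l, z)" for l z] in simp)
qed

lemma admissible_symbol:
  assumes \<sigma>: "\<sigma> \<in> symbol_class b \<rho> \<delta>" and \<delta>: "\<delta> \<le> \<alpha>" "\<alpha> \<le> \<rho>"
  shows "admissible i (\<lambda>l. br l powr (b / (1 - \<alpha>))) (\<lambda>l p. \<sigma> (fst p) (snd p) * fat l (snd p))"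
  unfolding admissible_def
proof (intro conjI allI impI)
  have s: "smooth_function (\<lambda>p. \<sigma> (fst p) (snd p))" "smooth_function (\<lambda>p::(real ^ 'n) \<times> (real ^ 'n). fat l (snd p))" for l
    using \<sigma> by (auto simp: symbol_class_def case_prod_beta' intro: smooth_function_snd fat_smooth)
  show "smooth_function (\<lambda>p. \<sigma> (fst p) (snd p) * fat l (snd p))" for l
    by (intro smooth_function_mult s)
  show "\<sigma> (fst p) (snd p) * fat l (snd p) = 0" if "p \<notin> slab l" for l p
    using that fat_supp by (auto simp: slab_def)
  fix j n
  have "bdd n (dirs i j) scale slab (\<lambda>l. br l powr (b / (1 - \<alpha>)) * 1) (\<lambda>l p. \<sigma> (fst p) (snd p) * fat l (snd p))"
    using symbol_bdd[OF \<sigma> \<delta>, of n i j] br_pos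
    by (intro bdd_mult bdd_snd_slab fat_bdd fat_smooth s dirs_Basis scale_pos) (auto simp: case_prod_beta' br_nz)
  then show "bdd n (dirs i j) scale slab (\<lambda>l. br l powr (b / (1 - \<alpha>))) (\<lambda>l p. \<sigma> (fst p) (snd p) * fat l (snd p))"
    by simp
qed

text \<open>The cutoff itself is the symbol of the identity on the piece l; it yields the
  reproducing formula behind Peetre's inequality.\<close>

lemma admissible_fat: "admissible i (\<lambda>_. 1) (\<lambda>l p. fat l (snd p))"
  unfolding admissible_def
proof (intro conjI allI impI)
  show "bdd n (dirs i j) scale slab (\<lambda>_. 1) (\<lambda>l p. fat l (snd p))" for j n
    by (intro bdd_snd_slab fat_bdd fat_smooth)
qed (use fat_supp in \<open>auto simp: slab_def intro: smooth_function_snd fat_smooth\<close>)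

end

section \<open>Frequency pieces of a Schwartz function\<close>

lemma norm_inv_fourier:
  fixes a :: "real ^ 'n::finite \<Rightarrow> complex"
  shows "norm (inv_fourier a u) = 1 / (2 * pi) ^ CARD('n) * norm (\<integral>\<xi>. iexp (u \<bullet> \<xi>) * a \<xi> \<partial>lborel)"
  unfolding inv_fourier_def norm_mult norm_of_real by simp

lemma iexp_diff_split:
  "iexp ((z - y) \<bullet> \<xi>) = iexp (z \<bullet> \<xi>) * exp (- \<i> * complex_of_real (\<xi> \<bullet> y))"
  unfolding inner_commute[of \<xi> y] by (simp add: exp_add[symmetric] inner_diff_left algebra_simps)

context alpha_cover
begin

text \<open>Differentiating the kernel of \<open>\<eta> k\<close> multiplies its symbol by the
  frequency. Only the deviation from the central frequency is recorded here, at a cost of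
  \<open>rad k\<close> for each factor.\<close>

definition moment_symbol :: "'n \<Rightarrow> nat \<Rightarrow> int ^ 'n \<Rightarrow> real ^ 'n \<Rightarrow> complex"
  where "moment_symbol i m k \<zeta> = cdist 1 i k \<zeta> ^ m * \<eta> k \<zeta>"

definition moment_kernel :: "'n \<Rightarrow> nat \<Rightarrow> int ^ 'n \<Rightarrow> real ^ 'n \<Rightarrow> complex"
  where "moment_kernel i m k = inv_fourier (moment_symbol i m k)"

definition kern :: "int ^ 'n \<Rightarrow> real ^ 'n \<Rightarrow> complex"
  where "kern k = inv_fourier (\<eta> k)"

lemma moment_kernel_0: "moment_kernel i 0 k = kern k"
  by (simp add: moment_kernel_def kern_def moment_symbol_def[abs_def])

lemma moment_symbol_smooth: "smooth_function (moment_symbol i m k)"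
  unfolding moment_symbol_def[abs_def]
  by (intro smooth_function_mult smooth_function_power cdist_smooth eta_smooth)

lemma moment_symbol_measurable [measurable]: "moment_symbol i m k \<in> borel_measurable borel"
  by (rule smooth_function_measurable[OF moment_symbol_smooth])

lemma moment_symbol_supp: "C * rad k < norm (\<xi> - ctr k) \<Longrightarrow> moment_symbol i m k \<xi> = 0"
  using eta_supp[of k \<xi>] by (auto simp: moment_symbol_def)

lemma moment_symbol_bdd:
  "bdd n {axis j 1} (\<lambda>_ l. 1 / rad l) (\<lambda>k. {\<xi>. norm (\<xi> - ctr k) \<le> C * rad k}) (\<lambda>k. rad k ^ m) (moment_symbol i m)"
proof (induction m)
  case 0
  then show ?case using eta_bdd by (simp add: moment_symbol_def[abs_def])
next
  case (Suc m)
  have "bdd n {axis j 1} (\<lambda>_ l. 1 / rad l) (\<lambda>k. {\<xi>. norm (\<xi> - ctr k) \<le> C * rad k}) (\<lambda>k. rad k * rad k ^ m)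
      (\<lambda>k \<xi>. cdist 1 i k \<xi> * moment_symbol i m k \<xi>)"
    by (intro bdd_mult cdist_bdd[of _ C] Suc cdist_smooth moment_symbol_smooth zero_less_power rad_pos)
      (auto simp: rad_pos)
  then show ?case by (simp add: moment_symbol_def[abs_def] mult.assoc)
qed

lemma moment_kernel_decay:
  obtains B where "0 \<le> B" "\<And>k u. norm (moment_kernel i m k u) \<le> B * (rad k ^ m * rad k ^ CARD('n)) * decay (rad k) N u"
proof -
  have "\<exists>B\<ge>0. \<forall>k u. norm (\<integral>\<xi>. iexp (u \<bullet> \<xi>) * moment_symbol i m k \<xi> \<partial>lborel)
      \<le> B * (rad k ^ m * rad k ^ CARD('n)) * decay (rad k) N u"
    by (rule bdd_fourier_decay[where c=ctr and A=C])
      (use C rad_pos moment_symbol_smooth moment_symbol_supp moment_symbol_bdd in auto)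
  then obtain B where B: "0 \<le> B" "\<And>k u. norm (\<integral>\<xi>. iexp (u \<bullet> \<xi>) * moment_symbol i m k \<xi> \<partial>lborel)
      \<le> B * (rad k ^ m * rad k ^ CARD('n)) * decay (rad k) N u" by blast
  let ?c = "1 / (2 * pi) ^ CARD('n)"
  show thesis
  proof (rule that[of "?c * B"])
    fix k and u :: "real ^ 'n"
    have "norm (moment_kernel i m k u) = ?c * norm (\<integral>\<xi>. iexp (u \<bullet> \<xi>) * moment_symbol i m k \<xi> \<partial>lborel)"
      unfolding moment_kernel_def by (rule norm_inv_fourier)
    also have "\<dots> \<le> ?c * (B * (rad k ^ m * rad k ^ CARD('n)) * decay (rad k) N u)"
      by (intro mult_left_mono B) auto
    finally show "norm (moment_kernel i m k u) \<le> ?c * B * (rad k ^ m * rad k ^ CARD('n)) * decay (rad k) N u"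
      by (simp add: mult.assoc)
  qed (use B in auto)
qed

lemma moment_symbol_integrable: "integrable lborel (moment_symbol i m k)"
proof -
  obtain B where "0 \<le> B" and B: "\<And>k \<xi>. \<xi> \<in> {\<xi>. norm (\<xi> - ctr k) \<le> C * rad k} \<Longrightarrow> norm (moment_symbol i m k \<xi>) \<le> B * rad k ^ m"
    using bdd_bound[OF moment_symbol_bdd[of 0 i m i]] rad_pos by (metis zero_less_power)
  show ?thesis
    by (rule compact_support_bound(1)[OF _ rad_pos _ _ moment_symbol_supp, where A=C and B="B * rad k ^ m"])
      (use C \<open>0 \<le> B\<close> rad_pos[of k] B in auto)
qed

lemma moment_kernel_continuous: "continuous_on UNIV (moment_kernel i m k)"
  unfolding moment_kernel_def inv_fourier_def[abs_def]
  by (intro continuous_intros continuous_on_fourier_integral moment_symbol_integrable)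

lemma moment_kernel_measurable [measurable]: "moment_kernel i m k \<in> borel_measurable borel"
  by (rule borel_measurable_continuous_onI[OF moment_kernel_continuous])

lemma moment_kernel_integrable: "integrable lborel (moment_kernel i m k)"
proof -
  obtain B where "\<And>k u. norm (moment_kernel i m k u) \<le> B * (rad k ^ m * rad k ^ CARD('n)) * decay (rad k) (2 * CARD('n)) u"
    using moment_kernel_decay[where i=i and m=m and N="2 * CARD('n)"] by blast
  then show ?thesis
    by (intro decay_integrable_bound[where R="rad k" and N="2 * CARD('n)" and y=0 and B="B * (rad k ^ m * rad k ^ CARD('n))"])
      (auto simp: rad_pos decay_def)
qed

text \<open>The frequency coordinate brought down by differentiation is split into its deviation
  from the centre, which raises the moment, and the centre, which multiplies the kernel. The sign
  stems from differentiating in z while the kernel is evaluated at \<open>x - z\<close>.\<close>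

lemma moment_kernel_derivative:
  "((\<lambda>t. moment_kernel i m k (x - (z + t *\<^sub>R axis i 1))) has_vector_derivative
    - (\<i> * moment_kernel i (Suc m) k (x - (z + s *\<^sub>R axis i 1))
      + \<i> * complex_of_real (ctr k $ i) * moment_kernel i m k (x - (z + s *\<^sub>R axis i 1)))) (at s)"
proof -
  let ?v = "- axis i 1 :: real ^ 'n" and ?a = "moment_symbol i m k" and ?b = "moment_symbol i (Suc m) k"
  let ?K = "complex_of_real (1 / (2 * pi) ^ CARD('n))"
  let ?y = "x - z + s *\<^sub>R ?v"
  have v: "complex_of_real (?v \<bullet> \<xi>) * ?a \<xi> = - (?b \<xi> + complex_of_real (ctr k $ i) * ?a \<xi>)" for \<xi>
    by (simp add: inner_axis' moment_symbol_def cdist_def algebra_simps)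
  have i: "integrable lborel (\<lambda>\<xi>. complex_of_real (?v \<bullet> \<xi>) * ?a \<xi>)"
    unfolding v by (intro Bochner_Integration.integrable_minus Bochner_Integration.integrable_add integrable_mult_right moment_symbol_integrable)
  have ie: "integrable lborel (\<lambda>\<xi>. iexp (y \<bullet> \<xi>) * moment_symbol i m k \<xi>)" for y m
    by (rule Bochner_Integration.integrable_bound[OF moment_symbol_integrable[of i m k]]) (auto simp: norm_mult)
  have "(\<integral>\<xi>. iexp (?y \<bullet> \<xi>) * (\<i> * complex_of_real (?v \<bullet> \<xi>) * ?a \<xi>) \<partial>lborel)
      = (\<integral>\<xi>. - \<i> * (iexp (?y \<bullet> \<xi>) * ?b \<xi>) + (- \<i> * complex_of_real (ctr k $ i)) * (iexp (?y \<bullet> \<xi>) * ?a \<xi>) \<partial>lborel)"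
    unfolding mult.assoc[of \<i>] v by (intro Bochner_Integration.integral_cong refl) (simp add: algebra_simps)
  also have "\<dots> = - \<i> * (\<integral>\<xi>. iexp (?y \<bullet> \<xi>) * ?b \<xi> \<partial>lborel) + (- \<i> * complex_of_real (ctr k $ i)) * (\<integral>\<xi>. iexp (?y \<bullet> \<xi>) * ?a \<xi> \<partial>lborel)"
    by (subst Bochner_Integration.integral_add, (intro integrable_mult_right ie)+, simp only: integral_mult_right_zero)
  finally have eq0: "(\<integral>\<xi>. iexp (?y \<bullet> \<xi>) * (\<i> * complex_of_real (?v \<bullet> \<xi>) * ?a \<xi>) \<partial>lborel)
      = - \<i> * (\<integral>\<xi>. iexp (?y \<bullet> \<xi>) * ?b \<xi> \<partial>lborel) + (- \<i> * complex_of_real (ctr k $ i)) * (\<integral>\<xi>. iexp (?y \<bullet> \<xi>) * ?a \<xi> \<partial>lborel)" .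
  have ring: "K * (- \<i> * P + (- \<i> * c) * Q) = - (\<i> * (K * P) + \<i> * c * (K * Q))" for K P Q c :: complex
    by (simp add: algebra_simps)
  have eq: "?K * (\<integral>\<xi>. iexp (?y \<bullet> \<xi>) * (\<i> * complex_of_real (?v \<bullet> \<xi>) * ?a \<xi>) \<partial>lborel)
      = - (\<i> * moment_kernel i (Suc m) k ?y + \<i> * complex_of_real (ctr k $ i) * moment_kernel i m k ?y)"
    unfolding eq0 moment_kernel_def inv_fourier_def by (rule ring)
  have "((\<lambda>t. ?K * (\<integral>\<xi>. iexp ((x - z + t *\<^sub>R ?v) \<bullet> \<xi>) * ?a \<xi> \<partial>lborel)) has_vector_derivative
      ?K * (\<integral>\<xi>. iexp (?y \<bullet> \<xi>) * (\<i> * complex_of_real (?v \<bullet> \<xi>) * ?a \<xi>) \<partial>lborel)) (at s)"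
    by (rule bounded_linear.has_vector_derivative[OF bounded_linear_mult_right
          fourier_integral_has_vector_derivative[OF moment_symbol_integrable i]])
  then have "((\<lambda>t. moment_kernel i m k (x - z + t *\<^sub>R ?v)) has_vector_derivative
      ?K * (\<integral>\<xi>. iexp (?y \<bullet> \<xi>) * (\<i> * complex_of_real (?v \<bullet> \<xi>) * ?a \<xi>) \<partial>lborel)) (at s)"
    by (simp only: moment_kernel_def inv_fourier_def)
  moreover have "x - z + t *\<^sub>R ?v = x - (z + t *\<^sub>R axis i 1)" for t by simp
  ultimately show ?thesis unfolding eq by (simp only:)
qed

lemma kern_facts:
  shows kern_continuous: "continuous_on UNIV (kern k)"
    and kern_integrable: "integrable lborel (kern k)"
    and eta_integrable: "integrable lborel (\<eta> k)"
  \<comment> \<open>The zeroth moment does not depend on the coordinate, so any coordinate, here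
    \<open>undefined\<close>, may be named.\<close>
  using moment_kernel_continuous[of undefined 0 k] moment_kernel_integrable[of undefined 0 k] moment_symbol_integrable[of undefined 0 k]
  by (simp_all add: moment_kernel_0 moment_symbol_def[abs_def])

lemma kern_measurable [measurable]: "kern k \<in> borel_measurable borel"
  by (rule borel_measurable_continuous_onI[OF kern_continuous])

lemma fourier_kern: "fourier (kern k) \<xi> = \<eta> k \<xi>"
proof -
  obtain B where B: "\<And>k \<xi>. norm (\<eta> k \<xi>) \<le> B" using eta_bound by blast
  show ?thesis
    unfolding kern_def
    by (rule fourier_inv_fourier[OF smooth_function_continuous[OF eta_smooth] B eta_integrable kern_integrable[unfolded kern_def]])
qed

text \<open>This is \<open>\<eta>\<^sub>l(D) f\<close> as a convolution. The form gives an
  integrable function whose transform follows from \<open>fourier_kern\<close> alone.\<close>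

definition piece :: "(real ^ 'n \<Rightarrow> complex) \<Rightarrow> int ^ 'n \<Rightarrow> real ^ 'n \<Rightarrow> complex"
  where "piece f l y = (\<integral>w. f w * kern l (y - w) \<partial>lborel)"

lemma kern_translate:
  "integrable lborel (\<lambda>y. kern l (y - w))" "(\<integral>y. norm (kern l (y - w)) \<partial>lborel) = (\<integral>y. norm (kern l y) \<partial>lborel)"
proof -
  have [measurable]: "(\<lambda>y. norm (kern l y)) \<in> borel_measurable borel" by measurable
  show "integrable lborel (\<lambda>y. kern l (y - w))"
    using lborel_integral_translate(1)[of "kern l" "- w"] kern_integrable by simp
  show "(\<integral>y. norm (kern l (y - w)) \<partial>lborel) = (\<integral>y. norm (kern l y) \<partial>lborel)"
    using lborel_integral_translate(2)[of "\<lambda>y. norm (kern l y)" "- w"] by simp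
qed

lemma
  assumes f: "schwartz f"
  shows piece_integrable: "integrable lborel (piece f l)"
    and fourier_piece: "fourier (piece f l) \<xi> = \<eta> l \<xi> * fourier f \<xi>"
proof -
  note [measurable] = schwartz_measurable[OF f]
  let ?c = "\<integral>y. norm (kern l y) \<partial>lborel"
  have c: "(\<integral>\<^sup>+y. ennreal (norm (kern l (y - w))) \<partial>lborel) \<le> ennreal ?c" for w
    using kern_translate[of l w] by (subst nn_integral_eq_integral) auto
  let ?F = "\<lambda>\<zeta> w y. exp (- \<i> * complex_of_real (\<zeta> \<bullet> y)) * (f w * kern l (y - w))"
  have m: "(\<lambda>(w, y). ?F \<zeta> w y) \<in> borel_measurable (lborel \<Otimes>\<^sub>M lborel)" for \<zeta>
    by measurable
  have km: "(\<lambda>y. norm (kern l (y - w))) \<in> borel_measurable borel" for w by measurable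
  have bd: "norm (?F \<zeta> w y) \<le> norm (f w) * norm (kern l (y - w))" for \<zeta> w y
    by (simp add: norm_mult norm_exp_eq_Re)
  have sw: "integrable (lborel \<Otimes>\<^sub>M lborel) (\<lambda>(w, y). ?F \<zeta> w y)"
    "(\<integral>w. \<integral>y. ?F \<zeta> w y \<partial>lborel \<partial>lborel) = (\<integral>y. \<integral>w. ?F \<zeta> w y \<partial>lborel \<partial>lborel)" for \<zeta>
    by (rule lborel_swap[OF m integrable_norm[OF schwartz_integrable[OF f]] km norm_ge_zero norm_ge_zero c bd])+
  have "integrable (lborel \<Otimes>\<^sub>M lborel) (\<lambda>(w, y). f w * kern l (y - w))"
    using sw(1)[of 0] by simp
  then show "integrable lborel (piece f l)"
    unfolding piece_def[abs_def] by (rule lborel_pair.integrable_snd)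
  have "fourier (piece f l) \<xi> = (\<integral>y. \<integral>w. exp (- \<i> * complex_of_real (\<xi> \<bullet> y)) * (f w * kern l (y - w)) \<partial>lborel \<partial>lborel)"
    unfolding fourier_def piece_def by (simp only: integral_mult_right_zero)
  also have "\<dots> = (\<integral>w. \<integral>y. exp (- \<i> * complex_of_real (\<xi> \<bullet> y)) * (f w * kern l (y - w)) \<partial>lborel \<partial>lborel)"
    by (rule sw(2)[symmetric])
  also have "\<dots> = (\<integral>w. \<eta> l \<xi> * (exp (- \<i> * complex_of_real (\<xi> \<bullet> w)) * f w) \<partial>lborel)"
  proof (intro Bochner_Integration.integral_cong refl)
    fix w :: "real ^ 'n"
    let ?h = "\<lambda>y. exp (- \<i> * complex_of_real (\<xi> \<bullet> y)) * kern l y"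
    have "exp (- \<i> * complex_of_real (\<xi> \<bullet> y)) * (f w * kern l (y - w))
        = (exp (- \<i> * complex_of_real (\<xi> \<bullet> w)) * f w) * ?h (y + - w)" for y
    proof -
      have "exp (- \<i> * complex_of_real (\<xi> \<bullet> y)) = exp (- \<i> * complex_of_real (\<xi> \<bullet> w)) * exp (- \<i> * complex_of_real (\<xi> \<bullet> (y + - w)))"
        by (simp add: exp_add[symmetric] inner_diff_right algebra_simps)
      then show ?thesis by (simp add: mult_ac)
    qed
    then have "(\<integral>y. exp (- \<i> * complex_of_real (\<xi> \<bullet> y)) * (f w * kern l (y - w)) \<partial>lborel)
        = (exp (- \<i> * complex_of_real (\<xi> \<bullet> w)) * f w) * (\<integral>y. ?h (y + - w) \<partial>lborel)"
      by (simp only: integral_mult_right_zero)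
    also have "(\<integral>y. ?h (y + - w) \<partial>lborel) = (\<integral>y. ?h y \<partial>lborel)"
      by (rule lborel_integral_translate(2)) measurable
    also have "\<dots> = \<eta> l \<xi>" using fourier_kern[of l \<xi>] by (simp add: fourier_def)
    finally show "(\<integral>y. exp (- \<i> * complex_of_real (\<xi> \<bullet> y)) * (f w * kern l (y - w)) \<partial>lborel)
        = \<eta> l \<xi> * (exp (- \<i> * complex_of_real (\<xi> \<bullet> w)) * f w)" by (simp only: mult.commute)
  qed
  also have "\<dots> = \<eta> l \<xi> * fourier f \<xi>"
    unfolding fourier_def by (rule integral_mult_right_zero)
  finally show "fourier (piece f l) \<xi> = \<eta> l \<xi> * fourier f \<xi>" .
qed

lemma piece_measurable: "schwartz f \<Longrightarrow> piece f l \<in> borel_measurable borel"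
  using piece_integrable[of f l] by auto

text \<open>Obtained by inserting the integral that defines \<open>kern\<close> and exchanging the
  order, not by Fourier inversion.\<close>

lemma piece_eq_inv_fourier:
  assumes f: "schwartz f"
  shows "piece f l y = inv_fourier (\<lambda>\<xi>. \<eta> l \<xi> * fourier f \<xi>) y"
proof -
  note [measurable] = schwartz_measurable[OF f]
  let ?K = "complex_of_real (1 / (2 * pi) ^ CARD('n))"
  have "piece f l y = (\<integral>w. \<integral>\<xi>. ?K * (f w * (iexp ((y - w) \<bullet> \<xi>) * \<eta> l \<xi>)) \<partial>lborel \<partial>lborel)"
    unfolding piece_def kern_def inv_fourier_def integral_mult_right_zero by (simp add: mult_ac)
  also have "\<dots> = (\<integral>\<xi>. \<integral>w. ?K * (f w * (iexp ((y - w) \<bullet> \<xi>) * \<eta> l \<xi>)) \<partial>lborel \<partial>lborel)"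
  proof (rule lborel_swap(2)[where g="\<lambda>w. norm ?K * norm (f w)" and k="\<lambda>w \<xi>. norm (\<eta> l \<xi>)" and c="\<integral>\<xi>. norm (\<eta> l \<xi>) \<partial>lborel"])
    show "(\<lambda>(w, \<xi>). ?K * (f w * (iexp ((y - w) \<bullet> \<xi>) * \<eta> l \<xi>))) \<in> borel_measurable (lborel \<Otimes>\<^sub>M lborel)"
      by measurable
    show "integrable lborel (\<lambda>w. norm ?K * norm (f w))"
      by (intro integrable_mult_right integrable_norm schwartz_integrable f)
    show "(\<integral>\<^sup>+\<xi>. ennreal (norm (\<eta> l \<xi>)) \<partial>lborel) \<le> ennreal (\<integral>\<xi>. norm (\<eta> l \<xi>) \<partial>lborel)"
      using eta_integrable[of l] by (subst nn_integral_eq_integral) auto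
    show "norm (?K * (f w * (iexp ((y - w) \<bullet> \<xi>) * \<eta> l \<xi>))) \<le> norm ?K * norm (f w) * norm (\<eta> l \<xi>)" for w \<xi>
      unfolding norm_mult by simp
  qed (auto intro: mult_nonneg_nonneg)
  also have "\<dots> = (\<integral>\<xi>. ?K * (iexp (y \<bullet> \<xi>) * (\<eta> l \<xi> * fourier f \<xi>)) \<partial>lborel)"
  proof (intro Bochner_Integration.integral_cong refl)
    fix \<xi> :: "real ^ 'n"
    have "?K * (f w * (iexp ((y - w) \<bullet> \<xi>) * \<eta> l \<xi>)) = (?K * (iexp (y \<bullet> \<xi>) * \<eta> l \<xi>)) * (exp (- \<i> * complex_of_real (\<xi> \<bullet> w)) * f w)" for w
      unfolding iexp_diff_split by (simp only: mult_ac)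
    then show "(\<integral>w. ?K * (f w * (iexp ((y - w) \<bullet> \<xi>) * \<eta> l \<xi>)) \<partial>lborel) = ?K * (iexp (y \<bullet> \<xi>) * (\<eta> l \<xi> * fourier f \<xi>))"
      unfolding fourier_def by (simp only: integral_mult_right_zero mult.assoc)
  qed
  also have "\<dots> = inv_fourier (\<lambda>\<xi>. \<eta> l \<xi> * fourier f \<xi>) y"
    unfolding inv_fourier_def by (rule integral_mult_right_zero)
  finally show ?thesis .
qed

lemma fourier_measurable: "schwartz f \<Longrightarrow> fourier f \<in> borel_measurable borel"
proof -
  assume "schwartz f"
  then have "f \<in> borel_measurable borel" by (rule schwartz_measurable)
  from fourier_measurable_aux[OF this, of "-1"] show ?thesis by (simp add: fourier_def[abs_def])
qed

lemma fourier_integrable: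
  fixes f :: "real ^ 'n \<Rightarrow> complex"
  assumes "schwartz f" shows "integrable lborel (fourier f)"
proof -
  obtain B where "\<And>\<xi>. norm (fourier f \<xi>) \<le> B * decay 1 (2 * CARD('n)) \<xi>"
    using schwartz_fourier_decay[OF assms] by blast
  then show ?thesis
    by (intro decay_bound_integrable[where B=B] fourier_measurable[OF assms]) simp
qed

lemma eta_fourier_integrable:
  assumes f: "schwartz f" shows "integrable lborel (\<lambda>\<xi>. \<eta> l \<xi> * fourier f \<xi>)"
proof -
  obtain B where B: "0 \<le> B" "\<And>k \<xi>. norm (\<eta> k \<xi>) \<le> B" using eta_bound by blast
  note [measurable] = fourier_measurable[OF f]
  show ?thesis
    by (rule Bochner_Integration.integrable_bound[OF integrable_mult_right[OF integrable_norm[OF fourier_integrable[OF f]], of B]])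
      (use B in \<open>auto simp: norm_mult intro!: mult_right_mono\<close>)
qed

text \<open>The bound depends on f and l. It is qualitative information: it makes the supremum in
  Peetre's argument finite and powers of the piece integrable against a decay weight.\<close>

lemma piece_bounded:
  assumes f: "schwartz f"
  obtains B where "0 \<le> B" "\<And>y. norm (piece f l y) \<le> B"
proof -
  let ?I = "\<integral>\<xi>. norm (\<eta> l \<xi> * fourier f \<xi>) \<partial>lborel"
  let ?c = "1 / (2 * pi) ^ CARD('n)"
  have "norm (\<integral>\<xi>. iexp (y \<bullet> \<xi>) * (\<eta> l \<xi> * fourier f \<xi>) \<partial>lborel) \<le> ?I" for y
    using integral_norm_bound[of lborel "\<lambda>\<xi>. iexp (y \<bullet> \<xi>) * (\<eta> l \<xi> * fourier f \<xi>)"] by (simp add: norm_mult)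
  then have "?c * norm (\<integral>\<xi>. iexp (y \<bullet> \<xi>) * (\<eta> l \<xi> * fourier f \<xi>) \<partial>lborel) \<le> ?c * ?I" for y
    by (intro mult_left_mono) auto
  then have "norm (piece f l y) \<le> ?c * ?I" for y
    unfolding piece_eq_inv_fourier[OF f] norm_inv_fourier .
  then show thesis by (intro that[of "?c * ?I"]) auto
qed

text \<open>Up to the factor \<open>(2 * pi) ^ CARD('n)\<close>, this is the pseudodifferential
  operator with symbol \<open>\<tau> l\<close> applied to the piece l of f.\<close>

definition osc :: "(int ^ 'n \<Rightarrow> (real ^ 'n) \<times> (real ^ 'n) \<Rightarrow> complex) \<Rightarrow> (real ^ 'n \<Rightarrow> complex) \<Rightarrow> int ^ 'n \<Rightarrow> real ^ 'n \<Rightarrow> complex"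
  where "osc \<tau> f l z = (\<integral>\<xi>. iexp (z \<bullet> \<xi>) * \<tau> l (z, \<xi>) * (\<eta> l \<xi> * fourier f \<xi>) \<partial>lborel)"

lemma admissible_bounded:
  assumes "admissible i W \<tau>" "\<And>l. 0 < W l"
  obtains B where "0 \<le> B" "\<And>l p. norm (\<tau> l p) \<le> B * W l"
proof -
  have "bdd 0 (dirs i i) scale slab W \<tau>" using assms(1) by (simp add: admissible_def)
  then obtain B where B: "0 \<le> B" "\<And>l p. p \<in> slab l \<Longrightarrow> norm (\<tau> l p) \<le> B * W l"
    using bdd_bound assms(2) by blast
  have z: "p \<notin> slab l \<Longrightarrow> \<tau> l p = 0" for l p using assms(1) unfolding admissible_def by blast
  have "norm (\<tau> l p) \<le> B * W l" for l p
    using B z[of p l] assms(2)[of l] by (cases "p \<in> slab l") auto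
  then show thesis using B(1) that by blast
qed

lemma admissible_smooth: "admissible i W \<tau> \<Longrightarrow> smooth_function (\<tau> l)"
  by (simp add: admissible_def)

text \<open>Writing \<open>\<eta> l \<xi> * fourier f \<xi>\<close> as the transform of the piece
  and exchanging the integrals turns the operator into integration of the piece against the Fourier
  integral of \<open>\<tau> l (z, \<xi>)\<close> in \<open>\<xi>\<close>, evaluated at
  \<open>z - y\<close>. That kernel is controlled by \<open>admissible_kernel\<close>.\<close>

lemma osc_bound:
  assumes \<tau>: "admissible i W \<tau>" and W: "\<And>l. 0 < W l"
  obtains B where "0 \<le> B" "\<And>f l z. schwartz f \<Longrightarrow> norm (osc \<tau> f l z)
    \<le> B * W l * rad l ^ CARD('n) * (\<integral>y. decay (rad l) N (z - y) * norm (piece f l y) \<partial>lborel)"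
proof -
  obtain B where B: "0 \<le> B" "\<And>l z u. norm (\<integral>\<xi>. iexp (u \<bullet> \<xi>) * \<tau> l (z, \<xi>) \<partial>lborel)
    \<le> B * (W l * rad l ^ CARD('n)) * decay (rad l) N u"
    by (rule admissible_kernel[OF \<tau> W]) blast
  show thesis
  proof (rule that[OF B(1)])
    fix f :: "real ^ 'n \<Rightarrow> complex" and l z assume f: "schwartz f"
    note [measurable] = piece_measurable[OF f] fourier_measurable[OF f]
    have sm: "smooth_function (\<lambda>\<xi>. \<tau> l (z, \<xi>))" by (intro smooth_function_section admissible_smooth[OF \<tau>])
    note [measurable] = smooth_function_measurable[OF sm]
    obtain B' where B': "0 \<le> B'" "\<And>l p. norm (\<tau> l p) \<le> B' * W l"
      using admissible_bounded[OF \<tau> W] by blast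
    have "\<tau> l (z, \<xi>) = 0" if "fatness * rad l < norm (\<xi> - ctr l)" for \<xi>
      using \<tau> that by (auto simp: admissible_def slab_def)
    then have it: "integrable lborel (\<lambda>\<xi>. \<tau> l (z, \<xi>))"
      by (intro compact_support_bound(1)[OF _ rad_pos[of l], where A=fatness and y="ctr l" and B="B' * W l"])
        (use B' W[of l] fatness_pos in auto)
    have eq: "\<eta> l \<xi> * fourier f \<xi> = (\<integral>y. exp (- \<i> * complex_of_real (\<xi> \<bullet> y)) * piece f l y \<partial>lborel)" for \<xi>
      by (simp only: fourier_piece[OF f, symmetric] fourier_def[of "piece f l"])
    have "osc \<tau> f l z = (\<integral>\<xi>. \<integral>y. iexp (z \<bullet> \<xi>) * \<tau> l (z, \<xi>) * (exp (- \<i> * complex_of_real (\<xi> \<bullet> y)) * piece f l y) \<partial>lborel \<partial>lborel)"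
      unfolding osc_def eq by (simp only: integral_mult_right_zero)
    also have "\<dots> = (\<integral>y. \<integral>\<xi>. iexp (z \<bullet> \<xi>) * \<tau> l (z, \<xi>) * (exp (- \<i> * complex_of_real (\<xi> \<bullet> y)) * piece f l y) \<partial>lborel \<partial>lborel)"
    proof (rule lborel_swap(2)[where g="\<lambda>\<xi>. norm (\<tau> l (z, \<xi>))" and k="\<lambda>\<xi> y. norm (piece f l y)" and c="\<integral>y. norm (piece f l y) \<partial>lborel"])
      show "(\<lambda>(\<xi>, y). iexp (z \<bullet> \<xi>) * \<tau> l (z, \<xi>) * (exp (- \<i> * complex_of_real (\<xi> \<bullet> y)) * piece f l y)) \<in> borel_measurable (lborel \<Otimes>\<^sub>M lborel)"
        by measurable
      show "(\<integral>\<^sup>+y. ennreal (norm (piece f l y)) \<partial>lborel) \<le> ennreal (\<integral>y. norm (piece f l y) \<partial>lborel)"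
        using piece_integrable[OF f, of l] by (subst nn_integral_eq_integral) auto
    qed (use it in \<open>auto simp: norm_mult norm_exp_eq_Re\<close>)
    also have "\<dots> = (\<integral>y. piece f l y * (\<integral>\<xi>. iexp ((z - y) \<bullet> \<xi>) * \<tau> l (z, \<xi>) \<partial>lborel) \<partial>lborel)"
    proof (intro Bochner_Integration.integral_cong refl)
      fix y :: "real ^ 'n"
      have "iexp (z \<bullet> \<xi>) * \<tau> l (z, \<xi>) * (exp (- \<i> * complex_of_real (\<xi> \<bullet> y)) * piece f l y)
          = piece f l y * (iexp ((z - y) \<bullet> \<xi>) * \<tau> l (z, \<xi>))" for \<xi>
        unfolding iexp_diff_split by (simp only: mult_ac)
      then show "(\<integral>\<xi>. iexp (z \<bullet> \<xi>) * \<tau> l (z, \<xi>) * (exp (- \<i> * complex_of_real (\<xi> \<bullet> y)) * piece f l y) \<partial>lborel)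
          = piece f l y * (\<integral>\<xi>. iexp ((z - y) \<bullet> \<xi>) * \<tau> l (z, \<xi>) \<partial>lborel)"
        by (simp only: integral_mult_right_zero)
    qed
    finally have "norm (osc \<tau> f l z) \<le> (\<integral>y. norm (piece f l y * (\<integral>\<xi>. iexp ((z - y) \<bullet> \<xi>) * \<tau> l (z, \<xi>) \<partial>lborel)) \<partial>lborel)"
      using integral_norm_bound by simp
    also have "\<dots> \<le> (\<integral>y. B * W l * rad l ^ CARD('n) * (decay (rad l) N (z - y) * norm (piece f l y)) \<partial>lborel)"
    proof (rule integral_mono')
      have "integrable lborel (\<lambda>y. decay (rad l) N (z - y) * norm (piece f l y))"
        by (rule Bochner_Integration.integrable_bound[OF piece_integrable[OF f, of l]])
          (use rad_pos[of l] in \<open>auto simp: abs_mult decay_nonneg decay_le_1 mult_left_le_one_le\<close>)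
      then show "integrable lborel (\<lambda>y. B * W l * rad l ^ CARD('n) * (decay (rad l) N (z - y) * norm (piece f l y)))"
        by (rule integrable_mult_right)
      show "norm (piece f l y * (\<integral>\<xi>. iexp ((z - y) \<bullet> \<xi>) * \<tau> l (z, \<xi>) \<partial>lborel))
          \<le> B * W l * rad l ^ CARD('n) * (decay (rad l) N (z - y) * norm (piece f l y))" for y
        using mult_left_mono[OF B(2)[where u="z - y" and l=l and z=z], of "norm (piece f l y)"]
        by (simp add: norm_mult mult_ac)
      show "0 \<le> B * W l * rad l ^ CARD('n) * (decay (rad l) N (z - y) * norm (piece f l y))" for y
        using B(1) W[of l] rad_pos[of l] by (intro mult_nonneg_nonneg) (auto simp: decay_nonneg less_imp_le)
    qed
    also have "\<dots> = B * W l * rad l ^ CARD('n) * (\<integral>y. decay (rad l) N (z - y) * norm (piece f l y) \<partial>lborel)"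
      by (rule integral_mult_right_zero)
    finally show "norm (osc \<tau> f l z) \<le> B * W l * rad l ^ CARD('n) * (\<integral>y. decay (rad l) N (z - y) * norm (piece f l y) \<partial>lborel)" .
  qed
qed

end

section \<open>The maximal function of a piece\<close>

context alpha_cover
begin

text \<open>The number s bounds Peetre's maximal function, the supremum over y of
  \<open>norm (piece f l y) / (1 + rad l * norm (x - y)) ^ A\<close>. Stating this as a relation
  avoids carrying finiteness of the supremum through all estimates.\<close>

definition controls :: "(real ^ 'n \<Rightarrow> complex) \<Rightarrow> int ^ 'n \<Rightarrow> nat \<Rightarrow> real ^ 'n \<Rightarrow> real \<Rightarrow> bool"
  where "controls f l A x s \<longleftrightarrow> 0 \<le> s \<and> (\<forall>y. norm (piece f l y) * decay (rad l) A (x - y) \<le> s)"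

lemma decay_piece_integrable:
  assumes "schwartz f" shows "integrable lborel (\<lambda>y. decay (rad l) N (z - y) * norm (piece f l y))"
proof (rule Bochner_Integration.integrable_bound[OF piece_integrable[OF assms, of l]])
  note [measurable] = piece_measurable[OF assms]
  show "(\<lambda>y. decay (rad l) N (z - y) * norm (piece f l y)) \<in> borel_measurable lborel" by measurable
  show "AE y in lborel. norm (decay (rad l) N (z - y) * norm (piece f l y)) \<le> norm (piece f l y)"
    using rad_pos[of l] by (intro AE_I2) (simp add: abs_mult decay_nonneg decay_le_1 mult_left_le_one_le)
qed

text \<open>The kernel is used with decay \<open>A + 2 * CARD('n)\<close>: the part A moves the
  centre from z to x by \<open>decay_triangle\<close>, and the rest is integrated.\<close>

lemma osc_controlled:
  assumes \<tau>: "admissible i W \<tau>" and W: "\<And>l. 0 < W l"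
  obtains B where "0 \<le> B" "\<And>f l z x s. schwartz f \<Longrightarrow> controls f l A x s \<Longrightarrow>
    norm (osc \<tau> f l z) * decay (rad l) A (x - z) \<le> B * W l * s"
proof -
  let ?n = "CARD('n)"
  obtain B where B: "0 \<le> B" "\<And>f l z. schwartz f \<Longrightarrow> norm (osc \<tau> f l z)
    \<le> B * W l * rad l ^ ?n * (\<integral>y. decay (rad l) (A + 2 * ?n) (z - y) * norm (piece f l y) \<partial>lborel)"
    by (rule osc_bound[OF \<tau> W, of "A + 2 * ?n"]) blast
  show thesis
  proof (rule that[of "B * decay_mass TYPE(real ^ 'n)"])
    show "0 \<le> B * decay_mass TYPE(real ^ 'n)" using B(1) by (simp add: decay_mass_nonneg)
    fix f l and x z :: "real ^ 'n" and s assume f: "schwartz f" and s: "controls f l A x s"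
    let ?R = "rad l"
    have R: "0 \<le> ?R" using rad_pos[of l] by simp
    have le: "decay ?R A (x - z) * (decay ?R (A + 2 * ?n) (z - y) * norm (piece f l y)) \<le> s * decay ?R (2 * ?n) (z - y)" for y
    proof -
      have "decay ?R A (x - z) * (decay ?R (A + 2 * ?n) (z - y) * norm (piece f l y))
          = (decay ?R A (x - z) * decay ?R A (z - y)) * norm (piece f l y) * decay ?R (2 * ?n) (z - y)"
        by (simp add: decay_add mult_ac)
      also have "\<dots> \<le> decay ?R A (x - y) * norm (piece f l y) * decay ?R (2 * ?n) (z - y)"
        using R by (intro mult_right_mono decay_triangle) (auto simp: decay_nonneg)
      also have "\<dots> \<le> s * decay ?R (2 * ?n) (z - y)"
        using s R by (intro mult_right_mono) (auto simp: controls_def mult.commute decay_nonneg)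
      finally show ?thesis .
    qed
    have "decay ?R A (x - z) * (\<integral>y. decay ?R (A + 2 * ?n) (z - y) * norm (piece f l y) \<partial>lborel)
        = (\<integral>y. decay ?R A (x - z) * (decay ?R (A + 2 * ?n) (z - y) * norm (piece f l y)) \<partial>lborel)"
      by (rule integral_mult_right_zero[symmetric])
    also have "\<dots> \<le> (\<integral>y. s * decay ?R (2 * ?n) (z - y) \<partial>lborel)"
      by (intro integral_mono le integrable_mult_right decay_piece_integrable f integrable_decay(1))
        (auto simp: rad_pos)
    also have "\<dots> = s * (\<integral>y. decay ?R (2 * ?n) (z - y) \<partial>lborel)" by (rule integral_mult_right_zero)
    finally have "B * W l * ?R ^ ?n * (decay ?R A (x - z) * (\<integral>y. decay ?R (A + 2 * ?n) (z - y) * norm (piece f l y) \<partial>lborel))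
        \<le> B * W l * ?R ^ ?n * (s * (\<integral>y. decay ?R (2 * ?n) (z - y) \<partial>lborel))"
      using B(1) W[of l] R by (intro mult_left_mono) auto
    also have "\<dots> = B * W l * s * (?R ^ ?n * (\<integral>y. decay ?R (2 * ?n) (z - y) \<partial>lborel))" by (simp add: mult_ac)
    also have "\<dots> \<le> B * W l * s * decay_mass TYPE(real ^ 'n)"
      using B(1) W[of l] s integrable_decay(2)[OF rad_pos[of l], of "2 * ?n" z]
      by (intro mult_left_mono) (auto simp: controls_def less_imp_le)
    finally have 1: "B * W l * ?R ^ ?n * (decay ?R A (x - z) * (\<integral>y. decay ?R (A + 2 * ?n) (z - y) * norm (piece f l y) \<partial>lborel))
        \<le> B * W l * s * decay_mass TYPE(real ^ 'n)" .
    have "norm (osc \<tau> f l z) * decay ?R A (x - z)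
        \<le> B * W l * ?R ^ ?n * (\<integral>y. decay ?R (A + 2 * ?n) (z - y) * norm (piece f l y) \<partial>lborel) * decay ?R A (x - z)"
      using R by (intro mult_right_mono B(2) f) (auto simp: decay_nonneg)
    also have "\<dots> \<le> B * W l * s * decay_mass TYPE(real ^ 'n)"
      using 1 by (simp add: mult_ac)
    finally show "norm (osc \<tau> f l z) * decay ?R A (x - z) \<le> B * decay_mass TYPE(real ^ 'n) * W l * s"
      by (simp add: mult_ac)
  qed
qed

text \<open>Applying the operator with symbol \<open>fat l\<close> does not change the piece, since
  the cutoff is 1 where \<open>\<eta> l\<close> lives. The kernel bound for \<open>osc\<close> then
  estimates the piece by an average of itself; the factor \<open>1 / (2 * pi) ^ CARD('n)\<close> is
  at most 1 and is discarded.\<close>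

lemma piece_reproducing:
  obtains B where "0 \<le> B" "\<And>f l y. schwartz f \<Longrightarrow> norm (piece f l y)
    \<le> B * rad l ^ CARD('n) * (\<integral>z. decay (rad l) N (y - z) * norm (piece f l z) \<partial>lborel)"
proof -
  let ?\<tau> = "\<lambda>l p::(real ^ 'n) \<times> (real ^ 'n). fat l (snd p)"
  have pos: "\<And>l::int ^ 'n. 0 < (1::real)" by simp
  obtain B where B: "0 \<le> B" "\<And>f l z. schwartz f \<Longrightarrow> norm (osc ?\<tau> f l z)
    \<le> B * 1 * rad l ^ CARD('n) * (\<integral>y. decay (rad l) N (z - y) * norm (piece f l y) \<partial>lborel)"
    by (rule osc_bound[OF admissible_fat[of undefined] pos, of N]) blast
  show thesis
  proof (rule that[OF B(1)])
    fix f :: "real ^ 'n \<Rightarrow> complex" and l y assume f: "schwartz f"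
    have "iexp (y \<bullet> \<xi>) * fat l \<xi> * (\<eta> l \<xi> * fourier f \<xi>) = iexp (y \<bullet> \<xi>) * (\<eta> l \<xi> * fourier f \<xi>)" for \<xi>
    proof -
      have "iexp (y \<bullet> \<xi>) * fat l \<xi> * (\<eta> l \<xi> * fourier f \<xi>) = iexp (y \<bullet> \<xi>) * ((fat l \<xi> * \<eta> l \<xi>) * fourier f \<xi>)"
        by (simp only: mult_ac)
      then show ?thesis unfolding fat_eta .
    qed
    then have eq: "osc ?\<tau> f l y = (\<integral>\<xi>. iexp (y \<bullet> \<xi>) * (\<eta> l \<xi> * fourier f \<xi>) \<partial>lborel)"
      by (simp only: osc_def snd_conv)
    have "1 \<le> (2 * pi) ^ CARD('n)" using pi_ge_two by (intro one_le_power) simp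
    then have "1 / (2 * pi) ^ CARD('n) * norm (osc ?\<tau> f l y) \<le> 1 * norm (osc ?\<tau> f l y)"
      by (intro mult_right_mono) (auto simp: divide_le_eq_1)
    then have "norm (piece f l y) \<le> norm (osc ?\<tau> f l y)"
      unfolding piece_eq_inv_fourier[OF f] norm_inv_fourier eq[symmetric] mult_1 .
    then show "norm (piece f l y) \<le> B * rad l ^ CARD('n) * (\<integral>z. decay (rad l) N (y - z) * norm (piece f l z) \<partial>lborel)"
      using B(2)[OF f, of l y] by simp
  qed
qed

text \<open>Peetre's inequality: the smallest controlling constant \<open>s\<close> reappears with a power smaller than
  one on the right-hand side of the reproducing formula, and is cancelled.\<close>

lemma peetre:
  assumes r: "0 < r" "r \<le> 1" and A: "2 * real CARD('n) \<le> real A * r"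
  obtains B where "0 \<le> B" "\<And>f l x. schwartz f \<Longrightarrow> \<exists>s. controls f l A x s \<and>
    s powr r \<le> B * (rad l ^ CARD('n) * (\<integral>z. norm (piece f l z) powr r * decay (rad l) (2 * CARD('n)) (x - z) \<partial>lborel))"
proof -
  let ?n = "CARD('n)"
  obtain B where B: "0 \<le> B" "\<And>f l y. schwartz f \<Longrightarrow> norm (piece f l y)
    \<le> B * rad l ^ ?n * (\<integral>z. decay (rad l) A (y - z) * norm (piece f l z) \<partial>lborel)"
    by (rule piece_reproducing[of A]) blast
  show thesis
  proof (rule that[OF B(1)])
    fix f :: "real ^ 'n \<Rightarrow> complex" and l x assume f: "schwartz f"
    note [measurable] = piece_measurable[OF f]
    let ?R = "rad l"
    have R: "0 \<le> ?R" using rad_pos[of l] by simp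
    define g where "g y = norm (piece f l y) * decay ?R A (x - y)" for y
    define Q where "Q = ?R ^ ?n * (\<integral>z. norm (piece f l z) powr r * decay ?R (2 * ?n) (x - z) \<partial>lborel)"
    obtain M where M: "0 \<le> M" "\<And>y. norm (piece f l y) \<le> M" using piece_bounded[OF f, of l] by blast
    have g0: "0 \<le> g y" for y using R by (simp add: g_def decay_nonneg)
    have gM: "g y \<le> M" for y
      unfolding g_def using mult_mono[OF M(2)[of y] decay_le_1[OF R, of A "x - y"] M(1)] R
      by (simp add: decay_nonneg)
    \<comment> \<open>Only finiteness of the supremum matters here; without it G could not be
      cancelled at the end.\<close>
    have bdd: "bdd_above (range g)" using gM by (auto intro: bdd_aboveI2[where M=M])
    define G where "G = (SUP y. g y)"
    have gG: "g y \<le> G" for y unfolding G_def by (rule cSUP_upper[OF UNIV_I bdd])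
    have G0: "0 \<le> G" using g0[of 0] gG[of 0] by linarith
    have gi: "integrable lborel g"
      using decay_piece_integrable[OF f, of l A x] by (simp add: g_def[abs_def] mult.commute)
    have Qi: "integrable lborel (\<lambda>z. norm (piece f l z) powr r * decay ?R (2 * ?n) (x - z))"
    proof (rule Bochner_Integration.integrable_bound[OF integrable_mult_right[OF integrable_decay(1)[OF rad_pos[of l], of "2 * ?n" x], of "M powr r"]])
      show "(\<lambda>z. norm (piece f l z) powr r * decay ?R (2 * ?n) (x - z)) \<in> borel_measurable lborel" by measurable
      show "AE z in lborel. norm (norm (piece f l z) powr r * decay ?R (2 * ?n) (x - z)) \<le> norm (M powr r * decay ?R (2 * ?n) (x - z))"
        using M R r by (intro AE_I2) (auto simp: abs_mult decay_nonneg intro!: mult_right_mono powr_mono2)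
    qed simp
    have Q0: "0 \<le> Q" unfolding Q_def using R by (intro mult_nonneg_nonneg Bochner_Integration.integral_nonneg) (auto simp: decay_nonneg)
    \<comment> \<open>Split g into the powers \<open>1 - r\<close> and r and bound the first by the
      supremum. The hypothesis on A makes the r-th power of the weight decay at the integrable order
      \<open>2 * CARD('n)\<close>.\<close>
    have gz: "g z \<le> G powr (1 - r) * (norm (piece f l z) powr r * decay ?R (2 * ?n) (x - z))" for z
    proof -
      have w: "1 \<le> 1 + ?R * norm (x - z)" using R by simp
      have "decay ?R A (x - z) powr r = 1 / (1 + ?R * norm (x - z)) powr (real A * r)"
        unfolding decay_def using w
        by (subst powr_divide) (auto simp: powr_powr powr_realpow[symmetric] simp del: powr_realpow)
      also have "\<dots> \<le> 1 / (1 + ?R * norm (x - z)) powr (real (2 * ?n))"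
        using w A by (intro divide_left_mono powr_mono) auto
      also have "\<dots> = decay ?R (2 * ?n) (x - z)"
        unfolding decay_def using w by (subst powr_realpow; simp)
      finally have d: "decay ?R A (x - z) powr r \<le> decay ?R (2 * ?n) (x - z)" .
      have "g z = g z powr (1 - r) * g z powr r" using g0[of z] by (simp add: powr_add[symmetric])
      also have "\<dots> \<le> G powr (1 - r) * g z powr r"
        using r g0 gG by (intro mult_right_mono powr_mono2) auto
      also have "g z powr r = norm (piece f l z) powr r * decay ?R A (x - z) powr r"
        unfolding g_def by (rule powr_mult)
      also have "G powr (1 - r) * \<dots> \<le> G powr (1 - r) * (norm (piece f l z) powr r * decay ?R (2 * ?n) (x - z))"
        by (intro mult_left_mono d) auto
      finally show ?thesis .
    qed
    have gB: "g y \<le> B * (G powr (1 - r) * Q)" for y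
    proof -
      have "g y \<le> (B * ?R ^ ?n * (\<integral>z. decay ?R A (y - z) * norm (piece f l z) \<partial>lborel)) * decay ?R A (x - y)"
        unfolding g_def using R by (intro mult_right_mono B(2) f) (auto simp: decay_nonneg)
      also have "\<dots> = B * ?R ^ ?n * (decay ?R A (x - y) * (\<integral>z. decay ?R A (y - z) * norm (piece f l z) \<partial>lborel))"
        by (simp add: mult_ac)
      also have "decay ?R A (x - y) * (\<integral>z. decay ?R A (y - z) * norm (piece f l z) \<partial>lborel)
          = (\<integral>z. decay ?R A (x - y) * (decay ?R A (y - z) * norm (piece f l z)) \<partial>lborel)"
        by (rule integral_mult_right_zero[symmetric])
      also have "B * ?R ^ ?n * \<dots> \<le> B * ?R ^ ?n * (\<integral>z. g z \<partial>lborel)"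
      proof (intro mult_left_mono integral_mono integrable_mult_right decay_piece_integrable f gi)
        show "decay ?R A (x - y) * (decay ?R A (y - z) * norm (piece f l z)) \<le> g z" for z
          unfolding g_def using mult_right_mono[OF decay_triangle[OF R, of A x y z], of "norm (piece f l z)"]
          by (simp add: mult_ac)
      qed (use B(1) R in auto)
      also have "\<dots> \<le> B * ?R ^ ?n * (\<integral>z. G powr (1 - r) * (norm (piece f l z) powr r * decay ?R (2 * ?n) (x - z)) \<partial>lborel)"
        using B(1) R by (intro mult_left_mono integral_mono gi integrable_mult_right Qi gz) auto
      also have "(\<integral>z. G powr (1 - r) * (norm (piece f l z) powr r * decay ?R (2 * ?n) (x - z)) \<partial>lborel)
          = G powr (1 - r) * (\<integral>z. norm (piece f l z) powr r * decay ?R (2 * ?n) (x - z) \<partial>lborel)"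
        by (rule integral_mult_right_zero)
      finally show ?thesis
        by (simp add: Q_def mult_ac)
    qed
    have "G powr r \<le> B * Q"
    \<comment> \<open>Cancelling \<open>G powr (1 - r)\<close> requires a nonzero supremum.\<close>
    proof (cases "G = 0")
      case True
      then show ?thesis using B(1) Q0 by simp
    next
      case False
      then have Gp: "0 < G" using G0 by simp
      have "G \<le> B * (G powr (1 - r) * Q)"
        unfolding G_def by (rule cSUP_least) (use gB in \<open>auto simp: G_def\<close>)
      moreover have "G = G powr (1 - r) * G powr r" using Gp by (simp add: powr_add[symmetric])
      ultimately have "G powr (1 - r) * G powr r \<le> G powr (1 - r) * (B * Q)" by (simp add: mult_ac)
      then show ?thesis using Gp by simp
    qed
    moreover have "controls f l A x G"
      using gG G0 by (simp add: controls_def g_def)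
    ultimately show "\<exists>s. controls f l A x s \<and>
      s powr r \<le> B * (?R ^ ?n * (\<integral>z. norm (piece f l z) powr r * decay ?R (2 * ?n) (x - z) \<partial>lborel))"
      unfolding Q_def by blast
  qed
qed

section \<open>Off-diagonal decay\<close>

text \<open>For \<open>m = 0\<close> and the cut-off symbol this is, up to normalization, the term
  (k, l) of the operator. Higher moments and twisted symbols appear through integration by
  parts.\<close>

definition conv :: "'n \<Rightarrow> nat \<Rightarrow> (int ^ 'n \<Rightarrow> (real ^ 'n) \<times> (real ^ 'n) \<Rightarrow> complex) \<Rightarrow> int ^ 'n \<Rightarrow> int ^ 'n \<Rightarrow> (real ^ 'n \<Rightarrow> complex) \<Rightarrow> real ^ 'n \<Rightarrow> complex"
  where "conv i m \<tau> k l f x = (\<integral>z. moment_kernel i m k (x - z) * osc \<tau> f l z \<partial>lborel)"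

text \<open>Changing the scale of the weight from \<open>rad k\<close> to \<open>rad l\<close> costs
  \<open>gap k l ^ ord\<close> per power, whichever radius is larger.\<close>

lemma decay_rad_le: "decay (rad k) A w \<le> gap k l ^ (ord * A) * decay (rad l) A w"
proof -
  have g: "1 \<le> gap k l ^ ord" using gap_ge_1 by (rule one_le_power)
  have "1 + rad l * norm w \<le> gap k l ^ ord * 1 + (rad k * gap k l ^ ord) * norm w"
    using rad_le[of l k] g by (intro add_mono mult_right_mono) (auto simp: gap_commute)
  also have "\<dots> = gap k l ^ ord * (1 + rad k * norm w)" by (simp add: algebra_simps)
  finally have "(1 + rad l * norm w) ^ A \<le> (gap k l ^ ord * (1 + rad k * norm w)) ^ A"
    using rad_pos[of l] by (intro power_mono) auto
  then have "(1 + rad l * norm w) ^ A \<le> gap k l ^ (ord * A) * (1 + rad k * norm w) ^ A"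
    by (simp add: power_mult_distrib power_mult)
  moreover have "0 < 1 + rad l * norm w" "0 < 1 + rad k * norm w"
    using rad_pos by (auto intro: add_pos_nonneg simp: less_imp_le)
  ultimately show ?thesis by (simp add: decay_def field_simps)
qed

text \<open>The estimate before any gain from oscillation. The kernel decays at scale
  \<open>1 / rad k\<close>, while the maximal function lives at scale \<open>1 / rad l\<close>;
  reconciling the two is what produces the power of the gap.\<close>

lemma conv_bound:
  assumes \<tau>: "admissible i W \<tau>" and W: "\<And>l. 0 < W l"
  obtains B where "0 \<le> B" "\<And>f k l x s. schwartz f \<Longrightarrow> controls f l A x s \<Longrightarrow>
    norm (conv i m \<tau> k l f x) \<le> B * W l * s * rad k ^ m * gap k l ^ (ord * A)"
proof -
  let ?n = "CARD('n)"
  obtain B where B: "0 \<le> B" "\<And>f l z x s. schwartz f \<Longrightarrow> controls f l A x s \<Longrightarrow>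
    norm (osc \<tau> f l z) * decay (rad l) A (x - z) \<le> B * W l * s"
    by (rule osc_controlled[OF \<tau> W, of A]) blast
  obtain D where D: "0 \<le> D" "\<And>k u. norm (moment_kernel i m k u) \<le> D * (rad k ^ m * rad k ^ ?n) * decay (rad k) (A + 2 * ?n) u"
    by (rule moment_kernel_decay[of i m "A + 2 * ?n"]) blast
  show thesis
  proof (rule that[of "D * B * decay_mass TYPE(real ^ 'n)"])
    show "0 \<le> D * B * decay_mass TYPE(real ^ 'n)" using B(1) D(1) by (simp add: decay_mass_nonneg)
    fix f k l and x :: "real ^ 'n" and s assume f: "schwartz f" and s: "controls f l A x s"
    let ?K = "D * (rad k ^ m * rad k ^ ?n) * gap k l ^ (ord * A) * (B * W l * s)"
    have s0: "0 \<le> s" using s by (simp add: controls_def)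
    have K0: "0 \<le> ?K" using D(1) B(1) W[of l] s0 rad_pos[of k] gap_pos[of k l]
      by (intro mult_nonneg_nonneg) (auto simp: less_imp_le)
    have id: "integrable lborel (\<lambda>z. ?K * decay (rad k) (2 * ?n) (x - z))"
      by (intro integrable_mult_right integrable_decay(1)) (auto simp: rad_pos)
    have "norm (conv i m \<tau> k l f x) \<le> (\<integral>z. norm (moment_kernel i m k (x - z) * osc \<tau> f l z) \<partial>lborel)"
      unfolding conv_def by (rule integral_norm_bound)
    also have "\<dots> \<le> (\<integral>z. ?K * decay (rad k) (2 * ?n) (x - z) \<partial>lborel)"
    proof (rule integral_mono'[OF id])
      fix z
      let ?d = "decay (rad k) (2 * ?n) (x - z)"
      have d0: "0 \<le> ?d" using rad_pos[of k] by (simp add: decay_nonneg)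
      show "0 \<le> ?K * ?d" using K0 d0 by simp
      have "norm (moment_kernel i m k (x - z) * osc \<tau> f l z)
          \<le> (D * (rad k ^ m * rad k ^ ?n) * decay (rad k) (A + 2 * ?n) (x - z)) * norm (osc \<tau> f l z)"
        unfolding norm_mult by (intro mult_right_mono D) auto
      also have "\<dots> = D * (rad k ^ m * rad k ^ ?n) * ?d * norm (osc \<tau> f l z) * decay (rad k) A (x - z)"
        by (simp add: decay_add mult_ac)
      also have "\<dots> \<le> D * (rad k ^ m * rad k ^ ?n) * ?d * norm (osc \<tau> f l z) * (gap k l ^ (ord * A) * decay (rad l) A (x - z))"
        using D(1) rad_pos[of k] d0 by (intro mult_left_mono decay_rad_le mult_nonneg_nonneg) (auto simp: less_imp_le)
      also have "\<dots> = (D * (rad k ^ m * rad k ^ ?n) * ?d * gap k l ^ (ord * A)) * (norm (osc \<tau> f l z) * decay (rad l) A (x - z))"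
        by (simp add: mult_ac)
      also have "\<dots> \<le> (D * (rad k ^ m * rad k ^ ?n) * ?d * gap k l ^ (ord * A)) * (B * W l * s)"
        using D(1) rad_pos[of k] d0 gap_pos[of k l]
        by (intro mult_left_mono B(2) f s mult_nonneg_nonneg) (auto simp: less_imp_le)
      finally show "norm (moment_kernel i m k (x - z) * osc \<tau> f l z) \<le> ?K * ?d" by (simp add: mult_ac)
    qed
    also have "\<dots> = ?K * (\<integral>z. decay (rad k) (2 * ?n) (x - z) \<partial>lborel)" by (rule integral_mult_right_zero)
    also have "\<dots> = (D * rad k ^ m * gap k l ^ (ord * A) * (B * W l * s)) * (rad k ^ ?n * (\<integral>z. decay (rad k) (2 * ?n) (x - z) \<partial>lborel))"
      by (simp add: mult_ac)
    also have "\<dots> \<le> (D * rad k ^ m * gap k l ^ (ord * A) * (B * W l * s)) * decay_mass TYPE(real ^ 'n)"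
      using integrable_decay(2)[OF rad_pos[of k], of "2 * ?n" x] D(1) B(1) W[of l] s0 rad_pos[of k] gap_pos[of k l]
      by (intro mult_left_mono mult_nonneg_nonneg) (auto simp: less_imp_le)
    finally show "norm (conv i m \<tau> k l f x) \<le> D * B * decay_mass TYPE(real ^ 'n) * W l * s * rad k ^ m * gap k l ^ (ord * A)"
      by (simp add: mult_ac)
  qed
qed

section \<open>Integration by parts in one coordinate\<close>

lemma admissible_measurable:
  assumes "admissible i W \<tau>" shows "\<tau> l \<in> borel_measurable (lborel \<Otimes>\<^sub>M lborel)"
  using smooth_function_measurable[OF admissible_smooth[OF assms]] by (simp add: lborel_prod)

text \<open>With the frequency integral moved outside, the inner integral over z can be integrated
  by parts for each fixed \<open>\<xi>\<close>, where all factors are explicit and smooth.\<close>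

definition inner_conv :: "'n \<Rightarrow> nat \<Rightarrow> (int ^ 'n \<Rightarrow> (real ^ 'n) \<times> (real ^ 'n) \<Rightarrow> complex) \<Rightarrow> int ^ 'n \<Rightarrow> int ^ 'n \<Rightarrow> real ^ 'n \<Rightarrow> real ^ 'n \<Rightarrow> complex"
  where "inner_conv i m \<tau> k l x \<xi> = (\<integral>z. moment_kernel i m k (x - z) * (iexp (z \<bullet> \<xi>) * \<tau> l (z, \<xi>)) \<partial>lborel)"

lemma
  assumes f: "schwartz f" and \<tau>: "admissible i W \<tau>" and W: "\<And>l. 0 < W l"
  shows conv_eq: "conv i m \<tau> k l f x = (\<integral>\<xi>. (\<eta> l \<xi> * fourier f \<xi>) * inner_conv i m \<tau> k l x \<xi> \<partial>lborel)"
    and inner_conv_integrable: "integrable lborel (\<lambda>\<xi>. (\<eta> l \<xi> * fourier f \<xi>) * inner_conv i m \<tau> k l x \<xi>)"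
proof -
  let ?q = "\<lambda>\<xi>. \<eta> l \<xi> * fourier f \<xi>"
  let ?F = "\<lambda>z \<xi>. ?q \<xi> * (moment_kernel i m k (x - z) * (iexp (z \<bullet> \<xi>) * \<tau> l (z, \<xi>)))"
  note [measurable] = fourier_measurable[OF f] admissible_measurable[OF \<tau>]
  obtain B where B: "0 \<le> B" "\<And>l p. norm (\<tau> l p) \<le> B * W l" by (rule admissible_bounded[OF \<tau> W]) blast
  have m: "(\<lambda>(z, \<xi>). ?F z \<xi>) \<in> borel_measurable (lborel \<Otimes>\<^sub>M lborel)" by measurable
  have gi: "integrable lborel (\<lambda>z. norm (moment_kernel i m k (x - z)))"
    using lborel_integral_translate(3)[of "moment_kernel i m k" x] moment_kernel_integrable by (intro integrable_norm) simp
  have km: "(\<lambda>\<xi>. B * W l * norm (?q \<xi>)) \<in> borel_measurable borel" by measurable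
  have k0: "0 \<le> B * W l * norm (?q \<xi>)" for \<xi> using B(1) W[of l] by simp
  have ki: "integrable lborel (\<lambda>\<xi>. B * W l * norm (?q \<xi>))"
    by (intro integrable_mult_right integrable_norm eta_fourier_integrable f)
  have c: "(\<integral>\<^sup>+\<xi>. ennreal (B * W l * norm (?q \<xi>)) \<partial>lborel) \<le> ennreal (\<integral>\<xi>. B * W l * norm (?q \<xi>) \<partial>lborel)"
    by (subst nn_integral_eq_integral[OF ki]) (use k0 in auto)
  have bd: "norm (?F z \<xi>) \<le> norm (moment_kernel i m k (x - z)) * (B * W l * norm (?q \<xi>))" for z \<xi>
    using mult_left_mono[OF B(2)[of l "(z, \<xi>)"], of "norm (moment_kernel i m k (x - z)) * norm (?q \<xi>)"]
    by (simp add: norm_mult mult_ac)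
  have sw: "integrable (lborel \<Otimes>\<^sub>M lborel) (\<lambda>(z, \<xi>). ?F z \<xi>)"
    "(\<integral>z. \<integral>\<xi>. ?F z \<xi> \<partial>lborel \<partial>lborel) = (\<integral>\<xi>. \<integral>z. ?F z \<xi> \<partial>lborel \<partial>lborel)"
    by (rule lborel_swap[OF m gi km norm_ge_zero k0 c bd])+
  have "conv i m \<tau> k l f x = (\<integral>z. \<integral>\<xi>. moment_kernel i m k (x - z) * (iexp (z \<bullet> \<xi>) * \<tau> l (z, \<xi>) * ?q \<xi>) \<partial>lborel \<partial>lborel)"
    unfolding conv_def osc_def by (simp only: integral_mult_right_zero)
  also have "\<dots> = (\<integral>z. \<integral>\<xi>. ?F z \<xi> \<partial>lborel \<partial>lborel)"
    by (simp only: mult_ac)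
  also have "\<dots> = (\<integral>\<xi>. \<integral>z. ?F z \<xi> \<partial>lborel \<partial>lborel)" by (rule sw(2))
  also have "\<dots> = (\<integral>\<xi>. ?q \<xi> * inner_conv i m \<tau> k l x \<xi> \<partial>lborel)"
    unfolding inner_conv_def by (simp only: integral_mult_right_zero)
  finally show "conv i m \<tau> k l f x = (\<integral>\<xi>. ?q \<xi> * inner_conv i m \<tau> k l x \<xi> \<partial>lborel)" .
  have "integrable lborel (\<lambda>\<xi>. \<integral>z. ?F z \<xi> \<partial>lborel)"
    by (rule lborel_pair.integrable_snd[OF sw(1)])
  then show "integrable lborel (\<lambda>\<xi>. ?q \<xi> * inner_conv i m \<tau> k l x \<xi>)"
    unfolding inner_conv_def by (simp only: integral_mult_right_zero)
qed

text \<open>Integration by parts in \<open>z\<^sub>i\<close>: the oscillation of kernel and symbol differs by the frequency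
  \<open>ctr k - ctr l\<close> up to terms of the same form, one of higher moment and one with twisted symbol.\<close>

lemma inner_conv_recursion:
  assumes \<tau>: "admissible i W \<tau>" and W: "\<And>l. 0 < W l"
  shows "\<i> * complex_of_real (ctr k $ i - ctr l $ i) * inner_conv i m \<tau> k l x \<xi>
    = - \<i> * inner_conv i (Suc m) \<tau> k l x \<xi> + inner_conv i m (twist i \<tau>) k l x \<xi>"
proof -
  let ?v = "axis i 1 :: real ^ 'n"
  let ?E = "\<lambda>m z. moment_kernel i m k (x - z)"
  let ?H = "\<lambda>\<tau> z. iexp (z \<bullet> \<xi>) * \<tau> l (z, \<xi>)"
  let ?a = "\<i> * complex_of_real (ctr k $ i)" and ?b = "\<i> * complex_of_real (ctr l $ i)"
  have \<tau>': "admissible i (\<lambda>l. W l * rad l) (twist i \<tau>)" by (rule admissible_twist[OF \<tau> W])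
  have W': "0 < W l * rad l" for l using W rad_pos by simp
  have int: "integrable lborel (\<lambda>z. ?E m z * ?H \<tau> z)" if adm: "admissible i W \<tau>" and W: "\<And>l. 0 < W l" for m \<tau> W
  proof -
    obtain B where B: "0 \<le> B" "\<And>l p. norm (\<tau> l p) \<le> B * W l" by (rule admissible_bounded[OF adm W]) blast
    have [measurable]: "(\<lambda>z. \<tau> l (z, \<xi>)) \<in> borel_measurable borel"
      by (intro smooth_function_measurable smooth_function_section admissible_smooth[OF adm])
    have E: "integrable lborel (?E m)"
      using lborel_integral_translate(3)[of "moment_kernel i m k" x] moment_kernel_integrable by simp
    show ?thesis
    proof (rule Bochner_Integration.integrable_bound[OF integrable_mult_right[OF integrable_norm[OF E], of "B * W l"]])
      show "(\<lambda>z. ?E m z * ?H \<tau> z) \<in> borel_measurable lborel" by measurable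
      show "AE z in lborel. norm (?E m z * ?H \<tau> z) \<le> norm (B * W l * norm (?E m z))"
      proof (intro AE_I2)
        fix z
        have "norm (?E m z * ?H \<tau> z) \<le> norm (?E m z) * (B * W l)"
          using mult_left_mono[OF B(2)[of l "(z, \<xi>)"], of "norm (?E m z)"] by (simp add: norm_mult)
        then show "norm (?E m z * ?H \<tau> z) \<le> norm (B * W l * norm (?E m z))"
          using B(1) W[of l] by (simp add: mult.commute)
      qed
    qed
  qed
  note I1 = int[OF \<tau> W, of "Suc m"] and I2 = int[OF \<tau> W, of m] and I3 = int[OF \<tau>' W', of m]
  \<comment> \<open>The derivative of the integrand in three groups: the raised moment, the
    difference of the central frequencies times the integrand itself, and the twisted symbol. The
    middle group is the one the recursion solves for.\<close>
  let ?F' = "\<lambda>z. (- \<i>) * (?E (Suc m) z * ?H \<tau> z) + (?b - ?a) * (?E m z * ?H \<tau> z) + ?E m z * ?H (twist i \<tau>) z"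
  have "(\<integral>z. ?F' z \<partial>lborel) = 0"
  proof (rule integral_directional_derivative_eq_0[where v="?v" and F="\<lambda>z. ?E m z * ?H \<tau> z"])
    fix z s
    let ?y = "z + s *\<^sub>R ?v"
    have dE: "((\<lambda>t. ?E m (z + t *\<^sub>R ?v)) has_vector_derivative - (\<i> * ?E (Suc m) ?y + ?a * ?E m ?y)) (at s)"
      by (rule moment_kernel_derivative)
    have "((\<lambda>t. iexp (\<xi> \<bullet> (z + t *\<^sub>R ?v))) has_vector_derivative \<i> * complex_of_real (\<xi> \<bullet> ?v) * iexp (\<xi> \<bullet> ?y)) (at s)"
      by (rule iexp_has_vector_derivative)
    then have de: "((\<lambda>t. iexp ((z + t *\<^sub>R ?v) \<bullet> \<xi>)) has_vector_derivative \<i> * complex_of_real (\<xi> $ i) * iexp (?y \<bullet> \<xi>)) (at s)"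
      by (simp add: inner_commute inner_axis)
    have "((\<lambda>t. (\<lambda>z. \<tau> l (z, \<xi>)) (z + t *\<^sub>R ?v)) has_vector_derivative partial_deriv ?v (\<lambda>z. \<tau> l (z, \<xi>)) ?y) (at s)"
      by (intro has_vector_derivative_partial_deriv smooth_function_imp_differentiable smooth_function_section admissible_smooth[OF \<tau>])
    then have dt: "((\<lambda>t. \<tau> l (z + t *\<^sub>R ?v, \<xi>)) has_vector_derivative partial_deriv (?v, 0) (\<tau> l) (?y, \<xi>)) (at s)"
      by (simp only: partial_deriv_section)
    have tw: "twist i \<tau> l (?y, \<xi>) = partial_deriv (?v, 0) (\<tau> l) (?y, \<xi>) + (\<i> * complex_of_real (\<xi> $ i) - ?b) * \<tau> l (?y, \<xi>)"
      by (simp add: twist_def cdist_def)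
    have ring: "E * (e * dt + (c * e) * t) + - (\<i> * E' + a * E) * (e * t)
        = (- \<i>) * (E' * (e * t)) + (b - a) * (E * (e * t)) + E * (e * (dt + (c - b) * t))" for E E' e t dt a b c :: complex
      by (simp add: algebra_simps)
    have "((\<lambda>t. ?E m (z + t *\<^sub>R ?v) * ?H \<tau> (z + t *\<^sub>R ?v)) has_vector_derivative
        ?E m ?y * (iexp (?y \<bullet> \<xi>) * partial_deriv (?v, 0) (\<tau> l) (?y, \<xi>) + (\<i> * complex_of_real (\<xi> $ i) * iexp (?y \<bullet> \<xi>)) * \<tau> l (?y, \<xi>))
        + - (\<i> * ?E (Suc m) ?y + ?a * ?E m ?y) * ?H \<tau> ?y) (at s)"
      by (intro has_vector_derivative_mult dE de dt)
    then show "((\<lambda>t. ?E m (z + t *\<^sub>R ?v) * ?H \<tau> (z + t *\<^sub>R ?v)) has_vector_derivative ?F' ?y) (at s)"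
      unfolding ring[where b="?b"] tw .
  next
    have c: "continuous_on UNIV (\<lambda>z. moment_kernel i m k (x - z))" for m
      by (intro continuous_on_compose2[OF moment_kernel_continuous] continuous_intros) auto
    have t: "continuous_on UNIV (\<lambda>z. \<tau> l (z, \<xi>))" "continuous_on UNIV (\<lambda>z. twist i \<tau> l (z, \<xi>))"
      by (intro smooth_function_continuous smooth_function_section admissible_smooth[OF \<tau>] admissible_smooth[OF \<tau>'])+
    show "continuous_on UNIV ?F'" by (intro continuous_intros c t)
    show "integrable lborel (\<lambda>z. ?E m z * ?H \<tau> z)" by (rule I2)
    show "integrable lborel ?F'" by (intro Bochner_Integration.integrable_add integrable_mult_right I1 I2 I3)
  qed
  moreover have "(\<integral>z. ?F' z \<partial>lborel) = (- \<i>) * inner_conv i (Suc m) \<tau> k l x \<xi> + (?b - ?a) * inner_conv i m \<tau> k l x \<xi>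
      + inner_conv i m (twist i \<tau>) k l x \<xi>"
    unfolding inner_conv_def
    by (subst Bochner_Integration.integral_add, (intro Bochner_Integration.integrable_add integrable_mult_right I1 I2 I3)+,
        subst Bochner_Integration.integral_add, (intro integrable_mult_right I1 I2)+, simp only: integral_mult_right_zero)
  ultimately have "(- \<i>) * inner_conv i (Suc m) \<tau> k l x \<xi> + (?b - ?a) * inner_conv i m \<tau> k l x \<xi>
      + inner_conv i m (twist i \<tau>) k l x \<xi> = 0" by simp
  moreover have "P + (\<i> * b - \<i> * a) * Q + S = 0 \<Longrightarrow> \<i> * (a - b) * Q = P + S" for P Q S a b :: complex
    by (simp add: algebra_simps add_eq_0_iff2)
  ultimately show ?thesis unfolding of_real_diff by blast
qed

lemma conv_recursion:
  assumes f: "schwartz f" and \<tau>: "admissible i W \<tau>" and W: "\<And>l. 0 < W l"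
  shows "\<bar>ctr k $ i - ctr l $ i\<bar> * norm (conv i m \<tau> k l f x)
    \<le> norm (conv i (Suc m) \<tau> k l f x) + norm (conv i m (twist i \<tau>) k l f x)"
proof -
  let ?q = "\<lambda>\<xi>. \<eta> l \<xi> * fourier f \<xi>" and ?c = "\<i> * complex_of_real (ctr k $ i - ctr l $ i)"
  have \<tau>': "admissible i (\<lambda>l. W l * rad l) (twist i \<tau>)" by (rule admissible_twist[OF \<tau> W])
  have W': "0 < W l * rad l" for l using W rad_pos by simp
  have "?c * conv i m \<tau> k l f x = (\<integral>\<xi>. ?q \<xi> * (?c * inner_conv i m \<tau> k l x \<xi>) \<partial>lborel)"
    unfolding conv_eq[OF f \<tau> W] integral_mult_right_zero[symmetric] by (simp only: mult_ac)
  also have "\<dots> = (\<integral>\<xi>. - \<i> * (?q \<xi> * inner_conv i (Suc m) \<tau> k l x \<xi>) + ?q \<xi> * inner_conv i m (twist i \<tau>) k l x \<xi> \<partial>lborel)"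
    unfolding inner_conv_recursion[OF \<tau> W] by (simp add: algebra_simps)
  also have "\<dots> = - \<i> * conv i (Suc m) \<tau> k l f x + conv i m (twist i \<tau>) k l f x"
    unfolding conv_eq[OF f \<tau> W] conv_eq[OF f \<tau>' W']
    by (subst Bochner_Integration.integral_add, (intro integrable_mult_right inner_conv_integrable[OF f \<tau> W] inner_conv_integrable[OF f \<tau>' W'])+,
        simp only: integral_mult_right_zero)
  finally have "norm (?c * conv i m \<tau> k l f x) \<le> norm (- \<i> * conv i (Suc m) \<tau> k l f x) + norm (conv i m (twist i \<tau>) k l f x)"
    using norm_triangle_ineq by metis
  then show ?thesis by (simp add: norm_mult del: of_real_diff)
qed

text \<open>Each step either raises the moment, at the cost of \<open>rad k\<close>, or twists the
  symbol, at the cost of \<open>rad l\<close>. Bounding both by the maximum makes the two branches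
  alike; the induction must therefore run over all m, W and \<open>\<tau>\<close>.\<close>

lemma conv_gain:
  assumes "admissible i W \<tau>" "\<And>l. 0 < W l"
  shows "\<exists>B\<ge>0. \<forall>f k l x s. schwartz f \<longrightarrow> controls f l A x s \<longrightarrow>
    \<bar>ctr k $ i - ctr l $ i\<bar> ^ M * norm (conv i m \<tau> k l f x)
      \<le> B * W l * s * max (rad k) (rad l) ^ (m + M) * gap k l ^ (ord * A)"
  using assms
proof (induction M arbitrary: m W \<tau>)
  case 0
  obtain B where B: "0 \<le> B" "\<And>f k l x s. schwartz f \<Longrightarrow> controls f l A x s \<Longrightarrow>
    norm (conv i m \<tau> k l f x) \<le> B * W l * s * rad k ^ m * gap k l ^ (ord * A)"
    by (rule conv_bound[OF 0, of A m]) blast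
  show ?case
  proof (intro exI[of _ B] conjI allI impI B(1))
    fix f k l x s assume f: "schwartz f" and s: "controls f l A x s"
    have "B * W l * s * rad k ^ m * gap k l ^ (ord * A) \<le> B * W l * s * max (rad k) (rad l) ^ m * gap k l ^ (ord * A)"
      using B(1) 0(2)[of l] s rad_pos[of k] gap_pos[of k l]
      by (intro mult_right_mono mult_left_mono power_mono mult_nonneg_nonneg) (auto simp: controls_def less_imp_le)
    then show "\<bar>ctr k $ i - ctr l $ i\<bar> ^ 0 * norm (conv i m \<tau> k l f x)
      \<le> B * W l * s * max (rad k) (rad l) ^ (m + 0) * gap k l ^ (ord * A)"
      using B(2)[OF f s, of k] by simp
  qed
next
  case (Suc M)
  have \<tau>': "admissible i (\<lambda>l. W l * rad l) (twist i \<tau>)" by (rule admissible_twist[OF Suc.prems])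
  have W': "0 < W l * rad l" for l using Suc.prems(2) rad_pos by simp
  obtain B1 where B1: "0 \<le> B1" "\<And>f k l x s. schwartz f \<Longrightarrow> controls f l A x s \<Longrightarrow>
    \<bar>ctr k $ i - ctr l $ i\<bar> ^ M * norm (conv i (Suc m) \<tau> k l f x)
      \<le> B1 * W l * s * max (rad k) (rad l) ^ (Suc m + M) * gap k l ^ (ord * A)"
    using Suc.IH[OF Suc.prems, of "Suc m"] by blast
  obtain B2 where B2: "0 \<le> B2" "\<And>f k l x s. schwartz f \<Longrightarrow> controls f l A x s \<Longrightarrow>
    \<bar>ctr k $ i - ctr l $ i\<bar> ^ M * norm (conv i m (twist i \<tau>) k l f x)
      \<le> B2 * (W l * rad l) * s * max (rad k) (rad l) ^ (m + M) * gap k l ^ (ord * A)"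
    using Suc.IH[OF \<tau>' W', of m] by blast
  show ?case
  proof (intro exI[of _ "B1 + B2"] conjI allI impI)
    show "0 \<le> B1 + B2" using B1 B2 by simp
    fix f k l x s assume f: "schwartz f" and s: "controls f l A x s"
    let ?c = "\<bar>ctr k $ i - ctr l $ i\<bar>" and ?X = "max (rad k) (rad l)" and ?g = "gap k l ^ (ord * A)"
    have "?c ^ Suc M * norm (conv i m \<tau> k l f x) = ?c ^ M * (?c * norm (conv i m \<tau> k l f x))" by simp
    also have "\<dots> \<le> ?c ^ M * (norm (conv i (Suc m) \<tau> k l f x) + norm (conv i m (twist i \<tau>) k l f x))"
      by (intro mult_left_mono conv_recursion[OF f Suc.prems]) auto
    also have "\<dots> \<le> B1 * W l * s * ?X ^ (Suc m + M) * ?g + B2 * (W l * rad l) * s * ?X ^ (m + M) * ?g"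
      using B1(2)[OF f s, of k] B2(2)[OF f s, of k] by (simp add: distrib_left)
    also have "B2 * (W l * rad l) * s * ?X ^ (m + M) * ?g \<le> B2 * (W l * ?X) * s * ?X ^ (m + M) * ?g"
      using B2(1) Suc.prems(2)[of l] s rad_pos[of k] rad_pos[of l] gap_pos[of k l]
      by (intro mult_right_mono mult_left_mono) (auto simp: controls_def less_imp_le less_max_iff_disj le_max_iff_disj)
    finally show "?c ^ Suc M * norm (conv i m \<tau> k l f x) \<le> (B1 + B2) * W l * s * ?X ^ (m + Suc M) * ?g"
      by (simp add: algebra_simps)
  qed
qed

text \<open>It selects the coordinate in which two centres are furthest apart, the one in which to
  integrate by parts.\<close>

lemma max_component:
  fixes v :: "real ^ 'm::finite"
  obtains i where "norm v \<le> real CARD('m) * \<bar>v $ i\<bar>"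
proof -
  obtain i where i: "\<And>j. \<bar>v $ j\<bar> \<le> \<bar>v $ i\<bar>"
  proof -
    have "Max (range (\<lambda>j. \<bar>v $ j\<bar>)) \<in> range (\<lambda>j. \<bar>v $ j\<bar>)" by (intro Max_in) auto
    then obtain i where i: "Max (range (\<lambda>j. \<bar>v $ j\<bar>)) = \<bar>v $ i\<bar>" by (rule rangeE)
    have "\<bar>v $ j\<bar> \<le> Max (range (\<lambda>j. \<bar>v $ j\<bar>))" for j by (intro Max_ge) auto
    then show thesis unfolding i by (rule that)
  qed
  have "norm v \<le> (\<Sum>j\<in>UNIV. \<bar>v $ j\<bar>)" by (rule norm_le_l1_cart)
  also have "\<dots> \<le> (\<Sum>j\<in>(UNIV::'m set). \<bar>v $ i\<bar>)" by (intro sum_mono i)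
  finally show thesis by (intro that[of i]) simp
qed

lemma conv_decay:
  assumes \<tau>: "\<And>i. admissible i W \<tau>" and W: "\<And>l. 0 < W l"
  obtains B where "0 \<le> B" "\<And>f k l x s. schwartz f \<Longrightarrow> controls f l A x s \<Longrightarrow>
    norm (\<integral>z. kern k (x - z) * osc \<tau> f l z \<partial>lborel) * gap k l ^ M \<le> B * W l * s"
proof -
  \<comment> \<open>The additional \<open>ord * A\<close> steps repay the loss from comparing the
    two scales.\<close>
  define M' where "M' = M + ord * A"
  have "\<forall>i. \<exists>B. B\<ge>0 \<and> (\<forall>f k l x s. schwartz f \<longrightarrow> controls f l A x s \<longrightarrow>
    \<bar>ctr k $ i - ctr l $ i\<bar> ^ M' * norm (conv i 0 \<tau> k l f x)
      \<le> B * W l * s * max (rad k) (rad l) ^ (0 + M') * gap k l ^ (ord * A))"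
    using conv_gain[OF \<tau> W] by blast
  from choice[OF this] obtain b where b0: "\<And>i. 0 \<le> b i" and b: "\<And>i f k l x s. schwartz f \<Longrightarrow> controls f l A x s \<Longrightarrow>
    \<bar>ctr k $ i - ctr l $ i\<bar> ^ M' * norm (conv i 0 \<tau> k l f x)
      \<le> b i * W l * s * max (rad k) (rad l) ^ (0 + M') * gap k l ^ (ord * A)" by blast
  obtain D where D: "0 \<le> D" "\<And>f k l x s. schwartz f \<Longrightarrow> controls f l A x s \<Longrightarrow>
    norm (conv undefined 0 \<tau> k l f x) \<le> D * W l * s * rad k ^ 0 * gap k l ^ (ord * A)"
    by (rule conv_bound[OF \<tau> W, where A=A and m=0]) blast
  let ?n = "real CARD('n)"
  \<comment> \<open>The best coordinate depends on k and l, so the constants of all coordinates are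
    added. D covers the diagonal, and \<open>4 * ?n\<close> collects a 2 from \<open>gap\<close>, a
    2 from \<open>ctr_dist\<close> and the dimension from \<open>max_component\<close>.\<close>
  define B where "B = D + (\<Sum>i\<in>UNIV. (4 * ?n) ^ M' * b i)"
  have S0: "0 \<le> (\<Sum>i\<in>(UNIV::'n set). (4 * ?n) ^ M' * b i)" using b0 by (intro sum_nonneg) simp
  show thesis
  proof (rule that[of B])
    show "0 \<le> B" using D(1) S0 by (simp add: B_def)
    fix f k l x s assume f: "schwartz f" and s: "controls f l A x s"
    let ?I = "norm (\<integral>z. kern k (x - z) * osc \<tau> f l z \<partial>lborel)"
    have I: "?I = norm (conv i 0 \<tau> k l f x)" for i by (simp add: conv_def moment_kernel_0)
    have s0: "0 \<le> s" using s by (simp add: controls_def)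
    have Ws: "0 \<le> W l * s" using W[of l] s0 by simp
    show "?I * gap k l ^ M \<le> B * W l * s"
    proof (cases "k = l")
      case True
      then have g: "gap k l = 1" by (simp add: gap_def bracket_def)
      have "?I \<le> D * (W l * s)" using D(2)[OF f s, of k] by (simp add: I[of undefined] g mult.assoc)
      also have "\<dots> \<le> B * (W l * s)" using S0 Ws by (intro mult_right_mono) (auto simp: B_def)
      finally show ?thesis by (simp add: g mult.assoc)
    next
      case False
      let ?X = "max (rad k) (rad l)"
      have X: "0 < ?X" using rad_pos[of k] by (simp add: less_max_iff_disj)
      obtain i where i: "norm (ctr k - ctr l) \<le> ?n * \<bar>(ctr k - ctr l) $ i\<bar>" by (rule max_component)
      let ?c = "\<bar>ctr k $ i - ctr l $ i\<bar>"
      have "1 \<le> norm (lattice_point k - lattice_point l)"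
        using norm_lattice_point_ge_1[of "k - l"] False by (simp add: lattice_point_diff)
      \<comment> \<open>Distinct lattice points are at least 1 apart, so the summand 1 in the gap is
        absorbed.\<close>
      then have "gap k l \<le> 2 * norm (lattice_point k - lattice_point l)" by (simp add: gap_def bracket_def)
      then have "?X * gap k l \<le> ?X * (2 * norm (lattice_point k - lattice_point l))" using X by (intro mult_left_mono) auto
      also have "\<dots> \<le> 4 * norm (ctr k - ctr l)" using ctr_dist[of k l] by (simp add: mult_ac)
      also have "\<dots> \<le> 4 * ?n * ?c" using i by simp
      finally have "(?X * gap k l) ^ M' \<le> (4 * ?n * ?c) ^ M'"
        using X gap_pos[of k l] by (intro power_mono mult_nonneg_nonneg) auto
      then have "(?X * gap k l) ^ M' * ?I \<le> (4 * ?n * ?c) ^ M' * ?I" by (intro mult_right_mono) auto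
      also have "\<dots> = (4 * ?n) ^ M' * (?c ^ M' * ?I)" by (simp add: power_mult_distrib mult_ac)
      also have "\<dots> \<le> (4 * ?n) ^ M' * (b i * W l * s * ?X ^ M' * gap k l ^ (ord * A))"
        using b[OF f s, of k i] by (intro mult_left_mono) (auto simp: I[of i])
      finally have "(?X ^ M' * gap k l ^ (ord * A)) * (?I * gap k l ^ M)
          \<le> (?X ^ M' * gap k l ^ (ord * A)) * ((4 * ?n) ^ M' * b i * (W l * s))"
        by (simp add: M'_def power_mult_distrib power_add mult_ac)
      then have "?I * gap k l ^ M \<le> (4 * ?n) ^ M' * b i * (W l * s)"
        using X gap_pos[of k l] by (subst (asm) mult_le_cancel_left_pos) auto
      also have "\<dots> \<le> B * (W l * s)"
      proof (rule mult_right_mono[OF _ Ws])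
        have "(4 * ?n) ^ M' * b i \<le> (\<Sum>i\<in>(UNIV::'n set). (4 * ?n) ^ M' * b i)"
          using b0 by (intro member_le_sum) auto
        then show "(4 * ?n) ^ M' * b i \<le> B" using D(1) by (simp add: B_def)
      qed
      finally show ?thesis by (simp add: mult.assoc)
    qed
  qed
qed

text \<open>The cutoff \<open>fat l\<close>, which made the symbol admissible, disappears again
  because it is multiplied by \<open>\<eta> l\<close>.\<close>

lemma symbol_decay:
  assumes \<sigma>: "\<sigma> \<in> symbol_class b \<rho> \<delta>" and \<delta>: "\<delta> \<le> \<alpha>" "\<alpha> \<le> \<rho>"
  obtains B where "0 \<le> B" "\<And>f k l x s. schwartz f \<Longrightarrow> controls f l A x s \<Longrightarrow>
    norm (\<integral>z. kern k (x - z) * (\<integral>\<xi>. iexp (z \<bullet> \<xi>) * \<sigma> z \<xi> * (\<eta> l \<xi> * fourier f \<xi>) \<partial>lborel) \<partial>lborel) * gap k l ^ M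
      \<le> B * br l powr (b / (1 - \<alpha>)) * s"
proof -
  let ?\<tau> = "\<lambda>l p. \<sigma> (fst p) (snd p) * fat l (snd p)"
  have "0 < br l powr (b / (1 - \<alpha>))" for l using br_pos[of l] by simp
  from conv_decay[OF admissible_symbol[OF \<sigma> \<delta>] this, of A M]
  obtain B where B: "0 \<le> B" "\<And>f k l x s. schwartz f \<Longrightarrow> controls f l A x s \<Longrightarrow>
    norm (\<integral>z. kern k (x - z) * osc ?\<tau> f l z \<partial>lborel) * gap k l ^ M \<le> B * br l powr (b / (1 - \<alpha>)) * s" by blast
  have "iexp (z \<bullet> \<xi>) * (\<sigma> z \<xi> * fat l \<xi>) * (\<eta> l \<xi> * fourier f \<xi>) = iexp (z \<bullet> \<xi>) * \<sigma> z \<xi> * (\<eta> l \<xi> * fourier f \<xi>)" for z \<xi> f l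
  proof -
    have "iexp (z \<bullet> \<xi>) * (\<sigma> z \<xi> * fat l \<xi>) * (\<eta> l \<xi> * fourier f \<xi>) = iexp (z \<bullet> \<xi>) * \<sigma> z \<xi> * ((fat l \<xi> * \<eta> l \<xi>) * fourier f \<xi>)"
      by (simp only: mult_ac)
    then show ?thesis unfolding fat_eta .
  qed
  then have "osc ?\<tau> f l z = (\<integral>\<xi>. iexp (z \<bullet> \<xi>) * \<sigma> z \<xi> * (\<eta> l \<xi> * fourier f \<xi>) \<partial>lborel)" for f l z
    unfolding osc_def fst_conv snd_conv by (simp only:)
  then show thesis using B that by simp
qed

end

section \<open>Sums over the lattice\<close>

text \<open>Each new term is smaller than the increment of the telescoping right-hand side.\<close>

lemma sum_inverse_square_le: "(\<Sum>j\<le>N. 1 / (1 + real j)\<^sup>2) \<le> 2 - 1 / (1 + real N)"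
proof (induction N)
  case (Suc N)
  have "1 / (1 + real (Suc N))\<^sup>2 \<le> 1 / ((1 + real N) * (1 + real (Suc N)))"
    by (intro divide_left_mono) (auto simp: power2_eq_square)
  also have "\<dots> = 1 / (1 + real N) - 1 / (1 + real (Suc N))" by (simp add: field_simps)
  finally show ?case using Suc by simp
qed simp

lemma int_sum_inverse_square_le:
  assumes "finite T" shows "(\<Sum>t\<in>T. 1 / (1 + \<bar>real_of_int t\<bar>)\<^sup>2) \<le> 4"
proof -
  let ?g = "\<lambda>t::int. 1 / (1 + \<bar>real_of_int t\<bar>)\<^sup>2"
  define N where "N = nat (Max (insert 0 (abs ` T)))"
  let ?P = "int ` {..N}" and ?Q = "(\<lambda>j. - int j) ` {..N}"
  have "\<bar>t\<bar> \<le> Max (insert 0 (abs ` T))" if "t \<in> T" for t using assms that by (intro Max_ge) auto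
  then have N: "\<bar>t\<bar> \<le> int N" if "t \<in> T" for t using that unfolding N_def by fastforce
  have "T \<subseteq> ?P \<union> ?Q"
  proof
    fix t assume "t \<in> T"
    then have "\<bar>t\<bar> \<le> int N" by (rule N)
    then have "t = int (nat t) \<and> nat t \<le> N \<or> t = - int (nat (- t)) \<and> nat (- t) \<le> N" by linarith
    then show "t \<in> ?P \<union> ?Q" by blast
  qed
  then have "sum ?g T \<le> sum ?g (?P \<union> ?Q)" by (intro sum_mono2) auto
  also have "\<dots> \<le> sum ?g ?P + sum ?g ?Q"
    using sum.union_inter[of ?P ?Q ?g] sum_nonneg[of "?P \<inter> ?Q" ?g] by simp
  also have "sum ?g ?P = (\<Sum>j\<le>N. 1 / (1 + real j)\<^sup>2)" by (subst sum.reindex) (auto simp: inj_on_def)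
  also have "sum ?g ?Q = (\<Sum>j\<le>N. 1 / (1 + real j)\<^sup>2)" by (subst sum.reindex) (auto simp: inj_on_def)
  also have "(\<Sum>j\<le>N. 1 / (1 + real j)\<^sup>2) + (\<Sum>j\<le>N. 1 / (1 + real j)\<^sup>2) \<le> 2 + 2"
  proof -
    have "0 \<le> 1 / (1 + real N)" by simp
    then show ?thesis using sum_inverse_square_le[of N] by linarith
  qed
  finally show ?thesis by simp
qed

text \<open>The exponent \<open>2 * CARD('n)\<close> lets each term be dominated by a product over
  the coordinates, so the sum over the lattice is at most a product of one-dimensional sums, each at
  most 4.\<close>

lemma lattice_sum_le:
  fixes F :: "(int ^ 'n::finite) set"
  assumes F: "finite F"
  shows "(\<Sum>m\<in>F. 1 / bracket (lattice_point m) ^ (2 * CARD('n))) \<le> 4 ^ CARD('n)"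
proof -
  let ?g = "\<lambda>t::int. 1 / (1 + \<bar>real_of_int t\<bar>)\<^sup>2"
  let ?T = "\<Union>i. (\<lambda>m. m $ i) ` F"
  have T: "finite ?T" using F by auto
  have "1 / bracket (lattice_point m) ^ (2 * CARD('n)) \<le> (\<Prod>i\<in>UNIV. ?g (m $ i))" for m :: "int ^ 'n"
  proof -
    have "(\<Prod>i\<in>UNIV. (1 + \<bar>real_of_int (m $ i)\<bar>)\<^sup>2) \<le> (\<Prod>i\<in>(UNIV::'n set). (bracket (lattice_point m))\<^sup>2)"
      using component_le_norm_cart[of "lattice_point m"]
      by (intro prod_mono conjI power_mono) (auto simp: bracket_def lattice_point_def)
    also have "\<dots> = bracket (lattice_point m) ^ (2 * CARD('n))" by (simp add: power_mult)
    finally have "1 / bracket (lattice_point m) ^ (2 * CARD('n)) \<le> 1 / (\<Prod>i\<in>UNIV. (1 + \<bar>real_of_int (m $ i)\<bar>)\<^sup>2)"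
      by (intro divide_left_mono mult_pos_pos prod_pos) (auto simp: bracket_def add_pos_nonneg)
    also have "\<dots> = (\<Prod>i\<in>UNIV. ?g (m $ i))" by (simp add: prod_dividef)
    finally show ?thesis .
  qed
  then have "(\<Sum>m\<in>F. 1 / bracket (lattice_point m) ^ (2 * CARD('n))) \<le> (\<Sum>m\<in>F. \<Prod>i\<in>UNIV. ?g (m $ i))"
    by (intro sum_mono)
  also have "\<dots> = (\<Sum>h\<in>vec_nth ` F. \<Prod>i\<in>UNIV. ?g (h i))"
    by (subst sum.reindex) (auto simp: inj_on_def vec_eq_iff)
  also have "\<dots> \<le> (\<Sum>h\<in>PiE (UNIV :: 'n set) (\<lambda>_. ?T). \<Prod>i\<in>UNIV. ?g (h i))"
    using T by (intro sum_mono2 finite_PiE) (auto intro!: prod_nonneg)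
  also have "\<dots> = (\<Prod>i\<in>(UNIV::'n set). \<Sum>t\<in>?T. ?g t)"
    using T by (intro prod_sum_PiE[symmetric]) auto
  also have "\<dots> \<le> (\<Prod>i\<in>(UNIV::'n set). 4)"
    using int_sum_inverse_square_le[OF T] by (intro prod_mono conjI sum_nonneg) auto
  finally show ?thesis by simp
qed

definition lattice_ball :: "nat \<Rightarrow> (int ^ 'n::finite) set"
  where "lattice_ball j = {l. norm (lattice_point l) \<le> real j}"

lemma finite_lattice_ball': "finite (lattice_ball j)"
  unfolding lattice_ball_def by (rule finite_lattice_ball)

text \<open>The lattice is exhausted by finite balls; monotone convergence reduces the claim to
  finite sums.\<close>

lemma nn_integral_lattice_le:
  fixes f :: "int ^ 'n::finite \<Rightarrow> real"
  assumes "\<And>F. finite F \<Longrightarrow> sum f F \<le> c" "\<And>l. 0 \<le> f l"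
  shows "(\<integral>\<^sup>+l. ennreal (f l) \<partial>count_space UNIV) \<le> ennreal c"
proof -
  let ?g = "\<lambda>j l. ennreal (f l) * indicator (lattice_ball j) l"
  have "ennreal (f l) = (SUP j. ?g j l)" for l
  proof (rule antisym)
    have "l \<in> lattice_ball (nat \<lceil>norm (lattice_point l)\<rceil>)" by (simp add: lattice_ball_def)
    then show "ennreal (f l) \<le> (SUP j. ?g j l)"
      by (intro SUP_upper2[of "nat \<lceil>norm (lattice_point l)\<rceil>"]) auto
  qed (auto intro!: SUP_least split: split_indicator)
  then have "(\<integral>\<^sup>+l. ennreal (f l) \<partial>count_space UNIV) = (\<integral>\<^sup>+l. (SUP j. ?g j l) \<partial>count_space UNIV)" by simp
  also have "\<dots> = (SUP j. \<integral>\<^sup>+l. ?g j l \<partial>count_space UNIV)"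
    by (rule nn_integral_monotone_convergence_SUP)
      (auto simp: incseq_def le_fun_def lattice_ball_def intro!: mult_left_mono split: split_indicator)
  also have "\<dots> \<le> ennreal c"
  proof (rule SUP_least)
    fix j
    have "(\<integral>\<^sup>+l. ?g j l \<partial>count_space UNIV) = (\<Sum>l\<in>lattice_ball j. ?g j l)"
      by (rule nn_integral_count_space') (auto simp: finite_lattice_ball')
    also have "\<dots> = (\<Sum>l\<in>lattice_ball j. ennreal (f l))" by (intro sum.cong) auto
    also have "\<dots> = ennreal (sum f (lattice_ball j))" using assms(2) by (intro sum_ennreal) auto
    also have "\<dots> \<le> ennreal c" by (intro ennreal_leI assms(1) finite_lattice_ball')
    finally show "(\<integral>\<^sup>+l. ?g j l \<partial>count_space UNIV) \<le> ennreal c" .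
  qed
  finally show ?thesis .
qed

context alpha_cover
begin

lemma gap_sum:
  assumes "finite F" shows "(\<Sum>l\<in>F. 1 / gap k l ^ (2 * CARD('n))) \<le> 4 ^ CARD('n)"
proof -
  have "(\<Sum>l\<in>F. 1 / gap k l ^ (2 * CARD('n))) = (\<Sum>m\<in>(\<lambda>l. k - l) ` F. 1 / bracket (lattice_point m) ^ (2 * CARD('n)))"
    by (subst sum.reindex) (auto simp: inj_on_def gap_def lattice_point_diff)
  also have "\<dots> \<le> 4 ^ CARD('n)" using assms by (intro lattice_sum_le) auto
  finally show ?thesis .
qed

lemma gap_nn_integral:
  assumes "\<And>l. 0 \<le> f l" "\<And>l. f l \<le> 1 / gap k l ^ (2 * CARD('n))"
  shows "(\<integral>\<^sup>+l. ennreal (f l) \<partial>count_space UNIV) \<le> ennreal (4 ^ CARD('n))"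
proof (rule nn_integral_lattice_le)
  fix F :: "(int ^ 'n) set" assume F: "finite F"
  have "sum f F \<le> (\<Sum>l\<in>F. 1 / gap k l ^ (2 * CARD('n)))" by (intro sum_mono assms)
  also have "\<dots> \<le> 4 ^ CARD('n)" by (rule gap_sum[OF F])
  finally show "sum f F \<le> 4 ^ CARD('n)" .
qed (rule assms)

section \<open>Fourier multipliers of functions\<close>

text \<open>The concrete function representing \<open>\<eta>\<^sub>k(D) g\<close> when g is bounded
  and measurable.\<close>

definition smoothing :: "int ^ 'n \<Rightarrow> (real ^ 'n \<Rightarrow> complex) \<Rightarrow> real ^ 'n \<Rightarrow> complex"
  where "smoothing k g y = (\<integral>z. kern k (y - z) * g z \<partial>lborel)"

lemma kern_reflect_integrable: "integrable lborel (\<lambda>z. kern k (y - z))"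
  using lborel_integral_translate(3)[of "kern k" y] kern_integrable by simp

lemma kern_reflect_norm: "(\<integral>z. norm (kern k (y - z)) \<partial>lborel) = (\<integral>z. norm (kern k z) \<partial>lborel)"
  using lborel_integral_translate(4)[of "\<lambda>z. norm (kern k z)" y] by simp

lemma kern_mult_integrable:
  assumes [measurable]: "g \<in> borel_measurable borel" and M: "\<And>z. norm (g z) \<le> M"
  shows "integrable lborel (\<lambda>z. kern k (y - z) * g z)"
proof (rule Bochner_Integration.integrable_bound[OF integrable_mult_right[OF integrable_norm[OF kern_reflect_integrable[of k y]], of M]])
  show "(\<lambda>z. kern k (y - z) * g z) \<in> borel_measurable lborel" by measurable
  have "0 \<le> M" using M[of 0] norm_ge_zero order_trans by blast
  then have e: "norm (M * norm (kern k (y - z))) = norm (kern k (y - z)) * M" for z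
    by (simp add: abs_mult)
  show "AE z in lborel. norm (kern k (y - z) * g z) \<le> norm (M * norm (kern k (y - z)))"
    unfolding e norm_mult[of "kern k _"] by (intro AE_I2 mult_left_mono M norm_ge_zero)
qed

lemma smoothing_measurable:
  assumes [measurable]: "g \<in> borel_measurable borel"
  shows "smoothing k g \<in> borel_measurable borel"
proof -
  have "smoothing k g \<in> borel_measurable lborel"
    unfolding smoothing_def[abs_def] by (rule lborel.borel_measurable_lebesgue_integral) measurable
  then show ?thesis by simp
qed

lemma smoothing_bounded:
  assumes [measurable]: "g \<in> borel_measurable borel" and M: "\<And>z. norm (g z) \<le> M"
  shows "norm (smoothing k g y) \<le> M * (\<integral>z. norm (kern k z) \<partial>lborel)"
proof -
  have "norm (smoothing k g y) \<le> (\<integral>z. norm (kern k (y - z) * g z) \<partial>lborel)"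
    unfolding smoothing_def by (rule integral_norm_bound)
  also have "\<dots> \<le> (\<integral>z. M * norm (kern k (y - z)) \<partial>lborel)"
    by (intro integral_mono integrable_norm kern_mult_integrable[OF assms] integrable_mult_right kern_reflect_integrable)
      (auto simp: norm_mult mult.commute intro!: mult_right_mono M)
  also have "\<dots> = M * (\<integral>z. norm (kern k (y - z)) \<partial>lborel)" by (rule integral_mult_right_zero)
  finally show ?thesis unfolding kern_reflect_norm .
qed

text \<open>By transposition the multiplier acts on the test function as \<open>fourier
  (\<lambda>\<xi>. \<eta> k \<xi> * inv_fourier \<phi> \<xi>)\<close>. A first exchange identifies
  this with \<open>\<phi>\<close> integrated against \<open>kern k\<close>; a second one, absolutely
  convergent because g is bounded, moves the kernel onto g.\<close>

lemma fourier_multiplier_eq: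
  assumes g[measurable]: "g \<in> borel_measurable borel" and M: "\<And>z. norm (g z) \<le> M" and \<phi>: "schwartz \<phi>"
  shows "fourier_multiplier (\<eta> k) (dist_of g) \<phi> = dist_of (smoothing k g) \<phi>"
proof -
  note [measurable] = schwartz_measurable[OF \<phi>]
  let ?K = "complex_of_real (1 / (2 * pi) ^ CARD('n))"
  have M0: "0 \<le> M" using M[of 0] norm_ge_zero order_trans by blast
  have 1: "fourier (\<lambda>\<xi>. \<eta> k \<xi> * inv_fourier \<phi> \<xi>) x = (\<integral>y. \<phi> y * kern k (y - x) \<partial>lborel)" for x
  proof -
    let ?F = "\<lambda>\<xi> y. ?K * (\<phi> y * (iexp ((y - x) \<bullet> \<xi>) * \<eta> k \<xi>))"
    have m: "(\<lambda>(\<xi>, y). ?F \<xi> y) \<in> borel_measurable (lborel \<Otimes>\<^sub>M lborel)" by measurable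
    have km: "(\<lambda>y. norm ?K * norm (\<phi> y)) \<in> borel_measurable borel" by measurable
    have k0: "0 \<le> norm ?K * norm (\<phi> y)" for y by simp
    have ki: "integrable lborel (\<lambda>y. norm ?K * norm (\<phi> y))"
      by (intro integrable_mult_right integrable_norm schwartz_integrable \<phi>)
    have c: "(\<integral>\<^sup>+y. ennreal (norm ?K * norm (\<phi> y)) \<partial>lborel) \<le> ennreal (\<integral>y. norm ?K * norm (\<phi> y) \<partial>lborel)"
      by (subst nn_integral_eq_integral[OF ki]) (use k0 in auto)
    have bd: "norm (?F \<xi> y) \<le> norm (\<eta> k \<xi>) * (norm ?K * norm (\<phi> y))" for \<xi> y
      unfolding norm_mult by simp
    have "fourier (\<lambda>\<xi>. \<eta> k \<xi> * inv_fourier \<phi> \<xi>) x = (\<integral>\<xi>. \<integral>y. ?F \<xi> y \<partial>lborel \<partial>lborel)"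
      unfolding fourier_def
    proof (intro Bochner_Integration.integral_cong refl)
      fix \<xi> :: "real ^ 'n"
      have "?F \<xi> y = (?K * (exp (- \<i> * complex_of_real (x \<bullet> \<xi>)) * \<eta> k \<xi>)) * (iexp (\<xi> \<bullet> y) * \<phi> y)" for y
        unfolding iexp_diff_split inner_commute[of x \<xi>] inner_commute[of y \<xi>] by (simp only: mult_ac)
      then have "(\<integral>y. ?F \<xi> y \<partial>lborel) = (?K * (exp (- \<i> * complex_of_real (x \<bullet> \<xi>)) * \<eta> k \<xi>)) * (\<integral>y. iexp (\<xi> \<bullet> y) * \<phi> y \<partial>lborel)"
        by (simp only: integral_mult_right_zero)
      then show "exp (- \<i> * complex_of_real (x \<bullet> \<xi>)) * (\<eta> k \<xi> * inv_fourier \<phi> \<xi>) = (\<integral>y. ?F \<xi> y \<partial>lborel)"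
        unfolding inv_fourier_def by (simp only: mult_ac)
    qed
    also have "\<dots> = (\<integral>y. \<integral>\<xi>. ?F \<xi> y \<partial>lborel \<partial>lborel)"
      by (rule lborel_swap(2)[OF m integrable_norm[OF eta_integrable] km norm_ge_zero k0 c bd])
    also have "\<dots> = (\<integral>y. \<phi> y * kern k (y - x) \<partial>lborel)"
    proof (intro Bochner_Integration.integral_cong refl)
      show "(\<integral>\<xi>. ?F \<xi> y \<partial>lborel) = \<phi> y * kern k (y - x)" for y
        unfolding kern_def inv_fourier_def integral_mult_right_zero by (simp only: mult_ac)
    qed
    finally show ?thesis .
  qed
  let ?H = "\<lambda>y x. \<phi> y * (kern k (y - x) * g x)"
  have m: "(\<lambda>(y, x). ?H y x) \<in> borel_measurable (lborel \<Otimes>\<^sub>M lborel)" by measurable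
  have km: "(\<lambda>x. M * norm (kern k (y - x))) \<in> borel_measurable borel" for y by measurable
  have k0: "0 \<le> M * norm (kern k (y - x))" for x y using M0 by simp
  have ki: "integrable lborel (\<lambda>x. M * norm (kern k (y - x)))" for y
    by (intro integrable_mult_right integrable_norm kern_reflect_integrable)
  have c: "(\<integral>\<^sup>+x. ennreal (M * norm (kern k (y - x))) \<partial>lborel) \<le> ennreal (M * (\<integral>z. norm (kern k z) \<partial>lborel))" for y
    by (subst nn_integral_eq_integral[OF ki]) (use k0 in \<open>auto simp: kern_reflect_norm\<close>)
  have bd: "norm (?H y x) \<le> norm (\<phi> y) * (M * norm (kern k (y - x)))" for x y
    unfolding norm_mult using mult_left_mono[OF M[of x], of "norm (\<phi> y) * norm (kern k (y - x))"] by (simp add: mult_ac)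
  have "fourier_multiplier (\<eta> k) (dist_of g) \<phi> = (\<integral>x. g x * (\<integral>y. \<phi> y * kern k (y - x) \<partial>lborel) \<partial>lborel)"
    unfolding fourier_multiplier_def dist_inv_fourier_def dist_mult_def dist_fourier_def dist_of_def 1 ..
  also have "\<dots> = (\<integral>x. \<integral>y. ?H y x \<partial>lborel \<partial>lborel)"
    unfolding integral_mult_right_zero[symmetric] by (simp only: mult_ac)
  also have "\<dots> = (\<integral>y. \<integral>x. ?H y x \<partial>lborel \<partial>lborel)"
    by (rule lborel_swap(2)[OF m integrable_norm[OF schwartz_integrable[OF \<phi>]] km norm_ge_zero k0 c bd, symmetric])
  also have "\<dots> = dist_of (smoothing k g) \<phi>"
    unfolding dist_of_def smoothing_def integral_mult_right_zero by (simp only: mult.commute)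
  finally show ?thesis .
qed

lemma dist_Lp_norm_smoothing_le:
  assumes "g \<in> borel_measurable borel" "\<And>z. norm (g z) \<le> M"
  shows "dist_Lp_norm p (fourier_multiplier (\<eta> k) (dist_of g)) \<le> Lp_norm lborel p (\<lambda>x. ennreal (norm (smoothing k g x)))"
  unfolding dist_Lp_norm_def
  by (rule INF_lower)
    (use bounded_tempered_function[OF smoothing_measurable[OF assms(1)] smoothing_bounded[OF assms]]
      fourier_multiplier_eq[OF assms] in auto)

lemma Lp_norm_cong_AE:
  assumes "AE x in M. F x = G x" "F \<in> borel_measurable M" "G \<in> borel_measurable M"
  shows "Lp_norm M p F = Lp_norm M p G"
proof -
  have "esssup M F = esssup M G" using assms by (intro esssup_AE_cong) auto
  moreover have "(\<integral>\<^sup>+ x. enn_powr (F x) (enn2real p) \<partial>M) = (\<integral>\<^sup>+ x. enn_powr (G x) (enn2real p) \<partial>M)"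
    using assms(1) by (intro nn_integral_cong_AE) auto
  ultimately show ?thesis by (simp add: Lp_norm_def)
qed

lemma smoothing_eq_piece: "smoothing l f = piece f l"
  by (simp add: smoothing_def[abs_def] piece_def[abs_def] mult.commute)

text \<open>Every representative of the multiplier applied to f agrees with the piece almost
  everywhere, so the infimum cannot drop below the quasi-norm of the piece. For f this lower
  estimate is what is needed, whereas for the image of the operator one representative
  suffices.\<close>

lemma piece_Lp_norm_le:
  assumes f: "schwartz f"
  shows "Lp_norm lborel p (\<lambda>x. ennreal (norm (piece f l x))) \<le> dist_Lp_norm p (fourier_multiplier (\<eta> l) (dist_of f))"
  unfolding dist_Lp_norm_def
proof (rule INF_greatest)
  fix g assume "g \<in> {g. tempered_function g \<and> (\<forall>\<phi>. schwartz \<phi> \<longrightarrow> fourier_multiplier (\<eta> l) (dist_of f) \<phi> = dist_of g \<phi>)}"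
  then have g: "tempered_function g" and eq: "\<And>\<phi>. schwartz \<phi> \<Longrightarrow> fourier_multiplier (\<eta> l) (dist_of f) \<phi> = dist_of g \<phi>"
    by auto
  have gm[measurable]: "g \<in> borel_measurable borel" using g by (simp add: tempered_function_def)
  note pm[measurable] = piece_measurable[OF f, of l]
  obtain B where "\<And>x. norm (f x) \<le> B * decay 1 0 x" using schwartz_bound[OF f] by blast
  then have B: "norm (f x) \<le> B" for x by (simp add: decay_def)
  obtain M where M: "\<And>y. norm (piece f l y) \<le> M" using piece_bounded[OF f] by blast
  have p: "tempered_function (piece f l)" by (rule bounded_tempered_function[OF pm M])
  have gi: "integrable lborel (\<lambda>x. g x * \<phi> x)" and pi: "integrable lborel (\<lambda>x. piece f l x * \<phi> x)" if "schwartz \<phi>" for \<phi>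
    using g p that by (auto simp: tempered_function_def)
  have "AE x in lborel. g x - piece f l x = 0"
  proof (rule AE_eq_0_if_schwartz_integrals_eq_0)
    fix \<phi> :: "real ^ 'n \<Rightarrow> complex" assume \<phi>: "schwartz \<phi>"
    show "integrable lborel (\<lambda>x. (g x - piece f l x) * \<phi> x)"
      unfolding left_diff_distrib by (intro Bochner_Integration.integrable_diff gi pi \<phi>)
    have "dist_of g \<phi> = dist_of (piece f l) \<phi>"
      using eq[OF \<phi>] fourier_multiplier_eq[OF schwartz_measurable[OF f] B \<phi>, of l] by (simp add: smoothing_eq_piece)
    then show "(\<integral>x. (g x - piece f l x) * \<phi> x \<partial>lborel) = 0"
      unfolding left_diff_distrib dist_of_def by (subst Bochner_Integration.integral_diff) (use gi pi \<phi> in auto)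
  qed simp
  then have "Lp_norm lborel p (\<lambda>x. ennreal (norm (piece f l x))) = Lp_norm lborel p (\<lambda>x. ennreal (norm (g x)))"
    by (intro Lp_norm_cong_AE) auto
  then show "Lp_norm lborel p (\<lambda>x. ennreal (norm (piece f l x))) \<le> Lp_norm lborel p (\<lambda>x. ennreal (norm (g x)))" by simp
qed

section \<open>Decomposition of the operator\<close>

text \<open>The transform of f decays fast enough to beat the growth
  \<open>bracket \<xi> powr b\<close> and to leave integrable decay, uniformly in z.\<close>

lemma symbol_fourier_bound:
  fixes \<sigma> :: "real ^ 'n \<Rightarrow> real ^ 'n \<Rightarrow> complex" and f :: "real ^ 'n \<Rightarrow> complex"
  assumes \<sigma>: "\<sigma> \<in> symbol_class b \<rho> \<delta>" and f: "schwartz f"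
  obtains K where "0 \<le> K" "\<And>z \<xi>. norm (\<sigma> z \<xi> * fourier f \<xi>) \<le> K * decay 1 (2 * CARD('n)) (\<xi> :: real ^ 'n)"
proof -
  have "\<exists>B. \<forall>x \<xi>. norm (multi_deriv (\<lambda>_. 0) (\<lambda>y. multi_deriv (\<lambda>_. 0) (\<sigma> y) \<xi>) x)
      \<le> B * bracket \<xi> powr (b + \<delta> * real (order_of (\<lambda>_::'n. 0)) - \<rho> * real (order_of (\<lambda>_::'n. 0)))"
    using \<sigma> unfolding symbol_class_def by blast
  then obtain B where B: "\<And>x \<xi>. norm (\<sigma> x \<xi>) \<le> B * bracket \<xi> powr b"
    by (auto simp: multi_deriv_0 order_of_def)
  let ?e = "nat \<lceil>\<bar>b\<bar>\<rceil>"
  obtain D where D: "0 \<le> D" "\<And>\<xi>. norm (fourier f \<xi>) \<le> D * decay 1 (?e + 2 * CARD('n)) \<xi>"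
    using schwartz_fourier_decay[OF f] by blast
  show thesis
  proof (rule that[of "\<bar>B\<bar> * D"])
    fix z and \<xi> :: "real ^ 'n"
    have b1: "1 \<le> bracket \<xi>" by (simp add: bracket_def)
    have "bracket \<xi> powr b \<le> bracket \<xi> powr real ?e" using b1 by (intro powr_mono) linarith+
    also have "\<dots> = bracket \<xi> ^ ?e" using b1 by (intro powr_realpow) simp
    finally have "bracket \<xi> powr b * decay 1 ?e \<xi> \<le> bracket \<xi> ^ ?e * decay 1 ?e \<xi>"
      by (intro mult_right_mono) (auto simp: decay_nonneg)
    also have "decay 1 ?e \<xi> = 1 / bracket \<xi> ^ ?e" by (simp add: decay_def bracket_def)
    also have "bracket \<xi> ^ ?e * (1 / bracket \<xi> ^ ?e) = 1" using b1 by simp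
    finally have c: "bracket \<xi> powr b * decay 1 ?e \<xi> \<le> 1"
      by (simp add: decay_def bracket_def)
    have "norm (\<sigma> z \<xi> * fourier f \<xi>) \<le> (\<bar>B\<bar> * bracket \<xi> powr b) * (D * decay 1 (?e + 2 * CARD('n)) \<xi>)"
      unfolding norm_mult
    proof (intro mult_mono D)
      show "norm (\<sigma> z \<xi>) \<le> \<bar>B\<bar> * bracket \<xi> powr b"
        by (rule order_trans[OF B mult_right_mono]) auto
    qed auto
    also have "\<dots> = \<bar>B\<bar> * D * decay 1 (2 * CARD('n)) \<xi> * (bracket \<xi> powr b * decay 1 ?e \<xi>)"
      by (simp add: decay_add mult_ac)
    also have "\<dots> \<le> \<bar>B\<bar> * D * decay 1 (2 * CARD('n)) \<xi> * 1"
      using D(1) by (intro mult_left_mono c mult_nonneg_nonneg) (auto simp: decay_nonneg)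
    finally show "norm (\<sigma> z \<xi> * fourier f \<xi>) \<le> \<bar>B\<bar> * D * decay 1 (2 * CARD('n)) \<xi>" by simp
  qed (use D in auto)
qed

section \<open>The operator as a limit of its frequency terms\<close>

definition partial_sum :: "nat \<Rightarrow> real ^ 'n \<Rightarrow> complex"
  where "partial_sum j \<xi> = (\<Sum>l\<in>lattice_ball j. \<eta> l \<xi>)"

lemma active_subset:
  assumes "\<eta> l0 \<xi> \<noteq> 0" shows "{l. \<eta> l \<xi> \<noteq> 0} \<subseteq> nb l0"
  using assms by (auto simp: nb_def)

text \<open>At any frequency at most \<open>overlap\<close> members of the partition are nonzero,
  whatever the number of summands. This provides the majorant for dominated convergence.\<close>

lemma partial_sum_bounded:
  obtains B where "0 \<le> B" "\<And>j \<xi>. norm (partial_sum j \<xi>) \<le> B"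
proof -
  obtain D where D: "0 \<le> D" "\<And>k \<xi>. norm (\<eta> k \<xi>) \<le> D" using eta_bound by blast
  show thesis
  proof (rule that[of "real overlap * D"])
    fix j \<xi>
    show "norm (partial_sum j \<xi>) \<le> real overlap * D"
    proof (cases "\<exists>l0. \<eta> l0 \<xi> \<noteq> 0")
      case True
      then obtain l0 where l0: "\<eta> l0 \<xi> \<noteq> 0" by blast
      have "partial_sum j \<xi> = (\<Sum>l\<in>lattice_ball j \<inter> nb l0. \<eta> l \<xi>)"
        unfolding partial_sum_def using active_subset[OF l0]
        by (intro sum.mono_neutral_right) (auto simp: finite_lattice_ball')
      also have "norm \<dots> \<le> (\<Sum>l\<in>lattice_ball j \<inter> nb l0. D)" by (intro sum_norm_le D)
      also have "\<dots> = real (card (lattice_ball j \<inter> nb l0)) * D" by simp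
      also have "\<dots> \<le> real overlap * D"
        using nb_card[of l0] card_mono[OF nb_finite[of l0], of "lattice_ball j \<inter> nb l0"] D(1)
        by (intro mult_right_mono) auto
      finally show ?thesis .
    next
      case False
      then show ?thesis using D(1) by (simp add: partial_sum_def)
    qed
  qed (use D in auto)
qed

text \<open>The members that are active at a given frequency are finite in number, so the partial
  sums are eventually equal to 1.\<close>

lemma partial_sum_tendsto: "(\<lambda>j. partial_sum j \<xi>) \<longlonglongrightarrow> 1"
proof -
  have "\<exists>l0. \<eta> l0 \<xi> \<noteq> 0"
  proof (rule ccontr)
    assume "\<not> ?thesis"
    then have "((\<lambda>k. 0 :: complex) has_sum 1) (UNIV :: (int ^ 'n) set)" using eta_sum[of \<xi>] by simp
    then show False using has_sum_0[of UNIV "\<lambda>k::int ^ 'n. 0 :: complex"] has_sum_unique by fastforce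
  qed
  then obtain l0 where l0: "\<eta> l0 \<xi> \<noteq> 0" by blast
  have fin: "finite {l. \<eta> l \<xi> \<noteq> 0}" by (rule finite_subset[OF active_subset[OF l0] nb_finite])
  have one: "(\<Sum>l\<in>{l. \<eta> l \<xi> \<noteq> 0}. \<eta> l \<xi>) = 1"
  proof -
    have "((\<lambda>k. \<eta> k \<xi>) has_sum (\<Sum>l\<in>{l. \<eta> l \<xi> \<noteq> 0}. \<eta> l \<xi>)) UNIV"
      by (rule has_sum_finite_neutralI[OF fin]) auto
    then show ?thesis using eta_sum has_sum_unique by blast
  qed
  define N where "N = nat \<lceil>Max (insert 0 ((\<lambda>l. norm (lattice_point l)) ` {l. \<eta> l \<xi> \<noteq> 0}))\<rceil>"
  have sub: "{l. \<eta> l \<xi> \<noteq> 0} \<subseteq> lattice_ball j" if "N \<le> j" for j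
  proof
    fix l assume l: "l \<in> {l. \<eta> l \<xi> \<noteq> 0}"
    have "norm (lattice_point l) \<le> Max (insert 0 ((\<lambda>l. norm (lattice_point l)) ` {l. \<eta> l \<xi> \<noteq> 0}))"
      using fin l by (intro Max_ge) auto
    also have "\<dots> \<le> real N" unfolding N_def by linarith
    also have "\<dots> \<le> real j" using that by simp
    finally show "l \<in> lattice_ball j" by (simp add: lattice_ball_def)
  qed
  have "partial_sum j \<xi> = 1" if "N \<le> j" for j
    unfolding partial_sum_def one[symmetric]
    by (intro sum.mono_neutral_right sub that finite_lattice_ball') auto
  then show ?thesis by (intro tendsto_eventually) (auto simp: eventually_sequentially)
qed

text \<open>The oscillatory integral with the uncut symbol and a general amplitude:
  \<open>fourier f\<close> gives the operator, \<open>\<eta> l \<xi> * fourier f \<xi>\<close> its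
  term of index l.\<close>

definition oscill :: "(real ^ 'n \<Rightarrow> real ^ 'n \<Rightarrow> complex) \<Rightarrow> (real ^ 'n \<Rightarrow> complex) \<Rightarrow> real ^ 'n \<Rightarrow> complex"
  where "oscill \<sigma> h z = (\<integral>\<xi>. iexp (z \<bullet> \<xi>) * \<sigma> z \<xi> * h \<xi> \<partial>lborel)"

lemma symbol_measurable:
  fixes \<sigma> :: "real ^ 'n \<Rightarrow> real ^ 'n \<Rightarrow> complex"
  assumes "\<sigma> \<in> symbol_class b \<rho> \<delta>" shows "(\<lambda>(x, \<xi>). \<sigma> x \<xi>) \<in> borel_measurable (lborel \<Otimes>\<^sub>M (lborel :: (real ^ 'n) measure))"
proof -
  have "smooth_function (\<lambda>(x, \<xi>). \<sigma> x \<xi>)" using assms by (simp add: symbol_class_def)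
  from smooth_function_measurable[OF this] show ?thesis by (simp add: lborel_prod)
qed

lemma oscill_measurable:
  fixes \<sigma> :: "real ^ 'n \<Rightarrow> real ^ 'n \<Rightarrow> complex"
  assumes \<sigma>: "\<sigma> \<in> symbol_class b \<rho> \<delta>" and [measurable]: "h \<in> borel_measurable borel"
  shows "oscill \<sigma> h \<in> borel_measurable borel"
proof -
  note [measurable] = symbol_measurable[OF \<sigma>]
  have "oscill \<sigma> h \<in> borel_measurable lborel"
    unfolding oscill_def[abs_def] by (rule lborel.borel_measurable_lebesgue_integral) measurable
  then show ?thesis by simp
qed

lemma oscill_facts:
  fixes \<sigma> :: "real ^ 'n \<Rightarrow> real ^ 'n \<Rightarrow> complex"
  assumes \<sigma>: "\<sigma> \<in> symbol_class b \<rho> \<delta>" and h[measurable]: "h \<in> borel_measurable borel"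
    and K: "\<And>z \<xi>. norm (\<sigma> z \<xi> * h \<xi>) \<le> K * decay 1 (2 * CARD('n)) (\<xi> :: real ^ 'n)"
  shows oscill_integrable: "integrable lborel (\<lambda>\<xi>. iexp (z \<bullet> \<xi>) * \<sigma> z \<xi> * h \<xi>)"
    and oscill_bounded: "norm (oscill \<sigma> h z) \<le> K * decay_mass TYPE(real ^ 'n)"
proof -
  have [measurable]: "(\<lambda>\<xi>. \<sigma> z \<xi>) \<in> borel_measurable borel"
  proof -
    have "smooth_function (\<lambda>(x, \<xi>). \<sigma> x \<xi>)" using \<sigma> by (simp add: symbol_class_def)
    from smooth_function_section(1)[OF this, of z] show ?thesis by (intro smooth_function_measurable) simp
  qed
  have n: "norm (iexp (z \<bullet> \<xi>) * \<sigma> z \<xi> * h \<xi>) \<le> K * decay 1 (2 * CARD('n)) \<xi>" for \<xi>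
    using K[of z \<xi>] by (simp add: norm_mult)
  show i: "integrable lborel (\<lambda>\<xi>. iexp (z \<bullet> \<xi>) * \<sigma> z \<xi> * h \<xi>)"
    by (rule decay_bound_integrable[where B=K]) (use n in auto)
  have "norm (oscill \<sigma> h z) \<le> (\<integral>\<xi>. norm (iexp (z \<bullet> \<xi>) * \<sigma> z \<xi> * h \<xi>) \<partial>lborel)"
    unfolding oscill_def by (rule integral_norm_bound)
  also have "\<dots> \<le> (\<integral>\<xi>. K * decay 1 (2 * CARD('n)) \<xi> \<partial>(lborel :: (real ^ 'n) measure))"
  proof (intro integral_mono integrable_norm i integrable_mult_right n)
    show "integrable lborel (decay 1 (2 * CARD('n)) :: real ^ 'n \<Rightarrow> real)"
      using integrable_decay_1[where 'a="real ^ 'n"] by simp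
  qed
  also have "\<dots> = K * decay_mass TYPE(real ^ 'n)"
    unfolding decay_mass_def by simp
  finally show "norm (oscill \<sigma> h z) \<le> K * decay_mass TYPE(real ^ 'n)" .
qed

lemma pseudo_op_eq_oscill:
  "pseudo_op \<sigma> f z = complex_of_real (1 / (2 * pi) ^ CARD('n)) * oscill \<sigma> (fourier f) z"
  by (simp add: pseudo_op_def oscill_def)

lemma pseudo_op_measurable:
  fixes \<sigma> :: "real ^ 'n \<Rightarrow> real ^ 'n \<Rightarrow> complex" and f :: "real ^ 'n \<Rightarrow> complex"
  assumes "\<sigma> \<in> symbol_class b \<rho> \<delta>" "schwartz f" shows "pseudo_op \<sigma> f \<in> borel_measurable borel"
  unfolding pseudo_op_eq_oscill[abs_def]
  using oscill_measurable[OF assms(1) fourier_measurable[OF assms(2)]] by measurable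

lemma pseudo_op_bounded:
  fixes \<sigma> :: "real ^ 'n \<Rightarrow> real ^ 'n \<Rightarrow> complex" and f :: "real ^ 'n \<Rightarrow> complex"
  assumes \<sigma>: "\<sigma> \<in> symbol_class b \<rho> \<delta>" and f: "schwartz f"
  obtains M where "\<And>z. norm (pseudo_op \<sigma> f z) \<le> M"
proof -
  obtain K where K: "0 \<le> K" "\<And>z \<xi>. norm (\<sigma> z \<xi> * fourier f \<xi>) \<le> K * decay 1 (2 * CARD('n)) \<xi>"
    by (rule symbol_fourier_bound[OF \<sigma> f]) blast
  have "norm (pseudo_op \<sigma> f z) \<le> norm (complex_of_real (1 / (2 * pi) ^ CARD('n))) * (K * decay_mass TYPE(real ^ 'n))" for z
    unfolding pseudo_op_eq_oscill norm_mult
    by (intro mult_left_mono oscill_bounded[OF \<sigma> fourier_measurable[OF f] K(2)]) auto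
  then show thesis by (rule that)
qed

text \<open>The sum over l is taken through two integrals, each by dominated convergence: first the
  frequency integral, with the decay of \<open>fourier f\<close> as majorant, then the convolution
  with \<open>kern k\<close>.\<close>

lemma smoothing_oscill_limit:
  fixes \<sigma> :: "real ^ 'n \<Rightarrow> real ^ 'n \<Rightarrow> complex" and f :: "real ^ 'n \<Rightarrow> complex"
  assumes \<sigma>: "\<sigma> \<in> symbol_class b \<rho> \<delta>" and f: "schwartz f"
  shows "(\<lambda>j. \<Sum>l\<in>lattice_ball j. smoothing k (oscill \<sigma> (\<lambda>\<xi>. \<eta> l \<xi> * fourier f \<xi>)) x)
    \<longlonglongrightarrow> smoothing k (oscill \<sigma> (fourier f)) x"
proof -
  note [measurable] = fourier_measurable[OF f]
  let ?D = "\<lambda>\<xi>::real ^ 'n. decay 1 (2 * CARD('n)) \<xi>"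
  let ?h = "\<lambda>j \<xi>. partial_sum j \<xi> * fourier f \<xi>"
  obtain K where K: "0 \<le> K" "\<And>z \<xi>. norm (\<sigma> z \<xi> * fourier f \<xi>) \<le> K * ?D \<xi>"
    by (rule symbol_fourier_bound[OF \<sigma> f]) blast
  obtain B where B: "0 \<le> B" "\<And>j \<xi>. norm (partial_sum j \<xi>) \<le> B" by (rule partial_sum_bounded) blast
  obtain E where E: "0 \<le> E" "\<And>k \<xi>. norm (\<eta> k \<xi>) \<le> E" by (rule eta_bound) blast
  have mult: "norm (\<sigma> z \<xi> * (c * fourier f \<xi>)) \<le> (A * K) * ?D \<xi>" if "norm c \<le> A" for c A z \<xi>
  proof -
    have "norm (\<sigma> z \<xi> * (c * fourier f \<xi>)) = norm c * norm (\<sigma> z \<xi> * fourier f \<xi>)" by (simp add: norm_mult)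
    also have "\<dots> \<le> A * (K * ?D \<xi>)" using that K by (intro mult_mono K) (auto intro: order_trans[OF norm_ge_zero])
    finally show ?thesis by (simp add: mult.assoc)
  qed
  have [measurable]: "partial_sum j \<in> borel_measurable borel" for j
    unfolding partial_sum_def[abs_def] by measurable
  have hj: "?h j \<in> borel_measurable borel" and hl: "(\<lambda>\<xi>. \<eta> l \<xi> * fourier f \<xi>) \<in> borel_measurable borel" for j l by measurable
  note Ij = oscill_facts[OF \<sigma> hj mult[OF B(2)]] and Il = oscill_facts[OF \<sigma> hl mult[OF E(2)]]
  have sum: "oscill \<sigma> (?h j) z = (\<Sum>l\<in>lattice_ball j. oscill \<sigma> (\<lambda>\<xi>. \<eta> l \<xi> * fourier f \<xi>) z)" for j z
  proof -
    have "oscill \<sigma> (?h j) z = (\<integral>\<xi>. (\<Sum>l\<in>lattice_ball j. iexp (z \<bullet> \<xi>) * \<sigma> z \<xi> * (\<eta> l \<xi> * fourier f \<xi>)) \<partial>lborel)"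
      unfolding oscill_def partial_sum_def by (simp only: sum_distrib_left sum_distrib_right)
    also have "\<dots> = (\<Sum>l\<in>lattice_ball j. oscill \<sigma> (\<lambda>\<xi>. \<eta> l \<xi> * fourier f \<xi>) z)"
      unfolding oscill_def by (intro Bochner_Integration.integral_sum Il(1))
    finally show ?thesis .
  qed
  have "(\<Sum>l\<in>lattice_ball j. smoothing k (oscill \<sigma> (\<lambda>\<xi>. \<eta> l \<xi> * fourier f \<xi>)) x) = smoothing k (oscill \<sigma> (?h j)) x" for j
    unfolding smoothing_def sum sum_distrib_left
    by (intro Bochner_Integration.integral_sum[symmetric] kern_mult_integrable[OF oscill_measurable[OF \<sigma> hl] Il(2)])
  moreover have "(\<lambda>j. smoothing k (oscill \<sigma> (?h j)) x) \<longlonglongrightarrow> smoothing k (oscill \<sigma> (fourier f)) x"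
    unfolding smoothing_def
  proof (rule integral_dominated_convergence[where w="\<lambda>z. (B * K * decay_mass TYPE(real ^ 'n)) * norm (kern k (x - z))"])
    note [measurable] = oscill_measurable[OF \<sigma> fourier_measurable[OF f]] oscill_measurable[OF \<sigma> hj]
    show "(\<lambda>z. kern k (x - z) * oscill \<sigma> (fourier f) z) \<in> borel_measurable lborel" by measurable
    show "(\<lambda>z. kern k (x - z) * oscill \<sigma> (?h j) z) \<in> borel_measurable lborel" for j by measurable
    show "integrable lborel (\<lambda>z. (B * K * decay_mass TYPE(real ^ 'n)) * norm (kern k (x - z)))"
      by (intro integrable_mult_right integrable_norm kern_reflect_integrable)
    show "AE z in lborel. norm (kern k (x - z) * oscill \<sigma> (?h j) z) \<le> (B * K * decay_mass TYPE(real ^ 'n)) * norm (kern k (x - z))" for j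
      unfolding norm_mult[of "kern k _"] mult.commute[of "B * K * decay_mass TYPE(real ^ 'n)"]
      by (intro AE_I2 mult_left_mono Ij(2) norm_ge_zero)
    show "AE z in lborel. (\<lambda>j. kern k (x - z) * oscill \<sigma> (?h j) z) \<longlonglongrightarrow> kern k (x - z) * oscill \<sigma> (fourier f) z"
    proof (intro AE_I2 tendsto_mult tendsto_const)
      fix z
      show "(\<lambda>j. oscill \<sigma> (?h j) z) \<longlonglongrightarrow> oscill \<sigma> (fourier f) z"
        unfolding oscill_def
      proof (rule integral_dominated_convergence[where w="\<lambda>\<xi>. (B * K) * ?D \<xi>"])
        have "integrable lborel (\<lambda>\<xi>. iexp (z \<bullet> \<xi>) * \<sigma> z \<xi> * fourier f \<xi>)"
          by (rule oscill_facts(1)[OF \<sigma> fourier_measurable[OF f] K(2)])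
        then show "(\<lambda>\<xi>. iexp (z \<bullet> \<xi>) * \<sigma> z \<xi> * fourier f \<xi>) \<in> borel_measurable lborel" by auto
        show "(\<lambda>\<xi>. iexp (z \<bullet> \<xi>) * \<sigma> z \<xi> * ?h j \<xi>) \<in> borel_measurable lborel" for j
          by (rule borel_measurable_integrable[OF Ij(1)])
        show "integrable lborel (\<lambda>\<xi>::real ^ 'n. (B * K) * ?D \<xi>)"
          using integrable_decay_1[where 'a="real ^ 'n"] by (intro integrable_mult_right) simp
        show "AE \<xi> in lborel. (\<lambda>j. iexp (z \<bullet> \<xi>) * \<sigma> z \<xi> * ?h j \<xi>) \<longlonglongrightarrow> iexp (z \<bullet> \<xi>) * \<sigma> z \<xi> * fourier f \<xi>"
        proof (intro AE_I2 tendsto_mult tendsto_const)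
          fix \<xi> :: "real ^ 'n"
          show "(\<lambda>j. ?h j \<xi>) \<longlonglongrightarrow> fourier f \<xi>"
            using tendsto_mult[OF partial_sum_tendsto tendsto_const, of \<xi> "fourier f \<xi>"] by simp
        qed
        show "AE \<xi> in lborel. norm (iexp (z \<bullet> \<xi>) * \<sigma> z \<xi> * ?h j \<xi>) \<le> (B * K) * ?D \<xi>" for j
        proof (intro AE_I2)
          fix \<xi> :: "real ^ 'n"
          have "norm (iexp (z \<bullet> \<xi>) * \<sigma> z \<xi> * ?h j \<xi>) = norm (\<sigma> z \<xi> * ?h j \<xi>)" by (simp add: norm_mult)
          also have "\<dots> \<le> (B * K) * ?D \<xi>" by (rule mult[OF B(2)])
          finally show "norm (iexp (z \<bullet> \<xi>) * \<sigma> z \<xi> * ?h j \<xi>) \<le> (B * K) * ?D \<xi>" .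
        qed
      qed
    qed
  qed
  ultimately show ?thesis by simp
qed

text \<open>The weighted controlling numbers may grow like \<open>gap k l ^ M\<close> away from k.
  The off-diagonal decay is used with exponent \<open>M + 2 * CARD('n)\<close>: M undoes that growth
  and the rest makes the sum over l converge. Later steps choose M to suit the exponents p and
  q.\<close>

lemma pseudo_op_pointwise:
  fixes \<sigma> :: "real ^ 'n \<Rightarrow> real ^ 'n \<Rightarrow> complex"
  assumes \<sigma>: "\<sigma> \<in> symbol_class b \<rho> \<delta>" and \<delta>: "\<delta> \<le> \<alpha>" "\<alpha> \<le> \<rho>"
  obtains K where "0 \<le> K" "\<And>f k x V s. schwartz f \<Longrightarrow> 0 \<le> V \<Longrightarrow> (\<And>l. controls f l A x (s l)) \<Longrightarrow>
    (\<And>l. br l powr (b / (1 - \<alpha>)) * s l \<le> V * gap k l ^ M) \<Longrightarrow> norm (smoothing k (pseudo_op \<sigma> f) x) \<le> K * V"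
proof -
  let ?n = "CARD('n)"
  obtain B where B: "0 \<le> B" "\<And>f k l x s. schwartz f \<Longrightarrow> controls f l A x s \<Longrightarrow>
    norm (\<integral>z. kern k (x - z) * (\<integral>\<xi>. iexp (z \<bullet> \<xi>) * \<sigma> z \<xi> * (\<eta> l \<xi> * fourier f \<xi>) \<partial>lborel) \<partial>lborel) * gap k l ^ (M + 2 * ?n)
      \<le> B * br l powr (b / (1 - \<alpha>)) * s"
    by (rule symbol_decay[OF \<sigma> \<delta>, where A=A and M="M + 2 * ?n"]) blast
  show thesis
  proof (rule that[of "B * 4 ^ ?n"])
    fix f :: "real ^ 'n \<Rightarrow> complex" and k x V s
    assume f: "schwartz f" and V: "0 \<le> V" and s: "\<And>l. controls f l A x (s l)"
      and le: "\<And>l. br l powr (b / (1 - \<alpha>)) * s l \<le> V * gap k l ^ M"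
    let ?T = "\<lambda>l. smoothing k (oscill \<sigma> (\<lambda>\<xi>. \<eta> l \<xi> * fourier f \<xi>)) x"
    have T: "norm (?T l) \<le> B * V * (1 / gap k l ^ (2 * ?n))" for l
    proof -
      have "norm (?T l) * gap k l ^ (M + 2 * ?n) \<le> B * (br l powr (b / (1 - \<alpha>)) * s l)"
        using B(2)[OF f s, of k l] by (simp add: smoothing_def oscill_def mult.assoc)
      also have "\<dots> \<le> B * (V * gap k l ^ M)" by (intro mult_left_mono le B)
      finally have "gap k l ^ M * (norm (?T l) * gap k l ^ (2 * ?n)) \<le> gap k l ^ M * (B * V)"
        by (simp add: power_add mult_ac)
      then have "norm (?T l) * gap k l ^ (2 * ?n) \<le> B * V"
        using gap_pos[of k l] by (subst (asm) mult_le_cancel_left_pos) auto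
      then show ?thesis using gap_pos[of k l] by (simp add: pos_le_divide_eq)
    qed
    have "norm (\<Sum>l\<in>lattice_ball j. ?T l) \<le> B * V * 4 ^ ?n" for j
    proof -
      have "norm (\<Sum>l\<in>lattice_ball j. ?T l) \<le> (\<Sum>l\<in>lattice_ball j. B * V * (1 / gap k l ^ (2 * ?n)))"
        by (intro sum_norm_le T)
      also have "\<dots> = B * V * (\<Sum>l\<in>lattice_ball j. 1 / gap k l ^ (2 * ?n))" by (rule sum_distrib_left[symmetric])
      also have "\<dots> \<le> B * V * 4 ^ ?n" using B(1) V by (intro mult_left_mono gap_sum finite_lattice_ball') auto
      finally show ?thesis .
    qed
    then have N: "norm (smoothing k (oscill \<sigma> (fourier f)) x) \<le> B * V * 4 ^ ?n"
      by (intro LIMSEQ_le_const2[OF tendsto_norm[OF smoothing_oscill_limit[OF \<sigma> f]]]) auto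
    let ?c = "1 / (2 * pi) ^ ?n"
    have "smoothing k (pseudo_op \<sigma> f) x = (\<integral>z. complex_of_real ?c * (kern k (x - z) * oscill \<sigma> (fourier f) z) \<partial>lborel)"
      unfolding smoothing_def pseudo_op_eq_oscill by (simp only: mult_ac)
    also have "\<dots> = complex_of_real ?c * smoothing k (oscill \<sigma> (fourier f)) x"
      unfolding smoothing_def by (rule integral_mult_right_zero)
    finally have "norm (smoothing k (pseudo_op \<sigma> f) x) = ?c * norm (smoothing k (oscill \<sigma> (fourier f)) x)"
      by (simp only: norm_mult norm_of_real) simp
    also have "\<dots> \<le> 1 * norm (smoothing k (oscill \<sigma> (fourier f)) x)"
    proof (intro mult_right_mono)
      have "1 \<le> (2 * pi) ^ ?n" using pi_ge_two by (intro one_le_power) simp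
      then show "?c \<le> 1" by (simp add: divide_le_eq_1)
    qed simp
    finally show "norm (smoothing k (pseudo_op \<sigma> f) x) \<le> B * 4 ^ ?n * V" using N by (simp add: mult_ac)
  qed (use B in auto)
qed

end

section \<open>Powers of extended nonnegative reals\<close>

lemma enn_powr_ennreal: "0 \<le> x \<Longrightarrow> enn_powr (ennreal x) r = ennreal (x powr r)"
  by (simp add: enn_powr_def)

lemma enn_powr_mono:
  assumes "x \<le> y" "0 \<le> r" shows "enn_powr x r \<le> enn_powr y r"
proof (cases "y = top")
  case False
  then have "x < top" "y < top" using assms(1) by (auto simp: top.not_eq_extremum)
  then show ?thesis using assms
    by (auto simp: enn_powr_def intro!: ennreal_leI powr_mono2 enn2real_mono)
qed (simp add: enn_powr_def)

lemma enn_powr_cmult: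
  assumes "0 < c" shows "enn_powr (ennreal c * x) r = ennreal (c powr r) * enn_powr x r"
proof (cases x)
  case (real t)
  then show ?thesis using assms
    by (simp add: ennreal_mult'[symmetric] enn_powr_ennreal powr_mult)
next
  case top
  then show ?thesis using assms by (simp add: enn_powr_def ennreal_mult_top)
qed

lemma enn_powr_root_le:
  assumes "enn_powr x (1 / r) \<le> ennreal t" "0 \<le> t" "0 < r"
  shows "x \<le> ennreal (t powr r)"
proof (cases x)
  case (real u)
  then have "u powr (1 / r) \<le> t" using assms by (simp add: enn_powr_ennreal)
  then have "(u powr (1 / r)) powr r \<le> t powr r" using assms by (intro powr_mono2) auto
  then show ?thesis using real assms(3) by (simp add: powr_powr ennreal_leI)
qed (use assms in \<open>simp add: enn_powr_def top_unique\<close>)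

lemma enn_powr_le_root:
  assumes "enn_powr x r \<le> ennreal t" "0 \<le> t" "0 < r"
  shows "x \<le> ennreal (t powr (1 / r))"
  using enn_powr_root_le[of x "1 / r" t] assms by simp

lemma Lp_norm_mono:
  assumes "\<And>x. F x \<le> G x" "F \<in> borel_measurable M" "G \<in> borel_measurable M"
  shows "Lp_norm M p F \<le> Lp_norm M p G"
proof (cases "p = top")
  case True
  have "AE x in M. F x \<le> esssup M G"
    using esssup_AE[of G M] by eventually_elim (rule order_trans[OF assms(1)])
  then show ?thesis using True assms by (auto simp: Lp_norm_def intro!: esssup_I)
next
  case False
  then show ?thesis using assms unfolding Lp_norm_def
    by (auto intro!: enn_powr_mono nn_integral_mono)
qed

section \<open>Bounds on the frequency pieces\<close>

context alpha_cover
begin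

text \<open>A local mean of the P-th power of the piece at scale \<open>1 / rad l\<close> around x,
  kept as an extended nonnegative integral so that it can be integrated in x and summed in l without
  side conditions.\<close>

abbreviation mean_power :: "(real ^ 'n \<Rightarrow> complex) \<Rightarrow> real \<Rightarrow> int ^ 'n \<Rightarrow> real ^ 'n \<Rightarrow> ennreal"
  where "mean_power f P l x \<equiv>
    (\<integral>\<^sup>+z. ennreal (rad l ^ CARD('n) * (norm (piece f l z) powr P * decay (rad l) (2 * CARD('n)) (x - z))) \<partial>lborel)"

lemma piece_powr_integrable:
  assumes f: "schwartz f" and P: "0 < P"
  shows "integrable lborel (\<lambda>z. norm (piece f l z) powr P * decay (rad l) (2 * CARD('n)) (x - z))"
proof -
  note [measurable] = piece_measurable[OF f]
  obtain B where B: "0 \<le> B" "\<And>y. norm (piece f l y) \<le> B" using piece_bounded[OF f] by blast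
  have i: "integrable lborel (\<lambda>z. decay (rad l) (2 * CARD('n)) (x - z))"
    using rad_pos by (intro integrable_decay) auto
  show ?thesis
  proof (rule Bochner_Integration.integrable_bound[OF integrable_mult_right[OF i, of "B powr P"]])
    show "AE z in lborel. norm (norm (piece f l z) powr P * decay (rad l) (2 * CARD('n)) (x - z))
        \<le> norm (B powr P * decay (rad l) (2 * CARD('n)) (x - z))"
      using B P rad_pos[of l] by (auto simp: abs_mult intro!: mult_right_mono powr_mono2)
  qed measurable
qed

text \<open>Peetre's inequality requires an exponent at most 1, so it is used with
  \<open>r = min 1 P\<close>. The constant \<open>?D + 1\<close> collects the mass of the weight and
  the assumed bound for the mean of order P.\<close>

lemma controls_of_mean_power:
  assumes P: "0 < P" and A: "2 * real CARD('n) \<le> real A * min 1 P"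
  obtains B where "0 \<le> B" "\<And>f l x T. schwartz f \<Longrightarrow> 0 < T \<Longrightarrow> mean_power f P l x \<le> ennreal (T powr P)
    \<Longrightarrow> \<exists>s. controls f l A x s \<and> s \<le> B * T"
proof -
  let ?n = "CARD('n)" and ?D = "decay_mass TYPE(real ^ 'n)"
  define r where "r = min 1 P"
  have r: "0 < r" "r \<le> 1" "r \<le> P" using P by (auto simp: r_def)
  obtain B where B: "0 \<le> B" "\<And>f l x. schwartz f \<Longrightarrow> \<exists>s. controls f l A x s \<and>
    s powr r \<le> B * (rad l ^ ?n * (\<integral>z. norm (piece f l z) powr r * decay (rad l) (2 * ?n) (x - z) \<partial>lborel))"
    by (rule peetre[OF r(1,2) A[folded r_def]]) blast
  have D: "0 \<le> ?D" by (rule decay_mass_nonneg)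
  show thesis
  proof (rule that[of "(B * (?D + 1)) powr (1 / r)"])
    fix f :: "real ^ 'n \<Rightarrow> complex" and l and x :: "real ^ 'n" and T :: real
    assume f: "schwartz f" and T: "0 < T" and m: "mean_power f P l x \<le> ennreal (T powr P)"
    let ?g = "\<lambda>z. norm (piece f l z)" and ?d = "\<lambda>z. decay (rad l) (2 * ?n) (x - z)"
    have rp: "0 < rad l" by (rule rad_pos)
    have iP: "integrable lborel (\<lambda>z. ?g z powr P * ?d z)" by (rule piece_powr_integrable[OF f P])
    have ir: "integrable lborel (\<lambda>z. ?g z powr r * ?d z)" by (rule piece_powr_integrable[OF f r(1)])
    have id: "integrable lborel ?d" "rad l ^ ?n * (\<integral>z. ?d z \<partial>lborel) \<le> ?D"
      using integrable_decay[OF rp, of "2 * ?n" x] by auto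
    have "mean_power f P l x = ennreal (\<integral>z. rad l ^ ?n * (?g z powr P * ?d z) \<partial>lborel)"
      using iP rp by (intro nn_integral_eq_integral) (auto intro!: AE_I2 mult_nonneg_nonneg decay_nonneg)
    with m have mP: "rad l ^ ?n * (\<integral>z. ?g z powr P * ?d z \<partial>lborel) \<le> T powr P"
      by (simp add: ennreal_le_iff)
    \<comment> \<open>Splitting at the level T takes the place of Hoelder's inequality in passing
      from the mean of order r to the mean of order P.\<close>
    have pt: "?g z powr r \<le> T powr r + T powr (r - P) * ?g z powr P" for z
    proof (cases "?g z \<le> T")
      case True
      then have "?g z powr r \<le> T powr r" using r by (intro powr_mono2) auto
      moreover have "0 \<le> T powr (r - P) * ?g z powr P" by simp
      ultimately show ?thesis by linarith
    next
      case False
      then have g: "T \<le> ?g z" "0 < ?g z" using T by linarith+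
      have "?g z powr r = ?g z powr (r - P) * ?g z powr P" using g by (simp add: powr_add[symmetric])
      also have "\<dots> \<le> T powr (r - P) * ?g z powr P"
        using g T r by (intro mult_right_mono powr_mono2') auto
      finally show ?thesis using powr_ge_zero[of T r] by linarith
    qed
    have "(\<integral>z. ?g z powr r * ?d z \<partial>lborel)
        \<le> (\<integral>z. T powr r * ?d z + T powr (r - P) * (?g z powr P * ?d z) \<partial>lborel)"
    proof (intro integral_mono ir Bochner_Integration.integrable_add integrable_mult_right id iP)
      fix z show "?g z powr r * ?d z \<le> T powr r * ?d z + T powr (r - P) * (?g z powr P * ?d z)"
        using mult_right_mono[OF pt[of z] decay_nonneg[of "rad l" "2 * ?n" "x - z"]] rp by (simp add: algebra_simps)
    qed
    also have "\<dots> = T powr r * (\<integral>z. ?d z \<partial>lborel) + T powr (r - P) * (\<integral>z. ?g z powr P * ?d z \<partial>lborel)"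
      using id iP by (subst Bochner_Integration.integral_add) auto
    finally have "rad l ^ ?n * (\<integral>z. ?g z powr r * ?d z \<partial>lborel)
        \<le> T powr r * (rad l ^ ?n * (\<integral>z. ?d z \<partial>lborel)) + T powr (r - P) * (rad l ^ ?n * (\<integral>z. ?g z powr P * ?d z \<partial>lborel))"
      using mult_left_mono[where c="rad l ^ ?n"] rp by (fastforce simp: algebra_simps)
    also have "\<dots> \<le> T powr r * ?D + T powr (r - P) * T powr P"
      by (intro add_mono mult_left_mono id mP) auto
    also have "\<dots> = (?D + 1) * T powr r" using T by (simp add: powr_add[symmetric] algebra_simps)
    finally have le: "rad l ^ ?n * (\<integral>z. ?g z powr r * ?d z \<partial>lborel) \<le> (?D + 1) * T powr r" .
    obtain s where s: "controls f l A x s"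
      "s powr r \<le> B * (rad l ^ ?n * (\<integral>z. ?g z powr r * ?d z \<partial>lborel))" using B(2)[OF f] by blast
    note s(2)
    also have "\<dots> \<le> B * ((?D + 1) * T powr r)" by (intro mult_left_mono le B)
    finally have "(s powr r) powr (1 / r) \<le> ((B * (?D + 1)) * T powr r) powr (1 / r)"
      using r by (intro powr_mono2) (auto simp: mult.assoc)
    then have "s \<le> (B * (?D + 1)) powr (1 / r) * T"
      using s(1) r T by (simp add: controls_def powr_powr powr_mult)
    with s(1) show "\<exists>s. controls f l A x s \<and> s \<le> (B * (?D + 1)) powr (1 / r) * T" by blast
  qed simp
qed

text \<open>The counterpart for an essential bound: Peetre's inequality with exponent 1 expresses
  control at every point by an integral, which does not see null sets.\<close>

lemma controls_of_bound:
  assumes A: "2 * real CARD('n) \<le> real A"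
  obtains B where "0 \<le> B" "\<And>f l x T. schwartz f \<Longrightarrow> 0 \<le> T \<Longrightarrow> (AE z in lborel. norm (piece f l z) \<le> T)
    \<Longrightarrow> \<exists>s. controls f l A x s \<and> s \<le> B * T"
proof -
  let ?n = "CARD('n)" and ?D = "decay_mass TYPE(real ^ 'n)"
  obtain B where B: "0 \<le> B" "\<And>f l x. schwartz f \<Longrightarrow> \<exists>s. controls f l A x s \<and>
    s powr 1 \<le> B * (rad l ^ ?n * (\<integral>z. norm (piece f l z) powr 1 * decay (rad l) (2 * ?n) (x - z) \<partial>lborel))"
    by (rule peetre[of 1 A]) (use A in auto)
  have D: "0 \<le> ?D" by (rule decay_mass_nonneg)
  show thesis
  proof (rule that[of "B * ?D"])
    fix f :: "real ^ 'n \<Rightarrow> complex" and l and x :: "real ^ 'n" and T :: real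
    assume f: "schwartz f" and T: "0 \<le> T" and m: "AE z in lborel. norm (piece f l z) \<le> T"
    let ?d = "\<lambda>z. decay (rad l) (2 * ?n) (x - z)"
    have rp: "0 < rad l" by (rule rad_pos)
    have id: "integrable lborel ?d" "rad l ^ ?n * (\<integral>z. ?d z \<partial>lborel) \<le> ?D"
      using integrable_decay[OF rp, of "2 * ?n" x] by auto
    have "(\<integral>z. norm (piece f l z) powr 1 * ?d z \<partial>lborel) \<le> (\<integral>z. T * ?d z \<partial>lborel)"
    proof (rule integral_mono_AE)
      show "integrable lborel (\<lambda>z. norm (piece f l z) powr 1 * ?d z)" by (rule piece_powr_integrable[OF f]) simp
      show "integrable lborel (\<lambda>z. T * ?d z)" using id by simp
      show "AE z in lborel. norm (piece f l z) powr 1 * ?d z \<le> T * ?d z"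
        using m by eventually_elim (use rp in \<open>auto intro!: mult_right_mono decay_nonneg\<close>)
    qed
    then have "rad l ^ ?n * (\<integral>z. norm (piece f l z) powr 1 * ?d z \<partial>lborel) \<le> rad l ^ ?n * (T * (\<integral>z. ?d z \<partial>lborel))"
      using rp by (intro mult_left_mono) auto
    also have "\<dots> = T * (rad l ^ ?n * (\<integral>z. ?d z \<partial>lborel))" by simp
    also have "\<dots> \<le> T * ?D" by (intro mult_left_mono id T)
    finally have le: "rad l ^ ?n * (\<integral>z. norm (piece f l z) powr 1 * ?d z \<partial>lborel) \<le> T * ?D" .
    obtain s where s: "controls f l A x s"
      "s powr 1 \<le> B * (rad l ^ ?n * (\<integral>z. norm (piece f l z) powr 1 * ?d z \<partial>lborel))" using B(2)[OF f] by blast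
    note s(2)
    also have "\<dots> \<le> B * (T * ?D)" by (intro mult_left_mono le B)
    finally have "s \<le> B * ?D * T" using s(1) by (simp add: controls_def mult_ac)
    with s(1) show "\<exists>s. controls f l A x s \<and> s \<le> B * ?D * T" by blast
  qed (use B D in simp)
qed

text \<open>After Tonelli, the integral in x meets only the weight, whose normalized mass is bounded
  independently of l.\<close>

lemma mean_power_mass:
  assumes f: "schwartz f"
  shows "(\<integral>\<^sup>+x. mean_power f P l x \<partial>lborel)
    \<le> ennreal (decay_mass TYPE(real ^ 'n)) * (\<integral>\<^sup>+z. ennreal (norm (piece f l z) powr P) \<partial>lborel)"
proof -
  let ?n = "CARD('n)" and ?D = "decay_mass TYPE(real ^ 'n)"
  note [measurable] = piece_measurable[OF f]
  have rp: "0 < rad l" by (rule rad_pos)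
  let ?h = "\<lambda>x z. ennreal (rad l ^ ?n * (norm (piece f l z) powr P * decay (rad l) (2 * ?n) (x - z)))"
  have "(\<integral>\<^sup>+x. mean_power f P l x \<partial>lborel) = (\<integral>\<^sup>+z. \<integral>\<^sup>+x. ?h x z \<partial>lborel \<partial>lborel)"
    by (rule lborel_pair.Fubini'[symmetric]) measurable
  also have "\<dots> \<le> (\<integral>\<^sup>+z. ennreal ?D * ennreal (norm (piece f l z) powr P) \<partial>lborel)"
  proof (rule nn_integral_mono)
    fix z :: "real ^ 'n"
    let ?d = "\<lambda>x. decay (rad l) (2 * ?n) (z - x)"
    have id: "integrable lborel ?d" "rad l ^ ?n * (\<integral>x. ?d x \<partial>lborel) \<le> ?D"
      using integrable_decay[OF rp, of "2 * ?n" z] by auto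
    have "(\<integral>\<^sup>+x. ?h x z \<partial>lborel) = (\<integral>\<^sup>+x. ennreal (norm (piece f l z) powr P) * ennreal (rad l ^ ?n * ?d x) \<partial>lborel)"
      using rp by (intro nn_integral_cong)
        (simp add: ennreal_mult'[symmetric] decay_minus_commute[of _ _ z] decay_nonneg mult_ac)
    also have "\<dots> = ennreal (norm (piece f l z) powr P) * (\<integral>\<^sup>+x. ennreal (rad l ^ ?n * ?d x) \<partial>lborel)"
      by (rule nn_integral_cmult) measurable
    also have "(\<integral>\<^sup>+x. ennreal (rad l ^ ?n * ?d x) \<partial>lborel) = ennreal (\<integral>x. rad l ^ ?n * ?d x \<partial>lborel)"
      using id rp by (intro nn_integral_eq_integral) (auto intro!: AE_I2 mult_nonneg_nonneg decay_nonneg)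
    also have "ennreal (norm (piece f l z) powr P) * \<dots> \<le> ennreal (norm (piece f l z) powr P) * ennreal ?D"
      using id by (intro mult_left_mono ennreal_leI) auto
    finally show "(\<integral>\<^sup>+x. ?h x z \<partial>lborel) \<le> ennreal ?D * ennreal (norm (piece f l z) powr P)" by (simp add: mult.commute)
  qed
  also have "\<dots> = ennreal ?D * (\<integral>\<^sup>+z. ennreal (norm (piece f l z) powr P) \<partial>lborel)"
    by (rule nn_integral_cmult) measurable
  finally show ?thesis .
qed

end

text \<open>Tonelli for counting measures: a bound on the sums over k with l fixed is all that is
  needed.\<close>

lemma lattice_sum_swap:
  fixes c :: "int ^ 'n::finite \<Rightarrow> int ^ 'n \<Rightarrow> real" and S :: "int ^ 'n \<Rightarrow> ennreal"
  assumes "\<And>l. (\<integral>\<^sup>+k. ennreal (c k l) \<partial>count_space UNIV) \<le> ennreal D"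
  shows "(\<integral>\<^sup>+k. (\<integral>\<^sup>+l. ennreal (c k l) * S l \<partial>count_space UNIV) \<partial>count_space UNIV)
    \<le> ennreal D * (\<integral>\<^sup>+l. S l \<partial>count_space UNIV)"
proof -
  have "(\<integral>\<^sup>+k. (\<integral>\<^sup>+l. ennreal (c k l) * S l \<partial>count_space UNIV) \<partial>count_space UNIV)
    = (\<integral>\<^sup>+l. (\<integral>\<^sup>+k. ennreal (c k l) * S l \<partial>count_space UNIV) \<partial>count_space UNIV)"
    by (rule nn_integral_count_space_nn_integral) auto
  also have "\<dots> \<le> (\<integral>\<^sup>+l. ennreal D * S l \<partial>count_space UNIV)"
    using assms by (intro nn_integral_mono) (auto simp: nn_integral_multc intro!: mult_right_mono)
  also have "\<dots> = ennreal D * (\<integral>\<^sup>+l. S l \<partial>count_space UNIV)" by (rule nn_integral_cmult) auto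
  finally show ?thesis .
qed

section \<open>Quasi-norm estimates in space and over the lattice\<close>

context alpha_cover
begin

lemma gap_powr_sum:
  assumes "2 * real CARD('n) \<le> real m * r"
  shows "(\<integral>\<^sup>+l. ennreal (gap k l powr - (real m * r)) \<partial>count_space UNIV) \<le> ennreal (4 ^ CARD('n))"
proof (rule gap_nn_integral)
  fix l
  have "gap k l powr - (real m * r) \<le> gap k l powr - (real (2 * CARD('n)))"
    using assms gap_ge_1 by (intro powr_mono) auto
  also have "\<dots> = 1 / gap k l ^ (2 * CARD('n))"
    using powr_realpow[OF gap_pos, of k l "2 * CARD('n)"] by (simp only: powr_minus_divide)
  finally show "gap k l powr - (real m * r) \<le> 1 / gap k l ^ (2 * CARD('n))" .
qed simp

text \<open>Norms of the terms are never added. Instead the P-th power of the smoothed image is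
  bounded pointwise by a weighted sum over l of local means, and this sum is integrated termwise.
  The power M of the gap stays free for the summation in \<open>\<ell>\<^sup>q\<close>.\<close>

lemma smoothing_Lp_norm_finite:
  fixes \<sigma> :: "real ^ 'n \<Rightarrow> real ^ 'n \<Rightarrow> complex" and M :: nat and p :: ennreal
  assumes \<sigma>: "\<sigma> \<in> symbol_class b \<rho> \<delta>" and \<delta>: "\<delta> \<le> \<alpha>" "\<alpha> \<le> \<rho>" and p: "0 < p" "p \<noteq> top"
  obtains K where "0 < K" "\<And>f k T. schwartz f \<Longrightarrow> 0 \<le> T \<Longrightarrow>
    (\<And>l. ennreal (br l powr (b / (1 - \<alpha>))) * Lp_norm lborel p (\<lambda>x. ennreal (norm (piece f l x))) \<le> ennreal (T * gap k l ^ M)) \<Longrightarrow>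
    Lp_norm lborel p (\<lambda>x. ennreal (norm (smoothing k (pseudo_op \<sigma> f) x))) \<le> ennreal (K * T)"
proof -
  let ?n = "CARD('n)" and ?D = "decay_mass TYPE(real ^ 'n)" and ?b = "b / (1 - \<alpha>)"
  define P where "P = enn2real p"
  have P: "0 < P" unfolding P_def using p by (simp add: enn2real_positive_iff top.not_eq_extremum)
  define A where "A = nat \<lceil>2 * real ?n / min 1 P\<rceil>"
  have "2 * real ?n / min 1 P \<le> real A" unfolding A_def by linarith
  then have A: "2 * real ?n \<le> real A * min 1 P" using P by (simp add: pos_divide_le_eq)
  \<comment> \<open>The surplus power of the gap whose P-th power is summable over the
    lattice.\<close>
  define m where "m = nat \<lceil>2 * real ?n / P\<rceil>"
  have "2 * real ?n / P \<le> real m" unfolding m_def by linarith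
  then have m: "2 * real ?n \<le> real m * P" using P by (simp add: pos_divide_le_eq)
  obtain B where B: "0 \<le> B" "\<And>f l x T. schwartz f \<Longrightarrow> 0 < T \<Longrightarrow> mean_power f P l x \<le> ennreal (T powr P)
    \<Longrightarrow> \<exists>s. controls f l A x s \<and> s \<le> B * T"
    by (rule controls_of_mean_power[OF P A]) blast
  obtain K0 where K0: "0 \<le> K0" "\<And>f k x V s. schwartz f \<Longrightarrow> 0 \<le> V \<Longrightarrow> (\<And>l. controls f l A x (s l)) \<Longrightarrow>
    (\<And>l. br l powr ?b * s l \<le> V * gap k l ^ (M + m)) \<Longrightarrow> norm (smoothing k (pseudo_op \<sigma> f) x) \<le> K0 * V"
    by (rule pseudo_op_pointwise[OF \<sigma> \<delta>, where A=A and M="M + m"]) blast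
  define K where "K = K0 * B + 1"
  have K: "0 < K" using K0 B by (simp add: K_def add_nonneg_pos)
  have D: "0 \<le> ?D" by (rule decay_mass_nonneg)
  show thesis
  proof (rule that[of "K * (?D * 4 ^ ?n + 1) powr (1 / P)"])
    show "0 < K * (?D * 4 ^ ?n + 1) powr (1 / P)"
      using K D by (intro mult_pos_pos) (auto simp: add_nonneg_pos powr_gt_zero intro!: less_imp_neq[THEN not_sym])
    fix f :: "real ^ 'n \<Rightarrow> complex" and k and T :: real
    assume f: "schwartz f" and T: "0 \<le> T"
      and hyp: "\<And>l. ennreal (br l powr ?b) * Lp_norm lborel p (\<lambda>x. ennreal (norm (piece f l x))) \<le> ennreal (T * gap k l ^ M)"
    note [measurable] = piece_measurable[OF f] smoothing_measurable[OF pseudo_op_measurable[OF \<sigma> f]]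
    define F where "F = smoothing k (pseudo_op \<sigma> f)"
    have [measurable]: "F \<in> borel_measurable borel" unfolding F_def by measurable
    \<comment> \<open>These weights make
      \<open>c l * (V * gap k l ^ (M + m) / br l powr ?b) powr P\<close> equal to
      \<open>V powr P\<close>. A bound for Y by \<open>V powr P\<close> therefore gives every mean
      exactly the bound that the pointwise estimate can absorb.\<close>
    define c where "c l = br l powr (?b * P) * gap k l powr - (real (M + m) * P)" for l
    have c: "0 \<le> c l" for l by (simp add: c_def)
    define Y where "Y x = (\<integral>\<^sup>+l. ennreal (c l) * mean_power f P l x \<partial>count_space UNIV)" for x
    interpret lattice: sigma_finite_measure "count_space (UNIV :: (int ^ 'n) set)"
      by (rule sigma_finite_measure_count_space_countable) auto
    have [measurable]: "Y \<in> borel_measurable borel"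
    proof -
      have "(\<lambda>(x, l). ennreal (c l) * mean_power f P l x) \<in> borel_measurable (borel \<Otimes>\<^sub>M count_space UNIV)"
        using measurable_pair_swap[OF measurable_pair_measure_countable1[of UNIV "\<lambda>(l, x). ennreal (c l) * mean_power f P l x" borel borel]]
        by simp
      then show ?thesis unfolding Y_def[abs_def] by (rule lattice.borel_measurable_nn_integral)
    qed
    have ck: "c l * (V * gap k l ^ (M + m) / br l powr ?b) powr P = V powr P" if "0 < V" for l V
      using that gap_pos[of k l] br_pos[of l]
      by (simp add: c_def powr_mult powr_divide powr_powr powr_minus powr_realpow[symmetric] del: of_nat_add)
    have pointwise: "ennreal (norm (F x) powr P) \<le> ennreal (K powr P) * Y x" for x
    proof (cases "Y x")
      case (real y)
      have "norm (F x) powr P \<le> K powr P * y + e" if "0 < e" for e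
      proof -
        \<comment> \<open>The slack e keeps V positive even if y is 0, as the control by means
          requires a positive level; e is removed at the end.\<close>
        define V where "V = (y + e / K powr P) powr (1 / P)"
        have pos: "0 < y + e / K powr P" using real that K by (simp add: add_nonneg_pos)
        have V: "0 < V" "V powr P = y + e / K powr P" using pos P by (simp_all add: V_def powr_powr)
        have "\<exists>s. controls f l A x s \<and> s \<le> B * (V * gap k l ^ (M + m) / br l powr ?b)" for l
        proof (rule B(2)[OF f])
          show t: "0 < V * gap k l ^ (M + m) / br l powr ?b" using V gap_pos br_pos br_nz by simp
          have "ennreal (c l) * mean_power f P l x \<le> Y x"
            unfolding Y_def by (rule nn_integral_ge_point) simp
          also have "\<dots> \<le> ennreal (V powr P)" using real V that by (auto intro!: ennreal_leI)
          also have "\<dots> = ennreal (c l) * ennreal ((V * gap k l ^ (M + m) / br l powr ?b) powr P)"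
            using ck[OF V(1)] c by (simp add: ennreal_mult'[symmetric])
          finally show "mean_power f P l x \<le> ennreal ((V * gap k l ^ (M + m) / br l powr ?b) powr P)"
            by (subst (asm) ennreal_mult_le_mult_iff) (auto simp: c_def br_nz gap_pos less_imp_neq[OF gap_pos, THEN not_sym])
        qed
        then obtain s where s: "\<And>l. controls f l A x (s l)" "\<And>l. s l \<le> B * (V * gap k l ^ (M + m) / br l powr ?b)"
          by metis
        have "norm (F x) \<le> K0 * (B * V)" unfolding F_def
        proof (rule K0(2)[OF f _ s(1)])
          fix l
          show "br l powr ?b * s l \<le> B * V * gap k l ^ (M + m)"
            using mult_left_mono[OF s(2)[of l], of "br l powr ?b"] br_pos[of l] by (simp add: field_simps)
        qed (use B V in simp)
        also have "\<dots> \<le> K * V" using V by (simp add: K_def algebra_simps)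
        finally have "norm (F x) powr P \<le> (K * V) powr P" using P by (intro powr_mono2) auto
        also have "\<dots> = K powr P * y + e" using K by (simp add: powr_mult V(2) field_simps)
        finally show ?thesis .
      qed
      then have "norm (F x) powr P \<le> K powr P * y" by (rule field_le_epsilon)
      then show ?thesis using real by (simp add: ennreal_mult'[symmetric] ennreal_leI)
    next
      case top
      then show ?thesis using K by (simp add: ennreal_mult_top)
    qed
    have piece: "(\<integral>\<^sup>+z. ennreal (norm (piece f l z) powr P) \<partial>lborel) \<le> ennreal ((T * gap k l ^ M / br l powr ?b) powr P)" for l
    proof (rule enn_powr_root_le[OF _ _ P])
      have "ennreal (br l powr ?b) * enn_powr (\<integral>\<^sup>+z. ennreal (norm (piece f l z) powr P) \<partial>lborel) (1 / P)
          \<le> ennreal (T * gap k l ^ M)"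
        using hyp[of l] p unfolding Lp_norm_def by (simp add: enn_powr_ennreal P_def)
      also have "\<dots> = ennreal (br l powr ?b) * ennreal (T * gap k l ^ M / br l powr ?b)"
        using br_nz[of l] by (simp add: ennreal_mult'[symmetric])
      finally show "enn_powr (\<integral>\<^sup>+z. ennreal (norm (piece f l z) powr P) \<partial>lborel) (1 / P) \<le> ennreal (T * gap k l ^ M / br l powr ?b)"
        by (subst (asm) ennreal_mult_le_mult_iff) (auto simp: br_nz)
      show "0 \<le> T * gap k l ^ M / br l powr ?b" using T gap_pos[of k l] by simp
    qed
    have term_le: "ennreal (c l) * (\<integral>\<^sup>+x. mean_power f P l x \<partial>lborel)
        \<le> ennreal (?D * T powr P) * ennreal (gap k l powr - (real m * P))" for l
    proof -
      have "ennreal (c l) * (\<integral>\<^sup>+x. mean_power f P l x \<partial>lborel)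
          \<le> ennreal (c l) * (ennreal ?D * ennreal ((T * gap k l ^ M / br l powr ?b) powr P))"
        by (intro mult_left_mono order_trans[OF mean_power_mass[OF f]] piece) auto
      also have "\<dots> = ennreal (c l * (?D * (T * gap k l ^ M / br l powr ?b) powr P))"
        using c D by (simp add: ennreal_mult'[symmetric])
      also have "c l * (?D * (T * gap k l ^ M / br l powr ?b) powr P) = ?D * T powr P * gap k l powr - (real m * P)"
        using gap_pos[of k l] br_pos[of l]
        by (simp add: c_def powr_mult powr_divide powr_powr powr_realpow[symmetric] powr_add[symmetric] algebra_simps)
      finally show ?thesis using D by (simp add: ennreal_mult'[symmetric])
    qed
    have "(\<integral>\<^sup>+x. ennreal (norm (F x) powr P) \<partial>lborel) \<le> (\<integral>\<^sup>+x. ennreal (K powr P) * Y x \<partial>lborel)"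
      by (intro nn_integral_mono pointwise)
    also have "\<dots> = ennreal (K powr P) * (\<integral>\<^sup>+x. Y x \<partial>lborel)"
      by (rule nn_integral_cmult) simp
    also have "(\<integral>\<^sup>+x. Y x \<partial>lborel) = (\<integral>\<^sup>+l. (\<integral>\<^sup>+x. ennreal (c l) * mean_power f P l x \<partial>lborel) \<partial>count_space UNIV)"
      unfolding Y_def by (rule nn_integral_count_space_nn_integral) (auto, measurable)
    also have "\<dots> = (\<integral>\<^sup>+l. ennreal (c l) * (\<integral>\<^sup>+x. mean_power f P l x \<partial>lborel) \<partial>count_space UNIV)"
      by (intro nn_integral_cong nn_integral_cmult) measurable
    also have "\<dots> \<le> (\<integral>\<^sup>+l. ennreal (?D * T powr P) * ennreal (gap k l powr - (real m * P)) \<partial>count_space UNIV)"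
      by (intro nn_integral_mono term_le)
    also have "\<dots> = ennreal (?D * T powr P) * (\<integral>\<^sup>+l. ennreal (gap k l powr - (real m * P)) \<partial>count_space UNIV)"
      by (rule nn_integral_cmult) simp
    also have "\<dots> \<le> ennreal (?D * T powr P) * ennreal (4 ^ ?n)"
      by (intro mult_left_mono gap_powr_sum m) auto
    finally have "(\<integral>\<^sup>+x. ennreal (norm (F x) powr P) \<partial>lborel) \<le> ennreal (K powr P) * (ennreal (?D * T powr P) * ennreal (4 ^ ?n))"
      by (simp add: mult_left_mono)
    also have "\<dots> = ennreal (K powr P * T powr P * (?D * 4 ^ ?n))" using D by (simp add: ennreal_mult'[symmetric] mult_ac)
    also have "\<dots> \<le> ennreal (K powr P * T powr P * (?D * 4 ^ ?n + 1))" by (intro ennreal_leI mult_left_mono) auto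
    finally have "enn_powr (\<integral>\<^sup>+x. ennreal (norm (F x) powr P) \<partial>lborel) (1 / P)
        \<le> enn_powr (ennreal (K powr P * T powr P * (?D * 4 ^ ?n + 1))) (1 / P)"
      using P by (intro enn_powr_mono) auto
    also have "\<dots> = ennreal (K * (?D * 4 ^ ?n + 1) powr (1 / P) * T)"
      using P K T D by (simp add: enn_powr_ennreal powr_mult powr_powr mult_ac)
    finally show "Lp_norm lborel p (\<lambda>x. ennreal (norm (smoothing k (pseudo_op \<sigma> f) x)))
        \<le> ennreal (K * (?D * 4 ^ ?n + 1) powr (1 / P) * T)"
      using p unfolding Lp_norm_def F_def by (simp add: enn_powr_ennreal P_def)
  qed
qed

text \<open>With essential bounds nothing has to be integrated in x, so no surplus power of the gap
  is needed and the pointwise estimate is applied directly.\<close>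

lemma smoothing_esssup:
  fixes \<sigma> :: "real ^ 'n \<Rightarrow> real ^ 'n \<Rightarrow> complex" and M :: nat
  assumes \<sigma>: "\<sigma> \<in> symbol_class b \<rho> \<delta>" and \<delta>: "\<delta> \<le> \<alpha>" "\<alpha> \<le> \<rho>"
  obtains K where "0 < K" "\<And>f k T. schwartz f \<Longrightarrow> 0 \<le> T \<Longrightarrow>
    (\<And>l. ennreal (br l powr (b / (1 - \<alpha>))) * Lp_norm lborel top (\<lambda>x. ennreal (norm (piece f l x))) \<le> ennreal (T * gap k l ^ M)) \<Longrightarrow>
    Lp_norm lborel top (\<lambda>x. ennreal (norm (smoothing k (pseudo_op \<sigma> f) x))) \<le> ennreal (K * T)"
proof -
  let ?n = "CARD('n)" and ?b = "b / (1 - \<alpha>)"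
  obtain B where B: "0 \<le> B" "\<And>f l x T. schwartz f \<Longrightarrow> 0 \<le> T \<Longrightarrow> (AE z in lborel. norm (piece f l z) \<le> T)
    \<Longrightarrow> \<exists>s. controls f l (2 * ?n) x s \<and> s \<le> B * T"
    by (rule controls_of_bound[of "2 * ?n"]) auto
  obtain K0 where K0: "0 \<le> K0" "\<And>f k x V s. schwartz f \<Longrightarrow> 0 \<le> V \<Longrightarrow> (\<And>l. controls f l (2 * ?n) x (s l)) \<Longrightarrow>
    (\<And>l. br l powr ?b * s l \<le> V * gap k l ^ M) \<Longrightarrow> norm (smoothing k (pseudo_op \<sigma> f) x) \<le> K0 * V"
    by (rule pseudo_op_pointwise[OF \<sigma> \<delta>, where A="2 * ?n" and M=M]) blast
  show thesis
  proof (rule that[of "K0 * B + 1"])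
    show "0 < K0 * B + 1" using K0 B by (simp add: add_nonneg_pos)
    fix f :: "real ^ 'n \<Rightarrow> complex" and k and T :: real
    assume f: "schwartz f" and T: "0 \<le> T"
      and hyp: "\<And>l. ennreal (br l powr ?b) * Lp_norm lborel top (\<lambda>x. ennreal (norm (piece f l x))) \<le> ennreal (T * gap k l ^ M)"
    note [measurable] = piece_measurable[OF f] smoothing_measurable[OF pseudo_op_measurable[OF \<sigma> f]]
    have t: "0 \<le> T * gap k l ^ M / br l powr ?b" for l using T gap_pos[of k l] by simp
    have ae: "AE z in lborel. norm (piece f l z) \<le> T * gap k l ^ M / br l powr ?b" for l
    proof -
      have "ennreal (br l powr ?b) * Lp_norm lborel top (\<lambda>x. ennreal (norm (piece f l x)))
          \<le> ennreal (br l powr ?b) * ennreal (T * gap k l ^ M / br l powr ?b)"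
        using hyp[of l] br_nz[of l] by (simp add: ennreal_mult'[symmetric])
      then have le: "esssup lborel (\<lambda>x. ennreal (norm (piece f l x))) \<le> ennreal (T * gap k l ^ M / br l powr ?b)"
        by (subst (asm) ennreal_mult_le_mult_iff) (auto simp: br_nz Lp_norm_def)
      show ?thesis using esssup_AE[of "\<lambda>x. ennreal (norm (piece f l x))" lborel]
      proof eventually_elim
        case (elim z)
        from order_trans[OF elim le] show ?case using t[of l] by (simp add: ennreal_le_iff)
      qed
    qed
    have pointwise: "norm (smoothing k (pseudo_op \<sigma> f) x) \<le> (K0 * B + 1) * T" for x
    proof -
      have "\<exists>s. controls f l (2 * ?n) x s \<and> s \<le> B * (T * gap k l ^ M / br l powr ?b)" for l
        by (rule B(2)[OF f t ae])
      then obtain s where s: "\<And>l. controls f l (2 * ?n) x (s l)" "\<And>l. s l \<le> B * (T * gap k l ^ M / br l powr ?b)"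
        by metis
      have "norm (smoothing k (pseudo_op \<sigma> f) x) \<le> K0 * (B * T)"
      proof (rule K0(2)[OF f _ s(1)])
        fix l
        show "br l powr ?b * s l \<le> B * T * gap k l ^ M"
          using mult_left_mono[OF s(2)[of l], of "br l powr ?b"] br_pos[of l] by (simp add: field_simps)
      qed (use B T in simp)
      also have "\<dots> \<le> (K0 * B + 1) * T" using T by (simp add: algebra_simps)
      finally show ?thesis .
    qed
    show "Lp_norm lborel top (\<lambda>x. ennreal (norm (smoothing k (pseudo_op \<sigma> f) x))) \<le> ennreal ((K0 * B + 1) * T)"
      using pointwise unfolding Lp_norm_def by (auto intro!: esssup_I ennreal_leI)
  qed
qed

text \<open>The premise says that \<open>N k\<close> is at most K times the supremum over l of
  \<open>br l powr d * a l / gap k l ^ M\<close>. A supremum, unlike a sum, is dominated by a sum of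
  q-th powers for every positive q, and the symmetric weight in the gap is then summed over k for
  fixed l.\<close>

lemma weighted_lattice_norm_le:
  fixes q :: ennreal and s d :: real
  assumes q: "0 < q"
  obtains M :: nat and B :: real where "0 < B"
    "\<And>a N K. 0 < K \<Longrightarrow> (\<And>k T. 0 \<le> T \<Longrightarrow> (\<And>l. ennreal (br l powr d) * a l \<le> ennreal (T * gap k l ^ M)) \<Longrightarrow> N k \<le> ennreal (K * T)) \<Longrightarrow>
      Lp_norm (count_space UNIV) q (\<lambda>k. ennreal (br k powr (s - d)) * N k)
        \<le> ennreal (B * K) * Lp_norm (count_space UNIV) q (\<lambda>l. ennreal (br l powr s) * a l)"
proof -
  let ?n = "CARD('n)"
  \<comment> \<open>The power of the gap that pays for moving the weight
    \<open>br l powr (d - s)\<close> to the index k.\<close>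
  define e where "e = nat \<lceil>\<bar>d - s\<bar>\<rceil>"
  have transfer: "ennreal (br l powr d) * a l \<le> ennreal (br k powr (d - s) * t * gap k l ^ (e + m))"
    if "ennreal (br l powr s) * a l \<le> ennreal (gap k l ^ m * t)" "0 \<le> t" for k l m t and a :: "int ^ 'n \<Rightarrow> ennreal"
  proof -
    have "ennreal (br l powr d) * a l = ennreal (br l powr (d - s)) * (ennreal (br l powr s) * a l)"
      by (simp add: mult.assoc[symmetric] ennreal_mult'[symmetric] powr_add[symmetric])
    also have "\<dots> \<le> ennreal (br k powr (d - s) * gap k l ^ e) * ennreal (gap k l ^ m * t)"
      using br_powr_le[of l "d - s" k] that(1) unfolding e_def gap_commute[of l k]
      by (intro mult_mono ennreal_leI) auto
    also have "\<dots> = ennreal (br k powr (d - s) * t * gap k l ^ (e + m))"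
      using gap_pos[of k l] that(2) by (simp add: ennreal_mult'[symmetric] power_add mult_ac)
    finally show ?thesis .
  qed
  have weight: "ennreal (br k powr (s - d)) * x \<le> ennreal (K * t)"
    if "x \<le> ennreal (K * (br k powr (d - s) * t))" for k K t x
  proof -
    have "ennreal (br k powr (s - d)) * x \<le> ennreal (br k powr (s - d)) * ennreal (K * (br k powr (d - s) * t))"
      by (intro mult_left_mono that) auto
    also have "\<dots> = ennreal (br k powr (s - d) * br k powr (d - s) * (K * t))" by (simp add: ennreal_mult'[symmetric] mult_ac)
    also have "br k powr (s - d) * br k powr (d - s) = 1" using br_nz[of k] by (simp add: powr_add[symmetric])
    finally show ?thesis by simp
  qed
  show thesis
  proof (cases "q = top")
    case True
    show thesis
    proof (rule that[of 1 e])
      fix a N :: "int ^ 'n \<Rightarrow> ennreal" and K :: real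
      assume K: "0 < K" and N: "\<And>k T. 0 \<le> T \<Longrightarrow> (\<And>l. ennreal (br l powr d) * a l \<le> ennreal (T * gap k l ^ e)) \<Longrightarrow> N k \<le> ennreal (K * T)"
      let ?u = "\<lambda>l. ennreal (br l powr s) * a l"
      show "Lp_norm (count_space UNIV) q (\<lambda>k. ennreal (br k powr (s - d)) * N k) \<le> ennreal (1 * K) * Lp_norm (count_space UNIV) q ?u"
      proof (cases "esssup (count_space UNIV) ?u")
        case (real U)
        have u: "?u l \<le> ennreal U" for l
          using esssup_AE[of ?u "count_space UNIV"] real by (simp add: AE_count_space)
        have "ennreal (br k powr (s - d)) * N k \<le> ennreal (K * U)" for k
        proof (rule weight[OF N])
          show "ennreal (br l powr d) * a l \<le> ennreal (br k powr (d - s) * U * gap k l ^ e)" for l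
            using transfer[of l a k 0 U] u real by simp
        qed (use real in simp)
        then show ?thesis using real K True by (auto simp: Lp_norm_def ennreal_mult'[symmetric] intro!: esssup_I)
      next
        case top
        then show ?thesis using K True by (simp add: Lp_norm_def ennreal_mult_top)
      qed
    qed simp
  next
    case False
    define r where "r = enn2real q"
    have r: "0 < r" unfolding r_def using q False by (simp add: enn2real_positive_iff top.not_eq_extremum)
    \<comment> \<open>The further power of the gap that makes the sum over k converge after raising
      to the power r.\<close>
    define m where "m = nat \<lceil>2 * real ?n / r\<rceil>"
    have "2 * real ?n / r \<le> real m" unfolding m_def by linarith
    then have m: "2 * real ?n \<le> real m * r" using r by (simp add: pos_divide_le_eq)
    show thesis
    proof (rule that[of "(4 ^ ?n) powr (1 / r)" "e + m"])
      fix a N :: "int ^ 'n \<Rightarrow> ennreal" and K :: real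
      assume K: "0 < K" and N: "\<And>k T. 0 \<le> T \<Longrightarrow> (\<And>l. ennreal (br l powr d) * a l \<le> ennreal (T * gap k l ^ (e + m))) \<Longrightarrow> N k \<le> ennreal (K * T)"
      let ?u = "\<lambda>l. ennreal (br l powr s) * a l"
      define S where "S l = enn_powr (?u l) r" for l
      let ?S = "\<integral>\<^sup>+l. S l \<partial>count_space UNIV"
      show "Lp_norm (count_space UNIV) q (\<lambda>k. ennreal (br k powr (s - d)) * N k)
        \<le> ennreal ((4 ^ ?n) powr (1 / r) * K) * Lp_norm (count_space UNIV) q ?u"
      proof (cases "?S = top")
        case True
        then show ?thesis using K False by (simp add: Lp_norm_def S_def r_def[symmetric] enn_powr_def ennreal_mult_top)
      next
        case fin: False
        let ?w = "\<lambda>k l. gap k l powr - (real m * r)"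
        define Z where "Z k = (\<integral>\<^sup>+l. ennreal (?w k l) * S l \<partial>count_space UNIV)" for k
        have le: "enn_powr (ennreal (br k powr (s - d)) * N k) r \<le> ennreal (K powr r) * Z k" for k
        proof -
          have "Z k \<le> ?S"
          proof -
            have "?w k l \<le> 1" for l
              using gap_ge_1[of k l] r powr_mono[of "- (real m * r)" 0 "gap k l"] by simp
            then have "Z k \<le> (\<integral>\<^sup>+l. 1 * S l \<partial>count_space UNIV)" unfolding Z_def
              by (intro nn_integral_mono mult_right_mono) (auto simp: ennreal_le_1)
            then show ?thesis by simp
          qed
          \<comment> \<open>Finiteness of the right-hand norm makes every \<open>Z k\<close> a real
            number, so its r-th root t can serve as the level in the premise on N.\<close>
          then obtain z where z: "Z k = ennreal z" "0 \<le> z" using fin by (cases "Z k") (auto simp: top_unique)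
          define t where "t = z powr (1 / r)"
          have "?u l \<le> ennreal (gap k l ^ m * t)" for l
          proof -
            have "ennreal (?w k l) * S l \<le> Z k" unfolding Z_def by (rule nn_integral_ge_point) simp
            also have "\<dots> = ennreal (?w k l) * ennreal (gap k l powr (real m * r) * z)"
              using z gap_pos[of k l] by (simp add: ennreal_mult'[symmetric] mult.assoc[symmetric] powr_add[symmetric])
            finally have "S l \<le> ennreal (gap k l powr (real m * r) * z)"
              by (subst (asm) ennreal_mult_le_mult_iff) (auto simp: less_imp_neq[OF gap_pos, THEN not_sym])
            then have "?u l \<le> ennreal ((gap k l powr (real m * r) * z) powr (1 / r))"
              unfolding S_def using z r by (intro enn_powr_le_root) auto
            also have "(gap k l powr (real m * r) * z) powr (1 / r) = gap k l ^ m * t"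
              using r gap_pos[of k l] by (simp add: powr_mult powr_powr t_def powr_realpow)
            finally show ?thesis .
          qed
          then have "ennreal (br k powr (s - d)) * N k \<le> ennreal (K * t)"
            by (intro weight N transfer) (auto simp: t_def)
          then have "enn_powr (ennreal (br k powr (s - d)) * N k) r \<le> enn_powr (ennreal (K * t)) r"
            using r by (intro enn_powr_mono) auto
          also have "\<dots> = ennreal (K powr r) * Z k"
            using K r z by (simp add: enn_powr_ennreal t_def powr_mult powr_powr ennreal_mult'[symmetric])
          finally show ?thesis .
        qed
        have "(\<integral>\<^sup>+k. enn_powr (ennreal (br k powr (s - d)) * N k) r \<partial>count_space UNIV)
            \<le> (\<integral>\<^sup>+k. ennreal (K powr r) * Z k \<partial>count_space UNIV)"
          by (intro nn_integral_mono le)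
        also have "\<dots> = ennreal (K powr r) * (\<integral>\<^sup>+k. Z k \<partial>count_space UNIV)" by (rule nn_integral_cmult) simp
        also have "\<dots> \<le> ennreal (K powr r) * (ennreal (4 ^ ?n) * ?S)" unfolding Z_def
        proof (intro mult_left_mono lattice_sum_swap)
          fix l
          have "(\<integral>\<^sup>+k. ennreal (?w k l) \<partial>count_space UNIV) = (\<integral>\<^sup>+k. ennreal (?w l k) \<partial>count_space UNIV)"
            by (simp add: gap_commute)
          also have "\<dots> \<le> ennreal (4 ^ ?n)" by (rule gap_powr_sum[OF m])
          finally show "(\<integral>\<^sup>+k. ennreal (?w k l) \<partial>count_space UNIV) \<le> ennreal (4 ^ ?n)" .
        qed simp
        also have "\<dots> = ennreal (K powr r * 4 ^ ?n) * ?S" by (simp add: ennreal_mult' mult.assoc)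
        finally have "enn_powr (\<integral>\<^sup>+k. enn_powr (ennreal (br k powr (s - d)) * N k) r \<partial>count_space UNIV) (1 / r)
            \<le> enn_powr (ennreal (K powr r * 4 ^ ?n) * ?S) (1 / r)"
          using r by (intro enn_powr_mono) auto
        also have "\<dots> = ennreal ((4 ^ ?n) powr (1 / r) * K) * enn_powr ?S (1 / r)"
          using K r by (subst enn_powr_cmult) (auto simp: powr_mult powr_powr mult.commute)
        finally show ?thesis using False by (simp add: Lp_norm_def S_def r_def)
      qed
    qed simp
  qed
qed

theorem pseudo_op_alpha_modulation_bounded:
  fixes \<sigma> :: "real ^ 'n \<Rightarrow> real ^ 'n \<Rightarrow> complex"
  assumes \<sigma>: "\<sigma> \<in> symbol_class b \<rho> \<delta>" and \<delta>: "\<delta> \<le> \<alpha>" "\<alpha> \<le> \<rho>" and p: "0 < p" and q: "0 < q"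
  shows "alpha_modulation_bounded \<eta> \<alpha> p q s (s - b) (pseudo_op \<sigma>)"
proof -
  let ?d = "b / (1 - \<alpha>)" and ?s = "s / (1 - \<alpha>)"
  have sd: "(s - b) / (1 - \<alpha>) = ?s - ?d" by (simp add: diff_divide_distrib)
  \<comment> \<open>The order of choices matters: M is dictated by q and the weights, and K is then
    obtained for this M, which the estimates in \<open>L\<^sup>p\<close> allow to be
    arbitrary.\<close>
  obtain M B where B: "0 < B"
    "\<And>a N K. 0 < K \<Longrightarrow> (\<And>k T. 0 \<le> T \<Longrightarrow> (\<And>l. ennreal (br l powr ?d) * a l \<le> ennreal (T * gap k l ^ M)) \<Longrightarrow> N k \<le> ennreal (K * T)) \<Longrightarrow>
      Lp_norm (count_space UNIV) q (\<lambda>k. ennreal (br k powr (?s - ?d)) * N k)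
        \<le> ennreal (B * K) * Lp_norm (count_space UNIV) q (\<lambda>l. ennreal (br l powr ?s) * a l)"
    by (rule weighted_lattice_norm_le[OF q, of ?d ?s]) blast
  obtain K where K: "0 < K" "\<And>f k T. schwartz f \<Longrightarrow> 0 \<le> T \<Longrightarrow>
    (\<And>l. ennreal (br l powr ?d) * Lp_norm lborel p (\<lambda>x. ennreal (norm (piece f l x))) \<le> ennreal (T * gap k l ^ M)) \<Longrightarrow>
    Lp_norm lborel p (\<lambda>x. ennreal (norm (smoothing k (pseudo_op \<sigma> f) x))) \<le> ennreal (K * T)"
  proof (cases "p = top")
    case True
    show thesis by (rule smoothing_esssup[OF \<sigma> \<delta>, where M=M]) (rule that[unfolded True], assumption, blast)
  next
    case False
    show thesis by (rule smoothing_Lp_norm_finite[OF \<sigma> \<delta> p False, where M=M]) (rule that, assumption, blast)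
  qed
  show ?thesis unfolding alpha_modulation_bounded_def
  proof (intro exI[of _ "B * K"] allI impI conjI)
    fix f :: "real ^ 'n \<Rightarrow> complex" assume f: "schwartz f"
    have pm: "pseudo_op \<sigma> f \<in> borel_measurable borel" by (rule pseudo_op_measurable[OF \<sigma> f])
    obtain L where L: "\<And>z. norm (pseudo_op \<sigma> f z) \<le> L" using pseudo_op_bounded[OF \<sigma> f] by blast
    show "tempered_function (pseudo_op \<sigma> f)" by (rule bounded_tempered_function[OF pm L])
    let ?N = "\<lambda>k. Lp_norm lborel p (\<lambda>x. ennreal (norm (smoothing k (pseudo_op \<sigma> f) x)))"
    let ?a = "\<lambda>l. Lp_norm lborel p (\<lambda>x. ennreal (norm (piece f l x)))"
    have "alpha_modulation_norm \<eta> \<alpha> p q (s - b) (dist_of (pseudo_op \<sigma> f))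
        \<le> Lp_norm (count_space UNIV) q (\<lambda>k. ennreal (br k powr (?s - ?d)) * ?N k)"
      unfolding alpha_modulation_norm_def sd br_def
      by (intro Lp_norm_mono mult_left_mono dist_Lp_norm_smoothing_le[OF pm L]) auto
    also have "\<dots> \<le> ennreal (B * K) * Lp_norm (count_space UNIV) q (\<lambda>l. ennreal (br l powr ?s) * ?a l)"
      by (rule B(2)[OF K(1)]) (rule K(2)[OF f])
    also have "\<dots> \<le> ennreal (B * K) * alpha_modulation_norm \<eta> \<alpha> p q s (dist_of f)"
      unfolding alpha_modulation_norm_def br_def
      by (intro mult_left_mono Lp_norm_mono piece_Lp_norm_le[OF f]) auto
    finally show "alpha_modulation_norm \<eta> \<alpha> p q (s - b) (dist_of (pseudo_op \<sigma> f))
        \<le> ennreal (B * K) * alpha_modulation_norm \<eta> \<alpha> p q s (dist_of f)" .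
  qed
qed

end

theorem corollary1p3:
  fixes \<alpha> \<rho> \<delta> s b C :: real
    and p q :: ennreal
    and \<eta> :: "int ^ 'n::finite \<Rightarrow> real ^ 'n \<Rightarrow> complex"
  assumes "0 \<le> \<alpha>" "\<alpha> < 1"
    and "0 < p" "0 < q"
    and "0 \<le> \<delta>" "\<delta> \<le> \<alpha>" "\<alpha> \<le> \<rho>" "\<rho> \<le> 1"
    and "1 < C" "alpha_partition \<alpha> C \<eta>"
  shows "\<forall>\<sigma> \<in> symbol_class b \<rho> \<delta>.
    alpha_modulation_bounded \<eta> \<alpha> p q s (s - b) (pseudo_op \<sigma>)"
proof -
  interpret alpha_cover \<alpha> C \<eta> by unfold_locales (use assms in auto)
  show ?thesis using pseudo_op_alpha_modulation_bounded assms by blast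
qed

end
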